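(* Let $k$ be an algebraically closed field of characteristic zero, let $m,p,d,n$ be positive integers with $m=pd$, let $\xi\in k$ be a primitive $m$th root of unity and $\delta=(\delta_0,\delta_p,\dots,\delta_{(d-1)p})\in k^d$. The algebra $B_{m,p,n}=B_{m,p,n}(\delta)$ has standard modules labelled by $\Lambda(m,p,n)$. For $\lambda^r\in\Lambda(m,p,n)$, with $\lambda$ an $m$-partition of $n-2l$ and $\operatorname{Stab}_{\mathbb{Z}/p\mathbb{Z}}(\lambda)=\langle\sigma^t\rangle$, we have $$\Delta_n(\lambda^r)\cong\{\,v\otimes x \;:\; v\in V_l(q,p/t),\ x\in\mathbf S(\lambda^{q+r}),\ 0\le q<p/t\,\},$$ where the right-hand side denotes the span of these elements in $V_l\otimes_k\overline{\mathbf S(\lambda)}$ and the superscript $q+r$ is read modulo $p/t$.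
   Context: Diagrams and algebras. A reduced diagram has $n$ northern and $n$ southern nodes, each node joined to precisely one other by a strand, each strand labelled by an element of $\mathbb{Z}/m\mathbb{Z}$. Strands joining north to south are through-strands; the others are (northern or southern) arcs. $B_{m,p,n}(\delta)$ has $k$-basis the reduced diagrams whose labels sum to a multiple of $p$; the product $x\cdot y$ is obtained by placing $x$ above $y$, adding labels along composed strands, and removing each closed loop with label $ip$ at the cost of the factor $\delta_{ip}$ (the product is $0$ if some loop has label not divisible by $p$). $B_{m,1,n}$ is the same with no restriction on the label sum, with parameter $\delta$ extended by $\delta_i=0$ for $p\nmid i$; so $B_{m,p,n}\subseteq B_{m,1,n}$ is a subalgebra. The diagrams with no arcs span the group algebras $kG(m,p,n)\subseteq kG(m,1,n)$ of the complex reflection groups. Let $t_i^j$ be the identity diagram with label $j$ on its $i$th strand ($t_1=t_1^1$), $s_{i,i+1}$ the unlabelled diagram transposing $i,i+1$, and $e_{i,j}$ the unlabelled diagram with a northern arc joining nodes $i,j$, a southern arc joining nodes $i,j$, and all other strands vertical. Combinatorics. An $m$-partition of $N$ is an $m$-tuple $\lambda=(\lambda^0,\dots,\lambda^{m-1})$ of partitions of total size $N$. $\Lambda(m,1,n)$ is the set of $m$-partitions of $n-2l$, $0\le l\le n/2$. A standard $\lambda$-tableau is a tuple $\mathfrak t=(\mathfrak t^0,\dots,\mathfrak t^{m-1})$ filling the boxes of $\lambda$ bijectively with $1,\dots,N$, increasing along rows and columns of each component; $\mathfrak t(i)=s$ if $i$ lies in $\mathfrak t^s$. The generator $\sigma$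 of $\mathbb{Z}/p\mathbb{Z}$ acts on $m$-partitions and tableaux by permuting the indices: $\sigma(\mathfrak t^0,\mathfrak t^1,\dots,\mathfrak t^{m-1})=(\mathfrak t^{m-d},\mathfrak t^{1-d},\dots,\mathfrak t^{m-1-d})$ (indices mod $m$). Write $\operatorname{Stab}_{\mathbb{Z}/p\mathbb{Z}}(\lambda)=\langle\sigma^t\rangle$ with $t\mid p$. $\Lambda(m,p,n)$ is the set of pairs $\lambda^r$ with $\lambda$ a representative of a $\mathbb{Z}/p\mathbb{Z}$-orbit on $\Lambda(m,1,n)$ and $0\le r<p/t$. Group modules. For $\lambda$ an $m$-partition of $N$, the simple $kG(m,1,N)$-module $\overline{\mathbf S(\lambda)}$ has basis the standard $\lambda$-tableaux, with $t_1\mathfrak t=\xi^{\mathfrak t(1)}\mathfrak t$ and $s_{i,i+1}\mathfrak t=\frac1{a}\mathfrak t+(1+\frac1{a})\mathfrak t_{i\leftrightarrow i+1}$. Here $\mathfrak t_{i\leftrightarrow i+1}$ is $\mathfrak t$ with $i,i+1$ exchanged if this is standard, and $0$ otherwise; $1/a=0$ if $\mathfrak t(i)\ne\mathfrak t(i+1)$, and otherwise $a=(i_0-i_1)-(j_0-j_1)$ with $i$ in row $i_0$, column $i_1$ and $i+1$ in row $j_0$, column $j_1$. For $0\le r<p/t$, $\mathbf S(\lambda^r)=\ker(\sigma^t-\xi^{dtr})\subseteq\overline{\mathbf S(\lambda)}$, a $kG(m,p,N)$-module. Dangles. $V_l$ is the $k$-span of the $(m,n,l)$-dangles: $n$ nodes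 on a line, $l$ arcs each joining two nodes and labelled by an element of $\mathbb{Z}/m\mathbb{Z}$, and $n-2l$ unlabelled free lines from the remaining nodes. $V_l(q,p/t)\subseteq V_l$ is the subspace of dangles whose label sum is congruent to $-q$ modulo $p/t$. $B_{m,1,n}$, and hence $B_{m,p,n}$, acts on $V_l\otimes_k\overline{\mathbf S(\lambda)}$ as follows: place a diagram $X$ above a dangle $v$. If more than $l$ arcs result, or a closed loop with label not divisible by $p$, then $X(v\otimes x)=0$. Otherwise one obtains (up to the product of the $\delta_{ip}$ of the removed loops) a dangle $Xv$ together with an element $w\in G(m,1,n-2l)$ acting on the free lines, and $X(v\otimes x)=(Xv)\otimes wx$. Standard modules. If some $\delta_{ip}\ne0$, fix one such and put $e_{n-2}=\frac1{\delta_{ip}}t_{n-1}^{ip}e_{n-1,n}$ ($n\ge2$); if $\delta=0$ and $n\ge3$, put $e_{n-2}=e_{n-1,n}e_{n-2,n-1}$. This is an idempotent of $B_{m,p,n}$ with $e_{n-2}B_{m,p,n}e_{n-2}\cong B_{m,p,n-2}$ and $B_{m,p,n}/B_{m,p,n}e_{n-2}B_{m,p,n}\cong kG(m,p,n)$. Iterating the first isomorphism gives idempotents $e_{n-2l}\in B_{m,p,n}$ with $e_{n-2l}B_{m,p,n}e_{n-2l}\cong B_{m,p,n-2l}$ (and $e_n=1$). For $\lambda^r\in\Lambda(m,p,n)$ with $\lambda$ an $m$-partition of $n-2l$, the standard module is $$\Delta_n(\lambda^r)=\bigl(B_{m,p,n}/(B_{m,p,n}e_{n-2l-2}B_{m,p,n})\bigr)e_{n-2l}\otimes_{B_{m,p,n-2l}}\mathbf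 S(\lambda^r),$$ where $B_{m,p,n-2l}$ acts on $\mathbf S(\lambda^r)$ through its quotient $kG(m,p,n-2l)$, and the ideal is $0$ if $n-2l<2$.
   Formalization: V_l(q,p/t) is taken with label sum congruent to +q, not -q (with -q the span is not stable under the algebra when p/t>2, 0<2l<n); for n=2l only δ≠0 and r=0 are covered (δ=0: e_0 is undefined; r≠0: Δ=0 but the right-hand side is nonzero). *)

theory Defs
  imports
    "HOL-Algebra.Module"
    "HOL-Algebra.QuotRing"
    "HOL-Algebra.Generated_Groups"
    "HOL-Algebra.Free_Abelian_Groups"
    "HOL-Combinatorics.Transposition"
    "HOL-Number_Theory.Cong"
    "HOL-Computational_Algebra.Polynomial"
begin

section \<open>Left modules over a non-commutative ring, and tensor products\<close>

text \<open>
  The locale \<open>module\<close> of the library requires a commutative ring. We reuse its record type;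
  the fields \<open>mult\<close> and \<open>one\<close> of a record that stands for a module are irrelevant.
\<close>

locale left_module = R?: ring R + M?: abelian_group M for R (structure) and M (structure) +
  assumes smult_closed:
      "\<lbrakk>a \<in> carrier R; x \<in> carrier M\<rbrakk> \<Longrightarrow> a \<odot>\<^bsub>M\<^esub> x \<in> carrier M"
    and smult_l_distr:
      "\<lbrakk>a \<in> carrier R; b \<in> carrier R; x \<in> carrier M\<rbrakk>
        \<Longrightarrow> (a \<oplus>\<^bsub>R\<^esub> b) \<odot>\<^bsub>M\<^esub> x = a \<odot>\<^bsub>M\<^esub> x \<oplus>\<^bsub>M\<^esub> b \<odot>\<^bsub>M\<^esub> x"
    and smult_r_distr:
      "\<lbrakk>a \<in> carrier R; x \<in> carrier M; y \<in> carrier M\<rbrakk>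
        \<Longrightarrow> a \<odot>\<^bsub>M\<^esub> (x \<oplus>\<^bsub>M\<^esub> y) = a \<odot>\<^bsub>M\<^esub> x \<oplus>\<^bsub>M\<^esub> a \<odot>\<^bsub>M\<^esub> y"
    and smult_assoc:
      "\<lbrakk>a \<in> carrier R; b \<in> carrier R; x \<in> carrier M\<rbrakk>
        \<Longrightarrow> (a \<otimes>\<^bsub>R\<^esub> b) \<odot>\<^bsub>M\<^esub> x = a \<odot>\<^bsub>M\<^esub> (b \<odot>\<^bsub>M\<^esub> x)"
    and smult_one: "x \<in> carrier M \<Longrightarrow> \<one>\<^bsub>R\<^esub> \<odot>\<^bsub>M\<^esub> x = x"

definition left_module_iso ::
  "('a, 'r) ring_scheme \<Rightarrow> ('a, 'b, 'e) module_scheme \<Rightarrow> ('a, 'c, 'f) module_scheme \<Rightarrow> bool"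
  where "left_module_iso R M N \<longleftrightarrow>
    left_module R M \<and> left_module R N \<and>
    (\<exists>f. bij_betw f (carrier M) (carrier N) \<and>
      (\<forall>x\<in>carrier M. \<forall>y\<in>carrier M. f (x \<oplus>\<^bsub>M\<^esub> y) = f x \<oplus>\<^bsub>N\<^esub> f y) \<and>
      (\<forall>a\<in>carrier R. \<forall>x\<in>carrier M. f (a \<odot>\<^bsub>M\<^esub> x) = a \<odot>\<^bsub>N\<^esub> f x))"

text \<open>
  The tensor product over a ring \<open>R\<close> of an \<open>(S,R)\<close>-bimodule \<open>M\<close> (a left module whose right
  \<open>R\<close>-action is the extra argument \<open>ract\<close>) with a left \<open>R\<close>-module \<open>N\<close>: the free abelian group on
  pairs modulo the biadditivity and balancing relations. If \<open>S\<close> and \<open>R\<close> are algebras over a field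
  \<open>k\<close> that acts in the same way on both sides of \<open>M\<close>, this is the usual tensor product of
  \<open>k\<close>-vector spaces over \<open>R\<close>.
\<close>

definition tensor_relations ::
  "('s, 'm, 'e) module_scheme \<Rightarrow> ('m \<Rightarrow> 'r \<Rightarrow> 'm) \<Rightarrow> ('r, 'c) ring_scheme \<Rightarrow>
   ('r, 'n, 'f) module_scheme \<Rightarrow> ('m \<times> 'n \<Rightarrow>\<^sub>0 int) set"
  where "tensor_relations M ract R N =
    {frag_of (x \<oplus>\<^bsub>M\<^esub> x', y) - frag_of (x, y) - frag_of (x', y) | x x' y.
       x \<in> carrier M \<and> x' \<in> carrier M \<and> y \<in> carrier N} \<union>
    {frag_of (x, y \<oplus>\<^bsub>N\<^esub> y') - frag_of (x, y) - frag_of (x, y') | x y y'.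
       x \<in> carrier M \<and> y \<in> carrier N \<and> y' \<in> carrier N} \<union>
    {frag_of (ract x a, y) - frag_of (x, a \<odot>\<^bsub>N\<^esub> y) | x a y.
       x \<in> carrier M \<and> a \<in> carrier R \<and> y \<in> carrier N}"

definition tensor_module ::
  "('s, 'm, 'e) module_scheme \<Rightarrow> ('m \<Rightarrow> 'r \<Rightarrow> 'm) \<Rightarrow> ('r, 'c) ring_scheme \<Rightarrow>
   ('r, 'n, 'f) module_scheme \<Rightarrow> ('s, ('m \<times> 'n \<Rightarrow>\<^sub>0 int) set) module"
  where "tensor_module M ract R N =
    (let F = free_Abelian_group (carrier M \<times> carrier N);
         K = generate F (tensor_relations M ract R N);
         T = F Mod K
     in \<lparr>carrier = carrier T, monoid.mult = undefined, monoid.one = undefined,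
         ring.zero = monoid.one T, ring.add = monoid.mult T,
         module.smult = (\<lambda>b C. \<Union>c\<in>C. K #>\<^bsub>F\<^esub> frag_extend (\<lambda>(x, y). frag_of (b \<odot>\<^bsub>M\<^esub> x, y)) c)\<rparr>)"


section \<open>Vector spaces with a given basis\<close>

text \<open>The vector space with basis \<open>A\<close> is the set of all \<open>x :: 'a \<Rightarrow>\<^sub>0 'k\<close> with support in \<open>A\<close>.\<close>

definition pscale :: "'k::field \<Rightarrow> ('a \<Rightarrow>\<^sub>0 'k) \<Rightarrow> ('a \<Rightarrow>\<^sub>0 'k)"
  where "pscale c x = Poly_Mapping.map ((*) c) x"

definition basis :: "'a \<Rightarrow> ('a \<Rightarrow>\<^sub>0 'k::field)"
  where "basis a = Poly_Mapping.single a 1"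

definition lin_ext :: "('a \<Rightarrow> ('b \<Rightarrow>\<^sub>0 'k)) \<Rightarrow> ('a \<Rightarrow>\<^sub>0 'k::field) \<Rightarrow> ('b \<Rightarrow>\<^sub>0 'k)"
  where "lin_ext f x = (\<Sum>a\<in>Poly_Mapping.keys x. pscale (Poly_Mapping.lookup x a) (f a))"

text \<open>The pure tensor \<open>x \<otimes> y\<close>, for the tensor product over \<open>k\<close> of spaces with given bases.\<close>

definition ptensor :: "('a \<Rightarrow>\<^sub>0 'k::field) \<Rightarrow> ('b \<Rightarrow>\<^sub>0 'k) \<Rightarrow> ('a \<times> 'b \<Rightarrow>\<^sub>0 'k)"
  where "ptensor x y = lin_ext (\<lambda>a. lin_ext (\<lambda>b. basis (a, b)) y) x"


section \<open>Diagrams and the algebras of type G(m,p,n)\<close>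

text \<open>
  Nodes are numbered from 1. A labelled strand is the set of its two ends together with a label,
  a natural number less than \<open>m\<close> that stands for an element of \<open>\<int>/m\<int>\<close>.
\<close>

datatype node = North nat | South nat

type_synonym diagram = "(node set \<times> nat) set"

definition nodes :: "nat \<Rightarrow> node set"
  where "nodes n = North ` {1..n} \<union> South ` {1..n}"

definition diagrams :: "nat \<Rightarrow> nat \<Rightarrow> diagram set"
  where "diagrams m n = {X.
    (\<forall>(s, c)\<in>X. s \<subseteq> nodes n \<and> card s = 2 \<and> c < m) \<and>
    (\<forall>a\<in>nodes n. \<exists>!e. e \<in> X \<and> a \<in> fst e)}"

definition label_sum :: "('a set \<times> nat) set \<Rightarrow> nat"
  where "label_sum X = (\<Sum>(s, c)\<in>X. c)"

definition group_diagrams :: "nat \<Rightarrow> nat \<Rightarrow> diagram set"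
  where "group_diagrams m n = {X \<in> diagrams m n. \<forall>(s, c)\<in>X. \<exists>a b. s = {North a, South b}}"

text \<open>
  Stacking \<open>X\<close> above \<open>Y\<close> identifies the southern nodes of \<open>X\<close> with the northern nodes of \<open>Y\<close>
  (\<open>Mid\<close>). Every connected component contains either two outer nodes, and then yields a strand of
  the composite, or none, and then is a closed loop. In the sum of the labels, the strands of \<open>X\<close>
  and those of \<open>Y\<close> are counted separately, since a strand of \<open>X\<close> and one of \<open>Y\<close> can have the
  same ends.
\<close>

datatype stack_node = Top nat | Mid nat | Bot nat

fun upper :: "node \<Rightarrow> stack_node"
  where "upper (North i) = Top i" | "upper (South i) = Mid i"

fun lower :: "node \<Rightarrow> stack_node"
  where "lower (North i) = Mid i" | "lower (South i) = Bot i"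

definition stack_ends :: "diagram \<Rightarrow> diagram \<Rightarrow> stack_node set set"
  where "stack_ends X Y = (\<lambda>e. upper ` fst e) ` X \<union> (\<lambda>e. lower ` fst e) ` Y"

definition components :: "diagram \<Rightarrow> diagram \<Rightarrow> stack_node set set"
  where "components X Y =
    \<Union>(stack_ends X Y) // {(a, b). \<exists>s\<in>stack_ends X Y. a \<in> s \<and> b \<in> s}\<^sup>*"

definition outer :: "stack_node set \<Rightarrow> node set"
  where "outer C = {North i | i. Top i \<in> C} \<union> {South i | i. Bot i \<in> C}"

definition comp_label :: "nat \<Rightarrow> diagram \<Rightarrow> diagram \<Rightarrow> stack_node set \<Rightarrow> nat"
  where "comp_label m X Y C =
    (label_sum {e \<in> X. upper ` fst e \<subseteq> C} + label_sum {e \<in> Y. lower ` fst e \<subseteq> C}) mod m"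

definition compose :: "nat \<Rightarrow> diagram \<Rightarrow> diagram \<Rightarrow> diagram"
  where "compose m X Y =
    {(outer C, comp_label m X Y C) | C. C \<in> components X Y \<and> outer C \<noteq> {}}"

text \<open>The parameter \<open>\<delta> i\<close>, for \<open>i < d\<close>, is the one usually written with the index \<open>i p\<close>.\<close>

definition loop_factor :: "nat \<Rightarrow> nat \<Rightarrow> (nat \<Rightarrow> 'k::field) \<Rightarrow> diagram \<Rightarrow> diagram \<Rightarrow> 'k"
  where "loop_factor m p \<delta> X Y =
    (\<Prod>C \<in> {C \<in> components X Y. outer C = {}}.
       let c = comp_label m X Y C in if p dvd c then \<delta> (c div p) else 0)"

definition diag_mult ::
  "nat \<Rightarrow> nat \<Rightarrow> (nat \<Rightarrow> 'k::field) \<Rightarrow> (diagram \<Rightarrow>\<^sub>0 'k) \<Rightarrow> (diagram \<Rightarrow>\<^sub>0 'k) \<Rightarrow> (diagram \<Rightarrow>\<^sub>0 'k)"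
  where "diag_mult m p \<delta> x y =
    lin_ext (\<lambda>X. lin_ext (\<lambda>Y. pscale (loop_factor m p \<delta> X Y) (basis (compose m X Y))) y) x"

definition id_diagram :: "nat \<Rightarrow> diagram"
  where "id_diagram n = {({North a, South a}, 0) | a. a \<in> {1..n}}"

definition t_diagram :: "nat \<Rightarrow> nat \<Rightarrow> nat \<Rightarrow> nat \<Rightarrow> diagram"
  where "t_diagram m n i j =
    {({North a, South a}, if a = i then j mod m else 0) | a. a \<in> {1..n}}"

definition s_diagram :: "nat \<Rightarrow> nat \<Rightarrow> diagram"
  where "s_diagram n i =
    {({North a, South (Transposition.transpose i (Suc i) a)}, 0) | a. a \<in> {1..n}}"

definition e_diagram :: "nat \<Rightarrow> nat \<Rightarrow> nat \<Rightarrow> diagram"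
  where "e_diagram n i j =
    {({North i, North j}, 0), ({South i, South j}, 0)} \<union>
    {({North a, South a}, 0) | a. a \<in> {1..n} - {i, j}}"

text \<open>
  The scalars of the field are the multiples of the identity diagram, so a homomorphism of modules
  over this ring is also linear over the field.
\<close>

definition brauer_algebra ::
  "nat \<Rightarrow> nat \<Rightarrow> (nat \<Rightarrow> 'k::field) \<Rightarrow> nat \<Rightarrow> (diagram \<Rightarrow>\<^sub>0 'k) ring"
  where "brauer_algebra m p \<delta> n =
    \<lparr>carrier = {x. Poly_Mapping.keys x \<subseteq> {X \<in> diagrams m n. p dvd label_sum X}},
     monoid.mult = diag_mult m p \<delta>, monoid.one = basis (id_diagram n), ring.zero = 0, ring.add = (+)\<rparr>"


section \<open>Idempotents\<close>

text \<open>\<open>i0\<close> is the chosen index with \<open>\<delta> i0 \<noteq> 0\<close>; it plays no role if all parameters vanish.\<close>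

definition idem_step ::
  "nat \<Rightarrow> nat \<Rightarrow> nat \<Rightarrow> (nat \<Rightarrow> 'k::field) \<Rightarrow> nat \<Rightarrow> nat \<Rightarrow> (diagram \<Rightarrow>\<^sub>0 'k)"
  where "idem_step m p d \<delta> i0 n =
    (if \<exists>i<d. \<delta> i \<noteq> 0
     then pscale (1 / \<delta> i0)
            (diag_mult m p \<delta> (basis (t_diagram m n (n - 1) (i0 * p))) (basis (e_diagram n (n - 1) n)))
     else diag_mult m p \<delta> (basis (e_diagram n (n - 1) n)) (basis (e_diagram n (n - 2) (n - 1))))"

text \<open>
  The isomorphism from the algebra on \<open>n - 2\<close> strands to \<open>e B e\<close>, where \<open>e\<close> is \<open>idem_step\<close>:
  add two vertical strands on the right, and multiply by \<open>e\<close> on both sides.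
\<close>

definition add_two_strands :: "nat \<Rightarrow> diagram \<Rightarrow> diagram"
  where "add_two_strands n X =
    X \<union> {({North (n - 1), South (n - 1)}, 0), ({North n, South n}, 0)}"

definition corner_step ::
  "nat \<Rightarrow> nat \<Rightarrow> nat \<Rightarrow> (nat \<Rightarrow> 'k::field) \<Rightarrow> nat \<Rightarrow> nat \<Rightarrow> (diagram \<Rightarrow>\<^sub>0 'k) \<Rightarrow> (diagram \<Rightarrow>\<^sub>0 'k)"
  where "corner_step m p d \<delta> i0 n x =
    diag_mult m p \<delta> (idem_step m p d \<delta> i0 n)
      (diag_mult m p \<delta> (lin_ext (\<lambda>X. basis (add_two_strands n X)) x) (idem_step m p d \<delta> i0 n))"

text \<open>The iterated isomorphism from the algebra on \<open>n - 2 * l\<close> strands, and the image of 1.\<close>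

fun corner ::
  "nat \<Rightarrow> nat \<Rightarrow> nat \<Rightarrow> (nat \<Rightarrow> 'k::field) \<Rightarrow> nat \<Rightarrow> nat \<Rightarrow> nat \<Rightarrow> (diagram \<Rightarrow>\<^sub>0 'k) \<Rightarrow> (diagram \<Rightarrow>\<^sub>0 'k)"
  where
    "corner m p d \<delta> i0 n 0 x = x"
  | "corner m p d \<delta> i0 n (Suc l) x = corner_step m p d \<delta> i0 n (corner m p d \<delta> i0 (n - 2) l x)"

definition idem ::
  "nat \<Rightarrow> nat \<Rightarrow> nat \<Rightarrow> (nat \<Rightarrow> 'k::field) \<Rightarrow> nat \<Rightarrow> nat \<Rightarrow> nat \<Rightarrow> (diagram \<Rightarrow>\<^sub>0 'k)"
  where "idem m p d \<delta> i0 n l = corner m p d \<delta> i0 n l (basis (id_diagram (n - 2 * l)))"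

text \<open>
  If all parameters vanish, \<open>idem_step\<close> makes sense on at least three strands only; on two strands
  there is then no nonzero idempotent in the span of the diagrams with arcs.
\<close>

definition idem_exists :: "nat \<Rightarrow> (nat \<Rightarrow> 'k::field) \<Rightarrow> nat \<Rightarrow> nat \<Rightarrow> bool"
  where "idem_exists d \<delta> n l \<longleftrightarrow> 2 * l \<le> n \<and> (l = 0 \<or> (\<exists>i<d. \<delta> i \<noteq> 0) \<or> 2 * l < n)"


section \<open>Multipartitions and tableaux\<close>

text \<open>
  An \<open>m\<close>-partition is a list of \<open>m\<close> lists of row lengths. A tableau lists the entries:
  \<open>T ! s ! i ! j\<close> is the entry in row \<open>i\<close> and column \<open>j\<close> of component \<open>s\<close>, counted from 0.
\<close>

type_synonym tableau = "nat list list list"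

definition mpartition :: "nat \<Rightarrow> nat \<Rightarrow> nat list list \<Rightarrow> bool"
  where "mpartition m N lam \<longleftrightarrow>
    length lam = m \<and> (\<forall>\<mu>\<in>set lam. sorted_wrt (\<ge>) \<mu> \<and> 0 \<notin> set \<mu>) \<and> sum_list (map sum_list lam) = N"

definition std_tableaux :: "nat list list \<Rightarrow> tableau set"
  where "std_tableaux lam = {T.
    map (map length) T = lam \<and>
    distinct (concat (concat T)) \<and>
    set (concat (concat T)) = {1..sum_list (map sum_list lam)} \<and>
    (\<forall>U\<in>set T. \<forall>row\<in>set U. sorted_wrt (<) row) \<and>
    (\<forall>U\<in>set T. \<forall>i i' j. i < i' \<and> i' < length U \<and> j < length (U ! i') \<longrightarrow> U ! i ! j < U ! i' ! j)}"

text \<open>The component, row and column of the entry \<open>i\<close>.\<close>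

definition position :: "tableau \<Rightarrow> nat \<Rightarrow> nat \<times> nat \<times> nat"
  where "position T i = (THE (s, a, b).
    s < length T \<and> a < length (T ! s) \<and> b < length (T ! s ! a) \<and> T ! s ! a ! b = i)"

definition component :: "tableau \<Rightarrow> nat \<Rightarrow> nat"
  where "component T i = fst (position T i)"

definition row_minus_col :: "tableau \<Rightarrow> nat \<Rightarrow> int"
  where "row_minus_col T i = (case position T i of (s, a, b) \<Rightarrow> int a - int b)"

definition swap_entries :: "nat \<Rightarrow> tableau \<Rightarrow> tableau"
  where "swap_entries i T = map (map (map (Transposition.transpose i (Suc i)))) T"

text \<open>
  The generator of \<open>\<int>/p\<int>\<close>, on \<open>m\<close>-partitions and on tableaux: the component of the result at the
  place \<open>s\<close> is the old component at the place \<open>s - d\<close> modulo the length.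
\<close>

definition shift :: "nat \<Rightarrow> 'a list \<Rightarrow> 'a list"
  where "shift d xs = rotate (length xs - d) xs"

definition stabiliser :: "nat \<Rightarrow> nat \<Rightarrow> nat list list \<Rightarrow> nat set"
  where "stabiliser d p lam = {a \<in> {..<p}. (shift d ^^ a) lam = lam}"


section \<open>Modules for the reflection groups\<close>

definition tableau_space :: "nat list list \<Rightarrow> (tableau \<Rightarrow>\<^sub>0 'k::field) set"
  where "tableau_space lam = {x. Poly_Mapping.keys x \<subseteq> std_tableaux lam}"

text \<open>
  \<open>\<rho>\<close> is the representation of the group of type G(m,1,N) on the span of the standard tableaux that
  is given by the seminormal formulas on the generators. As these elements generate the group, the
  formulas determine \<open>\<rho>\<close> uniquely on the group and the span.
\<close>

definition seminormal_rep ::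
  "nat \<Rightarrow> 'k::field \<Rightarrow> nat list list \<Rightarrow> nat \<Rightarrow>
   (diagram \<Rightarrow> (tableau \<Rightarrow>\<^sub>0 'k) \<Rightarrow> (tableau \<Rightarrow>\<^sub>0 'k)) \<Rightarrow> bool"
  where "seminormal_rep m \<xi> lam N \<rho> \<longleftrightarrow>
    (\<forall>w\<in>group_diagrams m N. \<forall>x\<in>tableau_space lam.
       \<rho> w x \<in> tableau_space lam \<and>
       (\<forall>y\<in>tableau_space lam. \<rho> w (x + y) = \<rho> w x + \<rho> w y) \<and>
       (\<forall>c. \<rho> w (pscale c x) = pscale c (\<rho> w x)) \<and>
       (\<forall>w'\<in>group_diagrams m N. \<rho> (compose m w w') x = \<rho> w (\<rho> w' x))) \<and>
    (\<forall>x\<in>tableau_space lam. \<rho> (id_diagram N) x = x) \<and>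
    (\<forall>T\<in>std_tableaux lam.
       (1 \<le> N \<longrightarrow> \<rho> (t_diagram m N 1 1) (basis T) = pscale (\<xi> ^ component T 1) (basis T)) \<and>
       (\<forall>i. 1 \<le> i \<and> i < N \<longrightarrow>
         (let a = row_minus_col T i - row_minus_col T (Suc i);
              inv_a = (if component T i = component T (Suc i) then 1 / of_int a else 0)
          in \<rho> (s_diagram N i) (basis T) =
               pscale inv_a (basis T) +
               pscale (1 + inv_a)
                 (if swap_entries i T \<in> std_tableaux lam then basis (swap_entries i T) else 0))))"

text \<open>The space \<open>S(\<lambda>\<^sup>r)\<close>, where \<open>t\<close> generates the stabiliser of \<open>\<lambda>\<close>.\<close>

definition specht_space ::
  "nat \<Rightarrow> 'k::field \<Rightarrow> nat list list \<Rightarrow> nat \<Rightarrow> nat \<Rightarrow> (tableau \<Rightarrow>\<^sub>0 'k) set"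
  where "specht_space d \<xi> lam t r =
    {x \<in> tableau_space lam.
       lin_ext (\<lambda>T. basis ((shift d ^^ t) T)) x - pscale (\<xi> ^ (d * t * r)) x = 0}"

text \<open>\<open>S(\<lambda>\<^sup>r)\<close> inflated to the algebra on \<open>N\<close> strands: diagrams with arcs act as zero.\<close>

definition specht_module ::
  "nat \<Rightarrow> nat \<Rightarrow> 'k::field \<Rightarrow> (diagram \<Rightarrow> (tableau \<Rightarrow>\<^sub>0 'k) \<Rightarrow> (tableau \<Rightarrow>\<^sub>0 'k)) \<Rightarrow>
   nat list list \<Rightarrow> nat \<Rightarrow> nat \<Rightarrow> nat \<Rightarrow> (diagram \<Rightarrow>\<^sub>0 'k, tableau \<Rightarrow>\<^sub>0 'k) module"
  where "specht_module m d \<xi> \<rho> lam N t r =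
    \<lparr>carrier = specht_space d \<xi> lam t r, monoid.mult = undefined, monoid.one = undefined,
     ring.zero = 0, ring.add = (+),
     module.smult = (\<lambda>b x. lin_ext (\<lambda>w. if w \<in> group_diagrams m N then \<rho> w x else 0) b)\<rparr>"


section \<open>Standard modules\<close>

definition lower_ideal ::
  "nat \<Rightarrow> nat \<Rightarrow> nat \<Rightarrow> (nat \<Rightarrow> 'k::field) \<Rightarrow> nat \<Rightarrow> nat \<Rightarrow> nat \<Rightarrow> (diagram \<Rightarrow>\<^sub>0 'k) set"
  where "lower_ideal m p d \<delta> i0 n l =
    (if idem_exists d \<delta> n (Suc l)
     then genideal (brauer_algebra m p \<delta> n) {idem m p d \<delta> i0 n (Suc l)} else {0})"

definition standard_module ::
  "nat \<Rightarrow> nat \<Rightarrow> nat \<Rightarrow> 'k::field \<Rightarrow> (nat \<Rightarrow> 'k) \<Rightarrow> nat \<Rightarrow>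
   (diagram \<Rightarrow> (tableau \<Rightarrow>\<^sub>0 'k) \<Rightarrow> (tableau \<Rightarrow>\<^sub>0 'k)) \<Rightarrow> nat \<Rightarrow> nat \<Rightarrow> nat list list \<Rightarrow> nat \<Rightarrow> nat \<Rightarrow>
   (diagram \<Rightarrow>\<^sub>0 'k, ((diagram \<Rightarrow>\<^sub>0 'k) set \<times> (tableau \<Rightarrow>\<^sub>0 'k) \<Rightarrow>\<^sub>0 int) set) module"
  where "standard_module m p d \<xi> \<delta> i0 \<rho> n l lam t r =
    (let B = brauer_algebra m p \<delta> n;
         J = lower_ideal m p d \<delta> i0 n l;
         Q = B Quot J;
         Qe = \<lparr>carrier = {y \<otimes>\<^bsub>Q\<^esub> (J +>\<^bsub>B\<^esub> idem m p d \<delta> i0 n l) | y. y \<in> carrier Q},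
               monoid.mult = undefined, monoid.one = undefined, ring.zero = \<zero>\<^bsub>Q\<^esub>, ring.add = ring.add Q,
               module.smult = (\<lambda>b y. (J +>\<^bsub>B\<^esub> b) \<otimes>\<^bsub>Q\<^esub> y)\<rparr>
     in tensor_module Qe
          (\<lambda>y c. y \<otimes>\<^bsub>Q\<^esub> (J +>\<^bsub>B\<^esub> corner m p d \<delta> i0 n l c))
          (brauer_algebra m p \<delta> (n - 2 * l))
          (specht_module m d \<xi> \<rho> lam (n - 2 * l) t r))"


section \<open>Dangles\<close>

text \<open>A dangle is the set of its labelled arcs; the nodes on no arc carry the free lines.\<close>

type_synonym dangle = "(nat set \<times> nat) set"

definition dangles :: "nat \<Rightarrow> nat \<Rightarrow> nat \<Rightarrow> dangle set"
  where "dangles m n l = {v.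
    card v = l \<and> (\<forall>(s, c)\<in>v. s \<subseteq> {1..n} \<and> card s = 2 \<and> c < m) \<and>
    (\<forall>x\<in>v. \<forall>y\<in>v. x \<noteq> y \<longrightarrow> fst x \<inter> fst y = {})}"

text \<open>
  The span of the dangles whose label sum is \<open>q\<close> modulo \<open>p/t\<close>. The sign is forced by the
  conventions for the shift and for \<open>t\<^sub>1\<close>: by these, \<open>t\<^sub>1\<close> maps \<open>S(\<lambda>\<^sup>r)\<close> onto \<open>S(\<lambda>\<^bsup>r-1\<^esup>)\<close>, so
  moving one unit of label from the arcs of a dangle to its free lines lowers \<open>q\<close> and the
  superscript \<open>q + r\<close> by one. With label sum \<open>-q\<close> instead, the space \<open>dangle_module\<close> below would not
  be stable under the algebra for \<open>p/t > 2\<close>.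
\<close>

definition dangle_space :: "nat \<Rightarrow> nat \<Rightarrow> nat \<Rightarrow> nat \<Rightarrow> nat \<Rightarrow> (dangle \<Rightarrow>\<^sub>0 'k::field) set"
  where "dangle_space m n l q pt =
    {x. Poly_Mapping.keys x \<subseteq> {v \<in> dangles m n l. [label_sum v = q] (mod pt)}}"

text \<open>The nodes on free lines, from left to right.\<close>

definition free_nodes :: "nat \<Rightarrow> dangle \<Rightarrow> nat list"
  where "free_nodes n v = sorted_list_of_set ({1..n} - \<Union>(fst ` v))"

text \<open>
  To place a diagram above a dangle, the \<open>j\<close>-th free line of the dangle is drawn down to a southern
  node \<open>j\<close>. In the composite, the northern arcs form the new dangle; the element \<open>w\<close> of the
  reflection group consists of the through-strands, with the northern ends renumbered from left to
  right.
\<close>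

definition dangle_diagram :: "nat \<Rightarrow> dangle \<Rightarrow> diagram"
  where "dangle_diagram n v =
    {(North ` s, c) | s c. (s, c) \<in> v} \<union>
    {({North (free_nodes n v ! j), South (Suc j)}, 0) | j. j < length (free_nodes n v)}"

definition dangle_above :: "nat \<Rightarrow> nat \<Rightarrow> diagram \<Rightarrow> dangle \<Rightarrow> dangle"
  where "dangle_above m n X v = {(s, c). (North ` s, c) \<in> compose m X (dangle_diagram n v)}"

definition group_element :: "nat \<Rightarrow> nat \<Rightarrow> diagram \<Rightarrow> dangle \<Rightarrow> diagram"
  where "group_element m n X v =
    (let f = free_nodes n (dangle_above m n X v)
     in {({North (Suc j), South b}, c) | j b c.
           j < length f \<and> ({North (f ! j), South b}, c) \<in> compose m X (dangle_diagram n v)})"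

definition dangle_act_basis ::
  "nat \<Rightarrow> nat \<Rightarrow> (nat \<Rightarrow> 'k::field) \<Rightarrow> (diagram \<Rightarrow> (tableau \<Rightarrow>\<^sub>0 'k) \<Rightarrow> (tableau \<Rightarrow>\<^sub>0 'k)) \<Rightarrow>
   nat \<Rightarrow> nat \<Rightarrow> diagram \<Rightarrow> dangle \<Rightarrow> (tableau \<Rightarrow>\<^sub>0 'k) \<Rightarrow> (dangle \<times> tableau \<Rightarrow>\<^sub>0 'k)"
  where "dangle_act_basis m p \<delta> \<rho> n l X v x =
    (if card (dangle_above m n X v) > l then 0
     else pscale (loop_factor m p \<delta> X (dangle_diagram n v))
            (ptensor (basis (dangle_above m n X v)) (\<rho> (group_element m n X v) x)))"

definition dangle_act ::
  "nat \<Rightarrow> nat \<Rightarrow> (nat \<Rightarrow> 'k::field) \<Rightarrow> (diagram \<Rightarrow> (tableau \<Rightarrow>\<^sub>0 'k) \<Rightarrow> (tableau \<Rightarrow>\<^sub>0 'k)) \<Rightarrow>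
   nat \<Rightarrow> nat \<Rightarrow> (diagram \<Rightarrow>\<^sub>0 'k) \<Rightarrow> (dangle \<times> tableau \<Rightarrow>\<^sub>0 'k) \<Rightarrow> (dangle \<times> tableau \<Rightarrow>\<^sub>0 'k)"
  where "dangle_act m p \<delta> \<rho> n l b u =
    lin_ext (\<lambda>X. lin_ext (\<lambda>(v, T). dangle_act_basis m p \<delta> \<rho> n l X v (basis T)) u) b"

definition dangle_module ::
  "nat \<Rightarrow> nat \<Rightarrow> nat \<Rightarrow> 'k::field \<Rightarrow> (nat \<Rightarrow> 'k) \<Rightarrow>
   (diagram \<Rightarrow> (tableau \<Rightarrow>\<^sub>0 'k) \<Rightarrow> (tableau \<Rightarrow>\<^sub>0 'k)) \<Rightarrow> nat \<Rightarrow> nat \<Rightarrow> nat list list \<Rightarrow> nat \<Rightarrow> nat \<Rightarrow>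
   (diagram \<Rightarrow>\<^sub>0 'k, dangle \<times> tableau \<Rightarrow>\<^sub>0 'k) module"
  where "dangle_module m p d \<xi> \<delta> \<rho> n l lam t r =
    \<lparr>carrier = Modules.module.span pscale
       {ptensor v x | v x q. q < p div t \<and> v \<in> dangle_space m n l q (p div t) \<and>
          x \<in> specht_space d \<xi> lam t ((q + r) mod (p div t))},
     monoid.mult = undefined, monoid.one = undefined, ring.zero = 0, ring.add = (+),
     module.smult = dangle_act m p \<delta> \<rho> n l\<rparr>"

end

(*
  Let N = n - 2l. Diagrams with arbitrary numbers of northern and southern nodes form a linear
  category, and in it e_N = U W with W U = 1, where U has n northern and N southern nodes. Hence
  (B/J) e_N is spanned by the classes of D W, for diagrams D with n northern and N southern nodes,
  and the algebra on N strands acts on it by composition with D from below.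

  If D has more than l northern arcs, then it has a southern arc too. Cutting one arc on each side
  gives D = D' x for a diagram x on N strands with arcs; since x kills S(lambda^r), so does D in the
  tensor product. If D has l northern arcs, then D = v w for a unique dangle v and a unique w in
  G(m,1,N), and the isomorphism maps D W (x) s to v (x) w s. It ends in the asserted span because an
  element w with label sum a maps S(lambda^r) into S(lambda^(r-a)), which is checked on generators.
  Conversely v (x) y comes from (v t_1^(-a)) W (x) t_1^a y, where a is the label sum of v.

  Associativity of the composition holds because the components of a stack of three diagrams may be
  computed by first contracting the components of two adjacent ones.
*)

theory Submission
  imports Defs "HOL-Combinatorics.Permutations"
begin

section \<open>Connected components of set systems\<close>

text \<open>The ideal \<open>J\<close> is never determined. It is only shown to lie in the span
  \<open>Kill\<close> of the diagrams with more than \<open>l\<close> northern arcs, so that the map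
  out of the tensor product is well defined; that such diagrams die in the tensor product comes from
  the Specht module, not from \<open>J\<close>. The tensor product is a quotient of a free abelian
  group, so no basis or dimension is at hand on that side. The inverse map is therefore a function
  \<open>Psi\<close> into the free group that is additive only modulo the relations. The delicate
  case is N = 0. Then t_1 does not exist and the label of a dangle cannot be moved to a free line.
  The Specht spaces come to the rescue: the only tableau is empty and fixed by the shift, so
  S(lambda^z) vanishes unless p divides z. This is also why r = 0 is required there: for other r the
  standard module is zero while the span is not. In the factorisation e_N = U W both recipes for the
  idempotents are treated alike: each step is a northern arc times a left inverse of it.\<close>

definition comps :: "'a set set \<Rightarrow> 'a set set"
  where "comps H = \<Union>H // {(a, b). \<exists>s\<in>H. a \<in> s \<and> b \<in> s}\<^sup>*"

text \<open>Components are handled through closed sets: a component is closed and is contained in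
  every closed set that it meets. This spares the construction of paths.\<close>

definition closed_in :: "'a set set \<Rightarrow> 'a set \<Rightarrow> bool"
  where "closed_in H A \<longleftrightarrow> (\<forall>s\<in>H. s \<inter> A \<noteq> {} \<longrightarrow> s \<subseteq> A)"

lemma closed_inD: "closed_in H A \<Longrightarrow> s \<in> H \<Longrightarrow> x \<in> s \<Longrightarrow> x \<in> A \<Longrightarrow> s \<subseteq> A"
  by (auto simp: closed_in_def)

lemma closed_inI: "(\<And>s x. s \<in> H \<Longrightarrow> x \<in> s \<Longrightarrow> x \<in> A \<Longrightarrow> s \<subseteq> A) \<Longrightarrow> closed_in H A"
  by (auto simp: closed_in_def)

lemma closed_in_rtrancl:
  assumes "closed_in H A" "(a, b) \<in> {(a, b). \<exists>s\<in>H. a \<in> s \<and> b \<in> s}\<^sup>*" "a \<in> A"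
  shows "b \<in> A"
  using assms(2,3) by (induction rule: rtrancl_induct) (use assms(1) in \<open>auto simp: closed_in_def\<close>)

lemma closed_in_class: "closed_in H ({(a, b). \<exists>s\<in>H. a \<in> s \<and> b \<in> s}\<^sup>* `` {a})"
  unfolding closed_in_def by (auto intro: rtrancl_into_rtrancl)

lemma comps_closed: "C \<in> comps H \<Longrightarrow> closed_in H C"
  unfolding comps_def by (elim quotientE) (simp add: closed_in_class)

lemma comps_nonempty: "C \<in> comps H \<Longrightarrow> C \<noteq> {}"
  unfolding comps_def by (elim quotientE) auto

lemma comps_subset: assumes "C \<in> comps H" shows "C \<subseteq> \<Union>H"
proof -
  have c: "closed_in H (\<Union>H)" by (auto simp: closed_in_def)
  show ?thesis using assms closed_in_rtrancl[OF c] unfolding comps_def by (elim quotientE) blast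
qed

lemma Union_comps: "\<Union>(comps H) = \<Union>H"
proof
  show "\<Union>(comps H) \<subseteq> \<Union>H" using comps_subset by blast
  show "\<Union>H \<subseteq> \<Union>(comps H)" unfolding comps_def quotient_def by auto
qed

lemma sym_overlap: "sym ({(a, b). \<exists>s\<in>H. a \<in> s \<and> b \<in> s}\<^sup>*)"
  by (rule sym_rtrancl) (auto simp: sym_def)

lemma comps_least:
  assumes "C \<in> comps H" "closed_in H A" "x \<in> A" "x \<in> C"
  shows "C \<subseteq> A"
proof -
  obtain a where C: "C = {(a, b). \<exists>s\<in>H. a \<in> s \<and> b \<in> s}\<^sup>* `` {a}"
    using assms(1) unfolding comps_def by (elim quotientE)
  have "(x, a) \<in> {(a, b). \<exists>s\<in>H. a \<in> s \<and> b \<in> s}\<^sup>*"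
    by (rule symD[OF sym_overlap]) (use assms(4) C in simp)
  then have a: "a \<in> A" by (rule closed_in_rtrancl[OF assms(2) _ assms(3)])
  show ?thesis unfolding C
    by (rule subsetI) (simp, erule closed_in_rtrancl[OF assms(2) _ a])
qed

lemma comps_disjoint: "C \<in> comps H \<Longrightarrow> D \<in> comps H \<Longrightarrow> x \<in> C \<Longrightarrow> x \<in> D \<Longrightarrow> C = D"
  by (meson comps_closed comps_least subset_antisym)

text \<open>Guess and check: a family of nonempty closed sets that covers everything is the family
  of components as soon as each member lies in every closed set it meets. The components of concrete
  stacks are identified in this way.\<close>

lemma comps_eqI:
  assumes "\<Union>P = \<Union>H" "{} \<notin> P" "\<And>C. C \<in> P \<Longrightarrow> closed_in H C"
    "\<And>C A. C \<in> P \<Longrightarrow> closed_in H A \<Longrightarrow> A \<inter> C \<noteq> {} \<Longrightarrow> C \<subseteq> A"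
  shows "comps H = P"
proof
  have *: "C = D" if "C \<in> comps H" "D \<in> P" "x \<in> C" "x \<in> D" for C D x
    using comps_least[OF that(1) assms(3)[OF that(2)] that(4,3)] assms(4)[OF that(2) comps_closed[OF that(1)]] that by blast
  show "comps H \<subseteq> P"
  proof
    fix C assume C: "C \<in> comps H"
    then obtain x where x: "x \<in> C" using comps_nonempty by blast
    then obtain D where "D \<in> P" "x \<in> D" using comps_subset[OF C] unfolding assms(1)[symmetric] by auto
    then show "C \<in> P" using *[OF C _ x] by blast
  qed
  show "P \<subseteq> comps H"
  proof
    fix D assume D: "D \<in> P"
    then obtain x where x: "x \<in> D" using assms(2) by (metis ex_in_conv)
    then have "x \<in> \<Union>(comps H)" using D assms(1) unfolding Union_comps by auto
    then obtain C where "C \<in> comps H" "x \<in> C" by blast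
    then show "D \<in> comps H" using *[OF _ D _ x] by blast
  qed
qed

lemma finite_comps: "finite (\<Union>H) \<Longrightarrow> finite (comps H)"
  by (rule finite_subset[of _ "Pow (\<Union>H)"]) (use comps_subset in auto)

lemma comps_image:
  assumes "inj f" shows "comps ((`) f ` H) = (`) f ` comps H"
proof (rule comps_eqI)
  show "\<Union>((`) f ` comps H) = \<Union>((`) f ` H)"
    using Union_comps[of H] by (metis image_Union)
  show "{} \<notin> (`) f ` comps H" using comps_nonempty by auto
  show "closed_in ((`) f ` H) C" if C: "C \<in> (`) f ` comps H" for C
  proof -
    from C obtain D where D: "C = f ` D" "D \<in> comps H" by (rule imageE)
    show ?thesis unfolding closed_in_def D(1)
    proof (intro ballI impI)
      fix s assume "s \<in> (`) f ` H" and ne: "s \<inter> f ` D \<noteq> {}"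
      then obtain u where u: "s = f ` u" "u \<in> H" by blast
      then have "u \<inter> D \<noteq> {}" using ne assms by (auto dest: injD)
      then show "s \<subseteq> f ` D" using comps_closed[OF D(2)] u unfolding closed_in_def by (metis image_mono)
    qed
  qed
  show "C \<subseteq> A" if "C \<in> (`) f ` comps H" "closed_in ((`) f ` H) A" "A \<inter> C \<noteq> {}" for C A
  proof -
    from that(1) obtain D where D: "C = f ` D" "D \<in> comps H" by (rule imageE)
    have "closed_in H (f -` A)"
    proof (rule closed_inI)
      fix s x assume "s \<in> H" "x \<in> s" "x \<in> f -` A"
      then have "f ` s \<subseteq> A" by (intro closed_inD[OF that(2), of _ "f x"]) auto
      then show "s \<subseteq> f -` A" by auto
    qed
    moreover obtain x where "x \<in> D" "x \<in> f -` A" using \<open>A \<inter> C \<noteq> {}\<close> D(1) by auto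
    ultimately have "D \<subseteq> f -` A" by (intro comps_least[OF D(2)])
    then show ?thesis using D by blast
  qed
qed

lemma comps_Un:
  assumes "\<Union>H \<inter> \<Union>K = {}" shows "comps (H \<union> K) = comps H \<union> comps K"
proof (rule comps_eqI)
  show "\<Union>(comps H \<union> comps K) = \<Union>(H \<union> K)" using Union_comps[of H] Union_comps[of K] by auto
  show "{} \<notin> comps H \<union> comps K" using comps_nonempty by blast
  have cl: "closed_in (H \<union> K) C" if "closed_in H C" "C \<subseteq> \<Union>H" "\<Union>H \<inter> \<Union>K = {}" for C and H K :: "'a set set"
    unfolding closed_in_def
  proof (intro ballI impI)
    fix s assume s: "s \<in> H \<union> K" "s \<inter> C \<noteq> {}"
    show "s \<subseteq> C"
    proof (cases "s \<in> H")
      case False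
      then have "s \<subseteq> \<Union>K" using s(1) by auto
      then have "s \<inter> C = {}" using that(2,3) by blast
      then show ?thesis using s(2) by simp
    qed (use s(2) that(1) in \<open>simp add: closed_in_def\<close>)
  qed
  show "closed_in (H \<union> K) C" if "C \<in> comps H \<union> comps K" for C
    using that
  proof
    assume "C \<in> comps H"
    then show ?thesis by (intro cl comps_closed comps_subset assms)
  next
    assume "C \<in> comps K"
    then have "closed_in (K \<union> H) C" by (intro cl comps_closed comps_subset) (use assms in auto)
    then show ?thesis by (simp add: Un_commute)
  qed
  show "C \<subseteq> A" if "C \<in> comps H \<union> comps K" "closed_in (H \<union> K) A" "A \<inter> C \<noteq> {}" for C A
  proof -
    have "closed_in H A" "closed_in K A" using \<open>closed_in (H \<union> K) A\<close> by (simp_all add: closed_in_def)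
    moreover obtain x where "x \<in> A" "x \<in> C" using \<open>A \<inter> C \<noteq> {}\<close> by auto
    ultimately show ?thesis using \<open>C \<in> comps H \<union> comps K\<close> comps_least[of C H A x] comps_least[of C K A x]
      by (elim UnE)
  qed
qed

text \<open>\<open>I\<close> holds interior nodes of \<open>H1\<close>, invisible to
  \<open>H2\<close>. In \<open>H'\<close> each component \<open>C\<close> of \<open>H1\<close> that
  leaves \<open>I\<close> is contracted to the single edge \<open>C - I\<close>, and
  \<open>L\<close> puts the contracted components back. Components of \<open>H1\<close> inside
  \<open>I\<close> are already complete and are listed separately. The second claim makes
  \<open>L\<close> injective on the components of \<open>H'\<close>.\<close>

lemma comps_contract:
  fixes H1 H2 :: "'a set set" and I :: "'a set"
  assumes H2: "\<And>s. s \<in> H2 \<Longrightarrow> s \<inter> I = {}"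
  defines "H' \<equiv> {C - I | C. C \<in> comps H1 \<and> C - I \<noteq> {}} \<union> H2"
  defines "L \<equiv> \<lambda>D. D \<union> \<Union>{C \<in> comps H1. C \<inter> D \<noteq> {}}"
  shows "comps (H1 \<union> H2) = {C \<in> comps H1. C \<subseteq> I} \<union> L ` comps H'"
    and "D \<in> comps H' \<Longrightarrow> L D - I = D"
proof -
  have nI: "D \<inter> I = {}" if "D \<in> comps H'" for D
    using comps_subset[OF that] H2 unfolding H'_def by blast
  \<comment> \<open>The trace \<open>C - I\<close> is an edge of \<open>H'\<close> that meets
    \<open>D\<close>, and \<open>D\<close> is closed.\<close>
  have CD: "C - I \<subseteq> D" if "D \<in> comps H'" "C \<in> comps H1" "C \<inter> D \<noteq> {}" for C D
  proof -
    have "C - I \<noteq> {}" using that(3) nI[OF that(1)] by blast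
    then have "C - I \<in> H'" using that(2) unfolding H'_def by blast
    moreover obtain x where "x \<in> C" "x \<in> D" using \<open>C \<inter> D \<noteq> {}\<close> by auto
    moreover have "x \<notin> I" using nI[OF that(1)] \<open>x \<in> D\<close> by auto
    ultimately show ?thesis by (intro closed_inD[OF comps_closed[OF that(1)], of _ x]) auto
  qed
  have LD: "L D - I = D" if "D \<in> comps H'" for D
    using CD[OF that] nI[OF that] unfolding L_def by blast
  then show "D \<in> comps H' \<Longrightarrow> L D - I = D" .
  show "comps (H1 \<union> H2) = {C \<in> comps H1. C \<subseteq> I} \<union> L ` comps H'"
  proof (rule comps_eqI)
    show "\<Union>({C \<in> comps H1. C \<subseteq> I} \<union> L ` comps H') = \<Union>(H1 \<union> H2)" (is "?l = ?r")
    proof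
      have "L D \<subseteq> ?r" if "D \<in> comps H'" for D
      proof -
        have "D \<subseteq> \<Union>H'" by (rule comps_subset[OF that])
        also have "\<dots> \<subseteq> ?r" unfolding H'_def using comps_subset[of _ H1] by blast
        finally show ?thesis unfolding L_def using comps_subset[of _ H1] by blast
      qed
      then show "?l \<subseteq> ?r" using comps_subset[of _ H1] by blast
      show "?r \<subseteq> ?l"
      proof
        fix x assume x: "x \<in> ?r"
        show "x \<in> ?l"
        proof (cases "x \<in> \<Union>H1")
          case True
          then obtain C where C: "C \<in> comps H1" "x \<in> C" using Union_comps[of H1] by blast
          show ?thesis
          proof (cases "C \<subseteq> I")
            case False
            then obtain y where y: "y \<in> C" "y \<notin> I" by blast
            then have "y \<in> \<Union>H'" using C unfolding H'_def by blast
            then obtain D where "D \<in> comps H'" "y \<in> D" using Union_comps[of H'] by blast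
            then show ?thesis using C y unfolding L_def by blast
          qed (use C in blast)
        next
          case False
          then have "x \<in> \<Union>H2" using x by simp
          then have "x \<in> \<Union>H'" unfolding H'_def by auto
          then obtain D where "D \<in> comps H'" "x \<in> D" unfolding Union_comps[of H', symmetric] by auto
          then have "x \<in> L D" "L D \<in> L ` comps H'" unfolding L_def by auto
          then show ?thesis by auto
        qed
      qed
    qed
    show "{} \<notin> {C \<in> comps H1. C \<subseteq> I} \<union> L ` comps H'"
      using comps_nonempty[of _ H1] comps_nonempty[of _ H'] unfolding L_def by blast
    show "closed_in (H1 \<union> H2) C" if "C \<in> {C \<in> comps H1. C \<subseteq> I} \<union> L ` comps H'" for C
      using that
    proof
      assume "C \<in> {C \<in> comps H1. C \<subseteq> I}"
      then show ?thesis using comps_closed[of C H1] H2 unfolding closed_in_def by blast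
    next
      assume "C \<in> L ` comps H'"
      then obtain D where D: "D \<in> comps H'" "C = L D" by blast
      show ?thesis unfolding closed_in_def
      proof (intro ballI impI)
        fix s assume s: "s \<in> H1 \<union> H2" "s \<inter> C \<noteq> {}"
        show "s \<subseteq> C"
        proof (cases "s \<in> H2")
          case True
          then have "s \<inter> D \<noteq> {}" using s(2) H2 LD[OF D(1)] D(2) by blast
          then have "s \<subseteq> D" using comps_closed[OF D(1)] True unfolding closed_in_def H'_def by blast
          then show ?thesis using D(2) unfolding L_def by blast
        next
          case False
          obtain x where x: "x \<in> s" "x \<in> C" using s by blast
          then obtain C' where C': "C' \<in> comps H1" "x \<in> C'" using s False Union_comps[of H1] by blast
          have sC': "s \<subseteq> C'" using closed_inD[OF comps_closed[OF C'(1)]] x C' s False by blast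
          have "C' \<inter> D \<noteq> {}"
          proof (cases "x \<in> D")
            case False
            then obtain C'' where "C'' \<in> comps H1" "C'' \<inter> D \<noteq> {}" "x \<in> C''" using x D unfolding L_def by blast
            then show ?thesis using comps_disjoint C' by metis
          qed (use C' in blast)
          then show ?thesis using sC' C' D unfolding L_def by blast
        qed
      qed
    qed
    show "C \<subseteq> A" if "C \<in> {C \<in> comps H1. C \<subseteq> I} \<union> L ` comps H'"
      and A: "closed_in (H1 \<union> H2) A" and "A \<inter> C \<noteq> {}" for C A
    proof -
      have A1: "closed_in H1 A" using A unfolding closed_in_def by blast
      show ?thesis using that(1)
      proof
        assume "C \<in> {C \<in> comps H1. C \<subseteq> I}"
        then show ?thesis using comps_least[of C H1 A] A1 that(3) by blast
      next
        assume "C \<in> L ` comps H'"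
        then obtain D where D: "D \<in> comps H'" "C = L D" by blast
        have in_A: "C' \<subseteq> A" if "C' \<in> comps H1" "x \<in> C'" "x \<in> A" for C' x
          using comps_least[OF that(1) A1 that(3,2)] .
        obtain x where x: "x \<in> A" "x \<in> L D" using \<open>A \<inter> C \<noteq> {}\<close> D(2) by auto
        have "\<exists>y. y \<in> A \<and> y \<in> D"
        proof (cases "x \<in> D")
          case False
          then obtain C' where "C' \<in> comps H1" "x \<in> C'" "C' \<inter> D \<noteq> {}" using x(2) unfolding L_def by auto
          then show ?thesis using in_A[of C' x] x(1) by auto
        qed (use x in auto)
        then obtain y where y: "y \<in> A" "y \<in> D" by auto
        have "closed_in H' (A - I)"
        proof (rule closed_inI)
          fix s z assume s: "s \<in> H'" "z \<in> s" "z \<in> A - I"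
          show "s \<subseteq> A - I"
          proof (cases "s \<in> H2")
            case True
            then show ?thesis using closed_inD[OF A, of s z] s H2[OF True] by auto
          next
            case False
            then obtain C' where "C' \<in> comps H1" "s = C' - I" using s(1) unfolding H'_def by auto
            then show ?thesis using in_A[of C' z] s by auto
          qed
        qed
        moreover have "y \<in> A - I" using y nI[OF D(1)] by auto
        ultimately have "D \<subseteq> A - I" using y(2) comps_least[OF D(1)] by simp
        then show ?thesis using in_A unfolding D L_def by blast
      qed
    qed
  qed
qed

section \<open>Composites of stacks of diagrams\<close>

text \<open>A stack is a list of diagrams together with the places of their nodes; \<open>g\<close> places the
  nodes of the composite.\<close>

definition wt :: "('a \<Rightarrow> 'b) \<Rightarrow> ('a set \<times> nat) set \<Rightarrow> 'b set \<Rightarrow> nat"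
  where "wt f X C = label_sum {e \<in> X. f ` fst e \<subseteq> C}"

definition ends :: "(('a \<Rightarrow> 'b) \<times> ('a set \<times> nat) set) list \<Rightarrow> 'b set set"
  where "ends W = (\<Union>(f, X)\<in>set W. (\<lambda>e. f ` fst e) ` X)"

definition wtl :: "(('a \<Rightarrow> 'b) \<times> ('a set \<times> nat) set) list \<Rightarrow> 'b set \<Rightarrow> nat"
  where "wtl W C = (\<Sum>(f, X)\<leftarrow>W. wt f X C)"

text \<open>Components that meet the image of \<open>g\<close> become strands, with their ends
  pulled back along \<open>g\<close>. The list allows stacks of any height; \<open>compose\<close>
  is the case of two diagrams with \<open>outer_node\<close> for \<open>g\<close>.\<close>

definition gcomp :: "nat \<Rightarrow> ('a \<Rightarrow> 'b) \<Rightarrow> (('a \<Rightarrow> 'b) \<times> ('a set \<times> nat) set) list \<Rightarrow> ('a set \<times> nat) set"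
  where "gcomp m g W = (\<lambda>C. (g -` C, wtl W C mod m)) ` {C \<in> comps (ends W). g -` C \<noteq> {}}"

definition gloop :: "nat \<Rightarrow> (nat \<Rightarrow> 'k::comm_monoid_mult) \<Rightarrow> ('a \<Rightarrow> 'b) \<Rightarrow> (('a \<Rightarrow> 'b) \<times> ('a set \<times> nat) set) list \<Rightarrow> 'k"
  where "gloop m \<phi> g W = (\<Prod>C\<in>{C \<in> comps (ends W). g -` C = {}}. \<phi> (wtl W C mod m))"

text \<open>Strands must be nonempty because an empty edge would lie in every component and be
  counted several times by \<open>wt\<close>.\<close>

definition good :: "('a set \<times> nat) set \<Rightarrow> bool"
  where "good X \<longleftrightarrow> finite X \<and> (\<forall>e\<in>X. finite (fst e) \<and> fst e \<noteq> {})"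

lemma ends_simps [simp]: "ends [] = {}" "ends ((f, X) # W) = (\<lambda>e. f ` fst e) ` X \<union> ends W"
  "ends (W @ W') = ends W \<union> ends W'"
  by (auto simp: ends_def)

lemma wtl_simps [simp]: "wtl [] C = 0" "wtl ((f, X) # W) C = wt f X C + wtl W C"
  "wtl (W @ W') C = wtl W C + wtl W' C"
  by (auto simp: wtl_def)

lemma finite_ends: "\<forall>(f, X)\<in>set W. good X \<Longrightarrow> finite (\<Union>(ends W))"
  by (induction W) (auto simp: good_def)

text \<open>An edge inside a union of components meets one of them and then lies in it; being
  nonempty, it lies in no other.\<close>

lemma wt_Union:
  assumes "good X" "(\<lambda>e. f ` fst e) ` X \<subseteq> H" "S \<subseteq> comps H" "finite S"
  shows "wt f X (\<Union>S) = (\<Sum>C\<in>S. wt f X C)"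
proof -
  have *: "{e \<in> X. f ` fst e \<subseteq> \<Union>S} = (\<Union>C\<in>S. {e \<in> X. f ` fst e \<subseteq> C})" (is "?l = ?r")
  proof
    show "?r \<subseteq> ?l" by blast
    show "?l \<subseteq> ?r"
    proof
      fix e assume e: "e \<in> ?l"
      then have eX: "e \<in> X" "f ` fst e \<subseteq> \<Union>S" by auto
      then have "fst e \<noteq> {}" using assms(1) unfolding good_def by simp
      then obtain x where x: "x \<in> f ` fst e" by auto
      then obtain C where C: "C \<in> S" "x \<in> C" using eX by auto
      have "f ` fst e \<in> H" using eX assms(2) by auto
      moreover have "closed_in H C" using C assms(3) comps_closed by auto
      ultimately have "f ` fst e \<subseteq> C" using closed_inD x C by metis
      then show "e \<in> ?r" using C e by blast
    qed
  qed
  show ?thesis unfolding wt_def label_sum_def *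
  proof (rule sum.UNION_disjoint)
    show "\<forall>C\<in>S. finite {e \<in> X. f ` fst e \<subseteq> C}" using assms(1) by (auto simp: good_def)
    show "\<forall>C\<in>S. \<forall>D\<in>S. C \<noteq> D \<longrightarrow> {e \<in> X. f ` fst e \<subseteq> C} \<inter> {e \<in> X. f ` fst e \<subseteq> D} = {}"
    proof (intro ballI impI equals0I)
      fix C D e assume C1: "C \<in> S" "D \<in> S" "C \<noteq> D" and e: "e \<in> {e \<in> X. f ` fst e \<subseteq> C} \<inter> {e \<in> X. f ` fst e \<subseteq> D}"
      then have "fst e \<noteq> {}" using assms(1) unfolding good_def by simp
      then obtain x where "x \<in> f ` fst e" by auto
      then have "x \<in> C" "x \<in> D" using e by auto
      then show False using comps_disjoint[of C H D x] assms(3) \<open>C \<in> S\<close> \<open>D \<in> S\<close> \<open>C \<noteq> D\<close> by auto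
    qed
  qed fact
qed

lemma wtl_Union:
  assumes "\<forall>(f, X)\<in>set W. good X" "ends W \<subseteq> H" "S \<subseteq> comps H" "finite S"
  shows "wtl W (\<Union>S) = (\<Sum>C\<in>S. wtl W C)"
  using assms(1,2)
proof (induction W)
  case (Cons a W)
  obtain f X where a: "a = (f, X)" by force
  have "wt f X (\<Union>S) = (\<Sum>C\<in>S. wt f X C)" using Cons.prems assms(3,4) unfolding a by (intro wt_Union) auto
  then show ?case using Cons unfolding a by (simp add: sum.distrib)
qed simp

lemma wtl_whole:
  assumes "\<forall>(f, X)\<in>set W. good X" "ends W \<subseteq> H"
  shows "wtl W (\<Union>H) = (\<Sum>(f, X)\<leftarrow>W. label_sum X)"
  using assms
proof (induction W)
  case (Cons a W)
  obtain f X where a: "a = (f, X)" by force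
  have "{e \<in> X. f ` fst e \<subseteq> \<Union>H} = X" using Cons.prems unfolding a by auto
  then have "wt f X (\<Union>H) = label_sum X" unfolding wt_def by simp
  then show ?case using Cons unfolding a by simp
qed simp

lemma inj_on_gcomp: "inj_on (\<lambda>C. (g -` C, wtl W C mod m)) {C \<in> comps (ends W). g -` C \<noteq> {}}"
proof (rule inj_onI)
  fix C D assume C: "C \<in> {C \<in> comps (ends W). g -` C \<noteq> {}}" and D: "D \<in> {C \<in> comps (ends W). g -` C \<noteq> {}}"
    and e: "(g -` C, wtl W C mod m) = (g -` D, wtl W D mod m)"
  obtain x where "g x \<in> C" using C by blast
  moreover then have "g x \<in> D" using e by blast
  ultimately show "C = D" using C D comps_disjoint[of C "ends W" D "g x"] by simp
qed

text \<open>Every edge lies in exactly one component, so the total label is distributed over the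
  strands and the closed loops. Only a congruence holds, since each label of the composite is
  reduced modulo \<open>m\<close>.\<close>

lemma label_sum_gcomp:
  assumes "\<forall>(f, X)\<in>set W. good X"
  shows "[label_sum (gcomp m g W) + (\<Sum>C\<in>{C \<in> comps (ends W). g -` C = {}}. wtl W C mod m)
    = (\<Sum>(f, X)\<leftarrow>W. label_sum X)] (mod m)"
proof -
  have fin: "finite (comps (ends W))" by (rule finite_comps[OF finite_ends[OF assms]])
  have "label_sum (gcomp m g W) = (\<Sum>C\<in>{C \<in> comps (ends W). g -` C \<noteq> {}}. wtl W C mod m)"
    unfolding label_sum_def gcomp_def by (subst sum.reindex[OF inj_on_gcomp]) (simp add: o_def)
  then have "label_sum (gcomp m g W) + (\<Sum>C\<in>{C \<in> comps (ends W). g -` C = {}}. wtl W C mod m)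
    = (\<Sum>C\<in>comps (ends W). wtl W C mod m)"
    using fin by (simp add: sum.union_disjoint[symmetric] disjoint_iff) (rule sum.cong, auto)
  also have "[\<dots> = (\<Sum>C\<in>comps (ends W). wtl W C)] (mod m)" by (rule cong_sum) (simp add: cong_def)
  also have "(\<Sum>C\<in>comps (ends W). wtl W C) = wtl W (\<Union>(comps (ends W)))"
    by (rule wtl_Union[symmetric, where H="ends W"]) (use assms fin in auto)
  also have "\<dots> = (\<Sum>(f, X)\<leftarrow>W. label_sum X)"
    unfolding Union_comps by (rule wtl_whole) (use assms in auto)
  finally show ?thesis .
qed

lemma ends_map: "ends (map (\<lambda>(f, X). (\<phi> \<circ> f, X)) W) = (`) \<phi> ` ends W"
  by (induction W) (force simp: image_Un image_image)+

lemma wtl_map: "inj \<phi> \<Longrightarrow> wtl (map (\<lambda>(f, X). (\<phi> \<circ> f, X)) W) (\<phi> ` C) = wtl W C"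
proof (induction W)
  case (Cons a W)
  obtain f X where a: "a = (f, X)" by force
  have "(\<phi> \<circ> f) ` s \<subseteq> \<phi> ` C \<longleftrightarrow> f ` s \<subseteq> C" for s by (metis Cons.prems image_comp inj_image_subset_iff)
  then show ?case using Cons by (simp add: a wt_def)
qed simp

text \<open>Only incidences matter, so the nodes of a stack may be renamed injectively. This carries
  two-diagram stacks into taller ones and gives the symmetry under reflection.\<close>

lemma gcomp_map:
  assumes "inj \<phi>"
  shows "gcomp m (\<phi> \<circ> g) (map (\<lambda>(f, X). (\<phi> \<circ> f, X)) W) = gcomp m g W"
    and "gloop m h (\<phi> \<circ> g) (map (\<lambda>(f, X). (\<phi> \<circ> f, X)) W) = gloop m h g W"
proof -
  have v: "(\<phi> \<circ> g) -` (\<phi> ` C) = g -` C" for C using assms by (auto simp: inj_image_mem_iff dest: injD)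
  have s: "{C \<in> (`) \<phi> ` K. P ((\<phi> \<circ> g) -` C)} = (`) \<phi> ` {C \<in> K. P (g -` C)}" for K P
    by (auto simp: v[unfolded o_def] o_def image_iff)
  show "gcomp m (\<phi> \<circ> g) (map (\<lambda>(f, X). (\<phi> \<circ> f, X)) W) = gcomp m g W"
    unfolding gcomp_def ends_map comps_image[OF assms] s[where P = "\<lambda>A. A \<noteq> {}"] image_image v wtl_map[OF assms] ..
  have "inj_on ((`) \<phi>) A" for A using assms by (meson inj_image_eq_iff inj_onI)
  then show "gloop m h (\<phi> \<circ> g) (map (\<lambda>(f, X). (\<phi> \<circ> f, X)) W) = gloop m h g W"
    unfolding gloop_def ends_map comps_image[OF assms] s[where P = "\<lambda>A. A = {}"]
    by (subst prod.reindex) (simp_all add: wtl_map[OF assms, unfolded o_def] o_def)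
qed

text \<open>A stack enters only through its edges and its total weights; in particular the order of
  the list is irrelevant.\<close>

lemma gcomp_cong:
  assumes "ends W = ends W'" "wtl W = wtl W'"
  shows "gcomp m g W = gcomp m g W'" "gloop m h g W = gloop m h g W'"
  unfolding gcomp_def gloop_def assms by simp_all

lemma good_gcomp:
  assumes "\<forall>(f, X)\<in>set W. good X" "inj g"
  shows "good (gcomp m g W)"
proof -
  have fin: "finite (comps (ends W))" by (rule finite_comps[OF finite_ends[OF assms(1)]])
  have "finite C" if "C \<in> comps (ends W)" for C
    using comps_subset[OF that] finite_ends[OF assms(1)] finite_subset by blast
  then show ?thesis using fin assms(2) unfolding good_def gcomp_def by (auto intro: finite_vimageI)
qed

lemma wtl_local:
  assumes "\<And>s. s \<in> ends W \<Longrightarrow> s \<subseteq> C \<longleftrightarrow> s \<subseteq> D"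
  shows "wtl W C = wtl W D"
  using assms
proof (induction W)
  case (Cons a W)
  obtain f X where a: "a = (f, X)" by force
  have "wt f X C = wt f X D" unfolding wt_def
    by (rule arg_cong[of _ _ label_sum]) (use Cons.prems a in auto)
  then show ?case using Cons by (simp add: a)
qed simp

text \<open>Rests on \<open>comps_contract\<close>, with the nodes of \<open>W1\<close> outside the
  range of \<open>g\<close> as interior nodes; the hypothesis says that neither \<open>W2\<close>
  nor \<open>h\<close> sees them. The loops of the full stack are the loops closed within
  \<open>W1\<close> and those that close only after the contraction, hence the product of two
  factors.\<close>

lemma gcomp_contract:
  fixes g h :: "'a \<Rightarrow> 'b"
  assumes g1: "\<forall>(f, X)\<in>set W1. good X" and g2: "\<forall>(f, X)\<in>set W2. good X"
    and inj: "inj g" "inj h"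
    and I: "\<And>x. x \<in> \<Union>(ends W1) \<Longrightarrow> x \<notin> range g \<Longrightarrow> x \<notin> \<Union>(ends W2) \<and> x \<notin> range h"
  shows "gcomp m h ((g, gcomp m g W1) # W2) = gcomp m h (W1 @ W2)"
    and "gloop m \<phi> g W1 * gloop m \<phi> h ((g, gcomp m g W1) # W2) = gloop m \<phi> h (W1 @ W2)"
proof -
  define I where "I = \<Union>(ends W1) - range g"
  define H' where "H' = {C - I | C. C \<in> comps (ends W1) \<and> C - I \<noteq> {}} \<union> ends W2"
  define L where "L = (\<lambda>D. D \<union> \<Union>{C \<in> comps (ends W1). C \<inter> D \<noteq> {}})"
  have II: "s \<inter> I = {}" if "s \<in> ends W2" for s using I that unfolding I_def by blast
  have hI: "h x \<notin> I" for x using I unfolding I_def by blast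
  have CI: "g ` (g -` C) = C - I" if "C \<in> comps (ends W1)" for C
    using comps_subset[OF that] unfolding I_def by blast
  have CI0: "g -` C \<noteq> {} \<longleftrightarrow> C - I \<noteq> {}" if "C \<in> comps (ends W1)" for C
    using CI[OF that] by blast
  have H': "ends ((g, gcomp m g W1) # W2) = H'"
  proof -
    have "(\<lambda>e. g ` fst e) ` gcomp m g W1 = (\<lambda>C. g ` (g -` C)) ` {C \<in> comps (ends W1). g -` C \<noteq> {}}"
      unfolding gcomp_def image_image by simp
    also have "\<dots> = (\<lambda>C. C - I) ` {C \<in> comps (ends W1). g -` C \<noteq> {}}"
      by (rule image_cong[OF refl]) (rule CI, simp)
    also have "{C \<in> comps (ends W1). g -` C \<noteq> {}} = {C \<in> comps (ends W1). C - I \<noteq> {}}"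
      using CI0 by (intro Collect_cong conj_cong refl)
    also have "(\<lambda>C. C - I) ` \<dots> = {C - I | C. C \<in> comps (ends W1) \<and> C - I \<noteq> {}}" by auto
    finally show ?thesis unfolding H'_def by simp
  qed
  have main: "comps (ends (W1 @ W2)) = {C \<in> comps (ends W1). C \<subseteq> I} \<union> L ` comps H'"
    unfolding ends_simps H'_def L_def by (rule comps_contract(1)) (rule II)
  have LD: "L D - I = D" if "D \<in> comps H'" for D
    using comps_contract(2)[where I=I and ?H1.0="ends W1" and ?H2.0="ends W2" and D=D] II that unfolding H'_def L_def by blast
  have fin1: "finite (comps (ends W1))" by (rule finite_comps[OF finite_ends[OF g1]])
  have hL: "h -` L D = h -` D" if "D \<in> comps H'" for D using LD[OF that] hI by blast
  have goodX: "good (gcomp m g W1)" by (rule good_gcomp[OF g1 inj(1)])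
  have finH': "finite (comps H')" unfolding H'[symmetric]
    by (rule finite_comps, rule finite_ends) (use goodX g2 in auto)
  have ne2: "s \<noteq> {}" if "s \<in> ends W2" for s using that g2 by (auto simp: ends_def good_def)
  have wI: "wtl (W1 @ W2) C = wtl W1 C" if "C \<subseteq> I" for C
  proof -
    have "wtl W2 C = wtl W2 {}" by (rule wtl_local) (use II ne2 that in blast)
    moreover have "wtl W2 {} = 0" using wtl_Union[OF g2, of "ends W2" "{}"] by simp
    ultimately show ?thesis by simp
  qed
  \<comment> \<open>The labels of the inner composite are already reduced, so the weights agree
    modulo \<open>m\<close> only.\<close>
  have wL: "wtl (W1 @ W2) (L D) mod m = wtl ((g, gcomp m g W1) # W2) D mod m" if D: "D \<in> comps H'" for D
  proof -
    let ?S = "{C \<in> comps (ends W1). C \<inter> D \<noteq> {}}"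
    have nI: "D \<inter> I = {}" using LD[OF D] by blast
    have "wtl W2 (L D) = wtl W2 D" by (rule wtl_local) (use II LD[OF D] in blast)
    moreover have "wtl W1 (L D) = wtl W1 (\<Union>?S)"
    proof (rule wtl_local)
      fix s assume s: "s \<in> ends W1"
      have sne: "s \<noteq> {}" using s g1 by (auto simp: ends_def good_def)
      show "s \<subseteq> L D \<longleftrightarrow> s \<subseteq> \<Union>?S"
      proof
        assume "s \<subseteq> L D"
        then show "s \<subseteq> \<Union>?S"
        proof (intro subsetI)
          fix x assume x: "x \<in> s"
          then obtain C where "C \<in> comps (ends W1)" "x \<in> C" using s Union_comps[of "ends W1"] by blast
          moreover have "x \<in> L D" using x \<open>s \<subseteq> L D\<close> by blast
          ultimately show "x \<in> \<Union>?S" unfolding L_def by blast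
        qed
      qed (auto simp: L_def)
    qed
    moreover have "wtl W1 (\<Union>?S) = (\<Sum>C\<in>?S. wtl W1 C)"
      by (rule wtl_Union[OF g1, of "ends W1"]) (use fin1 in auto)
    moreover have "wt g (gcomp m g W1) D = (\<Sum>C\<in>?S. wtl W1 C mod m)"
    proof -
      have eq: "{e \<in> gcomp m g W1. g ` fst e \<subseteq> D} = (\<lambda>C. (g -` C, wtl W1 C mod m)) ` ?S"
      proof -
        have "C \<in> comps (ends W1) \<and> g -` C \<noteq> {} \<and> g ` (g -` C) \<subseteq> D \<longleftrightarrow> C \<in> ?S" for C
        proof
          assume C: "C \<in> comps (ends W1) \<and> g -` C \<noteq> {} \<and> g ` (g -` C) \<subseteq> D"
          then show "C \<in> ?S" by blast
        next
          assume C: "C \<in> ?S"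
          have ne: "C - I \<noteq> {}" using C nI by blast
          then have "C - I \<in> H'" using C unfolding H'_def by blast
          moreover have "(C - I) \<inter> D \<noteq> {}" using C nI by blast
          ultimately have "C - I \<subseteq> D" using comps_closed[OF D] unfolding closed_in_def by auto
          then show "C \<in> comps (ends W1) \<and> g -` C \<noteq> {} \<and> g ` (g -` C) \<subseteq> D" using CI CI0 C ne by auto
        qed
        then have "{C \<in> comps (ends W1). g -` C \<noteq> {} \<and> g ` (g -` C) \<subseteq> D} = ?S" by auto
        then show ?thesis unfolding gcomp_def
          by (subst \<open>{C \<in> comps (ends W1). g -` C \<noteq> {} \<and> g ` (g -` C) \<subseteq> D} = ?S\<close>[symmetric]) fastforce
      qed
      have "inj_on (\<lambda>C. (g -` C, wtl W1 C mod m)) ?S"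
        by (rule inj_on_subset[OF inj_on_gcomp]) (use CI0 nI in blast)
      then show ?thesis unfolding wt_def eq label_sum_def by (subst sum.reindex) auto
    qed
    ultimately have "wtl (W1 @ W2) (L D) = (\<Sum>C\<in>?S. wtl W1 C) + wtl W2 D"
      "wtl ((g, gcomp m g W1) # W2) D = (\<Sum>C\<in>?S. wtl W1 C mod m) + wtl W2 D" by simp_all
    then show ?thesis using mod_add_left_eq[of "\<Sum>C\<in>?S. wtl W1 C mod m" m "wtl W2 D"]
      mod_add_left_eq[of "\<Sum>C\<in>?S. wtl W1 C" m "wtl W2 D"] by (simp add: mod_sum_eq)
  qed
  have injL: "inj_on L (comps H')" by (rule inj_onI) (metis LD)
  have vI: "h -` C = {}" if "C \<subseteq> I" for C using that hI by blast
  show "gcomp m h ((g, gcomp m g W1) # W2) = gcomp m h (W1 @ W2)"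
    unfolding gcomp_def[of m h] H' main
  proof -
    have "{C \<in> {C \<in> comps (ends W1). C \<subseteq> I} \<union> L ` comps H'. h -` C \<noteq> {}} = L ` {D \<in> comps H'. h -` D \<noteq> {}}" (is "?l = ?r")
    proof -
      have "?l = {C \<in> comps (ends W1). C \<subseteq> I \<and> h -` C \<noteq> {}} \<union> L ` {D \<in> comps H'. h -` L D \<noteq> {}}" by auto
      also have "{C \<in> comps (ends W1). C \<subseteq> I \<and> h -` C \<noteq> {}} = {}" using vI by auto
      also have "{D \<in> comps H'. h -` L D \<noteq> {}} = {D \<in> comps H'. h -` D \<noteq> {}}"
        using hL by (intro Collect_cong conj_cong refl) simp
      finally show ?thesis by simp
    qed
    then show "(\<lambda>C. (h -` C, wtl ((g, gcomp m g W1) # W2) C mod m)) ` {C \<in> comps H'. h -` C \<noteq> {}} =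
      (\<lambda>C. (h -` C, wtl (W1 @ W2) C mod m)) ` {C \<in> {C \<in> comps (ends W1). C \<subseteq> I} \<union> L ` comps H'. h -` C \<noteq> {}}"
      unfolding image_image using hL wL by (simp add: image_image)
  qed
  show "gloop m \<phi> g W1 * gloop m \<phi> h ((g, gcomp m g W1) # W2) = gloop m \<phi> h (W1 @ W2)"
  proof -
    have s: "{C \<in> {C \<in> comps (ends W1). C \<subseteq> I} \<union> L ` comps H'. h -` C = {}}
      = {C \<in> comps (ends W1). g -` C = {}} \<union> L ` {D \<in> comps H'. h -` D = {}}" (is "?l = ?r")
    proof -
      have "?l = {C \<in> comps (ends W1). C \<subseteq> I \<and> h -` C = {}} \<union> L ` {D \<in> comps H'. h -` L D = {}}" by auto
      also have "{C \<in> comps (ends W1). C \<subseteq> I \<and> h -` C = {}} = {C \<in> comps (ends W1). g -` C = {}}"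
        using vI CI0 by (intro Collect_cong conj_cong refl) auto
      also have "{D \<in> comps H'. h -` L D = {}} = {D \<in> comps H'. h -` D = {}}"
        using hL by (intro Collect_cong conj_cong refl) simp
      finally show ?thesis .
    qed
    have dis: "{C \<in> comps (ends W1). g -` C = {}} \<inter> L ` {D \<in> comps H'. h -` D = {}} = {}"
    proof (rule equals0I)
      fix C assume "C \<in> {C \<in> comps (ends W1). g -` C = {}} \<inter> L ` {D \<in> comps H'. h -` D = {}}"
      then obtain D where "C - I = {}" "C = L D" "D \<in> comps H'" using CI0 by auto
      then show False using LD comps_nonempty by metis
    qed
    have "inj_on L {D \<in> comps H'. h -` D = {}}" using injL by (rule inj_on_subset) auto
    then have "(\<Prod>C\<in>L ` {D \<in> comps H'. h -` D = {}}. \<phi> (wtl (W1 @ W2) C mod m))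
      = (\<Prod>D\<in>{D \<in> comps H'. h -` D = {}}. \<phi> (wtl ((g, gcomp m g W1) # W2) D mod m))"
      by (subst prod.reindex) (use wL in auto)
    moreover have "(\<Prod>C\<in>{C \<in> comps (ends W1). g -` C = {}}. \<phi> (wtl (W1 @ W2) C mod m))
      = (\<Prod>C\<in>{C \<in> comps (ends W1). g -` C = {}}. \<phi> (wtl W1 C mod m))"
      by (rule prod.cong) (use wI CI0 in auto)
    ultimately show ?thesis unfolding gloop_def H' main s
      by (subst prod.union_disjoint) (use dis fin1 finH' in auto)
  qed
qed

section \<open>Diagrams with arbitrary sets of northern and southern nodes\<close>

text \<open>Node sets instead of numbers of nodes let a diagram be split into pieces on disjoint
  sets without renumbering, which is how the composites below are computed.\<close>

definition dgr :: "nat \<Rightarrow> nat set \<Rightarrow> nat set \<Rightarrow> diagram set"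
  where "dgr m A B = {X.
    (\<forall>(s, c)\<in>X. s \<subseteq> North ` A \<union> South ` B \<and> card s = 2 \<and> c < m) \<and>
    (\<forall>a\<in>North ` A \<union> South ` B. \<exists>!e. e \<in> X \<and> a \<in> fst e)}"

lemma diagrams_dgr: "diagrams m n = dgr m {1..n} {1..n}"
  unfolding diagrams_def dgr_def nodes_def ..

lemma dgr_edge:
  assumes "X \<in> dgr m A B" "(s, c) \<in> X"
  shows "s \<subseteq> North ` A \<union> South ` B" "card s = 2" "c < m" "s \<noteq> {}" "finite s"
proof -
  show "s \<subseteq> North ` A \<union> South ` B" and 2: "card s = 2" and "c < m" using assms by (auto simp: dgr_def)
  show "s \<noteq> {}" using 2 by auto
  show "finite s" using 2 by (intro card_ge_0_finite) simp
qed

lemma dgr_ex: "X \<in> dgr m A B \<Longrightarrow> a \<in> North ` A \<union> South ` B \<Longrightarrow> \<exists>s c. (s, c) \<in> X \<and> a \<in> s"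
proof -
  assume "X \<in> dgr m A B" "a \<in> North ` A \<union> South ` B"
  then obtain e where "e \<in> X" "a \<in> fst e" unfolding dgr_def by blast
  then show ?thesis by (metis prod.collapse)
qed

lemma dgr_unique:
  assumes "X \<in> dgr m A B" "(s, c) \<in> X" "(s', c') \<in> X" "a \<in> s" "a \<in> s'"
  shows "s = s' \<and> c = c'"
proof -
  have "a \<in> North ` A \<union> South ` B" using dgr_edge(1)[OF assms(1,2)] assms(4) by auto
  then have "\<exists>!e. e \<in> X \<and> a \<in> fst e" using assms(1) by (auto simp: dgr_def)
  then have "(s, c) = (s', c')" using assms(2-5) by (metis fst_conv)
  then show ?thesis by simp
qed

lemma dgrI:
  assumes "\<And>s c. (s, c) \<in> X \<Longrightarrow> s \<subseteq> North ` A \<union> South ` B \<and> card s = 2 \<and> c < m"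
    and "\<And>a. a \<in> North ` A \<union> South ` B \<Longrightarrow> \<exists>s c. (s, c) \<in> X \<and> a \<in> s"
    and "\<And>s c s' c' a. (s, c) \<in> X \<Longrightarrow> (s', c') \<in> X \<Longrightarrow> a \<in> s \<Longrightarrow> a \<in> s' \<Longrightarrow> s = s' \<and> c = c'"
  shows "X \<in> dgr m A B"
proof -
  have "\<exists>!e. e \<in> X \<and> a \<in> fst e" if a: "a \<in> North ` A \<union> South ` B" for a
  proof -
    obtain s c where "(s, c) \<in> X" "a \<in> s" using assms(2)[OF a] by auto
    then show ?thesis using assms(3) by (intro ex1I[of _ "(s, c)"]) fastforce+
  qed
  moreover have "\<forall>(s, c)\<in>X. s \<subseteq> North ` A \<union> South ` B \<and> card s = 2 \<and> c < m" using assms(1) by blast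
  ultimately show ?thesis by (simp add: dgr_def)
qed

lemma finite_dgr_member:
  assumes "finite A" "finite B" "X \<in> dgr m A B" shows "finite X"
proof (rule finite_subset)
  show "X \<subseteq> Pow (North ` A \<union> South ` B) \<times> {..<m}" using dgr_edge[OF assms(3)] by auto
qed (use assms in auto)

lemma good_dgr: "finite A \<Longrightarrow> finite B \<Longrightarrow> X \<in> dgr m A B \<Longrightarrow> good X"
  unfolding good_def using finite_dgr_member[of A B X m] dgr_edge(4,5)[of X m A B] by (metis prod.collapse)

lemma dgr_Un:
  assumes "X1 \<in> dgr m A1 B1" "X2 \<in> dgr m A2 B2" "A1 \<inter> A2 = {}" "B1 \<inter> B2 = {}"
  shows "X1 \<union> X2 \<in> dgr m (A1 \<union> A2) (B1 \<union> B2)"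
proof (rule dgrI)
  have dis: "(North ` A1 \<union> South ` B1) \<inter> (North ` A2 \<union> South ` B2) = {}" using assms(3,4) by auto
  show "s \<subseteq> North ` (A1 \<union> A2) \<union> South ` (B1 \<union> B2) \<and> card s = 2 \<and> c < m" if "(s, c) \<in> X1 \<union> X2" for s c
    using that
  proof
    assume e: "(s, c) \<in> X1" show ?thesis using dgr_edge(1-3)[OF assms(1) e] by (auto simp: image_Un)
  next
    assume e: "(s, c) \<in> X2" show ?thesis using dgr_edge(1-3)[OF assms(2) e] by (auto simp: image_Un)
  qed
  show "\<exists>s c. (s, c) \<in> X1 \<union> X2 \<and> a \<in> s" if "a \<in> North ` (A1 \<union> A2) \<union> South ` (B1 \<union> B2)" for a
  proof -
    have "a \<in> North ` A1 \<union> South ` B1 \<or> a \<in> North ` A2 \<union> South ` B2" using that by auto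
    then show ?thesis using dgr_ex[OF assms(1)] dgr_ex[OF assms(2)] by (metis Un_iff)
  qed
  show "s = s' \<and> c = c'" if "(s, c) \<in> X1 \<union> X2" "(s', c') \<in> X1 \<union> X2" "a \<in> s" "a \<in> s'" for s c s' c' a
    using that(1,2)
  proof (elim UnE)
    assume "(s, c) \<in> X1" "(s', c') \<in> X1" then show ?thesis using dgr_unique[OF assms(1)] that by metis
  next
    assume "(s, c) \<in> X2" "(s', c') \<in> X2" then show ?thesis using dgr_unique[OF assms(2)] that by metis
  next
    assume "(s, c) \<in> X1" "(s', c') \<in> X2" 
    then show ?thesis using dgr_edge(1)[OF assms(1)] dgr_edge(1)[OF assms(2)] that dis by blast
  next
    assume "(s, c) \<in> X2" "(s', c') \<in> X1" 
    then show ?thesis using dgr_edge(1)[OF assms(1)] dgr_edge(1)[OF assms(2)] that dis by blast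
  qed
qed

section \<open>Associativity\<close>

text \<open>A node of a stack is a pair of a level and a number, and \<open>place i j\<close> puts a
  diagram between the levels \<open>i\<close> and \<open>j\<close>. A stack of three diagrams has
  four levels, one more than \<open>stack_node\<close>.\<close>

fun place :: "nat \<Rightarrow> nat \<Rightarrow> node \<Rightarrow> nat \<times> nat"
  where "place i j (North a) = (i, a)" | "place i j (South a) = (j, a)"

fun outer_node :: "node \<Rightarrow> stack_node"
  where "outer_node (North a) = Top a" | "outer_node (South a) = Bot a"

fun place3 :: "nat \<Rightarrow> nat \<Rightarrow> nat \<Rightarrow> stack_node \<Rightarrow> nat \<times> nat"
  where "place3 i j k (Top a) = (i, a)" | "place3 i j k (Mid a) = (j, a)" | "place3 i j k (Bot a) = (k, a)"

definition loop_value :: "nat \<Rightarrow> (nat \<Rightarrow> 'k::field) \<Rightarrow> nat \<Rightarrow> 'k"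
  where "loop_value p \<delta> c = (if p dvd c then \<delta> (c div p) else 0)"

lemma inj_place: "i \<noteq> j \<Longrightarrow> inj (place i j)"
proof (rule injI)
  show "x = y" if "i \<noteq> j" "place i j x = place i j y" for x y
    using that by (cases x; cases y) auto
qed

lemma inj_place3: "i \<noteq> j \<Longrightarrow> j \<noteq> k \<Longrightarrow> i \<noteq> k \<Longrightarrow> inj (place3 i j k)"
proof (rule injI)
  show "x = y" if "i \<noteq> j" "j \<noteq> k" "i \<noteq> k" "place3 i j k x = place3 i j k y" for x y
    using that by (cases x; cases y) auto
qed

lemma inj_upper: "inj upper" and inj_lower: "inj lower" and inj_outer_node: "inj outer_node"
proof -
  have "x = y" if "upper x = upper y" for x y using that by (cases x; cases y) auto
  then show "inj upper" by (rule injI)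
  have "x = y" if "lower x = lower y" for x y using that by (cases x; cases y) auto
  then show "inj lower" by (rule injI)
  have "x = y" if "outer_node x = outer_node y" for x y using that by (cases x; cases y) auto
  then show "inj outer_node" by (rule injI)
qed

lemma place_comp: "place3 i j k \<circ> upper = place i j" "place3 i j k \<circ> lower = place j k"
  "place3 i j k \<circ> outer_node = place i k"
proof -
  have "(place3 i j k \<circ> upper) x = place i j x" "(place3 i j k \<circ> lower) x = place j k x"
    "(place3 i j k \<circ> outer_node) x = place i k x" for x by (cases x; simp)+
  then show "place3 i j k \<circ> upper = place i j" "place3 i j k \<circ> lower = place j k"
    "place3 i j k \<circ> outer_node = place i k" by (auto intro!: ext)
qed

lemma outer_vimage: "outer C = outer_node -` C"
proof (rule Set.set_eqI)
  show "x \<in> outer C \<longleftrightarrow> x \<in> outer_node -` C" for x by (cases x) (auto simp: outer_def)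
qed

lemma components_comps: "components X Y = comps (ends [(upper, X), (lower, Y)])"
  unfolding components_def comps_def stack_ends_def by simp

lemma compose_gcomp: "compose m X Y = gcomp m outer_node [(upper, X), (lower, Y)]"
  unfolding compose_def gcomp_def components_comps outer_vimage comp_label_def wtl_simps wt_def
  by (auto simp: image_iff)

lemma loop_factor_gloop: "loop_factor m p \<delta> X Y = gloop m (loop_value p \<delta>) outer_node [(upper, X), (lower, Y)]"
  unfolding loop_factor_def gloop_def components_comps outer_vimage comp_label_def wtl_simps wt_def
  by (simp add: loop_value_def Let_def)

lemma compose_place:
  assumes "i \<noteq> j" "j \<noteq> k" "i \<noteq> k"
  shows "compose m X Y = gcomp m (place i k) [(place i j, X), (place j k, Y)]"
    and "loop_factor m p \<delta> X Y = gloop m (loop_value p \<delta>) (place i k) [(place i j, X), (place j k, Y)]"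
  using gcomp_map(1)[OF inj_place3[OF assms], where m=m and g=outer_node and W="[(upper, X), (lower, Y)]"]
    gcomp_map(2)[OF inj_place3[OF assms], where m=m and g=outer_node and W="[(upper, X), (lower, Y)]" and h="loop_value p \<delta>"]
  by (simp_all add: compose_gcomp loop_factor_gloop place_comp)

lemma ends_place: "x \<in> \<Union>(ends [(place i j, X)]) \<Longrightarrow> fst x = i \<or> fst x = j"
proof -
  assume "x \<in> \<Union>(ends [(place i j, X)])"
  then obtain y where "x = place i j y" by auto
  then show ?thesis by (cases y) auto
qed

lemma place_range: "fst x = i \<or> fst x = j \<Longrightarrow> x \<in> range (place i j)"
  by (metis place.simps prod.collapse rangeI)

lemma place_range_fst: "x \<in> range (place i j) \<Longrightarrow> fst x = i \<or> fst x = j"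
proof -
  assume "x \<in> range (place i j)"
  then obtain y where "x = place i j y" by auto
  then show ?thesis by (cases y) auto
qed

text \<open>Both bracketings agree with the composite of the full stack of three diagrams:
  contracting the upper pair hides level 1, contracting the lower pair hides level 2.\<close>

lemma compose_assoc:
  assumes "good X" "good Y" "good Z"
  shows "compose m (compose m X Y) Z = compose m X (compose m Y Z)"
    and "loop_factor m p \<delta> X Y * loop_factor m p \<delta> (compose m X Y) Z =
         loop_factor m p \<delta> Y Z * loop_factor m p \<delta> X (compose m Y Z)"
proof -
  let ?X = "(place 0 1, X)" and ?Y = "(place 1 2, Y)" and ?Z = "(place 2 3, Z)"
  have l: "gcomp m (place 0 3) ((place 0 2, gcomp m (place 0 2) [?X, ?Y]) # [?Z]) = gcomp m (place 0 3) ([?X, ?Y] @ [?Z])"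
    "gloop m (loop_value p \<delta>) (place 0 2) [?X, ?Y] * gloop m (loop_value p \<delta>) (place 0 3) ((place 0 2, gcomp m (place 0 2) [?X, ?Y]) # [?Z]) = gloop m (loop_value p \<delta>) (place 0 3) ([?X, ?Y] @ [?Z])"
  proof -
    have I: "x \<notin> \<Union>(ends [?Z]) \<and> x \<notin> range (place 0 3)" if x: "x \<in> \<Union>(ends [?X, ?Y])" "x \<notin> range (place 0 2)" for x
    proof -
      have "x \<in> \<Union>(ends [?X]) \<or> x \<in> \<Union>(ends [?Y])" using x(1) by auto
      then have "fst x = 1" using ends_place place_range[of x 0 2] x(2) by metis
      then show "x \<notin> \<Union>(ends [?Z]) \<and> x \<notin> range (place 0 3)" using ends_place[of x 2 3 Z] place_range_fst[of x 0 3]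
        by auto
    qed
    have g: "\<forall>(f, X)\<in>set [?X, ?Y]. good X" "\<forall>(f, X)\<in>set [?Z]. good X" "inj (place 0 2)" "inj (place 0 3)"
      using assms inj_place by auto
    show "gcomp m (place 0 3) ((place 0 2, gcomp m (place 0 2) [?X, ?Y]) # [?Z]) = gcomp m (place 0 3) ([?X, ?Y] @ [?Z])"
      by (rule gcomp_contract(1)[OF g]) (rule I)
    show "gloop m (loop_value p \<delta>) (place 0 2) [?X, ?Y] * gloop m (loop_value p \<delta>) (place 0 3) ((place 0 2, gcomp m (place 0 2) [?X, ?Y]) # [?Z]) = gloop m (loop_value p \<delta>) (place 0 3) ([?X, ?Y] @ [?Z])"
      by (rule gcomp_contract(2)[OF g]) (rule I)
  qed
  \<comment> \<open>\<open>gcomp_contract\<close> contracts the front of the list, so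
    \<open>X\<close> is moved to the end here; the order is restored afterwards by
    \<open>gcomp_cong\<close>.\<close>
  have r: "gcomp m (place 0 3) ((place 1 3, gcomp m (place 1 3) [?Y, ?Z]) # [?X]) = gcomp m (place 0 3) ([?Y, ?Z] @ [?X])"
    "gloop m (loop_value p \<delta>) (place 1 3) [?Y, ?Z] * gloop m (loop_value p \<delta>) (place 0 3) ((place 1 3, gcomp m (place 1 3) [?Y, ?Z]) # [?X]) = gloop m (loop_value p \<delta>) (place 0 3) ([?Y, ?Z] @ [?X])"
  proof -
    have I: "x \<notin> \<Union>(ends [?X]) \<and> x \<notin> range (place 0 3)" if x: "x \<in> \<Union>(ends [?Y, ?Z])" "x \<notin> range (place 1 3)" for x
    proof -
      have "x \<in> \<Union>(ends [?Y]) \<or> x \<in> \<Union>(ends [?Z])" using x(1) by auto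
      then have "fst x = 2" using ends_place place_range[of x 1 3] x(2) by metis
      then show "x \<notin> \<Union>(ends [?X]) \<and> x \<notin> range (place 0 3)" using ends_place[of x 0 1 X] place_range_fst[of x 0 3]
        by auto
    qed
    have g: "\<forall>(f, X)\<in>set [?Y, ?Z]. good X" "\<forall>(f, X)\<in>set [?X]. good X" "inj (place 1 3)" "inj (place 0 3)"
      using assms inj_place by auto
    show "gcomp m (place 0 3) ((place 1 3, gcomp m (place 1 3) [?Y, ?Z]) # [?X]) = gcomp m (place 0 3) ([?Y, ?Z] @ [?X])"
      by (rule gcomp_contract(1)[OF g]) (rule I)
    show "gloop m (loop_value p \<delta>) (place 1 3) [?Y, ?Z] * gloop m (loop_value p \<delta>) (place 0 3) ((place 1 3, gcomp m (place 1 3) [?Y, ?Z]) # [?X]) = gloop m (loop_value p \<delta>) (place 0 3) ([?Y, ?Z] @ [?X])"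
      by (rule gcomp_contract(2)[OF g]) (rule I)
  qed
  have s: "gcomp m (place 0 3) ([?Y, ?Z] @ [?X]) = gcomp m (place 0 3) ([?X, ?Y] @ [?Z])"
    "gloop m (loop_value p \<delta>) (place 0 3) ([?Y, ?Z] @ [?X]) = gloop m (loop_value p \<delta>) (place 0 3) ([?X, ?Y] @ [?Z])"
    by (rule gcomp_cong; auto simp: fun_eq_iff)+
  have t: "gcomp m (place 0 3) ((place 1 3, W) # [?X]) = gcomp m (place 0 3) [?X, (place 1 3, W)]"
    "gloop m (loop_value p \<delta>) (place 0 3) ((place 1 3, W) # [?X]) = gloop m (loop_value p \<delta>) (place 0 3) [?X, (place 1 3, W)]" for W
    by (rule gcomp_cong; auto simp: fun_eq_iff)+
  have c: "compose m X Y = gcomp m (place 0 2) [?X, ?Y]" "compose m Y Z = gcomp m (place 1 3) [?Y, ?Z]"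
    by (rule compose_place; simp)+
  have c': "compose m (compose m X Y) Z = gcomp m (place 0 3) [(place 0 2, compose m X Y), ?Z]"
    "compose m X (compose m Y Z) = gcomp m (place 0 3) [?X, (place 1 3, compose m Y Z)]"
    by (rule compose_place; simp)+
  show "compose m (compose m X Y) Z = compose m X (compose m Y Z)"
  proof -
    have "compose m (compose m X Y) Z = gcomp m (place 0 3) ([?X, ?Y] @ [?Z])"
      unfolding c'(1) unfolding c(1) by (rule l(1))
    moreover have "compose m X (compose m Y Z) = gcomp m (place 0 3) ([?Y, ?Z] @ [?X])"
      unfolding c'(2) t(1)[symmetric] unfolding c(2) by (rule r(1))
    ultimately show ?thesis unfolding s(1) by (simp only:)
  qed
  have f: "loop_factor m p \<delta> X Y = gloop m (loop_value p \<delta>) (place 0 2) [?X, ?Y]"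
    "loop_factor m p \<delta> Y Z = gloop m (loop_value p \<delta>) (place 1 3) [?Y, ?Z]"
    "loop_factor m p \<delta> (compose m X Y) Z = gloop m (loop_value p \<delta>) (place 0 3) [(place 0 2, compose m X Y), ?Z]"
    "loop_factor m p \<delta> X (compose m Y Z) = gloop m (loop_value p \<delta>) (place 0 3) [?X, (place 1 3, compose m Y Z)]"
    by (rule compose_place; simp)+
  show "loop_factor m p \<delta> X Y * loop_factor m p \<delta> (compose m X Y) Z =
         loop_factor m p \<delta> Y Z * loop_factor m p \<delta> X (compose m Y Z)"
  proof -
    have "loop_factor m p \<delta> X Y * loop_factor m p \<delta> (compose m X Y) Z = gloop m (loop_value p \<delta>) (place 0 3) ([?X, ?Y] @ [?Z])"
      unfolding f(1,3) unfolding c(1) by (rule l(2))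
    moreover have "loop_factor m p \<delta> Y Z * loop_factor m p \<delta> X (compose m Y Z) = gloop m (loop_value p \<delta>) (place 0 3) ([?Y, ?Z] @ [?X])"
      unfolding f(2,4) t(2)[symmetric] unfolding c(2) by (rule r(2))
    ultimately show ?thesis unfolding s(2) by (simp only:)
  qed
qed

text \<open>Loops take their labels away, but a loop whose label is not divisible by
  \<open>p\<close> annihilates the product. If the loop factor is nonzero, nothing is lost modulo
  \<open>p\<close>.\<close>

lemma label_sum_compose:
  assumes "good X" "good Y" "p dvd m" "loop_factor m p \<delta> X Y \<noteq> 0"
  shows "[label_sum (compose m X Y) = label_sum X + label_sum Y] (mod p)"
proof -
  let ?W = "[(upper, X), (lower, Y)]"
  let ?L = "{C \<in> comps (ends ?W). outer_node -` C = {}}"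
  have fin: "finite (comps (ends ?W))" by (rule finite_comps[OF finite_ends]) (use assms in auto)
  have d: "p dvd wtl ?W C mod m" if "C \<in> ?L" for C
  proof (rule ccontr)
    assume "\<not> p dvd wtl ?W C mod m"
    then have "loop_value p \<delta> (wtl ?W C mod m) = 0" by (simp add: loop_value_def)
    then have "gloop m (loop_value p \<delta>) outer_node ?W = 0"
      unfolding gloop_def using that fin by (intro prod_zero) (auto intro: finite_subset)
    then show False using assms(4) loop_factor_gloop by metis
  qed
  then have "p dvd (\<Sum>C\<in>?L. wtl ?W C mod m)" by (rule dvd_sum)
  moreover have "[label_sum (compose m X Y) + (\<Sum>C\<in>?L. wtl ?W C mod m) = (\<Sum>(f, X)\<leftarrow>?W. label_sum X)] (mod p)"
    unfolding compose_gcomp by (rule cong_dvd_modulus_nat[OF label_sum_gcomp assms(3)]) (use assms in auto)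
  ultimately show ?thesis by (simp add: cong_def mod_add_eq) (metis (no_types, lifting) add.right_neutral dvd_imp_mod_0 mod_add_right_eq)
qed

section \<open>The composite of two diagrams is a diagram\<close>

text \<open>The tree bound for a connected graph. A largest subset \<open>A\<close> of
  \<open>C\<close> that obeys the bound must be closed, since an edge leaving \<open>A\<close> would
  add one node and one edge; hence \<open>A\<close> is all of \<open>C\<close>.\<close>

lemma card_component_le:
  assumes "finite H" "\<And>s. s \<in> H \<Longrightarrow> card s = 2" "C \<in> comps H" "finite C"
  shows "card C \<le> card {s \<in> H. s \<subseteq> C} + 1"
proof -
  define F where "F = {A. A \<subseteq> C \<and> A \<noteq> {} \<and> card A \<le> card {s \<in> H. s \<subseteq> A} + 1}"
  have finF: "finite F" by (rule finite_subset[of _ "Pow C"]) (use assms(4) in \<open>auto simp: F_def\<close>)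
  obtain x where "x \<in> C" using comps_nonempty[OF assms(3)] by auto
  then have "{x} \<in> F" by (auto simp: F_def)
  then have "Max (card ` F) \<in> card ` F" using finF by (intro Max_in) auto
  then obtain A where A: "A \<in> F" "card A = Max (card ` F)" by auto
  have finA: "finite A" using A(1) assms(4) finite_subset unfolding F_def by auto
  have "closed_in H A"
  proof (rule closed_inI)
    fix s x assume s: "s \<in> H" "x \<in> s" "x \<in> A"
    show "s \<subseteq> A"
    proof (rule ccontr)
      assume "\<not> s \<subseteq> A"
      then obtain y where y: "y \<in> s" "y \<notin> A" by auto
      then have sxy: "s = {x, y}" using s assms(2)[OF s(1)] by (auto simp: card_2_iff)
      have sC: "s \<subseteq> C" using closed_inD[OF comps_closed[OF assms(3)] s(1,2)] s(3) A(1) by (auto simp: F_def)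
      have "insert s {s \<in> H. s \<subseteq> A} \<subseteq> {s \<in> H. s \<subseteq> insert y A}" using sxy s by auto
      then have "card (insert s {s \<in> H. s \<subseteq> A}) \<le> card {s \<in> H. s \<subseteq> insert y A}"
        using assms(1) by (intro card_mono) auto
      moreover have "card (insert s {s \<in> H. s \<subseteq> A}) = Suc (card {s \<in> H. s \<subseteq> A})"
        using assms(1) y by (intro card_insert_disjoint) auto
      ultimately have "insert y A \<in> F" using A(1) sC y finA by (auto simp: F_def)
      then have "card (insert y A) \<le> Max (card ` F)" using finF by (intro Max_ge) auto
      then show False using A(2) finA y by simp
    qed
  qed
  moreover obtain x where "x \<in> A" using A(1) by (auto simp: F_def)
  ultimately have "C \<subseteq> A" using A(1) by (intro comps_least[OF assms(3)]) (auto simp: F_def)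
  then show ?thesis using A(1) by (auto simp: F_def)
qed

text \<open>Double counting: every node lies on exactly one strand and every strand has two
  ends.\<close>

lemma card_edges_in:
  assumes X: "X \<in> dgr m A B" and fin: "finite A" "finite B"
    and S: "\<And>s c. (s, c) \<in> X \<Longrightarrow> f ` s \<inter> S \<noteq> {} \<Longrightarrow> f ` s \<subseteq> S"
  shows "2 * card {e \<in> X. f ` fst e \<subseteq> S} = card {v \<in> North ` A \<union> South ` B. f v \<in> S}"
proof -
  let ?E = "{e \<in> X. f ` fst e \<subseteq> S}"
  have eq: "{v \<in> North ` A \<union> South ` B. f v \<in> S} = (\<Union>e\<in>?E. fst e)"
  proof
    show "{v \<in> North ` A \<union> South ` B. f v \<in> S} \<subseteq> (\<Union>e\<in>?E. fst e)"
    proof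
      fix v assume v: "v \<in> {v \<in> North ` A \<union> South ` B. f v \<in> S}"
      then obtain s c where "(s, c) \<in> X" "v \<in> s" using dgr_ex[OF X, of v] by blast
      moreover have "f ` s \<inter> S \<noteq> {}" using v \<open>v \<in> s\<close> by auto
      ultimately show "v \<in> (\<Union>e\<in>?E. fst e)" using S[of s c] by (intro UN_I[of "(s, c)"]) auto
    qed
    show "(\<Union>e\<in>?E. fst e) \<subseteq> {v \<in> North ` A \<union> South ` B. f v \<in> S}"
    proof (rule UN_least)
      fix e assume e: "e \<in> ?E"
      then have "fst e \<subseteq> North ` A \<union> South ` B" using dgr_edge(1)[OF X, of "fst e" "snd e"] by simp
      then show "fst e \<subseteq> {v \<in> North ` A \<union> South ` B. f v \<in> S}" using e by auto
    qed
  qed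
  have "card (\<Union>e\<in>?E. fst e) = (\<Sum>e\<in>?E. card (fst e))"
  proof (rule card_UN_disjoint)
    show "finite ?E" using finite_dgr_member[OF fin X] by simp
    show "\<forall>e\<in>?E. finite (fst e)" using dgr_edge(5)[OF X] by auto
    show "\<forall>e\<in>?E. \<forall>e'\<in>?E. e \<noteq> e' \<longrightarrow> fst e \<inter> fst e' = {}"
    proof (intro ballI impI equals0I)
      fix e e' v assume "e \<in> ?E" "e' \<in> ?E" "e \<noteq> e'" "v \<in> fst e \<inter> fst e'"
      then show False using dgr_unique[OF X, of "fst e" "snd e" "fst e'" "snd e'" v] by (auto simp: prod_eq_iff)
    qed
  qed
  also have "\<dots> = (\<Sum>e\<in>?E. 2)" by (rule sum.cong) (use dgr_edge(2)[OF X] in auto)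
  finally show ?thesis unfolding eq by simp
qed

text \<open>Let a component have T top, M middle and B bottom nodes. It contains (T+M)/2 strands of
  \<open>X\<close> and (M+B)/2 of \<open>Y\<close>, so the tree bound gives T+B \<le> 2. As T+B is
  even, an open component has exactly two outer nodes.\<close>

lemma compose_in_dgr:
  assumes X: "X \<in> dgr m A B" and Y: "Y \<in> dgr m B D" and fin: "finite A" "finite B" "finite D" and m: "m > 0"
  shows "compose m X Y \<in> dgr m A D"
proof -
  let ?W = "[(upper, X), (lower, Y)]"
  let ?H = "ends ?W"
  have gX: "good X" and gY: "good Y" using good_dgr X Y fin by blast+
  have finH: "finite (\<Union>?H)" by (rule finite_ends) (use gX gY in auto)
  have UX: "(\<Union>e\<in>X. fst e) = North ` A \<union> South ` B" if "X \<in> dgr m A B" for X A B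
  proof
    show "(\<Union>e\<in>X. fst e) \<subseteq> North ` A \<union> South ` B" by (metis UN_least dgr_edge(1)[OF that] prod.collapse)
    show "North ` A \<union> South ` B \<subseteq> (\<Union>e\<in>X. fst e)"
    proof
      fix a assume "a \<in> North ` A \<union> South ` B"
      then have "\<exists>s c. (s, c) \<in> X \<and> a \<in> s" by (rule dgr_ex[OF that])
      then show "a \<in> (\<Union>e\<in>X. fst e)" by force
    qed
  qed
  have UH: "\<Union>?H = Top ` A \<union> Mid ` B \<union> Bot ` D"
  proof -
    have "\<Union>?H = upper ` (\<Union>e\<in>X. fst e) \<union> lower ` (\<Union>e\<in>Y. fst e)" by auto
    then show ?thesis unfolding UX[OF X] UX[OF Y] by (auto simp: image_Un image_image)
  qed
  have out: "card (outer_node -` C) = 2" and sub: "outer_node -` C \<subseteq> North ` A \<union> South ` D"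
    if C: "C \<in> comps ?H" and ne: "outer_node -` C \<noteq> {}" for C
  proof -
    have Csub: "C \<subseteq> Top ` A \<union> Mid ` B \<union> Bot ` D" using comps_subset[OF C] UH by simp
    have finC: "finite C" by (rule finite_subset[OF Csub]) (use fin in simp)
    let ?T = "{a \<in> A. Top a \<in> C}" and ?M = "{a \<in> B. Mid a \<in> C}" and ?B = "{a \<in> D. Bot a \<in> C}"
    let ?x = "card {e \<in> X. upper ` fst e \<subseteq> C}" and ?y = "card {e \<in> Y. lower ` fst e \<subseteq> C}"
    have x: "2 * ?x = card {v \<in> North ` A \<union> South ` B. upper v \<in> C}"
      by (rule card_edges_in[OF X fin(1,2)])
        (use comps_closed[OF C] in \<open>simp add: closed_in_def ball_Un, metis fst_conv\<close>)
    have y: "2 * ?y = card {v \<in> North ` B \<union> South ` D. lower v \<in> C}"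
      by (rule card_edges_in[OF Y fin(2,3)])
        (use comps_closed[OF C] in \<open>simp add: closed_in_def ball_Un, metis fst_conv\<close>)
    have ix: "{v \<in> North ` A \<union> South ` B. upper v \<in> C} = North ` ?T \<union> South ` ?M" by auto
    have iy: "{v \<in> North ` B \<union> South ` D. lower v \<in> C} = North ` ?M \<union> South ` ?B" by auto
    have iC: "C = Top ` ?T \<union> Mid ` ?M \<union> Bot ` ?B" using Csub by auto
    have io: "outer_node -` C = North ` ?T \<union> South ` ?B"
    proof (rule Set.set_eqI)
      show "v \<in> outer_node -` C \<longleftrightarrow> v \<in> North ` ?T \<union> South ` ?B" for v using Csub by (cases v) auto
    qed
    have cNS: "card (North ` P \<union> South ` Q) = card P + card Q" if "finite P" "finite Q" for P Q
      using that by (subst card_Un_disjoint) (auto simp: card_image inj_on_def)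
    have cC: "card C = card ?T + card ?M + card ?B"
    proof -
      have "card (Top ` ?T \<union> Mid ` ?M \<union> Bot ` ?B) = card (Top ` ?T \<union> Mid ` ?M) + card (Bot ` ?B)"
        using fin by (intro card_Un_disjoint) auto
      also have "card (Top ` ?T \<union> Mid ` ?M) = card (Top ` ?T) + card (Mid ` ?M)"
        using fin by (intro card_Un_disjoint) auto
      finally show ?thesis using iC by (simp add: card_image inj_on_def)
    qed
    have "card C \<le> card {s \<in> ?H. s \<subseteq> C} + 1"
    proof (rule card_component_le[OF _ _ C finC])
      show "finite ?H" using gX gY by (simp add: good_def)
      show "card s = 2" if "s \<in> ?H" for s
        using that dgr_edge(2)[OF X] dgr_edge(2)[OF Y]
        by (auto simp: card_image inj_on_subset[OF inj_upper] inj_on_subset[OF inj_lower])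
    qed
    also have "card {s \<in> ?H. s \<subseteq> C} \<le> ?x + ?y"
    proof -
      have "{s \<in> ?H. s \<subseteq> C} = (\<lambda>e. upper ` fst e) ` {e \<in> X. upper ` fst e \<subseteq> C} \<union> (\<lambda>e. lower ` fst e) ` {e \<in> Y. lower ` fst e \<subseteq> C}"
        by auto
      also have "card \<dots> \<le> card ((\<lambda>e. upper ` fst e) ` {e \<in> X. upper ` fst e \<subseteq> C}) + card ((\<lambda>e. lower ` fst e) ` {e \<in> Y. lower ` fst e \<subseteq> C})"
        by (rule card_Un_le)
      also have "\<dots> \<le> ?x + ?y" using gX gY by (intro add_mono card_image_le) (auto simp: good_def)
      finally show ?thesis .
    qed
    finally have le: "card ?T + card ?M + card ?B \<le> ?x + ?y + 1" unfolding cC by simp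
    have x': "2 * ?x = card ?T + card ?M" using x unfolding ix using cNS[of ?T ?M] fin by simp
    have y': "2 * ?y = card ?M + card ?B" using y unfolding iy using cNS[of ?M ?B] fin by simp
    have o: "card (outer_node -` C) = card ?T + card ?B" unfolding io using cNS[of ?T ?B] fin by simp
    have "finite (outer_node -` C)" unfolding io using fin by simp
    then have "card (outer_node -` C) \<noteq> 0" using ne by simp
    moreover have "even (card ?T + card ?B)" using x' y' by presburger
    ultimately show "card (outer_node -` C) = 2" using le x' y' o by presburger
    show "outer_node -` C \<subseteq> North ` A \<union> South ` D" unfolding io by auto
  qed
  show ?thesis
  proof (rule dgrI)
    show "s \<subseteq> North ` A \<union> South ` D \<and> card s = 2 \<and> c < m" if sc: "(s, c) \<in> compose m X Y" for s c
    proof -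
      obtain C where C: "C \<in> comps ?H" "outer_node -` C \<noteq> {}" "s = outer_node -` C" "c = wtl ?W C mod m"
        using sc unfolding compose_gcomp gcomp_def by auto
      show ?thesis using out[OF C(1,2)] sub[OF C(1,2)] m C(3,4) by simp
    qed
    show "\<exists>s c. (s, c) \<in> compose m X Y \<and> a \<in> s" if "a \<in> North ` A \<union> South ` D" for a
    proof -
      have "outer_node a \<in> \<Union>(comps ?H)" unfolding Union_comps UH using that by auto
      then obtain C where "C \<in> comps ?H" "outer_node a \<in> C" by auto
      then show ?thesis unfolding compose_gcomp gcomp_def by (force simp: image_iff)
    qed
    show "s = s' \<and> c = c'" if sc: "(s, c) \<in> compose m X Y" "(s', c') \<in> compose m X Y" and "a \<in> s" "a \<in> s'" for s c s' c' a
    proof -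
      obtain C where C: "C \<in> comps ?H" "s = outer_node -` C" "c = wtl ?W C mod m"
        using sc(1) unfolding compose_gcomp gcomp_def by auto
      obtain C' where C': "C' \<in> comps ?H" "s' = outer_node -` C'" "c' = wtl ?W C' mod m"
        using sc(2) unfolding compose_gcomp gcomp_def by auto
      have "C = C'" using comps_disjoint[OF C(1) C'(1), of "outer_node a"] that C C' by auto
      then show ?thesis using C C' by simp
    qed
  qed
qed

section \<open>Symmetry and disjoint unions\<close>

fun flip_node :: "node \<Rightarrow> node"
  where "flip_node (North a) = South a" | "flip_node (South a) = North a"

fun flip_stack :: "stack_node \<Rightarrow> stack_node"
  where "flip_stack (Top a) = Bot a" | "flip_stack (Mid a) = Mid a" | "flip_stack (Bot a) = Top a"

text \<open>Reflection in a horizontal line, an anti-automorphism. Facts about southern arcs are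
  obtained from those about northern arcs by means of it.\<close>

definition flip :: "diagram \<Rightarrow> diagram"
  where "flip X = (\<lambda>(s, c). (flip_node ` s, c)) ` X"

lemma flip_flip_node [simp]: "flip_node (flip_node a) = a"
  by (cases a) auto

lemma flip_flip [simp]: "flip (flip X) = X"
  unfolding flip_def by (auto simp: image_image case_prod_unfold)

lemma inj_flip_node: "inj flip_node" by (metis flip_flip_node injI)

lemma flip_in_dgr: "flip X \<in> dgr m B A" if "X \<in> dgr m A B"
proof (rule dgrI)
  show "s \<subseteq> North ` B \<union> South ` A \<and> card s = 2 \<and> c < m" if sc: "(s, c) \<in> flip X" for s c
  proof -
    obtain s' where s': "(s', c) \<in> X" "s = flip_node ` s'" using sc by (auto simp: flip_def)
    have "card s = card s'" unfolding s'(2) by (intro card_image inj_on_subset[OF inj_flip_node]) auto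
    moreover have "flip_node ` (North ` A \<union> South ` B) = North ` B \<union> South ` A"
      by (auto simp: image_Un image_image)
    ultimately show ?thesis using dgr_edge[OF \<open>X \<in> dgr m A B\<close> s'(1)] s'(2) by (metis image_mono)
  qed
  show "\<exists>s c. (s, c) \<in> flip X \<and> a \<in> s" if a: "a \<in> North ` B \<union> South ` A" for a
  proof -
    have "flip_node a \<in> North ` A \<union> South ` B" using a by auto
    then obtain s c where "(s, c) \<in> X" "flip_node a \<in> s" using dgr_ex[OF \<open>X \<in> dgr m A B\<close>] by blast
    then have "(flip_node ` s, c) \<in> flip X" "a \<in> flip_node ` s"
      by (force simp: flip_def image_iff, metis flip_flip_node image_eqI)
    then show ?thesis by blast
  qed
  show "s = s' \<and> c = c'" if sc: "(s, c) \<in> flip X" "(s', c') \<in> flip X" "a \<in> s" "a \<in> s'" for s c s' c' a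
  proof -
    obtain u where u: "(u, c) \<in> X" "s = flip_node ` u" using sc by (auto simp: flip_def)
    obtain u' where u': "(u', c') \<in> X" "s' = flip_node ` u'" using sc by (auto simp: flip_def)
    have "flip_node a \<in> u" "flip_node a \<in> u'" using sc(3,4) unfolding u u' by (metis flip_flip_node imageE)+
    then have "u = u' \<and> c = c'" by (rule dgr_unique[OF \<open>X \<in> dgr m A B\<close> u(1) u'(1)])
    then show ?thesis using u u' by simp
  qed
qed

lemma ends_flip: "ends ((f, flip X) # W) = ends ((f \<circ> flip_node, X) # W)"
  by (auto simp: flip_def image_image case_prod_unfold image_comp)

lemma inj_on_flip: "inj_on (\<lambda>(s, c). (flip_node ` s, c)) X"
  by (rule inj_onI) (use inj_flip_node in \<open>auto simp: inj_image_eq_iff\<close>)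

lemma label_sum_flip [simp]: "label_sum (flip X) = label_sum X"
  unfolding label_sum_def flip_def by (subst sum.reindex[OF inj_on_flip]) (simp add: case_prod_unfold o_def)

lemma wt_flip: "wt f (flip X) = wt (f \<circ> flip_node) X"
proof (rule ext)
  fix C
  have "{e \<in> flip X. f ` fst e \<subseteq> C} = flip {e \<in> X. (f \<circ> flip_node) ` fst e \<subseteq> C}"
  proof -
    let ?g = "\<lambda>(s, c). (flip_node ` s, c)"
    have "{e \<in> ?g ` X. f ` fst e \<subseteq> C} = ?g ` {e \<in> X. f ` fst (?g e) \<subseteq> C}" by auto
    also have "(\<lambda>e. f ` fst (?g e) \<subseteq> C) = (\<lambda>e. (f \<circ> flip_node) ` fst e \<subseteq> C)"
      by (auto simp: fun_eq_iff case_prod_unfold)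
    finally show ?thesis unfolding flip_def .
  qed
  then show "wt f (flip X) C = wt (f \<circ> flip_node) X C" unfolding wt_def by simp
qed

lemma compose_flip:
  shows "compose m (flip Y) (flip X) = flip (compose m X Y)"
    and "loop_factor m p \<delta> (flip Y) (flip X) = loop_factor m p \<delta> X Y"
proof -
  have inj: "inj flip_stack" by (rule injI) (metis flip_stack.elims stack_node.inject stack_node.distinct)
  have f: "upper \<circ> flip_node = flip_stack \<circ> lower" "lower \<circ> flip_node = flip_stack \<circ> upper"
    "outer_node = flip_stack \<circ> (outer_node \<circ> flip_node)"
  proof -
    have "(upper \<circ> flip_node) x = (flip_stack \<circ> lower) x" for x by (cases x; simp)
    then show "upper \<circ> flip_node = flip_stack \<circ> lower" by (rule ext)
    have "(lower \<circ> flip_node) x = (flip_stack \<circ> upper) x" for x by (cases x; simp)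
    then show "lower \<circ> flip_node = flip_stack \<circ> upper" by (rule ext)
    have "outer_node x = (flip_stack \<circ> (outer_node \<circ> flip_node)) x" for x by (cases x; simp)
    then show "outer_node = flip_stack \<circ> (outer_node \<circ> flip_node)" by (rule ext)
  qed
  let ?W = "[(upper, flip Y), (lower, flip X)]" and ?V = "[(upper, X), (lower, Y)]"
  have W: "ends ?W = ends (map (\<lambda>(f, X). (flip_stack \<circ> f, X)) ?V)"
    "wtl ?W = wtl (map (\<lambda>(f, X). (flip_stack \<circ> f, X)) ?V)"
  proof -
    have "ends ?W = ends [(upper \<circ> flip_node, Y)] \<union> ends [(lower \<circ> flip_node, X)]"
      using ends_flip[of upper Y "[(lower, flip X)]"] ends_flip[of lower X "[]"] by simp
    then show "ends ?W = ends (map (\<lambda>(f, X). (flip_stack \<circ> f, X)) ?V)" unfolding f(1,2) by auto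
    show "wtl ?W = wtl (map (\<lambda>(f, X). (flip_stack \<circ> f, X)) ?V)"
      by (rule ext) (simp only: list.map prod.case wtl_simps wt_flip f add.commute add_0_right add_0_left)
  qed
  have g: "gcomp m outer_node ?W = gcomp m (outer_node \<circ> flip_node) ?V"
    "gloop m (loop_value p \<delta>) outer_node ?W = gloop m (loop_value p \<delta>) (outer_node \<circ> flip_node) ?V"
    unfolding gcomp_cong[OF W] by (subst f(3), rule gcomp_map[OF inj])+
  have v: "(outer_node \<circ> flip_node) -` C = flip_node ` (outer_node -` C)" for C
  proof (intro Set.set_eqI iffI)
    fix x assume "x \<in> (outer_node \<circ> flip_node) -` C"
    then show "x \<in> flip_node ` (outer_node -` C)" by (intro image_eqI[of _ _ "flip_node x"]) auto
  qed auto
  show "compose m (flip Y) (flip X) = flip (compose m X Y)"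
  proof -
    have "compose m (flip Y) (flip X) = (\<lambda>C. (flip_node ` (outer_node -` C), wtl ?V C mod m)) ` {C \<in> comps (ends ?V). outer_node -` C \<noteq> {}}"
      unfolding compose_gcomp g(1) unfolding gcomp_def v by simp
    also have "\<dots> = flip (compose m X Y)" unfolding compose_gcomp unfolding gcomp_def flip_def image_image by simp
    finally show ?thesis .
  qed
  show "loop_factor m p \<delta> (flip Y) (flip X) = loop_factor m p \<delta> X Y"
    unfolding loop_factor_gloop g(2) unfolding gloop_def v by simp
qed

text \<open>Diagrams side by side do not interact: the components of the joint stack are those of
  the two stacks. Composites of large diagrams are thereby reduced to a few strands and an
  identity.\<close>

lemma compose_Un:
  assumes X: "X1 \<in> dgr m A1 B1" "X2 \<in> dgr m A2 B2" and Y: "Y1 \<in> dgr m B1 D1" "Y2 \<in> dgr m B2 D2"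
    and dis: "A1 \<inter> A2 = {}" "B1 \<inter> B2 = {}" "D1 \<inter> D2 = {}"
    and fin: "finite A1" "finite A2" "finite B1" "finite B2" "finite D1" "finite D2"
  shows "compose m (X1 \<union> X2) (Y1 \<union> Y2) = compose m X1 Y1 \<union> compose m X2 Y2"
    and "loop_factor m p \<delta> (X1 \<union> X2) (Y1 \<union> Y2) = loop_factor m p \<delta> X1 Y1 * loop_factor m p \<delta> X2 Y2"
proof -
  let ?W = "[(upper, X1 \<union> X2), (lower, Y1 \<union> Y2)]"
  let ?W1 = "[(upper, X1), (lower, Y1)]" and ?W2 = "[(upper, X2), (lower, Y2)]"
  have U: "\<Union>(ends [(upper, X), (lower, Y)]) \<subseteq> Top ` A \<union> Mid ` B \<union> Bot ` D"
    if "X \<in> dgr m A B" "Y \<in> dgr m B D" for X Y A B D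
  proof -
    have "fst e \<subseteq> North ` A \<union> South ` B" if "e \<in> X" for e
      using dgr_edge(1)[OF \<open>X \<in> dgr m A B\<close>, of "fst e" "snd e"] that by simp
    then have "(\<Union>e\<in>X. fst e) \<subseteq> North ` A \<union> South ` B" by auto
    moreover have "fst e \<subseteq> North ` B \<union> South ` D" if "e \<in> Y" for e
      using dgr_edge(1)[OF \<open>Y \<in> dgr m B D\<close>, of "fst e" "snd e"] that by simp
    then have "(\<Union>e\<in>Y. fst e) \<subseteq> North ` B \<union> South ` D" by auto
    moreover have "\<Union>(ends [(upper, X), (lower, Y)]) = upper ` (\<Union>e\<in>X. fst e) \<union> lower ` (\<Union>e\<in>Y. fst e)" by auto
    moreover have "upper ` (North ` A \<union> South ` B) \<union> lower ` (North ` B \<union> South ` D) = Top ` A \<union> Mid ` B \<union> Bot ` D"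
      by (auto simp: image_Un image_image)
    ultimately show ?thesis by (metis image_mono Un_mono)
  qed
  have d: "\<Union>(ends ?W1) \<inter> \<Union>(ends ?W2) = {}"
    using U[OF X(1) Y(1)] U[OF X(2) Y(2)] dis by blast
  have e: "ends ?W = ends ?W1 \<union> ends ?W2" by auto
  have c: "comps (ends ?W) = comps (ends ?W1) \<union> comps (ends ?W2)" unfolding e by (rule comps_Un[OF d])
  have ne: "fst e \<noteq> {}" if "e \<in> X1 \<union> X2 \<union> Y1 \<union> Y2" for e
    using that dgr_edge(4) X Y by (metis UnE prod.collapse)
  have aux: "\<not> f ` fst e \<subseteq> C" if eP: "e \<in> P" and Pne: "\<And>e. e \<in> P \<Longrightarrow> fst e \<noteq> {}" and CP: "C \<inter> (\<Union>e\<in>P. f ` fst e) = {}"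
    for P C e and f :: "node \<Rightarrow> stack_node"
  proof -
    obtain x where "x \<in> fst e" using Pne[OF eP] by auto
    then have "f x \<in> (\<Union>e\<in>P. f ` fst e)" "f x \<in> f ` fst e" using eP by auto
    then show ?thesis using CP by auto
  qed
  have w1: "wtl ?W C = wtl ?W1 C" if "C \<in> comps (ends ?W1)" for C
  proof -
    have C: "C \<inter> \<Union>(ends ?W2) = {}" using comps_subset[OF that] d by (metis Int_mono order_refl subset_empty)
    have "{e \<in> X1 \<union> X2. upper ` fst e \<subseteq> C} = {e \<in> X1. upper ` fst e \<subseteq> C}"
    proof -
      have "\<not> upper ` fst e \<subseteq> C" if "e \<in> X2" for e by (rule aux[OF that]) (use ne in simp, use C in \<open>simp add: Int_Un_distrib\<close>)
      then show ?thesis by auto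
    qed
    moreover have "{e \<in> Y1 \<union> Y2. lower ` fst e \<subseteq> C} = {e \<in> Y1. lower ` fst e \<subseteq> C}"
    proof -
      have "\<not> lower ` fst e \<subseteq> C" if "e \<in> Y2" for e by (rule aux[OF that]) (use ne in simp, use C in \<open>simp add: Int_Un_distrib\<close>)
      then show ?thesis by auto
    qed
    ultimately show ?thesis by (simp add: wt_def)
  qed
  have w2: "wtl ?W C = wtl ?W2 C" if "C \<in> comps (ends ?W2)" for C
  proof -
    have C: "C \<inter> \<Union>(ends ?W1) = {}" using comps_subset[OF that] d by (metis Int_commute Int_mono order_refl subset_empty)
    have "{e \<in> X1 \<union> X2. upper ` fst e \<subseteq> C} = {e \<in> X2. upper ` fst e \<subseteq> C}"
    proof -
      have "\<not> upper ` fst e \<subseteq> C" if "e \<in> X1" for e by (rule aux[OF that]) (use ne in simp, use C in \<open>simp add: Int_Un_distrib\<close>)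
      then show ?thesis by auto
    qed
    moreover have "{e \<in> Y1 \<union> Y2. lower ` fst e \<subseteq> C} = {e \<in> Y2. lower ` fst e \<subseteq> C}"
    proof -
      have "\<not> lower ` fst e \<subseteq> C" if "e \<in> Y1" for e by (rule aux[OF that]) (use ne in simp, use C in \<open>simp add: Int_Un_distrib\<close>)
      then show ?thesis by auto
    qed
    ultimately show ?thesis by (simp add: wt_def)
  qed
  have s: "{C \<in> P \<union> Q. R C} = {C \<in> P. R C} \<union> {C \<in> Q. R C}" for P Q :: "stack_node set set" and R by auto
  show "compose m (X1 \<union> X2) (Y1 \<union> Y2) = compose m X1 Y1 \<union> compose m X2 Y2"
    unfolding compose_gcomp gcomp_def c s image_Un
    by (intro arg_cong2[of _ _ _ _ "(\<union>)"] image_cong refl) (use w1 w2 in auto)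
  have fin': "finite (comps (ends ?W1))" "finite (comps (ends ?W2))"
    using good_dgr[OF _ _ X(1)] good_dgr[OF _ _ X(2)] good_dgr[OF _ _ Y(1)] good_dgr[OF _ _ Y(2)] fin
    by (auto simp del: ends_simps intro!: finite_comps finite_ends)
  have dis': "comps (ends ?W1) \<inter> comps (ends ?W2) = {}"
  proof (rule equals0I)
    fix C assume "C \<in> comps (ends ?W1) \<inter> comps (ends ?W2)"
    then have "C \<subseteq> \<Union>(ends ?W1)" "C \<subseteq> \<Union>(ends ?W2)" "C \<noteq> {}"
      using comps_subset comps_nonempty by blast+
    then show False using d by (metis Int_greatest subset_empty)
  qed
  have "gloop m (loop_value p \<delta>) outer_node ?W =
    (\<Prod>C\<in>{C \<in> comps (ends ?W1). outer_node -` C = {}}. loop_value p \<delta> (wtl ?W C mod m)) *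
    (\<Prod>C\<in>{C \<in> comps (ends ?W2). outer_node -` C = {}}. loop_value p \<delta> (wtl ?W C mod m))"
    unfolding gloop_def c s by (rule prod.union_disjoint) (use fin' dis' in auto)
  also have "\<dots> = gloop m (loop_value p \<delta>) outer_node ?W1 * gloop m (loop_value p \<delta>) outer_node ?W2"
    unfolding gloop_def by (intro arg_cong2[of _ _ _ _ "(*)"] prod.cong refl) (use w1 w2 in auto)
  finally show "loop_factor m p \<delta> (X1 \<union> X2) (Y1 \<union> Y2) = loop_factor m p \<delta> X1 Y1 * loop_factor m p \<delta> X2 Y2"
    unfolding loop_factor_gloop .
qed

section \<open>Arcs and strands\<close>

text \<open>Arcs are stored in the encoding of dangles, so that \<open>dangle_above\<close> is
  \<open>narcs\<close> of a composite. The southern arcs are obtained as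
  \<open>narcs (flip D)\<close>.\<close>

definition narcs :: "diagram \<Rightarrow> dangle"
  where "narcs D = {(s, c). (North ` s, c) \<in> D}"

definition arcs :: "dangle \<Rightarrow> diagram"
  where "arcs v = (\<lambda>(s, c). (North ` s, c)) ` v"

definition strands :: "nat set \<Rightarrow> (nat \<Rightarrow> nat) \<Rightarrow> (nat \<Rightarrow> nat) \<Rightarrow> (nat \<Rightarrow> nat) \<Rightarrow> diagram"
  where "strands J a b c = (\<lambda>j. ({North (a j), South (b j)}, c j)) ` J"

fun south_map :: "(nat \<Rightarrow> nat) \<Rightarrow> node \<Rightarrow> node"
  where "south_map b (North a) = North a" | "south_map b (South a) = South (b a)"

lemma North_image_eq_iff [simp]: "North ` s = North ` s' \<longleftrightarrow> s = s'"
  by (simp add: inj_image_eq_iff inj_def)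

lemma narcs_arcs_Un:
  assumes "\<And>s c. (s, c) \<in> Y \<Longrightarrow> \<exists>a. South a \<in> s"
  shows "narcs (arcs v \<union> Y) = v"
proof -
  have "(North ` s, c) \<notin> Y" for s c
  proof
    assume "(North ` s, c) \<in> Y"
    then obtain a where "South a \<in> North ` s" using assms by blast
    then show False by auto
  qed
  then show ?thesis unfolding narcs_def arcs_def by auto
qed

lemma compsI:
  assumes "C \<subseteq> \<Union>H" "C \<noteq> {}" "closed_in H C" "\<And>A. closed_in H A \<Longrightarrow> A \<inter> C \<noteq> {} \<Longrightarrow> C \<subseteq> A"
  shows "C \<in> comps H"
proof -
  obtain x where x: "x \<in> C" using assms(2) by auto
  then have "x \<in> \<Union>(comps H)" using assms(1) unfolding Union_comps by auto
  then obtain C' where C': "C' \<in> comps H" "x \<in> C'" by auto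
  have "C' \<subseteq> C" by (rule comps_least[OF C'(1) assms(3) x C'(2)])
  moreover have "C \<subseteq> C'" by (rule assms(4)[OF comps_closed[OF C'(1)]]) (use x C' in auto)
  ultimately show ?thesis using C' by auto
qed

lemma upper_image_subset_iff [simp]: "upper ` s \<subseteq> upper ` t \<longleftrightarrow> s \<subseteq> t"
  using inj_upper by (rule inj_image_subset_iff)

text \<open>A northern arc of the upper factor touches no middle node and is therefore a whole
  component of the stack.\<close>

lemma north_arc_compose:
  assumes X: "X \<in> dgr m A B" and fin: "finite A" "finite B" and e: "(s, c) \<in> X" "s \<subseteq> range North" and Y: "good Y"
  shows "(s, c) \<in> compose m X Y"
proof -
  let ?W = "[(upper, X), (lower, Y)]"
  let ?C = "upper ` s"
  have lowT: "lower x \<noteq> Top a" for x a by (cases x) auto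
  have sT: "\<exists>a. z = Top a" if z: "z \<in> ?C" for z
  proof -
    obtain x where "x \<in> s" "z = upper x" using z by auto
    then show ?thesis using e(2) by auto
  qed
  have C: "?C \<in> comps (ends ?W)"
  proof (rule compsI)
    show "?C \<subseteq> \<Union>(ends ?W)" using e(1) by force
    show "?C \<noteq> {}" using dgr_edge(4)[OF X e(1)] by simp
    show "closed_in (ends ?W) ?C"
    proof (rule closed_inI)
      fix t x assume t: "t \<in> ends ?W" "x \<in> t" "x \<in> ?C"
      show "t \<subseteq> ?C"
      proof (cases "\<exists>e\<in>X. t = upper ` fst e")
        case True
        then obtain s' c' where e': "(s', c') \<in> X" "t = upper ` s'" by force
        obtain y where "y \<in> s" "y \<in> s'" using t e'(2) inj_upper by (auto dest: injD)
        then have "s' = s" using dgr_unique[OF X e'(1) e(1)] by blast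
        then show ?thesis using e' by simp
      next
        case False
        then obtain e' where "t = lower ` fst e'" using t(1) by auto
        then show ?thesis using t sT[OF t(3)] lowT by (metis imageE)
      qed
    qed
    show "?C \<subseteq> A'" if "closed_in (ends ?W) A'" "A' \<inter> ?C \<noteq> {}" for A'
    proof -
      have "?C \<in> ends ?W" using e(1) by force
      then show ?thesis using that unfolding closed_in_def by (simp add: Int_commute)
    qed
  qed
  have "{e \<in> X. upper ` fst e \<subseteq> ?C} = {(s, c)}"
  proof -
    have *: "e' = (s, c)" if e': "e' \<in> X" "upper ` fst e' \<subseteq> ?C" for e'
    proof -
      have "(fst e', snd e') \<in> X" "fst e' \<subseteq> s" using e' by auto
      moreover then obtain y where "y \<in> fst e'" using dgr_edge(4)[OF X] by blast
      ultimately show ?thesis using dgr_unique[OF X _ e(1), of "fst e'" "snd e'" y] by (auto simp: prod_eq_iff)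
    qed
    have "(s, c) \<in> {e \<in> X. upper ` fst e \<subseteq> ?C}" using e(1) by simp
    moreover have "{e \<in> X. upper ` fst e \<subseteq> ?C} \<subseteq> {(s, c)}" by (rule subsetI, unfold singleton_iff, rule *) simp_all
    ultimately show ?thesis by (intro equalityI) simp_all
  qed
  moreover have "{e \<in> Y. lower ` fst e \<subseteq> ?C} = {}"
  proof -
    have "\<not> lower ` fst e' \<subseteq> ?C" if "e' \<in> Y" for e'
    proof
      assume sub: "lower ` fst e' \<subseteq> ?C"
      have "fst e' \<noteq> {}" using Y that unfolding good_def by simp
      then obtain x where "x \<in> fst e'" by auto
      then have "lower x \<in> ?C" using sub by auto
      then show False using sT lowT by metis
    qed
    then show ?thesis by auto
  qed
  ultimately have "wt upper X ?C = c" "wt lower Y ?C = 0" by (simp_all only: wt_def label_sum_def) simp_all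
  then have w: "wtl ?W ?C mod m = c" using dgr_edge(3)[OF X e(1)] by simp
  have o: "outer_node -` ?C = s"
  proof (rule Set.set_eqI)
    fix x
    show "x \<in> outer_node -` ?C \<longleftrightarrow> x \<in> s"
    proof
      assume "x \<in> outer_node -` ?C"
      then obtain y where y: "y \<in> s" "outer_node x = upper y" by auto
      then obtain a where "y = North a" using e(2) by auto
      then show "x \<in> s" using y by (cases x) auto
    next
      assume x: "x \<in> s"
      then obtain a where "x = North a" using e(2) by auto
      then show "x \<in> outer_node -` ?C" using x by (auto intro!: image_eqI[of _ _ x])
    qed
  qed
  have ne: "s \<noteq> {}" by (rule dgr_edge(4)[OF X e(1)])
  show ?thesis unfolding compose_gcomp gcomp_def
    by (rule image_eqI[of _ _ ?C]) (use C w o ne in auto)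
qed

lemma narcs_compose:
  assumes "X \<in> dgr m A B" "finite A" "finite B" "good Y"
  shows "narcs X \<subseteq> narcs (compose m X Y)"
  using north_arc_compose[OF assms(1-3) _ _ assms(4)] unfolding narcs_def by auto

lemma card_nodes:
  assumes D: "D \<in> dgr m A B" and fin: "finite A" "finite B"
  shows "card A = (\<Sum>e\<in>D. card {a. North a \<in> fst e})"
proof -
  have "A = (\<Union>e\<in>D. {a. North a \<in> fst e})"
  proof (intro Set.set_eqI iffI)
    fix a assume "a \<in> A"
    then have "\<exists>s c. (s, c) \<in> D \<and> North a \<in> s" by (intro dgr_ex[OF D]) auto
    then show "a \<in> (\<Union>e\<in>D. {a. North a \<in> fst e})" by force
  next
    fix a assume "a \<in> (\<Union>e\<in>D. {a. North a \<in> fst e})"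
    then obtain s c where "(s, c) \<in> D" "North a \<in> s" by auto
    then show "a \<in> A" using dgr_edge(1)[OF D, of s c] by auto
  qed
  also have "card \<dots> = (\<Sum>e\<in>D. card {a. North a \<in> fst e})"
  proof (rule card_UN_disjoint)
    show "finite D" using finite_dgr_member[OF fin D] .
    have "{a. North a \<in> fst e} \<subseteq> A" if "e \<in> D" for e
      using dgr_edge(1)[OF D, of "fst e" "snd e"] that by auto
    then show "\<forall>e\<in>D. finite {a. North a \<in> fst e}" using fin(1) finite_subset by blast
    show "\<forall>e\<in>D. \<forall>e'\<in>D. e \<noteq> e' \<longrightarrow> {a. North a \<in> fst e} \<inter> {a. North a \<in> fst e'} = {}"
    proof (intro ballI impI equals0I)
      fix e e' a assume "e \<in> D" "e' \<in> D" "e \<noteq> e'" "a \<in> {a. North a \<in> fst e} \<inter> {a. North a \<in> fst e'}"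
      then show False using dgr_unique[OF D, of "fst e" "snd e" "fst e'" "snd e'" "North a"] by (auto simp: prod_eq_iff)
    qed
  qed
  finally show ?thesis .
qed

lemma edge_cases:
  assumes "card s = 2"
  obtains (NN) a b where "s = {North a, North b}" "a \<noteq> b" | (SS) a b where "s = {South a, South b}" "a \<noteq> b"
    | (NS) a b where "s = {North a, South b}"
proof -
  obtain x y where "s = {x, y}" "x \<noteq> y" using assms by (auto simp: card_2_iff)
  then show ?thesis using that by (cases x; cases y) (auto simp: insert_commute)
qed

lemma card_narcs:
  "card (narcs D) = card {e \<in> D. fst e \<subseteq> range North}"
proof (rule bij_betw_same_card)
  show "bij_betw (\<lambda>(s, c). (North ` s, c)) (narcs D) {e \<in> D. fst e \<subseteq> range North}"
  proof (rule bij_betwI')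
    show "\<exists>x\<in>narcs D. y = (case x of (s, c) \<Rightarrow> (North ` s, c))" if y: "y \<in> {e \<in> D. fst e \<subseteq> range North}" for y
    proof -
      obtain s where "fst y = North ` s" using y by (auto simp: subset_image_iff)
      then show ?thesis using y by (cases y) (force simp: narcs_def intro!: bexI[of _ "(s, snd y)"])
    qed
  qed (auto simp: narcs_def)
qed

lemma card_sarcs:
  "card (narcs (flip D)) = card {e \<in> D. fst e \<subseteq> range South}"
proof -
  have f: "flip_node ` s \<subseteq> range North \<longleftrightarrow> s \<subseteq> range South" for s
  proof
    assume a: "flip_node ` s \<subseteq> range North"
    show "s \<subseteq> range South"
    proof
      fix x assume "x \<in> s"
      then have "flip_node x \<in> range North" using a by auto
      then show "x \<in> range South" by (cases x) auto
    qed
  qed auto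
  have "{e \<in> flip D. fst e \<subseteq> range North} = (\<lambda>(s, c). (flip_node ` s, c)) ` {e \<in> D. fst e \<subseteq> range South}"
  proof -
    let ?g = "\<lambda>(s, c::nat). (flip_node ` s, c)"
    have "{e \<in> ?g ` D. fst e \<subseteq> range North} = ?g ` {e \<in> D. fst (?g e) \<subseteq> range North}" by auto
    also have "(\<lambda>e. fst (?g e) \<subseteq> range North) = (\<lambda>e. fst e \<subseteq> range South)"
      by (simp add: fun_eq_iff case_prod_unfold f)
    finally show ?thesis unfolding flip_def .
  qed
  then show ?thesis unfolding card_narcs by (simp add: card_image[OF inj_on_flip])
qed

text \<open>Each side has as many nodes as through-strands plus twice its arcs, and the
  through-strands cancel.\<close>

lemma arcs_count:
  assumes D: "D \<in> dgr m A B" and fin: "finite A" "finite B"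
  shows "card A + 2 * card (narcs (flip D)) = card B + 2 * card (narcs D)"
proof -
  let ?n = "\<lambda>e::node set \<times> nat. card {a. North a \<in> fst e}" and ?s = "\<lambda>e::node set \<times> nat. card {a. South a \<in> fst e}"
  have finD: "finite D" using finite_dgr_member[OF fin D] .
  have cA: "card A = (\<Sum>e\<in>D. ?n e)" by (rule card_nodes[OF D fin])
  have cB: "card B = (\<Sum>e\<in>D. ?s e)"
  proof -
    have "card B = (\<Sum>e\<in>flip D. ?n e)" by (rule card_nodes[OF flip_in_dgr[OF D] fin(2,1)])
    also have "\<dots> = (\<Sum>e\<in>D. ?n ((\<lambda>(s, c). (flip_node ` s, c)) e))"
      unfolding flip_def by (subst sum.reindex[OF inj_on_flip]) simp
    also have "\<dots> = (\<Sum>e\<in>D. ?s e)"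
    proof (rule sum.cong[OF refl])
      fix e :: "node set \<times> nat"
      have "North a \<in> flip_node ` fst e \<longleftrightarrow> South a \<in> fst e" for a
        by (metis flip_flip_node flip_node.simps(1) image_iff)
      then show "?n ((\<lambda>(s, c). (flip_node ` s, c)) e) = ?s e" by (simp add: case_prod_unfold)
    qed
    finally show ?thesis .
  qed
  have "?n e + 2 * of_bool (fst e \<subseteq> range South) = ?s e + 2 * of_bool (fst e \<subseteq> range North)" if "e \<in> D" for e
  proof -
    have "card (fst e) = 2" using dgr_edge(2)[OF D, of "fst e" "snd e"] that by simp
    then show ?thesis
    proof (cases rule: edge_cases)
      case (NN a b)
      have "{x. x = a \<or> x = b} = {a, b}" by auto
      then show ?thesis using NN by auto
    next
      case (SS a b)
      have "{x. x = a \<or> x = b} = {a, b}" by auto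
      then show ?thesis using SS by auto
    next
      case (NS a b)
      then show ?thesis by auto
    qed
  qed
  then have "(\<Sum>e\<in>D. ?n e + 2 * of_bool (fst e \<subseteq> range South)) = (\<Sum>e\<in>D. ?s e + 2 * of_bool (fst e \<subseteq> range North))"
    by (rule sum.cong[OF refl])
  moreover have s: "(\<Sum>e\<in>D. of_bool (P (fst e))) = card {e \<in> D. P (fst e)}" for P
    using finD by (simp add: of_bool_def sum.If_cases Int_def)
  note s[of "\<lambda>s. s \<subseteq> range North"] s[of "\<lambda>s. s \<subseteq> range South"]
  ultimately show ?thesis unfolding cA cB card_sarcs unfolding card_narcs
    by (simp add: sum.distrib sum_distrib_left[symmetric])
qed

lemma finite_narcs: "finite D \<Longrightarrow> finite (narcs D)"
proof (rule finite_subset)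
  have "North -` North ` s = s" for s by auto
  then show "narcs D \<subseteq> (\<lambda>(s, c). (North -` s, c)) ` D" unfolding narcs_def by force
qed simp

lemma card_narcs_compose_left:
  assumes X: "X \<in> dgr m A B" and Y: "Y \<in> dgr m B D" and fin: "finite A" "finite B" "finite D" and m: "m > 0"
  shows "card (narcs X) \<le> card (narcs (compose m X Y))"
  by (intro card_mono finite_narcs narcs_compose[OF X fin(1,2)] finite_dgr_member[OF fin(1,3)]
      good_dgr[OF fin(2,3) Y]) (rule compose_in_dgr[OF X Y fin m])

text \<open>The southern arcs of \<open>Y\<close> survive. As \<open>A\<close> and \<open>B\<close>
  have equal size, \<open>Y\<close> and the composite have the same surplus of northern over
  southern arcs by \<open>arcs_count\<close>, so the inequality passes to the northern arcs.\<close>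

lemma card_narcs_compose_right:
  assumes X: "X \<in> dgr m A B" and Y: "Y \<in> dgr m B D" and fin: "finite A" "finite B" "finite D" and m: "m > 0"
    and AB: "card A = card B"
  shows "card (narcs Y) \<le> card (narcs (compose m X Y))"
proof -
  have "card (narcs (flip Y)) \<le> card (narcs (compose m (flip Y) (flip X)))"
    by (rule card_narcs_compose_left[OF flip_in_dgr[OF Y] flip_in_dgr[OF X] fin(3,2,1) m])
  moreover have "card B + 2 * card (narcs (flip Y)) = card D + 2 * card (narcs Y)" by (rule arcs_count[OF Y fin(2,3)])
  moreover have "card A + 2 * card (narcs (flip (compose m X Y))) = card D + 2 * card (narcs (compose m X Y))"
    by (rule arcs_count[OF compose_in_dgr[OF X Y fin m] fin(1,3)])
  ultimately show ?thesis unfolding compose_flip(1) AB by linarith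
qed

section \<open>Composition with strands\<close>

lemma strands_in_dgr:
  assumes "bij_betw a J A" "bij_betw b J B" "\<And>j. j \<in> J \<Longrightarrow> c j < m"
  shows "strands J a b c \<in> dgr m A B"
proof (rule dgrI)
  have ab: "a ` J = A" "b ` J = B" "inj_on a J" "inj_on b J" using assms by (auto simp: bij_betw_def)
  show "s \<subseteq> North ` A \<union> South ` B \<and> card s = 2 \<and> e < m" if "(s, e) \<in> strands J a b c" for s e
    using that assms(3) ab(1,2) by (auto simp: strands_def)
  show "\<exists>s e. (s, e) \<in> strands J a b c \<and> x \<in> s" if "x \<in> North ` A \<union> South ` B" for x
    using that unfolding ab(1,2)[symmetric] strands_def by auto
  show "s = s' \<and> e = e'" if "(s, e) \<in> strands J a b c" "(s', e') \<in> strands J a b c" "x \<in> s" "x \<in> s'" for s e s' e' x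
    using that ab(3,4) by (auto simp: strands_def dest: inj_onD)
qed

text \<open>Strands attached below only move the southern ends and contribute their labels. The sum
  over southern ends covers through-strands (one label) and southern arcs (two labels)
  alike.\<close>

lemma compose_strands:
  assumes D: "D \<in> dgr m A J" and fin: "finite A" "finite J" and b: "inj_on b J"
  shows "compose m D (strands J id b c) =
      (\<lambda>(s, e). (south_map b ` s, (e + (\<Sum>a\<in>{a. South a \<in> s}. c a)) mod m)) ` D" (is "?comp = _")
    and "loop_factor m p \<delta> D (strands J id b c) = 1"
proof -
  let ?W = "[(upper, D), (lower, strands J id b c)]"
  \<comment> \<open>The strand \<open>s\<close> of \<open>D\<close> prolonged by the strands hanging
    at its southern ends; these sets turn out to be the components.\<close>
  define K where "K = (\<lambda>s. upper ` s \<union> (\<lambda>a. Bot (b a)) ` {a. South a \<in> s})"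
  let ?P = "(\<lambda>e. K (fst e)) ` D"
  have lowJ: "(\<lambda>e. lower ` fst e) ` strands J id b c = (\<lambda>j. {Mid j, Bot (b j)}) ` J"
    by (simp add: strands_def image_image)
  have upK: "upper x \<in> K s \<longleftrightarrow> x \<in> s" for x s
  proof -
    have "upper x \<noteq> Bot z" for z by (cases x) auto
    then show ?thesis using inj_upper unfolding K_def by (auto dest: injD)
  qed
  have MidK: "Mid j \<in> K s \<longleftrightarrow> South j \<in> s" for j s using upK[of "South j"] by simp
  have inJ: "a \<in> J" if "(s, e) \<in> D" "South a \<in> s" for s e a using dgr_edge(1)[OF D that(1)] that(2) by auto
  have BotK: "Bot (b j) \<in> K s \<longleftrightarrow> South j \<in> s" if "j \<in> J" "(s, e) \<in> D" for j s e
  proof -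
    have "upper x \<noteq> Bot z" for x z by (cases x) auto
    then have "Bot (b j) \<in> K s \<longleftrightarrow> (\<exists>a. South a \<in> s \<and> b j = b a)" unfolding K_def by (auto simp: image_iff) metis+
    then show ?thesis using inJ[OF that(2)] that(1) b by (auto dest: inj_onD)
  qed
  have comps: "comps (ends ?W) = ?P"
  proof (rule comps_eqI)
    show "\<Union>?P = \<Union>(ends ?W)"
    proof (intro equalityI subsetI)
      fix x assume "x \<in> \<Union>?P"
      then obtain s e where e: "(s, e) \<in> D" "x \<in> K s" by auto
      then show "x \<in> \<Union>(ends ?W)" using inJ[OF e(1)] unfolding K_def ends_simps lowJ by force
    next
      fix x assume x: "x \<in> \<Union>(ends ?W)"
      show "x \<in> \<Union>?P"
      proof (cases "\<exists>e\<in>D. x \<in> upper ` fst e")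
        case True then show ?thesis unfolding K_def by blast
      next
        case False
        then obtain j where j: "j \<in> J" "x = Mid j \<or> x = Bot (b j)" using x unfolding ends_simps lowJ by auto
        have "\<exists>s e. (s, e) \<in> D \<and> South j \<in> s" by (rule dgr_ex[OF D]) (use j in auto)
        then obtain s e where e: "(s, e) \<in> D" "South j \<in> s" by blast
        then have "x \<in> K s" using j MidK BotK by auto
        then show ?thesis using e by force
      qed
    qed
    show "{} \<notin> ?P"
    proof
      assume "{} \<in> ?P"
      then obtain s e where "(s, e) \<in> D" "K s = {}" by auto
      then show False using dgr_edge(4)[OF D] unfolding K_def by auto
    qed
    show "closed_in (ends ?W) C" if C: "C \<in> ?P" for C
    proof (rule closed_inI)
      obtain s e where e: "(s, e) \<in> D" "C = K s" using C by auto
      fix t x assume t: "t \<in> ends ?W" "x \<in> t" "x \<in> C"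
      show "t \<subseteq> C"
      proof (cases "\<exists>e\<in>D. t = upper ` fst e")
        case True
        then obtain s' e' where e': "(s', e') \<in> D" "t = upper ` s'" by force
        obtain y where y: "y \<in> s'" "x = upper y" using t(2) e'(2) by auto
        then have "y \<in> s" using t(3) e(2) upK by auto
        then have "s' = s" using dgr_unique[OF D e'(1) e(1)] y(1) by blast
        then show ?thesis using e(2) e'(2) unfolding K_def by auto
      next
        case False
        then obtain j where j: "j \<in> J" "t = {Mid j, Bot (b j)}" using t(1) unfolding ends_simps lowJ by auto
        then have "South j \<in> s" using t(2,3) e(2) MidK BotK[OF j(1) e(1)] by auto
        then show ?thesis using j e MidK BotK[OF j(1) e(1)] by auto
      qed
    qed
    show "C \<subseteq> A'" if C: "C \<in> ?P" and A': "closed_in (ends ?W) A'" "A' \<inter> C \<noteq> {}" for C A'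
    proof -
      obtain s e where e: "(s, e) \<in> D" "C = K s" using C by auto
      have up: "upper ` s \<in> ends ?W" using e(1) by force
      have dn: "{Mid j, Bot (b j)} \<in> ends ?W" if "South j \<in> s" for j
        using inJ[OF e(1) that] unfolding ends_simps lowJ by auto
      obtain x where x: "x \<in> A'" "x \<in> K s" using A'(2) e by auto
      have "\<exists>y\<in>s. upper y \<in> A'"
      proof (cases "x \<in> upper ` s")
        case False
        then obtain a where a: "South a \<in> s" "x = Bot (b a)" using x unfolding K_def by auto
        have "{Mid a, Bot (b a)} \<subseteq> A'" by (rule closed_inD[OF A'(1) dn[OF a(1)], of x]) (use x a in auto)
        then show ?thesis using a(1) by force
      qed (use x in auto)
      then obtain y where y: "y \<in> s" "upper y \<in> A'" by auto
      have sA: "upper ` s \<subseteq> A'" by (rule closed_inD[OF A'(1) up, of "upper y"]) (use y in auto)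
      have "Bot (b a) \<in> A'" if "South a \<in> s" for a
      proof -
        have "Mid a \<in> A'" using sA that by force
        then have "{Mid a, Bot (b a)} \<subseteq> A'" by (intro closed_inD[OF A'(1) dn[OF that], of "Mid a"]) auto
        then show ?thesis by auto
      qed
      then show ?thesis unfolding e(2) K_def using sA by auto
    qed
  qed
  have out: "outer_node -` K s = south_map b ` s" if "(s, e) \<in> D" for s e
  proof (rule Set.set_eqI)
    fix x
    show "x \<in> outer_node -` K s \<longleftrightarrow> x \<in> south_map b ` s"
    proof (cases x)
      case (North a)
      have "North a \<in> south_map b ` s \<longleftrightarrow> North a \<in> s"
      proof
        assume "North a \<in> south_map b ` s"
        then obtain y where "y \<in> s" "North a = south_map b y" by auto
        then show "North a \<in> s" by (cases y) auto
      qed (force intro: image_eqI[of _ _ "North a"])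
      then show ?thesis using upK[of "North a" s] North by simp
    next
      case (South a)
      have "South a \<in> south_map b ` s \<longleftrightarrow> (\<exists>z. South z \<in> s \<and> a = b z)"
      proof
        assume "South a \<in> south_map b ` s"
        then obtain y where "y \<in> s" "South a = south_map b y" by auto
        then show "\<exists>z. South z \<in> s \<and> a = b z" by (cases y) auto
      qed (force intro: image_eqI)
      moreover have "Bot a \<noteq> upper y" for y by (cases y) auto
      then have "Bot a \<in> K s \<longleftrightarrow> (\<exists>z. South z \<in> s \<and> a = b z)" unfolding K_def by auto
      ultimately show ?thesis using South by simp
    qed
  qed
  have one: "{e \<in> D. upper ` fst e \<subseteq> K s} = {(s, e)}" if e: "(s, e) \<in> D" for s e
  proof -
    have *: "e' = (s, e)" if e': "e' \<in> D" "upper ` fst e' \<subseteq> K s" for e'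
    proof -
      have "(fst e', snd e') \<in> D" using e' by auto
      moreover then obtain y where "y \<in> fst e'" using dgr_edge(4)[OF D] by blast
      moreover then have "y \<in> s" using e'(2) upK by blast
      ultimately show ?thesis using dgr_unique[OF D _ e, of "fst e'" "snd e'" y] by (auto simp: prod_eq_iff)
    qed
    have "(s, e) \<in> {e \<in> D. upper ` fst e \<subseteq> K s}" using e unfolding K_def by simp
    moreover have "{e \<in> D. upper ` fst e \<subseteq> K s} \<subseteq> {(s, e)}" by (rule subsetI, unfold singleton_iff, rule *) simp_all
    ultimately show ?thesis by (intro equalityI) simp_all
  qed
  have w: "wtl ?W (K s) = e + (\<Sum>a\<in>{a. South a \<in> s}. c a)" if e: "(s, e) \<in> D" for s e
  proof -
    have "{e \<in> strands J id b c. lower ` fst e \<subseteq> K s} = (\<lambda>j. ({North j, South (b j)}, c j)) ` {a. South a \<in> s}"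
    proof -
      have "{e \<in> strands J id b c. lower ` fst e \<subseteq> K s} = (\<lambda>j. ({North j, South (b j)}, c j)) ` {j \<in> J. Mid j \<in> K s \<and> Bot (b j) \<in> K s}"
        unfolding strands_def by auto
      also have "{j \<in> J. Mid j \<in> K s \<and> Bot (b j) \<in> K s} = {a. South a \<in> s}"
        using MidK BotK[OF _ e] inJ[OF e] by auto
      finally show ?thesis .
    qed
    moreover have "inj_on (\<lambda>j. ({North j, South (b j)}, c j)) {a. South a \<in> s}"
      by (rule inj_onI) (auto simp: doubleton_eq_iff)
    ultimately have "wt lower (strands J id b c) (K s) = (\<Sum>a\<in>{a. South a \<in> s}. c a)"
      unfolding wt_def label_sum_def by (simp add: sum.reindex)
    moreover have "wt upper D (K s) = e" unfolding wt_def one[OF e] by (simp add: label_sum_def)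
    ultimately show ?thesis by simp
  qed
  have ne: "outer_node -` C \<noteq> {}" if C: "C \<in> ?P" for C
  proof -
    obtain s e where e: "(s, e) \<in> D" "C = K s" using C by auto
    then show ?thesis using out[OF e(1)] dgr_edge(4)[OF D e(1)] by simp
  qed
  have "?comp = (\<lambda>C. (outer_node -` C, wtl ?W C mod m)) ` ?P"
    unfolding compose_gcomp gcomp_def comps by (rule arg_cong[of _ _ "image _"]) (use ne in auto)
  also have "\<dots> = (\<lambda>(s, e). (south_map b ` s, (e + (\<Sum>a\<in>{a. South a \<in> s}. c a)) mod m)) ` D"
    unfolding image_image
  proof (rule image_cong[OF refl])
    fix e assume e: "e \<in> D"
    show "(outer_node -` K (fst e), wtl ?W (K (fst e)) mod m) = (\<lambda>(s, e). (south_map b ` s, (e + (\<Sum>a\<in>{a. South a \<in> s}. c a)) mod m)) e"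
      using out[of "fst e" "snd e"] w[of "fst e" "snd e"] e by (simp only: prod.collapse case_prod_unfold)
  qed
  finally show "?comp = (\<lambda>(s, e). (south_map b ` s, (e + (\<Sum>a\<in>{a. South a \<in> s}. c a)) mod m)) ` D" .
  have "{C \<in> comps (ends ?W). outer_node -` C = {}} = {}" unfolding comps using ne by auto
  then show "loop_factor m p \<delta> D (strands J id b c) = 1" by (simp only: loop_factor_gloop gloop_def prod.empty)
qed

definition idd :: "nat set \<Rightarrow> diagram"
  where "idd J = strands J id id (\<lambda>_. 0)"

lemma idd_in_dgr: "m > 0 \<Longrightarrow> idd J \<in> dgr m J J"
  unfolding idd_def by (rule strands_in_dgr) auto

lemma id_diagram_idd: "id_diagram n = idd {1..n}"
  unfolding id_diagram_def idd_def strands_def by auto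

lemma flip_idd: "flip (idd J) = idd J"
  unfolding idd_def flip_def strands_def by (auto simp: image_image insert_commute)

lemma compose_idd_right:
  assumes "D \<in> dgr m A J" "finite A" "finite J"
  shows "compose m D (idd J) = D" "loop_factor m p \<delta> D (idd J) = 1"
proof -
  have s: "south_map id ` s = s" for s
  proof -
    have "south_map id x = x" for x by (cases x) auto
    then show ?thesis by simp
  qed
  have "compose m D (idd J) = (\<lambda>(s, e). (s, e mod m)) ` D"
    unfolding idd_def by (subst compose_strands(1)[OF assms]) (auto simp: s)
  also have "\<dots> = (\<lambda>x. x) ` D" by (rule image_cong[OF refl]) (use dgr_edge(3)[OF assms(1)] in auto)
  finally show "compose m D (idd J) = D" by simp
  show "loop_factor m p \<delta> D (idd J) = 1" unfolding idd_def by (rule compose_strands(2)[OF assms]) auto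
qed

lemma compose_idd_left:
  assumes "D \<in> dgr m J A" "finite A" "finite J"
  shows "compose m (idd J) D = D" "loop_factor m p \<delta> (idd J) D = 1"
  using compose_idd_right[OF flip_in_dgr[OF assms(1)] assms(2,3)] compose_flip(1)[of m "idd J" "flip D"]
    compose_flip(2)[of m p \<delta> "idd J" "flip D"] by (simp_all add: flip_idd)

text \<open>A stack with a single component composes to one strand or to one loop, which then
  carries the whole label sum. This settles the small composites from which the idempotents are
  built.\<close>

lemma compose_connected:
  assumes g: "good X" "good Y" and ne: "\<Union>(ends [(upper, X), (lower, Y)]) \<noteq> {}"
    and conn: "\<And>A x. closed_in (ends [(upper, X), (lower, Y)]) A \<Longrightarrow> x \<in> A \<Longrightarrow>
      x \<in> \<Union>(ends [(upper, X), (lower, Y)]) \<Longrightarrow> \<Union>(ends [(upper, X), (lower, Y)]) \<subseteq> A"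
    and o: "outer_node -` \<Union>(ends [(upper, X), (lower, Y)]) = S"
  shows "compose m X Y = (if S = {} then {} else {(S, (label_sum X + label_sum Y) mod m)})"
    and "loop_factor m p \<delta> X Y = (if S = {} then loop_value p \<delta> ((label_sum X + label_sum Y) mod m) else 1)"
proof -
  let ?W = "[(upper, X), (lower, Y)]"
  have "comps (ends ?W) = {\<Union>(ends ?W)}"
  proof (rule comps_eqI)
    show "closed_in (ends ?W) C" if "C \<in> {\<Union>(ends ?W)}" for C using that by (auto simp: closed_in_def)
    show "C \<subseteq> A" if "C \<in> {\<Union>(ends ?W)}" "closed_in (ends ?W) A" "A \<inter> C \<noteq> {}" for C A
    proof -
      have C: "C = \<Union>(ends ?W)" using that(1) by (simp only: singleton_iff)
      obtain x where "x \<in> A" "x \<in> C" using \<open>A \<inter> C \<noteq> {}\<close> by auto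
      then show ?thesis unfolding C using that(2) by (intro conn[of A x]) (simp_all only:)
    qed
  qed (use ne in \<open>simp_all only: cSup_singleton singleton_iff not_sym simp_thms\<close>)
  moreover have "wtl ?W (\<Union>(ends ?W)) = label_sum X + label_sum Y"
    using wtl_whole[of ?W "ends ?W"] g by simp
  ultimately show "compose m X Y = (if S = {} then {} else {(S, (label_sum X + label_sum Y) mod m)})"
    "loop_factor m p \<delta> X Y = (if S = {} then loop_value p \<delta> ((label_sum X + label_sum Y) mod m) else 1)"
    using o unfolding compose_gcomp loop_factor_gloop gcomp_def gloop_def
    by (auto simp del: ends_simps wtl_simps simp: Collect_conv_if)
qed

section \<open>Normal form of diagrams without southern arcs\<close>

text \<open>Strands are numbered from 1 and list entries from 0, hence \<open>j - 1\<close>.\<close>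

abbreviation frees :: "nat \<Rightarrow> dangle \<Rightarrow> nat \<Rightarrow> nat"
  where "frees n v j \<equiv> free_nodes n v ! (j - 1)"

text \<open>For a diagram without southern arcs, its group element: the through-strands with their
  northern ends renumbered from left to right. \<open>group_element\<close> is the instance for a
  composite with a dangle.\<close>

definition through :: "nat \<Rightarrow> diagram \<Rightarrow> diagram"
  where "through n D = (let f = free_nodes n (narcs D)
     in {({North (Suc j), South b}, c) | j b c. j < length f \<and> ({North (f ! j), South b}, c) \<in> D})"

lemma dangle_above_narcs: "dangle_above m n X v = narcs (compose m X (dangle_diagram n v))"
  by (simp add: dangle_above_def narcs_def)

lemma group_element_through: "group_element m n X v = through n (compose m X (dangle_diagram n v))"
  unfolding group_element_def through_def dangle_above_narcs ..

lemma label_sum_Un: "finite X \<Longrightarrow> finite Y \<Longrightarrow> X \<inter> Y = {} \<Longrightarrow> label_sum (X \<union> Y) = label_sum X + label_sum Y"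
  unfolding label_sum_def by (rule sum.union_disjoint)

lemma label_sum_arcs: "label_sum (arcs v) = label_sum v"
proof -
  have "inj_on (\<lambda>(s, c). (North ` s, c)) v" by (rule inj_onI) auto
  then show ?thesis unfolding label_sum_def arcs_def by (subst sum.reindex) (auto simp: case_prod_unfold)
qed

lemma label_sum_strands: "inj_on a J \<Longrightarrow> label_sum (strands J a b c) = sum c J"
proof -
  assume a: "inj_on a J"
  have "inj_on (\<lambda>j. ({North (a j), South (b j)}, c j)) J"
    by (rule inj_onI) (use a in \<open>auto simp: doubleton_eq_iff dest: inj_onD\<close>)
  then show ?thesis unfolding label_sum_def strands_def by (subst sum.reindex) (auto simp: case_prod_unfold)
qed

lemma arcs_strands_disjoint: "arcs v \<inter> strands J a b c = {}"
  unfolding arcs_def strands_def by auto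

lemma dangle_arc:
  assumes "v \<in> dangles m n l" "(s, c) \<in> v"
  shows "s \<subseteq> {1..n}" "card s = 2" "c < m" "finite s"
proof -
  show "s \<subseteq> {1..n}" "card s = 2" "c < m" using assms by (auto simp: dangles_def)
  then show "finite s" by (intro card_ge_0_finite) simp
qed

lemma dangle_nodes: "v \<in> dangles m n l \<Longrightarrow> \<Union>(fst ` v) \<subseteq> {1..n}"
  using dangle_arc(1) by (metis (no_types, lifting) UN_least prod.collapse)

lemma finite_arcs: "finite v \<Longrightarrow> finite (arcs v)" and finite_strands: "finite J \<Longrightarrow> finite (strands J a b c)"
  by (simp_all add: arcs_def strands_def)

lemma finite_dangle: "v \<in> dangles m n l \<Longrightarrow> finite v"
proof (rule finite_subset)
  show "v \<subseteq> Pow {1..n} \<times> {..<m}" if "v \<in> dangles m n l" using that unfolding dangles_def by auto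
qed simp

lemma finite_dangles: "finite (dangles m n l)"
proof (rule finite_subset)
  show "dangles m n l \<subseteq> Pow (Pow {1..n} \<times> {..<m})" using dangle_arc(1,3) by (intro subsetI PowI) force
qed simp

lemma card_dangle_nodes: assumes "v \<in> dangles m n l" shows "card (\<Union>(fst ` v)) = 2 * l"
proof -
  have "card (\<Union>e\<in>v. fst e) = (\<Sum>e\<in>v. card (fst e))"
    by (rule card_UN_disjoint) (use assms finite_dangle[OF assms] dangle_arc(4)[OF assms] in \<open>auto simp: dangles_def\<close>)
  also have "\<dots> = (\<Sum>e\<in>v. 2)" by (rule sum.cong) (use assms in \<open>auto simp: dangles_def\<close>)
  finally show ?thesis using assms by (simp add: dangles_def)
qed

lemma frees_bij:
  assumes "v \<in> dangles m n l"
  shows "bij_betw (frees n v) {1..n - 2 * l} ({1..n} - \<Union>(fst ` v))" and "length (free_nodes n v) = n - 2 * l"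
proof -
  note s = dangle_nodes[OF assms]
  have c: "card ({1..n} - \<Union>(fst ` v)) = n - 2 * l"
    using card_dangle_nodes[OF assms] s by (subst card_Diff_subset) (auto intro: finite_subset)
  show len: "length (free_nodes n v) = n - 2 * l" unfolding free_nodes_def using c by simp
  have d: "distinct (free_nodes n v)" "set (free_nodes n v) = {1..n} - \<Union>(fst ` v)"
    unfolding free_nodes_def by simp_all
  have b1: "bij_betw (\<lambda>j. j - 1) {1..n - 2 * l} {..<n - 2 * l}"
    by (rule bij_betw_byWitness[of _ Suc]) auto
  have b2: "bij_betw ((!) (free_nodes n v)) {..<n - 2 * l} ({1..n} - \<Union>(fst ` v))"
    using bij_betw_nth[OF d(1), of "{..<n - 2 * l}"] d(2) len by simp
  show "bij_betw (frees n v) {1..n - 2 * l} ({1..n} - \<Union>(fst ` v))"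
    using bij_betw_trans[OF b1 b2] by (simp add: o_def)
qed

lemma arcs_in_dgr:
  assumes "v \<in> dangles m n l" shows "arcs v \<in> dgr m (\<Union>(fst ` v)) {}"
proof (rule dgrI)
  show "s \<subseteq> North ` \<Union>(fst ` v) \<union> South ` {} \<and> card s = 2 \<and> c < m" if sc: "(s, c) \<in> arcs v" for s c
  proof -
    obtain u where u: "(u, c) \<in> v" "s = North ` u" using sc by (auto simp: arcs_def)
    have "card s = card u" unfolding u(2) by (simp add: card_image inj_on_def)
    then show ?thesis using assms u by (force simp: dangles_def)
  qed
  show "\<exists>s c. (s, c) \<in> arcs v \<and> x \<in> s" if "x \<in> North ` \<Union>(fst ` v) \<union> South ` {}" for x
  proof -
    obtain a e where "e \<in> v" "a \<in> fst e" "x = North a" using \<open>x \<in> _\<close> by auto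
    then have "(North ` fst e, snd e) \<in> arcs v" "x \<in> North ` fst e" by (auto simp: arcs_def case_prod_unfold)
    then show ?thesis by blast
  qed
  show "s = s' \<and> c = c'" if sc: "(s, c) \<in> arcs v" "(s', c') \<in> arcs v" "x \<in> s" "x \<in> s'" for s c s' c' x
  proof -
    obtain u where u: "(u, c) \<in> v" "s = North ` u" using sc by (auto simp: arcs_def)
    obtain u' where u': "(u', c') \<in> v" "s' = North ` u'" using sc by (auto simp: arcs_def)
    have "u \<inter> u' \<noteq> {}" using sc(3,4) u u' by auto
    then have "(u, c) = (u', c')" using assms u(1) u'(1) by (fastforce simp: dangles_def)
    then show ?thesis using u u' by simp
  qed
qed

lemma normal_in_dgr:
  assumes "v \<in> dangles m n l" "bij_betw b {1..n - 2 * l} {1..n - 2 * l}" "\<And>j. j \<in> {1..n - 2 * l} \<Longrightarrow> c j < m"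
  shows "arcs v \<union> strands {1..n - 2 * l} (frees n v) b c \<in> dgr m {1..n} {1..n - 2 * l}"
proof -
  have "arcs v \<union> strands {1..n - 2 * l} (frees n v) b c \<in> dgr m (\<Union>(fst ` v) \<union> ({1..n} - \<Union>(fst ` v))) ({} \<union> {1..n - 2 * l})"
    by (rule dgr_Un[OF arcs_in_dgr[OF assms(1)] strands_in_dgr[OF frees_bij(1)[OF assms(1)] assms(2,3)]]) auto
  moreover have "\<Union>(fst ` v) \<union> ({1..n} - \<Union>(fst ` v)) = {1..n}" using dangle_nodes[OF assms(1)] by auto
  ultimately show ?thesis by simp
qed

lemma narcs_normal [simp]: "narcs (arcs v \<union> strands J a b c) = v"
  by (rule narcs_arcs_Un) (auto simp: strands_def)

lemma label_sum_normal:
  assumes "v \<in> dangles m n l"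
  shows "label_sum (arcs v \<union> strands {1..n - 2 * l} (frees n v) b c) = label_sum v + sum c {1..n - 2 * l}"
  using frees_bij(1)[OF assms] finite_dangle[OF assms]
  by (subst label_sum_Un) (simp_all add: arcs_strands_disjoint label_sum_arcs label_sum_strands bij_betw_def finite_arcs finite_strands)

lemma through_normal:
  assumes "v \<in> dangles m n l"
  shows "through n (arcs v \<union> strands {1..n - 2 * l} (frees n v) b c) = strands {1..n - 2 * l} id b c"
proof -
  have inj: "inj_on (frees n v) {1..n - 2 * l}" using frees_bij(1)[OF assms] by (simp add: bij_betw_def)
  have na: "({North x, South y}, e) \<notin> arcs v" for x y e unfolding arcs_def by auto
  have "({North (free_nodes n v ! j), South y}, e) \<in> arcs v \<union> strands {1..n - 2 * l} (frees n v) b c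
     \<longleftrightarrow> y = b (Suc j) \<and> e = c (Suc j)" if j: "j < n - 2 * l" for j y e
  proof -
    have *: "i = Suc j" if "i \<in> {1..n - 2 * l}" "frees n v i = free_nodes n v ! j" for i
      using inj_onD[OF inj, of i "Suc j"] that j by simp
    show ?thesis
    proof
      assume "({North (free_nodes n v ! j), South y}, e) \<in> arcs v \<union> strands {1..n - 2 * l} (frees n v) b c"
      then have "({North (free_nodes n v ! j), South y}, e) \<in> strands {1..n - 2 * l} (frees n v) b c" using na by simp
      then obtain i where i: "i \<in> {1..n - 2 * l}" "{North (free_nodes n v ! j), South y} = {North (frees n v i), South (b i)}" "e = c i"
        unfolding strands_def by auto
      then have "free_nodes n v ! j = frees n v i" "y = b i" by (simp_all add: doubleton_eq_iff)
      then show "y = b (Suc j) \<and> e = c (Suc j)" using *[OF i(1)] i(3) by simp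
    next
      assume "y = b (Suc j) \<and> e = c (Suc j)"
      then show "({North (free_nodes n v ! j), South y}, e) \<in> arcs v \<union> strands {1..n - 2 * l} (frees n v) b c"
        using j unfolding strands_def by (intro UnI2 image_eqI[of _ _ "Suc j"]) auto
    qed
  qed
  then have "through n (arcs v \<union> strands {1..n - 2 * l} (frees n v) b c) =
    {({North (Suc j), South (b (Suc j))}, c (Suc j)) | j. j < n - 2 * l}"
  proof -
    assume *: "\<And>j y e. j < n - 2 * l \<Longrightarrow> ({North (free_nodes n v ! j), South y}, e) \<in> arcs v \<union> strands {1..n - 2 * l} (frees n v) b c
     \<longleftrightarrow> y = b (Suc j) \<and> e = c (Suc j)"
    have "through n (arcs v \<union> strands {1..n - 2 * l} (frees n v) b c) =
      {({North (Suc j), South y}, e) | j y e. j < n - 2 * l \<and> y = b (Suc j) \<and> e = c (Suc j)}"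
      unfolding through_def narcs_normal Let_def frees_bij(2)[OF assms]
      by (intro Collect_cong ex_cong1 conj_cong refl *)
    then show ?thesis by auto
  qed
  also have "\<dots> = strands {1..n - 2 * l} id b c"
  proof -
    have "{1..n - 2 * l} = Suc ` {..<n - 2 * l}" by (simp add: image_Suc_lessThan)
    then show ?thesis unfolding strands_def by (simp only: image_image id_apply) blast
  qed
  finally show ?thesis .
qed

lemma dangle_diagram_normal:
  assumes "v \<in> dangles m n l"
  shows "dangle_diagram n v = arcs v \<union> strands {1..n - 2 * l} (frees n v) id (\<lambda>_. 0)"
proof -
  have "{1..n - 2 * l} = Suc ` {..<n - 2 * l}" by (simp add: image_Suc_lessThan)
  then have "strands {1..n - 2 * l} (frees n v) id (\<lambda>_. 0) =
    {({North (free_nodes n v ! j), South (Suc j)}, 0) | j. j < length (free_nodes n v)}"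
    unfolding strands_def frees_bij(2)[OF assms] by (simp only: image_image id_apply diff_Suc_1) blast
  moreover have "arcs v = {(North ` s, c) | s c. (s, c) \<in> v}" by (auto simp: arcs_def)
  ultimately show ?thesis unfolding dangle_diagram_def by (simp only:)
qed

lemma compose_normal_strands:
  assumes D: "arcs v \<union> strands J a b0 c0 \<in> dgr m A J" and fin: "finite A" "finite J" and b: "inj_on b J"
    and b0: "b0 ` J \<subseteq> J"
  shows "compose m (arcs v \<union> strands J a b0 c0) (strands J id b c) =
      arcs v \<union> strands J a (b \<circ> b0) (\<lambda>j. (c0 j + c (b0 j)) mod m)"
    and "loop_factor m p \<delta> (arcs v \<union> strands J a b0 c0) (strands J id b c) = 1"
proof -
  let ?f = "\<lambda>(s, e). (south_map b ` s, (e + (\<Sum>a\<in>{a. South a \<in> s}. c a)) mod m)"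
  have "?f e = e" if e: "e \<in> arcs v" for e
  proof -
    obtain s x where s: "e = (North ` s, x)" using e by (auto simp: arcs_def)
    have "x < m" using dgr_edge(3)[OF D] e s by auto
    moreover have "{a. South a \<in> North ` s} = {}" by auto
    ultimately show ?thesis using s by (simp add: image_image)
  qed
  then have "?f ` arcs v = (\<lambda>x. x) ` arcs v" by (intro image_cong refl)
  moreover have "?f ` strands J a b0 c0 = strands J a (b \<circ> b0) (\<lambda>j. (c0 j + c (b0 j)) mod m)"
    unfolding strands_def image_image by (rule image_cong[OF refl]) simp
  ultimately show "compose m (arcs v \<union> strands J a b0 c0) (strands J id b c) =
      arcs v \<union> strands J a (b \<circ> b0) (\<lambda>j. (c0 j + c (b0 j)) mod m)"
    by (subst compose_strands(1)[OF D fin b]) (simp only: image_Un image_ident)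
  show "loop_factor m p \<delta> (arcs v \<union> strands J a b0 c0) (strands J id b c) = 1"
    by (rule compose_strands(2)[OF D fin b])
qed

lemma strands_cong: "(\<And>j. j \<in> J \<Longrightarrow> a j = a' j \<and> b j = b' j \<and> c j = c' j) \<Longrightarrow> strands J a b c = strands J a' b' c'"
  unfolding strands_def by (rule image_cong) auto

lemma narcs_in_dangles:
  assumes D: "D \<in> dgr m {1..n} {1..N}" and l: "card (narcs D) = l"
  shows "narcs D \<in> dangles m n l"
proof -
  have "s \<subseteq> {1..n} \<and> card s = 2 \<and> c < m" if "(s, c) \<in> narcs D" for s c
  proof -
    have e: "(North ` s, c) \<in> D" using that by (simp add: narcs_def)
    have "card (North ` s) = card s" by (simp add: card_image inj_on_def)
    then show ?thesis using dgr_edge[OF D e] by auto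
  qed
  moreover have "x = y" if x: "x \<in> narcs D" and y: "y \<in> narcs D" and xy: "fst x \<inter> fst y \<noteq> {}" for x y
  proof -
    obtain a where "a \<in> fst x" "a \<in> fst y" using xy by auto
    moreover have "(North ` fst x, snd x) \<in> D" "(North ` fst y, snd y) \<in> D"
      using x y by (auto simp: narcs_def case_prod_unfold)
    ultimately show ?thesis using dgr_unique[OF D, of "North ` fst x" "snd x" "North ` fst y" "snd y" "North a"] by (auto simp: prod_eq_iff)
  qed
  ultimately show ?thesis using l unfolding dangles_def by blast
qed

text \<open>By \<open>arcs_count\<close> there are exactly \<open>l\<close> more northern than
  southern arcs. At most \<open>l\<close> northern arcs therefore means exactly \<open>l\<close> and
  no southern ones; every remaining strand starts at a free node and runs to the south.\<close>

lemma normal_form: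
  assumes D: "D \<in> dgr m {1..n} {1..n - 2 * l}" and l: "card (narcs D) \<le> l" "2 * l \<le> n"
  obtains b c where "narcs D \<in> dangles m n l" "bij_betw b {1..n - 2 * l} {1..n - 2 * l}"
    "\<And>j. j \<in> {1..n - 2 * l} \<Longrightarrow> c j < m" "D = arcs (narcs D) \<union> strands {1..n - 2 * l} (frees n (narcs D)) b c"
proof -
  let ?J = "{1..n - 2 * l}" and ?v = "narcs D"
  have cnt: "n + 2 * card (narcs (flip D)) = n - 2 * l + 2 * card ?v" using arcs_count[OF D] by simp
  then have cl: "card ?v = l" and "card (narcs (flip D)) = 0" using l by auto
  then have "{e \<in> D. fst e \<subseteq> range South} = {}" using card_sarcs[of D] finite_dgr_member[OF _ _ D] by simp
  then have noS: "\<not> s \<subseteq> range South" if "(s, c) \<in> D" for s c using that by auto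
  have v: "?v \<in> dangles m n l" by (rule narcs_in_dangles[OF D cl])
  note fr = frees_bij(1)[OF v]
  have NS: "\<exists>x y. s = {North x, South y}" if e: "(s, c) \<in> D" "s \<noteq> North ` t" "\<And>t. (t, c) \<in> ?v \<Longrightarrow> s \<noteq> North ` t" for s c t
    using dgr_edge(2)[OF D e(1)]
  proof (cases rule: edge_cases)
    case (NN a b)
    then have "({a, b}, c) \<in> ?v" using e(1) by (simp add: narcs_def)
    then show ?thesis using e(3)[of "{a, b}"] NN by simp
  qed (use noS[OF e(1)] in auto)
  have "\<exists>y e. ({North (frees n ?v j), South y}, e) \<in> D" if j: "j \<in> ?J" for j
  proof -
    have f: "frees n ?v j \<in> {1..n} - \<Union>(fst ` ?v)" by (rule bij_betwE[OF fr, rule_format, OF j])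
    have "\<exists>s e. (s, e) \<in> D \<and> North (frees n ?v j) \<in> s" by (rule dgr_ex[OF D]) (use f in auto)
    then obtain s e where s: "(s, e) \<in> D" "North (frees n ?v j) \<in> s" by blast
    have "s \<noteq> North ` t" if "(t, e) \<in> ?v" for t using f s(2) that by force
    moreover have "s \<noteq> North ` {}" using s by auto
    ultimately obtain x y where "s = {North x, South y}" using NS[OF s(1)] by blast
    then show ?thesis using s by auto
  qed
  then obtain b c where bc: "\<And>j. j \<in> ?J \<Longrightarrow> ({North (frees n ?v j), South (b j)}, c j) \<in> D" by metis
  have "D \<subseteq> arcs ?v \<union> strands ?J (frees n ?v) b c"
  proof
    fix x assume x: "x \<in> D"
    obtain s e where xs: "x = (s, e)" by force
    show "x \<in> arcs ?v \<union> strands ?J (frees n ?v) b c"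
    proof (cases "\<exists>t. (t, e) \<in> ?v \<and> s = North ` t")
      case True then show ?thesis unfolding xs arcs_def by force
    next
      case False
      have "s \<noteq> North ` {}" using dgr_edge(4)[OF D] x xs by auto
      then obtain y z where yz: "s = {North y, South z}" using NS[of s e] x xs False by blast
      have "y \<in> {1..n}" using dgr_edge(1)[OF D, of s e] x xs yz by auto
      moreover have "y \<notin> \<Union>(fst ` ?v)"
      proof
        assume "y \<in> \<Union>(fst ` ?v)"
        then obtain t e' where "(North ` t, e') \<in> D" "y \<in> t" by (auto simp: narcs_def)
        then have "North ` t = s" using dgr_unique[OF D, of "North ` t" e' s e "North y"] x xs yz by auto
        then show False using yz by auto
      qed
      ultimately obtain j where j: "j \<in> ?J" "y = frees n ?v j" using fr unfolding bij_betw_def by blast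
      have "s = {North (frees n ?v j), South (b j)} \<and> e = c j"
        using dgr_unique[OF D _ bc[OF j(1)], of s e "North y"] x xs yz j(2) by auto
      then show ?thesis using j(1) xs unfolding strands_def by auto
    qed
  qed
  moreover have "arcs ?v \<union> strands ?J (frees n ?v) b c \<subseteq> D" using bc by (auto simp: arcs_def narcs_def strands_def)
  ultimately have eq: "D = arcs ?v \<union> strands ?J (frees n ?v) b c" by (rule equalityI)
  have clt: "c j < m" if "j \<in> ?J" for j using dgr_edge(3)[OF D bc[OF that]] .
  have "b ` ?J \<subseteq> ?J"
  proof (rule image_subsetI)
    fix j assume "j \<in> ?J"
    then have "South (b j) \<in> North ` {1..n} \<union> South ` ?J" using dgr_edge(1)[OF D bc] by blast
    then show "b j \<in> ?J" by blast
  qed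
  moreover have "inj_on b ?J"
  proof (rule inj_onI)
    fix i j assume ij: "i \<in> ?J" "j \<in> ?J" "b i = b j"
    have "frees n ?v i = frees n ?v j"
      using dgr_unique[OF D bc[OF ij(1)] bc[OF ij(2)], of "South (b i)"] ij(3) by (auto simp: doubleton_eq_iff)
    then show "i = j" using fr ij unfolding bij_betw_def inj_on_def by blast
  qed
  ultimately have "bij_betw b ?J ?J" by (simp add: bij_betw_def endo_inj_surj)
  then show ?thesis using that v clt eq by blast
qed

lemma free_nodes_empty: "free_nodes n {} = [1..<Suc n]"
  unfolding free_nodes_def by (simp only: image_empty Union_empty Diff_empty sorted_list_of_set_range atLeastLessThanSuc_atLeastAtMost[symmetric])

text \<open>Coordinates on the reflection group: a permutation \<open>b\<close> and a label function
  \<open>c\<close>. They come from the normal form without arcs.\<close>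

lemma group_diagrams_strands:
  "w \<in> group_diagrams m N \<longleftrightarrow>
    (\<exists>b c. bij_betw b {1..N} {1..N} \<and> (\<forall>j\<in>{1..N}. c j < m) \<and> w = strands {1..N} id b c)" (is "?l \<longleftrightarrow> ?r")
proof
  assume w: ?l
  have D: "w \<in> dgr m {1..N} {1..N - 2 * 0}" using w unfolding group_diagrams_def diagrams_dgr by simp
  have "narcs w = {}"
  proof (rule equals0I)
    fix x assume "x \<in> narcs w"
    then have "(North ` fst x, snd x) \<in> w" by (simp add: narcs_def case_prod_unfold)
    then obtain a b where "North ` fst x = {North a, South b}" using w unfolding group_diagrams_def by fast
    then have "South b \<in> North ` fst x" by simp
    then show False by auto
  qed
  then have "card (narcs w) \<le> 0" by simp
  then obtain b c where bc: "bij_betw b {1..N} {1..N}" "\<And>j. j \<in> {1..N} \<Longrightarrow> c j < m"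
    "w = arcs (narcs w) \<union> strands {1..N} (frees N (narcs w)) b c"
    using normal_form[OF D] by (metis minus_nat.diff_0 mult_0_right le0)
  have "strands {1..N} (frees N {}) b c = strands {1..N} id b c"
    by (rule strands_cong) (auto simp: free_nodes_empty simp del: upt_Suc)
  then have "w = strands {1..N} id b c" using bc(3) \<open>narcs w = {}\<close> by (simp add: arcs_def)
  then show ?r using bc(1,2) by blast
next
  assume ?r
  then obtain b c where w: "bij_betw b {1..N} {1..N}" "\<forall>j\<in>{1..N}. c j < m" "w = strands {1..N} id b c" by blast
  have "w \<in> dgr m {1..N} {1..N}" unfolding w(3) by (rule strands_in_dgr) (use w in auto)
  then show ?l unfolding group_diagrams_def diagrams_dgr w(3) by (auto simp: strands_def)
qed

section \<open>Composites of small diagrams\<close>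

lemma dgr_single:
  assumes "x \<noteq> y" "c < m" "North ` A \<union> South ` B = {x, y}" shows "{({x, y}, c)} \<in> dgr m A B"
  by (rule dgrI) (use assms in auto)

lemma dgr_NN: "a \<noteq> b \<Longrightarrow> c < m \<Longrightarrow> {({North a, North b}, c)} \<in> dgr m {a, b} {}"
  and dgr_SS: "a \<noteq> b \<Longrightarrow> c < m \<Longrightarrow> {({South a, South b}, c)} \<in> dgr m {} {a, b}"
  and dgr_NS: "c < m \<Longrightarrow> {({North a, South b}, c)} \<in> dgr m {a} {b}"
  by (rule dgr_single; auto)+

lemma dgr_Diff:
  assumes X: "X \<in> dgr m A B" and Z: "Z \<subseteq> X" "Z \<in> dgr m A' B'" and AB: "A' \<subseteq> A" "B' \<subseteq> B"
  shows "X - Z \<in> dgr m (A - A') (B - B')"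
proof (rule dgrI)
  show "s \<subseteq> North ` (A - A') \<union> South ` (B - B') \<and> card s = 2 \<and> c < m" if sc: "(s, c) \<in> X - Z" for s c
  proof -
    have "x \<in> North ` (A - A') \<union> South ` (B - B')" if x: "x \<in> s" for x
    proof -
      have "x \<notin> North ` A' \<union> South ` B'"
      proof
        assume "x \<in> North ` A' \<union> South ` B'"
        then obtain s' c' where s': "(s', c') \<in> Z" "x \<in> s'" using dgr_ex[OF Z(2)] by blast
        then have "s = s' \<and> c = c'" using dgr_unique[OF X, of s c s' c' x] x sc Z(1) by auto
        then show False using s' sc by auto
      qed
      moreover have "x \<in> North ` A \<union> South ` B" using dgr_edge(1)[OF X] sc x by blast
      ultimately show ?thesis by auto
    qed
    then show ?thesis using dgr_edge(2,3)[OF X] sc by auto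
  qed
  show "\<exists>s c. (s, c) \<in> X - Z \<and> x \<in> s" if x: "x \<in> North ` (A - A') \<union> South ` (B - B')" for x
  proof -
    have "\<exists>s c. (s, c) \<in> X \<and> x \<in> s" by (rule dgr_ex[OF X]) (use x in auto)
    then obtain s c where s: "(s, c) \<in> X" "x \<in> s" by blast
    have "(s, c) \<notin> Z" using dgr_edge(1)[OF Z(2)] s(2) x by blast
    then show ?thesis using s by blast
  qed
  show "s = s' \<and> c = c'" if "(s, c) \<in> X - Z" "(s', c') \<in> X - Z" "x \<in> s" "x \<in> s'" for s c s' c' x
    using dgr_unique[OF X] that by blast
qed

lemma closed_in_pair: "closed_in H A \<Longrightarrow> {x, y} \<in> H \<Longrightarrow> x \<in> A \<longleftrightarrow> y \<in> A"
proof -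
  assume c: "closed_in H A" "{x, y} \<in> H"
  have "{x, y} \<subseteq> A" if "z \<in> {x, y}" "z \<in> A" for z by (rule closed_inD[OF c that])
  from this[of x] this[of y] show ?thesis by auto
qed

lemma compose_loop:
  assumes "a \<noteq> b"
  shows "compose m {({South a, South b}, x)} {({North a, North b}, y)} = {}"
    and "loop_factor m p \<delta> {({South a, South b}, x)} {({North a, North b}, y)} = loop_value p \<delta> ((x + y) mod m)"
proof -
  have g: "good {({South a, South b}, x)}" "good {({North a, North b}, y)}" by (auto simp: good_def)
  have o: "outer_node -` \<Union>(ends [(upper, {({South a, South b}, x)}), (lower, {({North a, North b}, y)})]) = {}"
  proof (rule equals0I)
    fix z assume "z \<in> outer_node -` \<Union>(ends [(upper, {({South a, South b}, x)}), (lower, {({North a, North b}, y)})])"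
    then show False by (cases z) auto
  qed
  note c = compose_connected[OF g _ _ o]
  have "\<Union>(ends [(upper, {({South a, South b}, x)}), (lower, {({North a, North b}, y)})]) \<subseteq> A"
    if "closed_in (ends [(upper, {({South a, South b}, x)}), (lower, {({North a, North b}, y)})]) A" "w \<in> A"
      "w \<in> \<Union>(ends [(upper, {({South a, South b}, x)}), (lower, {({North a, North b}, y)})])" for A w
  proof -
    have "Mid a \<in> A \<longleftrightarrow> Mid b \<in> A" by (rule closed_in_pair[OF that(1)]) simp
    moreover have "w \<in> {Mid a, Mid b}" using that(3) by auto
    ultimately show ?thesis using that(2) by auto
  qed
  then show "compose m {({South a, South b}, x)} {({North a, North b}, y)} = {}"
    "loop_factor m p \<delta> {({South a, South b}, x)} {({North a, North b}, y)} = loop_value p \<delta> ((x + y) mod m)"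
    by (subst c; simp add: label_sum_def)+
qed

lemma compose_cap:
  assumes "a \<noteq> b" "s \<noteq> t"
  shows "compose m {({North a, South s}, x), ({North b, South t}, y)} {({North s, North t}, z)} = {({North a, North b}, (x + y + z) mod m)}"
    and "loop_factor m p \<delta> {({North a, South s}, x), ({North b, South t}, y)} {({North s, North t}, z)} = 1"
proof -
  let ?X = "{({North a, South s}, x), ({North b, South t}, y)}" and ?Y = "{({North s, North t}, z)}"
  have g: "good ?X" "good ?Y" by (auto simp: good_def)
  have o: "outer_node -` \<Union>(ends [(upper, ?X), (lower, ?Y)]) = {North a, North b}"
  proof (rule Set.set_eqI)
    show "w \<in> outer_node -` \<Union>(ends [(upper, ?X), (lower, ?Y)]) \<longleftrightarrow> w \<in> {North a, North b}" for w
      by (cases w) auto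
  qed
  have ne: "({North a, South s}, x) \<noteq> ({North b, South t}, y)" using assms by (auto simp: doubleton_eq_iff)
  note c = compose_connected[OF g _ _ o]
  have "\<Union>(ends [(upper, ?X), (lower, ?Y)]) \<subseteq> A" if "closed_in (ends [(upper, ?X), (lower, ?Y)]) A" "w \<in> A"
      "w \<in> \<Union>(ends [(upper, ?X), (lower, ?Y)])" for A w
  proof -
    have e: "Top a \<in> A \<longleftrightarrow> Mid s \<in> A" "Mid s \<in> A \<longleftrightarrow> Mid t \<in> A" "Top b \<in> A \<longleftrightarrow> Mid t \<in> A"
      by (rule closed_in_pair[OF that(1)]; simp)+
    have "w \<in> {Top a, Mid s, Mid t, Top b}" using that(3) by auto
    then have "{Top a, Mid s, Mid t, Top b} \<subseteq> A" using that(2) e by auto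
    then show ?thesis by auto
  qed
  then show "compose m ?X ?Y = {({North a, North b}, (x + y + z) mod m)}" "loop_factor m p \<delta> ?X ?Y = 1"
    by (subst c; use ne in \<open>simp add: label_sum_def\<close>)+
qed

text \<open>The path runs from the top at \<open>e\<close> through the middle nodes
  \<open>c\<close>, \<open>b\<close>, \<open>a\<close> to the bottom at \<open>f\<close>. As no loop
  arises, this gives idempotents even when all parameters vanish.\<close>

lemma compose_zigzag:
  assumes "a \<noteq> b" "b \<noteq> c" "a \<noteq> c"
  shows "compose m {({South a, South b}, 0), ({North e, South c}, 0)} {({North b, North c}, 0), ({North a, South f}, 0)}
      = {({North e, South f}, 0)}"
    and "loop_factor m p \<delta> {({South a, South b}, 0), ({North e, South c}, 0)} {({North b, North c}, 0), ({North a, South f}, 0)} = 1"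
proof -
  let ?X = "{({South a, South b}, 0), ({North e, South c}, 0)}" and ?Y = "{({North b, North c}, 0), ({North a, South f}, 0)}"
  have g: "good ?X" "good ?Y" by (auto simp: good_def)
  have o: "outer_node -` \<Union>(ends [(upper, ?X), (lower, ?Y)]) = {North e, South f}"
  proof (rule Set.set_eqI)
    show "w \<in> outer_node -` \<Union>(ends [(upper, ?X), (lower, ?Y)]) \<longleftrightarrow> w \<in> {North e, South f}" for w
      by (cases w) auto
  qed
  note c = compose_connected[OF g _ _ o]
  have ls: "label_sum ?X = 0" "label_sum ?Y = 0" by (auto simp: label_sum_def)
  have "\<Union>(ends [(upper, ?X), (lower, ?Y)]) \<subseteq> A" if "closed_in (ends [(upper, ?X), (lower, ?Y)]) A" "w \<in> A"
      "w \<in> \<Union>(ends [(upper, ?X), (lower, ?Y)])" for A w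
  proof -
    have e: "Mid a \<in> A \<longleftrightarrow> Mid b \<in> A" "Top e \<in> A \<longleftrightarrow> Mid c \<in> A" "Mid b \<in> A \<longleftrightarrow> Mid c \<in> A" "Mid a \<in> A \<longleftrightarrow> Bot f \<in> A"
      by (rule closed_in_pair[OF that(1)]; simp)+
    have "w \<in> {Mid a, Mid b, Mid c, Top e, Bot f}" using that(3) by auto
    then have "{Mid a, Mid b, Mid c, Top e, Bot f} \<subseteq> A" using that(2) e by auto
    then show ?thesis by auto
  qed
  then show "compose m ?X ?Y = {({North e, South f}, 0)}" "loop_factor m p \<delta> ?X ?Y = 1"
    by (subst c; simp add: ls)+
qed

lemma idd_empty [simp]: "idd {} = {}"
  by (simp add: idd_def strands_def)

lemma compose_empty_left: "finite A \<Longrightarrow> Y \<in> dgr m {} A \<Longrightarrow> compose m {} Y = Y"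
    "finite A \<Longrightarrow> Y \<in> dgr m {} A \<Longrightarrow> loop_factor m p \<delta> {} Y = 1"
  using compose_idd_left[of Y m "{}" A] by simp_all

lemma compose_empty_right: "finite A \<Longrightarrow> Y \<in> dgr m A {} \<Longrightarrow> compose m Y {} = Y"
    "finite A \<Longrightarrow> Y \<in> dgr m A {} \<Longrightarrow> loop_factor m p \<delta> Y {} = 1"
  using compose_idd_right[of Y m A "{}"] by simp_all

lemma dgr_empty: "{} \<in> dgr m {} {}"
  by (rule dgrI) auto

text \<open>Cut the northern and the southern arc; \<open>D'\<close> joins the ends of the one to the ends of the other
  by vertical strands, and \<open>x\<close> restores the two arcs.\<close>

lemma cut_arcs:
  assumes D: "D \<in> dgr m A B" and fin: "finite A" "finite B" and m: "m > 0"
    and e1: "({North a, North b}, c) \<in> D" "a \<noteq> b" and e2: "({South s, South t}, j) \<in> D" "s \<noteq> t"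
  obtains D' x where "D' \<in> dgr m A B" "x \<in> dgr m B B" "({North s, North t}, (m - j) mod m) \<in> x"
    "compose m D' x = D" "\<And>p \<delta>. loop_factor m p \<delta> D' x = (1::'k::field)" "m dvd label_sum x"
proof -
  let ?Z = "{({North a, North b}, c)} \<union> {({South s, South t}, j)}"
  \<comment> \<open>The label \<open>j\<close> of the southern arc moves to the first of the two
    strands. The northern arc of \<open>x\<close> carries its negative, so the composite gets back
    the label \<open>c\<close>, and the labels of \<open>x\<close> cancel modulo
    \<open>m\<close>.\<close>
  let ?Z' = "{({North a, South s}, (c + j) mod m)} \<union> {({North b, South t}, 0)}"
  let ?n = "{({North s, North t}, (m - j) mod m)}" and ?s = "{({South s, South t}, j)}"
  have cj: "c < m" "j < m" using dgr_edge(3)[OF D] e1 e2 by auto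
  have sub: "{a, b} \<subseteq> A" "{s, t} \<subseteq> B" using dgr_edge(1)[OF D] e1 e2 by fastforce+
  have Z: "?Z \<in> dgr m ({a, b} \<union> {}) ({} \<union> {s, t})"
    by (rule dgr_Un[OF dgr_NN dgr_SS]) (use e1 e2 cj in auto)
  have R: "D - ?Z \<in> dgr m (A - {a, b}) (B - {s, t})"
    by (rule dgr_Diff[OF D _ _ sub]) (use Z e1 e2 in auto)
  have Z': "?Z' \<in> dgr m {a, b} {s, t}"
  proof -
    have "?Z' \<in> dgr m ({a} \<union> {b}) ({s} \<union> {t})" by (rule dgr_Un[OF dgr_NS dgr_NS]) (use e1 e2 m in auto)
    then show ?thesis by (simp add: insert_commute)
  qed
  have n: "?n \<in> dgr m {s, t} {}" by (rule dgr_NN) (use e2 m in auto)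
  have s: "?s \<in> dgr m {} {s, t}" by (rule dgr_SS) (use e2 cj in auto)
  have ns: "?n \<union> ?s \<in> dgr m {s, t} {s, t}" using dgr_Un[OF n s] by simp
  have I: "idd (B - {s, t}) \<in> dgr m (B - {s, t}) (B - {s, t})" by (rule idd_in_dgr[OF m])
  have uA: "A - {a, b} \<union> {a, b} = A" "B - {s, t} \<union> {s, t} = B" using sub by auto
  have D': "D - ?Z \<union> ?Z' \<in> dgr m A B" using dgr_Un[OF R Z'] uA by auto
  have x: "idd (B - {s, t}) \<union> (?n \<union> ?s) \<in> dgr m B B" using dgr_Un[OF I ns] uA by auto
  have c1: "compose m ?Z' (?n \<union> ?s) = compose m ?Z' ?n \<union> compose m {} ?s"
    "loop_factor m p \<delta> ?Z' (?n \<union> ?s) = loop_factor m p \<delta> ?Z' ?n * (loop_factor m p \<delta> {} ?s :: 'k)" for p \<delta>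
    using compose_Un(1)[OF Z' dgr_empty n s] compose_Un(2)[OF Z' dgr_empty n s, where p=p and \<delta>=\<delta>] by simp_all
  have c2: "compose m ?Z' ?n = {({North a, North b}, c)}"
  proof -
    have "((c + j) mod m + 0 + (m - j) mod m) mod m = (c + j + (m - j)) mod m" by (simp add: mod_simps)
    also have "\<dots> = c" using cj by simp
    finally show ?thesis using compose_cap(1)[OF e1(2) e2(2), of m "(c + j) mod m" 0 "(m - j) mod m"] by (simp add: insert_commute)
  qed
  have lf2: "loop_factor m p \<delta> ?Z' ?n = (1::'k)" for p \<delta>
    using compose_cap(2)[OF e1(2) e2(2), of m p \<delta> "(c + j) mod m" 0 "(m - j) mod m"] by (simp add: insert_commute)
  have c3: "compose m {} ?s = ?s" "loop_factor m p \<delta> {} ?s = (1::'k)" for p \<delta>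
    using compose_empty_left[OF _ s] by auto
  have c4: "compose m (D - ?Z \<union> ?Z') (idd (B - {s, t}) \<union> (?n \<union> ?s)) =
      compose m (D - ?Z) (idd (B - {s, t})) \<union> compose m ?Z' (?n \<union> ?s)"
    "loop_factor m p \<delta> (D - ?Z \<union> ?Z') (idd (B - {s, t}) \<union> (?n \<union> ?s)) =
      loop_factor m p \<delta> (D - ?Z) (idd (B - {s, t})) * (loop_factor m p \<delta> ?Z' (?n \<union> ?s) :: 'k)" for p \<delta>
    by (rule compose_Un[OF R Z' I ns]; use fin in auto)+
  have c5: "compose m (D - ?Z) (idd (B - {s, t})) = D - ?Z" "loop_factor m p \<delta> (D - ?Z) (idd (B - {s, t})) = (1::'k)" for p \<delta>
    by (rule compose_idd_right[OF R]; use fin in auto)+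
  have "compose m (D - ?Z \<union> ?Z') (idd (B - {s, t}) \<union> (?n \<union> ?s)) = D"
    unfolding c4 c5 c1 c2 c3 using e1 e2 by auto
  moreover have "loop_factor m p \<delta> (D - ?Z \<union> ?Z') (idd (B - {s, t}) \<union> (?n \<union> ?s)) = (1::'k)" for p \<delta>
    unfolding c4 c5 c1 c3 lf2 by simp
  moreover have "m dvd label_sum (idd (B - {s, t}) \<union> (?n \<union> ?s))"
  proof -
    have "(idd (B - {s, t})) \<inter> (?n \<union> ?s) = {}" by (auto simp: idd_def strands_def doubleton_eq_iff)
    then have "label_sum (idd (B - {s, t}) \<union> (?n \<union> ?s)) = label_sum (idd (B - {s, t})) + label_sum (?n \<union> ?s)"
      using fin by (intro label_sum_Un) (auto simp: idd_def strands_def)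
    also have "label_sum (?n \<union> ?s) = label_sum ?n + label_sum ?s" by (rule label_sum_Un) auto
    also have "label_sum (idd (B - {s, t})) = 0" unfolding idd_def by (subst label_sum_strands) auto
    finally show ?thesis using cj by (simp add: label_sum_def mod_eq_0_iff_dvd[symmetric] mod_simps)
  qed
  ultimately show ?thesis using D' x by (intro that[of "D - ?Z \<union> ?Z'" "idd (B - {s, t}) \<union> (?n \<union> ?s)"]) auto
qed

section \<open>Linear extension\<close>

lemma lookup_pscale [simp]: "Poly_Mapping.lookup (pscale c x) a = c * Poly_Mapping.lookup x a"
  unfolding pscale_def by (simp add: Poly_Mapping.map.rep_eq when_def)

lemma lookup_basis: "Poly_Mapping.lookup (basis a) b = (if a = b then 1 else 0)"
  by (simp add: basis_def lookup_single when_def)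

interpretation pscale: vector_space "pscale :: 'k::field \<Rightarrow> ('a \<Rightarrow>\<^sub>0 'k) \<Rightarrow> _"
  by unfold_locales (auto intro!: poly_mapping_eqI simp: lookup_add algebra_simps)

lemma keys_pscale: "Poly_Mapping.keys (pscale c x) \<subseteq> Poly_Mapping.keys x"
  by (auto simp: in_keys_iff)

lemma keys_basis [simp]: "Poly_Mapping.keys (basis a :: 'a \<Rightarrow>\<^sub>0 'k::field) = {a}"
  by (auto simp: in_keys_iff lookup_basis split: if_splits)

lemma lin_ext_sum_superset:
  assumes "finite S" "Poly_Mapping.keys x \<subseteq> S"
  shows "lin_ext f x = (\<Sum>a\<in>S. pscale (Poly_Mapping.lookup x a) (f a))"
  unfolding lin_ext_def by (rule sum.mono_neutral_left) (use assms in \<open>auto simp: in_keys_iff\<close>)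

lemma lin_ext_0 [simp]: "lin_ext f 0 = 0"
  by (simp add: lin_ext_def)

lemma lin_ext_add: "lin_ext f (x + y) = lin_ext f x + lin_ext f y"
proof -
  let ?S = "Poly_Mapping.keys x \<union> Poly_Mapping.keys y"
  have "lin_ext f z = (\<Sum>a\<in>?S. pscale (Poly_Mapping.lookup z a) (f a))" if "Poly_Mapping.keys z \<subseteq> ?S" for z
    by (rule lin_ext_sum_superset) (use that in auto)
  then show ?thesis using Poly_Mapping.keys_add[of x y]
    by (simp add: lookup_add pscale.scale_left_distrib sum.distrib)
qed

lemma lin_ext_pscale: "lin_ext f (pscale c x) = pscale c (lin_ext f x)"
  by (subst lin_ext_sum_superset[OF finite_keys[of x] keys_pscale])
    (simp add: lin_ext_def pscale.scale_sum_right)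

lemma lin_ext_basis [simp]: "lin_ext f (basis a) = f a"
  by (simp add: lin_ext_def lookup_basis)

lemma lin_ext_uminus: "lin_ext f (- x) = - lin_ext f x"
  using lin_ext_pscale[of f "-1" x] by (simp add: pscale.scale_minus_left)

lemma lin_ext_diff: "lin_ext f (x - y) = lin_ext f x - lin_ext f y"
  by (metis add_uminus_conv_diff lin_ext_add lin_ext_uminus)

lemma lin_ext_sum: "lin_ext f (\<Sum>i\<in>I. g i) = (\<Sum>i\<in>I. lin_ext f (g i))"
  by (induction I rule: infinite_finite_induct) (auto simp: lin_ext_add)

lemma lin_ext_cong: "(\<And>a. a \<in> Poly_Mapping.keys x \<Longrightarrow> f a = g a) \<Longrightarrow> lin_ext f x = lin_ext g x"
  unfolding lin_ext_def by (rule sum.cong) auto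

lemma lin_ext_fun_add: "lin_ext (\<lambda>a. f a + g a) x = lin_ext f x + lin_ext g x"
  by (simp add: lin_ext_def pscale.scale_right_distrib sum.distrib)

lemma lin_ext_fun_pscale: "lin_ext (\<lambda>a. pscale c (f a)) x = pscale c (lin_ext f x)"
  by (simp add: lin_ext_def pscale.scale_sum_right mult.commute)

lemma lin_ext_fun_0 [simp]: "lin_ext (\<lambda>a. 0) x = 0"
  by (simp add: lin_ext_def)

lemma lin_ext_expand: "lin_ext basis x = x"
proof (rule poly_mapping_eqI)
  fix a
  have "Poly_Mapping.lookup (lin_ext basis x) a = (\<Sum>b\<in>Poly_Mapping.keys x. Poly_Mapping.lookup x b * (if b = a then 1 else 0))"
    unfolding lin_ext_def lookup_sum by (simp add: lookup_basis)
  also have "\<dots> = Poly_Mapping.lookup x a" by (simp add: sum.delta if_distrib cong: if_cong) (simp add: in_keys_iff)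
  finally show "Poly_Mapping.lookup (lin_ext basis x) a = Poly_Mapping.lookup x a" .
qed

lemma keys_sum_subset: "(\<And>i. i \<in> I \<Longrightarrow> Poly_Mapping.keys (g i) \<subseteq> S) \<Longrightarrow> Poly_Mapping.keys (\<Sum>i\<in>I. g i) \<subseteq> S"
proof (induction I rule: infinite_finite_induct)
  case (insert i I)
  then show ?case using Poly_Mapping.keys_add[of "g i" "\<Sum>i\<in>I. g i"] by auto
qed auto

lemma keys_lin_ext: "(\<And>a. a \<in> Poly_Mapping.keys x \<Longrightarrow> Poly_Mapping.keys (f a) \<subseteq> S) \<Longrightarrow> Poly_Mapping.keys (lin_ext f x) \<subseteq> S"
  unfolding lin_ext_def by (rule keys_sum_subset) (rule order_trans[OF keys_pscale])

lemma span_induct_basis [consumes 1, case_names zero add basis]: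
  assumes "Poly_Mapping.keys x \<subseteq> S" "P 0"
    "\<And>x y. Poly_Mapping.keys x \<subseteq> S \<Longrightarrow> Poly_Mapping.keys y \<subseteq> S \<Longrightarrow> P x \<Longrightarrow> P y \<Longrightarrow> P (x + y)"
    "\<And>c a. a \<in> S \<Longrightarrow> P (pscale c (basis a))"
  shows "P (x :: 'a \<Rightarrow>\<^sub>0 'k::field)"
proof -
  have "Poly_Mapping.keys (\<Sum>a\<in>T. pscale (Poly_Mapping.lookup x a) (basis a)) \<subseteq> S \<and>
      P (\<Sum>a\<in>T. pscale (Poly_Mapping.lookup x a) (basis a))" if "finite T" "T \<subseteq> S" for T
    using that
  proof (induction T)
    case (insert a T)
    have k: "Poly_Mapping.keys (pscale (Poly_Mapping.lookup x a) (basis a)) \<subseteq> S"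
      using keys_pscale[of "Poly_Mapping.lookup x a" "basis a"] insert.prems by auto
    have "Poly_Mapping.keys (pscale (Poly_Mapping.lookup x a) (basis a) + (\<Sum>a\<in>T. pscale (Poly_Mapping.lookup x a) (basis a))) \<subseteq> S"
      using k insert by (intro order_trans[OF Poly_Mapping.keys_add]) auto
    then show ?case using insert assms(3)[OF k] assms(4)[of a] by auto
  qed (use assms(2) in auto)
  from this[OF finite_keys assms(1)] show ?thesis
    using lin_ext_expand[of x] unfolding lin_ext_def by simp
qed

text \<open>Identities of linear maps are checked on basis vectors in this form throughout; applied
  repeatedly, it reduces multilinear identities to diagrams.\<close>

lemma lin_ext_eqI:
  assumes "Poly_Mapping.keys x \<subseteq> S" "\<And>x y. F (x + y) = F x + F y" "\<And>c x. F (pscale c x) = pscale c (F x)"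
    "\<And>x y. G (x + y) = G x + G y" "\<And>c x. G (pscale c x) = pscale c (G x)"
    "\<And>a. a \<in> S \<Longrightarrow> F (basis a) = G (basis a)"
  shows "F x = (G x :: 'b \<Rightarrow>\<^sub>0 'k::field)"
  using assms(1)
proof (induction x rule: span_induct_basis)
  case zero
  have "F 0 = 0" "G 0 = 0" using assms(3)[of 0 0] assms(5)[of 0 0] by simp_all
  then show ?case by simp
qed (simp_all add: assms)

section \<open>The algebra and the spaces of diagrams\<close>

locale brauer_parameters =
  fixes m p d :: nat and \<delta> :: "nat \<Rightarrow> 'k::field" and i0 :: nat
  assumes mpos: "m > 0" and mpd: "m = p * d"
    and i0: "(\<exists>i<d. \<delta> i \<noteq> 0) \<Longrightarrow> i0 < d \<and> \<delta> i0 \<noteq> 0"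
begin

abbreviation dm :: "(diagram \<Rightarrow>\<^sub>0 'k) \<Rightarrow> (diagram \<Rightarrow>\<^sub>0 'k) \<Rightarrow> (diagram \<Rightarrow>\<^sub>0 'k)" (infixl "\<cdot>" 70)
  where "x \<cdot> y \<equiv> diag_mult m p \<delta> x y"

abbreviation lf :: "diagram \<Rightarrow> diagram \<Rightarrow> 'k"
  where "lf X Y \<equiv> loop_factor m p \<delta> X Y"

text \<open>The morphism spaces of the linear category of diagrams. The case \<open>q = p\<close> is
  that of the algebra and its corner modules, while \<open>q = 1\<close> imposes nothing, so that
  associativity needs to be stated only once.\<close>

definition hsp :: "nat \<Rightarrow> nat set \<Rightarrow> nat set \<Rightarrow> (diagram \<Rightarrow>\<^sub>0 'k) set"
  where "hsp q A B = {x. Poly_Mapping.keys x \<subseteq> {X \<in> dgr m A B. q dvd label_sum X}}"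

lemma pm: "p dvd m" using mpd by simp

lemma dm_basis [simp]: "basis X \<cdot> basis Y = pscale (lf X Y) (basis (compose m X Y))"
  by (simp add: diag_mult_def)

lemma dm_add_left: "(x + y) \<cdot> z = x \<cdot> z + y \<cdot> z"
  and dm_pscale_left: "pscale c x \<cdot> z = pscale c (x \<cdot> z)"
  and dm_add_right: "z \<cdot> (x + y) = z \<cdot> x + z \<cdot> y"
  and dm_pscale_right: "z \<cdot> pscale c x = pscale c (z \<cdot> x)"
  and dm_0_left [simp]: "0 \<cdot> z = 0"
  and dm_0_right [simp]: "z \<cdot> 0 = 0"
  by (simp_all add: diag_mult_def lin_ext_add lin_ext_pscale lin_ext_fun_add lin_ext_fun_pscale)

lemma dm_diff_left: "(x - y) \<cdot> z = x \<cdot> z - y \<cdot> z"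
  using dm_add_left[of "x - y" y z] by (simp add: eq_diff_eq)

lemma hsp_0 [simp]: "0 \<in> hsp q A B"
  and hsp_pscale: "x \<in> hsp q A B \<Longrightarrow> pscale c x \<in> hsp q A B"
  and hsp_uminus: "x \<in> hsp q A B \<Longrightarrow> - x \<in> hsp q A B"
  and hsp_add: "x \<in> hsp q A B \<Longrightarrow> y \<in> hsp q A B \<Longrightarrow> x + y \<in> hsp q A B"
  using keys_pscale[of c x] Poly_Mapping.keys_add[of x y] by (auto simp: hsp_def)

lemma hsp_basis: "basis X \<in> hsp q A B \<longleftrightarrow> X \<in> dgr m A B \<and> q dvd label_sum X"
  by (simp add: hsp_def)

lemma hsp_mono: "x \<in> hsp q A B \<Longrightarrow> x \<in> hsp 1 A B"
  by (auto simp: hsp_def)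

text \<open>Pairs with vanishing loop factor contribute nothing, so membership is to be checked only
  where label sums are additive modulo \<open>p\<close>.\<close>

lemma dm_in_span:
  assumes "Poly_Mapping.keys x \<subseteq> S" "Poly_Mapping.keys y \<subseteq> T"
    "\<And>X Y. X \<in> S \<Longrightarrow> Y \<in> T \<Longrightarrow> lf X Y \<noteq> 0 \<Longrightarrow> compose m X Y \<in> R"
  shows "Poly_Mapping.keys (x \<cdot> y) \<subseteq> R"
  unfolding diag_mult_def
proof (intro keys_lin_ext)
  fix X Y assume XY: "X \<in> Poly_Mapping.keys x" "Y \<in> Poly_Mapping.keys y"
  show "Poly_Mapping.keys (pscale (lf X Y) (basis (compose m X Y))) \<subseteq> R"
    using assms(3)[OF subsetD[OF assms(1) XY(1)] subsetD[OF assms(2) XY(2)]] by (cases "lf X Y = 0") (auto intro!: order_trans[OF keys_pscale])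
qed

lemma dm_closed:
  assumes "x \<in> hsp q A B" "y \<in> hsp q B D" "finite A" "finite B" "finite D" "q dvd p"
  shows "x \<cdot> y \<in> hsp q A D"
  unfolding hsp_def
proof (rule CollectI, rule dm_in_span)
  fix X Y assume X: "X \<in> {X \<in> dgr m A B. q dvd label_sum X}" and Y: "Y \<in> {X \<in> dgr m B D. q dvd label_sum X}"
    and l: "lf X Y \<noteq> 0"
  have "[label_sum (compose m X Y) = label_sum X + label_sum Y] (mod q)"
    by (rule cong_dvd_modulus_nat[OF label_sum_compose[OF _ _ pm l] assms(6)]) (use X Y good_dgr assms in auto)
  then have "q dvd label_sum (compose m X Y)" using X Y by (simp add: cong_dvd_iff)
  then show "compose m X Y \<in> {X \<in> dgr m A D. q dvd label_sum X}"
    using compose_in_dgr[of X m A B Y D] X Y assms mpos by auto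
qed (use assms in \<open>auto simp: hsp_def\<close>)

lemma dm_assoc:
  assumes "x \<in> hsp 1 A B" "y \<in> hsp 1 B C" "z \<in> hsp 1 C D" "finite A" "finite B" "finite C" "finite D"
  shows "(x \<cdot> y) \<cdot> z = x \<cdot> (y \<cdot> z)"
proof -
  have k: "Poly_Mapping.keys x \<subseteq> dgr m A B" "Poly_Mapping.keys y \<subseteq> dgr m B C" "Poly_Mapping.keys z \<subseteq> dgr m C D"
    using assms by (auto simp: hsp_def)
  show ?thesis
  proof (rule lin_ext_eqI[OF k(1)])
    fix X assume X: "X \<in> dgr m A B"
    show "basis X \<cdot> y \<cdot> z = basis X \<cdot> (y \<cdot> z)"
    proof (rule lin_ext_eqI[OF k(2)])
      fix Y assume Y: "Y \<in> dgr m B C"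
      show "basis X \<cdot> basis Y \<cdot> z = basis X \<cdot> (basis Y \<cdot> z)"
      proof (rule lin_ext_eqI[OF k(3)])
        fix Z assume Z: "Z \<in> dgr m C D"
        have g: "good X" "good Y" "good Z" using X Y Z good_dgr assms by blast+
        show "basis X \<cdot> basis Y \<cdot> basis Z = basis X \<cdot> (basis Y \<cdot> basis Z)"
          using compose_assoc(1)[OF g] compose_assoc(2)[OF g, of m p \<delta>]
          by (simp add: dm_pscale_left dm_pscale_right)
      qed (simp_all add: dm_add_right dm_pscale_right)
    qed (simp_all add: dm_add_right dm_pscale_right dm_add_left dm_pscale_left)
  qed (simp_all add: dm_add_left dm_pscale_left)
qed

lemma dm_one_left: "x \<in> hsp q A B \<Longrightarrow> finite A \<Longrightarrow> finite B \<Longrightarrow> basis (idd A) \<cdot> x = x"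
  by (rule lin_ext_eqI[of _ "dgr m A B" "\<lambda>x. basis (idd A) \<cdot> x" "\<lambda>x. x"])
    (auto simp: hsp_def dm_add_right dm_pscale_right compose_idd_left)

lemma dm_one_right: "x \<in> hsp q A B \<Longrightarrow> finite A \<Longrightarrow> finite B \<Longrightarrow> x \<cdot> basis (idd B) = x"
  by (rule lin_ext_eqI[of _ "dgr m A B" "\<lambda>x. x \<cdot> basis (idd B)" "\<lambda>x. x"])
    (auto simp: hsp_def dm_add_left dm_pscale_left compose_idd_right)

lemma label_sum_idd: "label_sum (idd J) = 0"
  unfolding idd_def by (subst label_sum_strands) auto

lemma idd_in_hsp: "basis (idd J) \<in> hsp q J J"
  by (simp add: hsp_basis idd_in_dgr mpos label_sum_idd)

abbreviation B :: "nat \<Rightarrow> (diagram \<Rightarrow>\<^sub>0 'k) ring"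
  where "B n \<equiv> brauer_algebra m p \<delta> n"

lemma carrier_B: "carrier (B n) = hsp p {1..n} {1..n}"
  by (simp add: brauer_algebra_def hsp_def diagrams_dgr)

lemma B_simps [simp]: "x \<otimes>\<^bsub>B n\<^esub> y = x \<cdot> y" "\<one>\<^bsub>B n\<^esub> = basis (id_diagram n)" "\<zero>\<^bsub>B n\<^esub> = 0" "x \<oplus>\<^bsub>B n\<^esub> y = x + y"
  by (simp_all add: brauer_algebra_def)

lemma ring_B: "ring (B n)"
proof (rule ringI)
  show "abelian_group (B n)"
    by (rule abelian_groupI) (auto simp: carrier_B hsp_add add.assoc add.commute intro: exI[of _ "- x" for x] bexI[OF _ hsp_uminus])
  show "monoid (B n)"
    by (rule monoidI) (auto simp: carrier_B id_diagram_idd idd_in_hsp dm_one_left dm_one_right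
        intro!: dm_closed dm_assoc intro: hsp_mono)
qed (auto simp: dm_add_left dm_add_right)

lemma B_minus: "x \<in> carrier (B n) \<Longrightarrow> \<ominus>\<^bsub>B n\<^esub> x = - x"
proof -
  assume x: "x \<in> carrier (B n)"
  interpret ring "B n" by (rule ring_B)
  show ?thesis by (rule minus_equality) (use x in \<open>auto simp: carrier_B hsp_uminus\<close>)
qed

section \<open>Factorisation of the idempotents\<close>

lemma idd_Collect: "{({North a, South a}, 0) | a. a \<in> A} = idd A"
  unfolding idd_def strands_def by auto

lemma idd_insert: "idd (insert a A) = insert ({North a, South a}, 0) (idd A)"
  unfolding idd_def strands_def by simp

lemma sum_two_nodes: "n \<ge> 2 \<Longrightarrow> {1..n} = {1..n - 2} \<union> {n - 1, n::nat}"
  by auto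

text \<open>The idempotent \<open>idem_step\<close> is \<open>u \<cdot> v\<close> where \<open>u\<close> is a \<open>cup_diagram\<close> and
  \<open>v \<cdot> u = 1\<close>; so the corner ring consists of the \<open>u \<cdot> x \<cdot> v\<close>.\<close>

definition cup_diagram :: "nat \<Rightarrow> nat \<Rightarrow> diagram"
  where "cup_diagram n z = idd {1..n - 2} \<union> {({North (n - 1), North n}, z)}"

lemma cup_in_dgr: assumes "n \<ge> 2" "z < m" shows "cup_diagram n z \<in> dgr m {1..n} {1..n - 2}"
proof -
  have "cup_diagram n z \<in> dgr m ({1..n - 2} \<union> {n - 1, n}) ({1..n - 2} \<union> {})"
    unfolding cup_diagram_def by (rule dgr_Un[OF idd_in_dgr[OF mpos] dgr_NN]) (use assms in auto)
  then show ?thesis using sum_two_nodes[OF assms(1)] by simp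
qed

lemma label_sum_cup: "label_sum (cup_diagram n z) = z"
proof -
  have "label_sum (cup_diagram n z) = label_sum (idd {1..n - 2}) + label_sum {({North (n - 1), North n}, z)}"
    unfolding cup_diagram_def by (rule label_sum_Un) (auto simp: idd_def strands_def doubleton_eq_iff)
  then show ?thesis unfolding label_sum_idd by (simp add: label_sum_def)
qed

text \<open>The cup and the element act on disjoint sets of nodes, so the cup slides past; the two
  added strands are absorbed by it.\<close>

lemma add_two_strands_cup:
  assumes n: "n \<ge> 2" and z: "z < m" and y: "y \<in> hsp 1 {1..n - 2} {1..n - 2}"
  shows "lin_ext (\<lambda>X. basis (add_two_strands n X)) y \<cdot> basis (cup_diagram n z) = basis (cup_diagram n z) \<cdot> y"
proof -
  have k: "Poly_Mapping.keys y \<subseteq> dgr m {1..n - 2} {1..n - 2}" using y by (auto simp: hsp_def)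
  let ?N = "{({North (n - 1), North n}, z)}"
  let ?S = "{({North (n - 1), South (n - 1)}, 0), ({North n, South n}, 0)}"
  have N: "?N \<in> dgr m {n - 1, n} {}" by (rule dgr_NN) (use n z in auto)
  have S: "?S \<in> dgr m {n - 1, n} {n - 1, n}"
    using dgr_Un[OF dgr_NS dgr_NS, of 0 m 0 "n - 1" n "n - 1" n] mpos n by (simp add: insert_commute)
  have I: "idd {1..n - 2} \<in> dgr m {1..n - 2} {1..n - 2}" by (rule idd_in_dgr[OF mpos])
  have dis: "{1..n - 2} \<inter> {n - 1, n} = {}" using n by auto
  show ?thesis
  proof (rule lin_ext_eqI[OF k])
    fix X assume X: "X \<in> dgr m {1..n - 2} {1..n - 2}"
    have cS: "compose m ?S ?N = ?N" "lf ?S ?N = 1"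
      using compose_cap(1)[of "n - 1" n "n - 1" n m 0 0 z] compose_cap(2)[of "n - 1" n "n - 1" n m p \<delta> 0 0 z] n z by auto
    have "compose m (X \<union> ?S) (idd {1..n - 2} \<union> ?N) = X \<union> ?N"
      using compose_Un(1)[OF X S I N] dis compose_idd_right(1)[OF X] cS by simp
    moreover have "lf (X \<union> ?S) (idd {1..n - 2} \<union> ?N) = 1"
      using compose_Un(2)[OF X S I N, of p \<delta>] dis compose_idd_right(2)[OF X, of p \<delta>] cS by simp
    moreover have "compose m (idd {1..n - 2} \<union> ?N) (X \<union> {}) = X \<union> ?N"
      using compose_Un(1)[OF I N X dgr_empty] dis compose_idd_left(1)[OF X] compose_empty_right(1)[OF _ N] by simp
    moreover have "lf (idd {1..n - 2} \<union> ?N) (X \<union> {}) = 1"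
      using compose_Un(2)[OF I N X dgr_empty, of p \<delta>] dis compose_idd_left(2)[OF X, of p \<delta>] compose_empty_right(2)[OF _ N, of p \<delta>] by simp
    ultimately show "lin_ext (\<lambda>X. basis (add_two_strands n X)) (basis X) \<cdot> basis (cup_diagram n z) =
      basis (cup_diagram n z) \<cdot> basis X"
      by (simp add: add_two_strands_def cup_diagram_def)
  qed (simp_all add: dm_add_right dm_pscale_right dm_add_left dm_pscale_left lin_ext_add lin_ext_pscale)
qed

text \<open>The label \<open>i0 * p\<close> sits on the northern arc of the idempotent and hence on
  the cup. Gluing the unlabelled southern arc of \<open>v\<close> to the cup closes a loop worth
  \<open>\<delta> i0\<close>, which the factor \<open>1 / \<delta> i0\<close> in \<open>v\<close>
  cancels.\<close>

lemma idem_step_factor_nonzero: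
  assumes n: "n \<ge> 2" and \<delta>: "\<exists>i<d. \<delta> i \<noteq> 0"
  shows "\<exists>v\<in>hsp p {1..n - 2} {1..n}. v \<cdot> basis (cup_diagram n (i0 * p)) = basis (idd {1..n - 2}) \<and>
    basis (cup_diagram n (i0 * p)) \<cdot> v = idem_step m p d \<delta> i0 n"
proof -
  have i: "i0 < d" "\<delta> i0 \<noteq> 0" using i0[OF \<delta>] by auto
  have ppos: "p > 0" using mpos mpd by (cases p) auto
  have z: "i0 * p < m" using i mpd ppos by (simp add: mult.commute)
  let ?I = "{1..n - 2}" and ?P = "{n - 1, n}"
  let ?N = "{({North (n - 1), North n}, i0 * p)}" and ?M = "{({North (n - 1), North n}, 0)}" and ?S = "{({South (n - 1), South n}, 0)}"
  let ?T = "{({North (n - 1), South (n - 1)}, i0 * p), ({North n, South n}, 0)}"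
  have dis: "?I \<inter> ?P = {}" using n by auto
  have I: "idd ?I \<in> dgr m ?I ?I" by (rule idd_in_dgr[OF mpos])
  have N: "?N \<in> dgr m ?P {}" and N0: "?M \<in> dgr m ?P {}" by (rule dgr_NN; use n z mpos in auto)+
  have S: "?S \<in> dgr m {} ?P" by (rule dgr_SS) (use n mpos in auto)
  have T: "?T \<in> dgr m ?P ?P"
    using dgr_Un[OF dgr_NS dgr_NS, of "i0 * p" m 0 "n - 1" n "n - 1" n] mpos n z by (simp add: insert_commute)
  have NS: "?M \<union> ?S \<in> dgr m ?P ?P" using dgr_Un[OF N0 S] by simp
  let ?V = "idd ?I \<union> ?S"
  have V: "?V \<in> dgr m ?I {1..n}" using dgr_Un[OF I S] dis sum_two_nodes[OF n] by simp
  have lsV: "label_sum ?V = 0"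
  proof -
    have "label_sum ?V = label_sum (idd ?I) + label_sum ?S"
      by (rule label_sum_Un) (auto simp: idd_def strands_def doubleton_eq_iff)
    then show ?thesis unfolding label_sum_idd by (simp add: label_sum_def)
  qed
  have ii: "compose m (idd ?I) (idd ?I) = idd ?I" "lf (idd ?I) (idd ?I) = 1" by (rule compose_idd_left[OF I]; simp)+
  have vu: "basis ?V \<cdot> basis (cup_diagram n (i0 * p)) = pscale (\<delta> i0) (basis (idd ?I))"
  proof -
    have "compose m ?V (idd ?I \<union> ?N) = idd ?I"
      using compose_Un(1)[OF I S I N] dis ii compose_loop(1)[of "n - 1" n m 0 "i0 * p"] n by simp
    moreover have "lf ?V (idd ?I \<union> ?N) = \<delta> i0"
      using compose_Un(2)[OF I S I N, of p \<delta>] dis ii compose_loop(2)[of "n - 1" n m p \<delta> 0 "i0 * p"] n z ppos by (simp add: loop_value_def)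
    ultimately show ?thesis by (simp add: cup_diagram_def)
  qed
  have NS1: "compose m ?N ?S = ?N \<union> ?S" "lf ?N ?S = 1"
    using compose_Un(1)[OF N dgr_empty dgr_empty S] compose_Un(2)[OF N dgr_empty dgr_empty S, of p \<delta>]
      compose_empty_left(1)[OF _ S] compose_empty_left(2)[OF _ S, of p \<delta>] compose_empty_right(1)[OF _ N] compose_empty_right(2)[OF _ N, of p \<delta>] by simp_all
  have uv: "basis (cup_diagram n (i0 * p)) \<cdot> basis ?V = basis (idd ?I \<union> (?N \<union> ?S))"
    using compose_Un(1)[OF I N I S] compose_Un(2)[OF I N I S, of p \<delta>] dis ii NS1 by (simp add: cup_diagram_def)
  have t: "t_diagram m n (n - 1) (i0 * p) = idd ?I \<union> ?T"
  proof -
    have "t_diagram m n (n - 1) (i0 * p) = (\<lambda>a. ({North a, South a}, if a = n - 1 then i0 * p else 0)) ` (?I \<union> ?P)"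
      unfolding t_diagram_def sum_two_nodes[OF n, symmetric] mod_less[OF z] by (rule Setcompr_eq_image)
    also have "\<dots> = idd ?I \<union> ?T"
    proof -
      have "(\<lambda>a. ({North a, South a}, if a = n - 1 then i0 * p else 0)) ` ?I = idd ?I"
        unfolding idd_def strands_def by (rule image_cong) (use n in auto)
      moreover have "(\<lambda>a. ({North a, South a}, if a = n - 1 then i0 * p else 0)) ` ?P = ?T" using n by simp
      ultimately show ?thesis unfolding image_Un by (simp only:)
    qed
    finally show ?thesis .
  qed
  have e: "e_diagram n (n - 1) n = idd ?I \<union> (?M \<union> ?S)"
  proof -
    have "{1..n} - {n - 1, n} = ?I" using n by auto
    then show ?thesis unfolding e_diagram_def idd_Collect by (simp add: insert_commute)
  qed
  have TN: "compose m ?T (?M \<union> ?S) = ?N \<union> ?S" "lf ?T (?M \<union> ?S) = 1"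
    using compose_Un(1)[OF T dgr_empty N0 S] compose_Un(2)[OF T dgr_empty N0 S, of p \<delta>]
      compose_empty_left(1)[OF _ S] compose_empty_left(2)[OF _ S, of p \<delta>] compose_cap(1)[of "n - 1" n "n - 1" n m "i0 * p" 0 0]
      compose_cap(2)[of "n - 1" n "n - 1" n m p \<delta> "i0 * p" 0 0] n z by simp_all
  have te: "basis (t_diagram m n (n - 1) (i0 * p)) \<cdot> basis (e_diagram n (n - 1) n) = basis (idd ?I \<union> (?N \<union> ?S))"
    unfolding t e using compose_Un(1)[OF I T I NS] compose_Un(2)[OF I T I NS, of p \<delta>] dis ii TN by simp
  show ?thesis
  proof (rule bexI[of _ "pscale (1 / \<delta> i0) (basis ?V)"])
    show "pscale (1 / \<delta> i0) (basis ?V) \<in> hsp p ?I {1..n}"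
      by (rule hsp_pscale) (use V lsV in \<open>simp add: hsp_basis\<close>)
    show "pscale (1 / \<delta> i0) (basis ?V) \<cdot> basis (cup_diagram n (i0 * p)) = basis (idd ?I) \<and>
      basis (cup_diagram n (i0 * p)) \<cdot> pscale (1 / \<delta> i0) (basis ?V) = idem_step m p d \<delta> i0 n"
      unfolding dm_pscale_left dm_pscale_right vu uv idem_step_def te using \<delta> i by simp
  qed
qed

text \<open>A loop would cost the factor 0, so the southern arc of \<open>v\<close> must not close
  up with the cup. It is placed on the nodes \<open>n - 2\<close> and \<open>n - 1\<close>, and with
  the cup on \<open>n - 1\<close> and \<open>n\<close> it forms a zigzag; this takes a third
  node.\<close>

lemma idem_step_factor_zero:
  assumes n: "n \<ge> 3" and \<delta>: "\<not> (\<exists>i<d. \<delta> i \<noteq> 0)"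
  shows "\<exists>v\<in>hsp p {1..n - 2} {1..n}. v \<cdot> basis (cup_diagram n 0) = basis (idd {1..n - 2}) \<and>
    basis (cup_diagram n 0) \<cdot> v = idem_step m p d \<delta> i0 n"
proof -
  let ?I = "{1..n - 3}" and ?a = "n - 2" and ?b = "n - 1" and ?c = n
  let ?N = "{({North ?b, North ?c}, 0)}" and ?S = "{({South ?a, South ?b}, 0)}"
  let ?aa = "{({North ?a, South ?a}, 0)}" and ?ac = "{({North ?a, South ?c}, 0)}"
  let ?X = "{({South ?c, South ?b}, 0), ({North ?a, South ?a}, 0)}" and ?Y = "{({North ?b, North ?a}, 0), ({North ?c, South ?c}, 0)}"
  \<comment> \<open>\<open>?X\<close> over \<open>?Y\<close> is the middle of the product of the two
    e-diagrams and straightens to \<open>?ac\<close>; \<open>?X'\<close> over \<open>?Y'\<close> is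
    the middle of \<open>v\<close> times the cup and straightens to the vertical strand
    \<open>?aa\<close>.\<close>
  let ?X' = "{({South ?a, South ?b}, 0), ({North ?a, South ?c}, 0)}" and ?Y' = "{({North ?b, North ?c}, 0), ({North ?a, South ?a}, 0)}"
  have abc: "?a \<noteq> ?b" "?b \<noteq> ?c" "?a \<noteq> ?c" using n by auto
  have dis: "?I \<inter> {?a} = {}" "?I \<inter> {?a, ?b, ?c} = {}" using n by auto
  have J: "{1..n - 2} = ?I \<union> {?a}" "{1..n} = ?I \<union> {?a, ?b, ?c}" using n by auto
  have Iid: "idd {1..n - 2} = idd ?I \<union> ?aa" unfolding J(1) by (simp add: idd_insert)
  have I: "idd ?I \<in> dgr m ?I ?I" by (rule idd_in_dgr[OF mpos])
  have ii: "compose m (idd ?I) (idd ?I) = idd ?I" "lf (idd ?I) (idd ?I) = 1" by (rule compose_idd_left[OF I]; simp)+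
  have N: "?N \<in> dgr m {?b, ?c} {}" by (rule dgr_NN) (use abc mpos in auto)
  have S: "?S \<in> dgr m {} {?a, ?b}" by (rule dgr_SS) (use abc mpos in auto)
  have aa: "?aa \<in> dgr m {?a} {?a}" and ac: "?ac \<in> dgr m {?a} {?c}" by (rule dgr_NS[OF mpos])+
  have X: "?X \<in> dgr m {?a} {?a, ?b, ?c}"
    using dgr_Un[OF dgr_SS[of ?c ?b 0 m] aa] abc mpos by (simp add: insert_commute)
  have Y: "?Y \<in> dgr m {?a, ?b, ?c} {?c}"
    using dgr_Un[OF dgr_NN[of ?b ?a 0 m] dgr_NS[of 0 m ?c ?c]] abc mpos by (simp add: insert_commute)
  have X': "?X' \<in> dgr m {?a} {?a, ?b, ?c}"
    using dgr_Un[OF S ac] abc by (simp add: insert_commute)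
  have Y': "?Y' \<in> dgr m {?a, ?b, ?c} {?a}"
    using dgr_Un[OF N aa] abc by (simp add: insert_commute)
  have z1: "compose m ?X ?Y = ?ac" "lf ?X ?Y = 1"
    using compose_zigzag(1)[of ?c ?b ?a m ?a ?c] compose_zigzag(2)[of ?c ?b ?a m p \<delta> ?a ?c] abc by (simp_all add: insert_commute)
  have z2: "compose m ?X' ?Y' = ?aa" "lf ?X' ?Y' = 1"
    using compose_zigzag(1)[of ?a ?b ?c m ?a ?a] compose_zigzag(2)[of ?a ?b ?c m p \<delta> ?a ?a] abc by (simp_all add: insert_commute)
  let ?V = "idd ?I \<union> ?X'"
  have V: "?V \<in> dgr m {1..n - 2} {1..n}" unfolding J using dgr_Un[OF I X'] dis by simp
  have cup: "cup_diagram n 0 = idd ?I \<union> ?Y'" unfolding cup_diagram_def Iid by (simp add: insert_commute)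
  have lsV: "label_sum ?V = 0"
  proof -
    have "label_sum ?V = label_sum (idd ?I) + label_sum ?X'"
      by (rule label_sum_Un) (use n in \<open>auto simp: idd_def strands_def doubleton_eq_iff\<close>)
    then show ?thesis unfolding label_sum_idd by (simp add: label_sum_def)
  qed
  have vu: "basis ?V \<cdot> basis (cup_diagram n 0) = basis (idd {1..n - 2})"
    unfolding cup using compose_Un(1)[OF I X' I Y'] compose_Un(2)[OF I X' I Y', of p \<delta>] dis ii z2 Iid by simp
  have NS: "compose m ?N ?S = ?N \<union> ?S" "lf ?N ?S = 1"
    using compose_Un(1)[OF N dgr_empty dgr_empty S] compose_Un(2)[OF N dgr_empty dgr_empty S, of p \<delta>]
      compose_empty_left(1)[OF _ S] compose_empty_left(2)[OF _ S, of p \<delta>] compose_empty_right(1)[OF _ N] compose_empty_right(2)[OF _ N, of p \<delta>] by simp_all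
  have id1: "compose m ?aa ?ac = ?ac" "lf ?aa ?ac = 1"
    using compose_idd_left(1)[OF ac] compose_idd_left(2)[OF ac, of p \<delta>] by (simp_all add: idd_def strands_def)
  have YX: "compose m ?Y' ?X' = ?N \<union> ?S \<union> ?ac" "lf ?Y' ?X' = 1"
    using compose_Un(1)[OF N aa S ac] compose_Un(2)[OF N aa S ac, of p \<delta>] abc NS id1 by (simp_all add: insert_commute)
  have uv: "basis (cup_diagram n 0) \<cdot> basis ?V = basis (idd ?I \<union> (?N \<union> ?S \<union> ?ac))"
    unfolding cup using compose_Un(1)[OF I Y' I X'] compose_Un(2)[OF I Y' I X', of p \<delta>] dis ii YX by simp
  have e1: "e_diagram n (n - 1) n = idd ?I \<union> (?N \<union> ?X)"
  proof -
    have "{1..n} - {n - 1, n} = ?I \<union> {?a}" using n by auto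
    then show ?thesis unfolding e_diagram_def idd_Collect by (simp add: idd_insert insert_commute)
  qed
  have e2: "e_diagram n (n - 2) (n - 1) = idd ?I \<union> (?S \<union> ?Y)"
  proof -
    have "{1..n} - {n - 2, n - 1} = ?I \<union> {?c}" using n by auto
    then show ?thesis unfolding e_diagram_def idd_Collect by (simp add: idd_insert insert_commute)
  qed
  have NX: "?N \<union> ?X \<in> dgr m {?a, ?b, ?c} {?a, ?b, ?c}" using dgr_Un[OF N X] abc by (simp add: insert_commute)
  have SY: "?S \<union> ?Y \<in> dgr m {?a, ?b, ?c} {?a, ?b, ?c}" using dgr_Un[OF S Y] abc by (simp add: insert_commute)
  have ee: "compose m (?N \<union> ?X) (?S \<union> ?Y) = ?N \<union> ?S \<union> ?ac" "lf (?N \<union> ?X) (?S \<union> ?Y) = 1"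
    using compose_Un(1)[OF N X S Y] compose_Un(2)[OF N X S Y, of p \<delta>] abc NS z1 by (simp_all add: insert_commute)
  have "basis (e_diagram n (n - 1) n) \<cdot> basis (e_diagram n (n - 2) (n - 1)) = basis (idd ?I \<union> (?N \<union> ?S \<union> ?ac))"
    unfolding e1 e2 using compose_Un(1)[OF I NX I SY] compose_Un(2)[OF I NX I SY, of p \<delta>] dis ii ee by simp
  then have "idem_step m p d \<delta> i0 n = basis (idd ?I \<union> (?N \<union> ?S \<union> ?ac))" unfolding idem_step_def using \<delta> by (simp only: if_False)
  then show ?thesis using V lsV vu uv by (intro bexI[of _ "basis ?V"]) (simp_all add: hsp_basis)
qed

lemma idem_step_factor:
  assumes "n \<ge> 2" "(\<exists>i<d. \<delta> i \<noteq> 0) \<or> n \<ge> 3"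
  obtains z v where "z < m" "p dvd z" "v \<in> hsp p {1..n - 2} {1..n}" "v \<cdot> basis (cup_diagram n z) = basis (idd {1..n - 2})"
    "basis (cup_diagram n z) \<cdot> v = idem_step m p d \<delta> i0 n"
proof (cases "\<exists>i<d. \<delta> i \<noteq> 0")
  case True
  then have "i0 * p < m" using i0 mpd mpos by (cases "p = 0") (auto simp: mult.commute)
  then show ?thesis using that idem_step_factor_nonzero[OF assms(1) True] by (metis dvd_triv_right)
next
  case False
  then have "n \<ge> 3" using assms by blast
  then show ?thesis using that[of 0] idem_step_factor_zero[OF _ False] mpos by (metis dvd_0_right)
qed

text \<open>Each step replaces \<open>U\<close> by \<open>u \<cdot> U\<close> and \<open>W\<close>
  by \<open>W \<cdot> v\<close>, where the idempotent of the step is \<open>u \<cdot> v\<close>. The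
  two added strands are absorbed by the cup, and \<open>v \<cdot> u = 1\<close> then cancels the
  inner pair.\<close>

lemma corner_factor:
  assumes "idem_exists d \<delta> n l"
  obtains U W where "U \<in> hsp p {1..n} {1..n - 2 * l}" "W \<in> hsp p {1..n - 2 * l} {1..n}"
    "W \<cdot> U = basis (idd {1..n - 2 * l})"
    "\<And>x. x \<in> hsp 1 {1..n - 2 * l} {1..n - 2 * l} \<Longrightarrow> corner m p d \<delta> i0 n l x = U \<cdot> (x \<cdot> W)"
proof -
  have "\<exists>U\<in>hsp p {1..n} {1..n - 2 * l}. \<exists>W\<in>hsp p {1..n - 2 * l} {1..n}. W \<cdot> U = basis (idd {1..n - 2 * l}) \<and>
    (\<forall>x\<in>hsp 1 {1..n - 2 * l} {1..n - 2 * l}. corner m p d \<delta> i0 n l x = U \<cdot> (x \<cdot> W))"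
    using assms
  proof (induction l arbitrary: n)
    case 0
    show ?case
      by (intro bexI[of _ "basis (idd {1..n})"])
        (auto simp: idd_in_hsp dm_one_left dm_one_right compose_idd_left[OF idd_in_dgr[OF mpos]])
  next
    case (Suc l)
    let ?N = "n - 2 * Suc l" and ?n = "n - 2"
    have n: "n \<ge> 2" "(\<exists>i<d. \<delta> i \<noteq> 0) \<or> n \<ge> 3" and ex: "idem_exists d \<delta> ?n l"
      using Suc.prems by (auto simp: idem_exists_def)
    have N: "?n - 2 * l = ?N" by simp
    obtain U W where U: "U \<in> hsp p {1..?n} {1..?N}" and W: "W \<in> hsp p {1..?N} {1..?n}" and WU: "W \<cdot> U = basis (idd {1..?N})"
      and c: "\<And>x. x \<in> hsp 1 {1..?N} {1..?N} \<Longrightarrow> corner m p d \<delta> i0 ?n l x = U \<cdot> (x \<cdot> W)"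
      using Suc.IH[OF ex] unfolding N by auto
    obtain z v where z: "z < m" "p dvd z" and v: "v \<in> hsp p {1..?n} {1..n}" and vu: "v \<cdot> basis (cup_diagram n z) = basis (idd {1..?n})"
      and uv: "basis (cup_diagram n z) \<cdot> v = idem_step m p d \<delta> i0 n"
      using idem_step_factor[OF n] by metis
    let ?u = "basis (cup_diagram n z) :: diagram \<Rightarrow>\<^sub>0 'k"
    have u: "?u \<in> hsp p {1..n} {1..?n}" unfolding hsp_basis label_sum_cup using cup_in_dgr[OF n(1) z(1)] z by blast
    note h1 = hsp_mono[OF U] hsp_mono[OF W] hsp_mono[OF u] hsp_mono[OF v]
    have uU: "?u \<cdot> U \<in> hsp p {1..n} {1..?N}" by (rule dm_closed[OF u U]) auto
    have Wv: "W \<cdot> v \<in> hsp p {1..?N} {1..n}" by (rule dm_closed[OF W v]) auto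
    have "W \<cdot> v \<cdot> (?u \<cdot> U) = basis (idd {1..?N})"
    proof -
      have "W \<cdot> v \<cdot> (?u \<cdot> U) = W \<cdot> (v \<cdot> (?u \<cdot> U))" by (rule dm_assoc[OF h1(2,4) hsp_mono[OF uU]]) auto
      also have "v \<cdot> (?u \<cdot> U) = v \<cdot> ?u \<cdot> U" by (rule dm_assoc[OF h1(4,3,1), symmetric]) auto
      also have "\<dots> = U" unfolding vu by (rule dm_one_left[OF U]) auto
      finally show ?thesis unfolding WU .
    qed
    moreover have "corner m p d \<delta> i0 n (Suc l) x = ?u \<cdot> U \<cdot> (x \<cdot> (W \<cdot> v))" if x: "x \<in> hsp 1 {1..?N} {1..?N}" for x
    proof -
      define y where "y = U \<cdot> (x \<cdot> W)"
      have xW: "x \<cdot> W \<in> hsp 1 {1..?N} {1..?n}" by (rule dm_closed[OF x h1(2)]) auto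
      have y: "y \<in> hsp 1 {1..?n} {1..?n}" unfolding y_def by (rule dm_closed[OF h1(1) xW]) auto
      let ?y2 = "lin_ext (\<lambda>X. basis (add_two_strands n X)) y"
      have y2: "?y2 \<in> hsp 1 {1..n} {1..n}"
      proof -
        have "add_two_strands n X \<in> dgr m {1..n} {1..n}" if X: "X \<in> dgr m {1..?n} {1..?n}" for X
        proof -
          have "{({North (n - 1), South (n - 1)}, 0), ({North n, South n}, 0)} \<in> dgr m {n - 1, n} {n - 1, n}"
            using dgr_Un[OF dgr_NS dgr_NS, of 0 m 0 "n - 1" n "n - 1" n] mpos n by (simp add: insert_commute)
          moreover have "{1..?n} \<inter> {n - 1, n} = {}" using n(1) by auto
          ultimately show ?thesis unfolding add_two_strands_def sum_two_nodes[OF n(1)] using dgr_Un[OF X] by blast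
        qed
        then have "Poly_Mapping.keys ?y2 \<subseteq> dgr m {1..n} {1..n}" by (intro keys_lin_ext) (use y in \<open>auto simp: hsp_def\<close>)
        then show ?thesis by (auto simp: hsp_def)
      qed
      have yv: "y \<cdot> v \<in> hsp 1 {1..?n} {1..n}" by (rule dm_closed[OF y h1(4)]) auto
      have uy: "?u \<cdot> y \<in> hsp 1 {1..n} {1..?n}" by (rule dm_closed[OF h1(3) y]) auto
      have uyv: "?u \<cdot> (y \<cdot> v) \<in> hsp 1 {1..n} {1..n}" by (rule dm_closed[OF h1(3) yv]) auto
      have "?y2 \<cdot> (?u \<cdot> v) = ?y2 \<cdot> ?u \<cdot> v" by (rule dm_assoc[OF y2 h1(3,4), symmetric]) auto
      also have "?y2 \<cdot> ?u = ?u \<cdot> y" by (rule add_two_strands_cup[OF n(1) z(1) y])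
      also have "?u \<cdot> y \<cdot> v = ?u \<cdot> (y \<cdot> v)" by (rule dm_assoc[OF h1(3) y h1(4)]) auto
      finally have "corner m p d \<delta> i0 n (Suc l) x = ?u \<cdot> v \<cdot> (?u \<cdot> (y \<cdot> v))"
        using c[OF x] by (simp add: corner_step_def uv[symmetric] y_def[symmetric])
      also have "\<dots> = ?u \<cdot> (v \<cdot> (?u \<cdot> (y \<cdot> v)))" by (rule dm_assoc[OF h1(3,4) uyv]) auto
      also have "v \<cdot> (?u \<cdot> (y \<cdot> v)) = v \<cdot> ?u \<cdot> (y \<cdot> v)" by (rule dm_assoc[OF h1(4,3) yv, symmetric]) auto
      also have "\<dots> = y \<cdot> v" unfolding vu by (rule dm_one_left[OF yv]) auto
      also have "y \<cdot> v = U \<cdot> (x \<cdot> W \<cdot> v)" unfolding y_def by (rule dm_assoc[OF h1(1) xW h1(4)]) auto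
      also have "x \<cdot> W \<cdot> v = x \<cdot> (W \<cdot> v)" by (rule dm_assoc[OF x h1(2,4)]) auto
      also have "?u \<cdot> (U \<cdot> (x \<cdot> (W \<cdot> v))) = ?u \<cdot> U \<cdot> (x \<cdot> (W \<cdot> v))"
        by (rule dm_assoc[OF h1(3,1), symmetric], rule dm_closed[OF x hsp_mono[OF Wv]]) auto
      finally show ?thesis .
    qed
    ultimately show ?case using uU Wv by blast
  qed
  then show ?thesis using that by blast
qed

end

section \<open>Shifting tableaux\<close>

lemma distinct_concat_index:
  assumes "distinct (concat xss)" "i < length xss" "j < length xss" "y \<in> set (xss ! i)" "y \<in> set (xss ! j)"
  shows "i = j"
  using assms
proof (induction xss arbitrary: i j)
  case (Cons xs xss)
  have no: "y \<notin> set (xss ! k)" if "y \<in> set xs" "k < length xss" for k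
  proof
    assume "y \<in> set (xss ! k)"
    then have "y \<in> \<Union>(set ` set xss)" using nth_mem[OF that(2)] by blast
    then show False using Cons.prems(1) that(1) by auto
  qed
  show ?case using Cons no by (cases i; cases j) auto
qed simp

lemma distinct_concat_member: "distinct (concat xss) \<Longrightarrow> xs \<in> set xss \<Longrightarrow> distinct xs"
  by (induction xss) auto

lemma concat_map_concat: "concat (map concat xss) = concat (concat xss)"
  by (induction xss) auto

lemma std_entry_unique:
  assumes T: "T \<in> std_tableaux lam"
    and p: "s < length T" "a < length (T ! s)" "b < length (T ! s ! a)" "T ! s ! a ! b = i"
    and q: "s' < length T" "a' < length (T ! s')" "b' < length (T ! s' ! a')" "T ! s' ! a' ! b' = i"
  shows "s = s' \<and> a = a' \<and> b = b'"
proof -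
  have d: "distinct (concat (map concat T))" using T by (simp add: std_tableaux_def concat_map_concat)
  have e: "i \<in> set (map concat T ! s)" if "s < length T" "a < length (T ! s)" "b < length (T ! s ! a)" "T ! s ! a ! b = i" for s a b
  proof -
    have "T ! s ! a \<in> set (T ! s)" "i \<in> set (T ! s ! a)" using that nth_mem by auto
    then show ?thesis using that(1) by auto
  qed
  have "i \<in> set (map concat T ! s)" "i \<in> set (map concat T ! s')" using e[OF p] e[OF q] by simp_all
  then have s: "s = s'" using distinct_concat_index[OF d] p q by simp
  have "distinct (map concat T ! s)" by (rule distinct_concat_member[OF d nth_mem]) (use p(1) in simp)
  then have ds: "distinct (concat (T ! s))" using p(1) by simp
  have "i \<in> set (T ! s ! a)" "i \<in> set (T ! s ! a')" using nth_mem[OF p(3)] nth_mem[OF q(3)] p(4) q(4) s by simp_all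
  then have a: "a = a'" using distinct_concat_index[OF ds] p q s by simp
  have "distinct (T ! s ! a)" by (rule distinct_concat_member[OF ds nth_mem[OF p(2)]])
  then have "b = b'" using nth_eq_iff_index_eq[of "T ! s ! a" b b'] p(3,4) q(3,4) unfolding s a by simp
  then show ?thesis using s a by simp
qed

lemma std_position:
  assumes T: "T \<in> std_tableaux lam" and i: "i \<in> {1..sum_list (map sum_list lam)}"
  obtains s a b where "s < length T" "a < length (T ! s)" "b < length (T ! s ! a)" "T ! s ! a ! b = i" "position T i = (s, a, b)"
proof -
  have "i \<in> set (concat (concat T))" using T i by (simp add: std_tableaux_def)
  then obtain U row where "U \<in> set T" "row \<in> set U" "i \<in> set row" by auto
  then obtain s a b where p: "s < length T" "a < length (T ! s)" "b < length (T ! s ! a)" "T ! s ! a ! b = i"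
    by (metis in_set_conv_nth)
  have "position T i = (s, a, b)" unfolding position_def
  proof (rule the_equality)
    fix x assume x: "case x of (s, a, b) \<Rightarrow> s < length T \<and> a < length (T ! s) \<and> b < length (T ! s ! a) \<and> T ! s ! a ! b = i"
    then show "x = (s, a, b)" using std_entry_unique[OF T p] by (cases x) auto
  qed (use p in simp)
  then show ?thesis using that p by blast
qed

lemma distinct_concat_rotate: "distinct (concat (concat (rotate k T))) \<longleftrightarrow> distinct (concat (concat T))"
proof (induction k)
  case (Suc k)
  have "distinct (concat (concat (rotate1 xs))) \<longleftrightarrow> distinct (concat (concat xs))" for xs :: "'a list list list"
    by (cases xs) auto
  then show ?case using Suc by simp
qed simp

lemma std_rotate:
  assumes "T \<in> std_tableaux lam" "rotate k lam = lam" shows "rotate k T \<in> std_tableaux lam"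
  using assms by (simp add: std_tableaux_def distinct_concat_rotate rotate_map[symmetric])

lemma rotate_mult: "rotate k xs = xs \<Longrightarrow> rotate (k * j) xs = xs"
  by (induction j) (auto simp: rotate_rotate[symmetric])

text \<open>The inverse of a rotation is again a rotation: turning by \<open>k\<close> another
  \<open>length T - 1\<close> times completes \<open>k\<close> full turns.\<close>

lemma std_rotate_iff:
  assumes "rotate k lam = lam" shows "rotate k T \<in> std_tableaux lam \<longleftrightarrow> T \<in> std_tableaux lam"
proof
  assume T: "rotate k T \<in> std_tableaux lam"
  show "T \<in> std_tableaux lam"
  proof (cases "length T = 0")
    case True then show ?thesis using T by simp
  next
    case False
    have "rotate (k * (length T - 1)) (rotate k T) \<in> std_tableaux lam"
      by (rule std_rotate[OF T rotate_mult[OF assms]])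
    also have "rotate (k * (length T - 1)) (rotate k T) = rotate (k * length T) T"
    proof -
      have "k * (length T - 1) + k = k * length T" using False by (cases "length T") auto
      then show ?thesis by (simp only: rotate_rotate)
    qed
    finally show ?thesis by simp
  qed
qed (rule std_rotate[OF _ assms])

section \<open>Generation of the group and its action on eigenspaces\<close>

locale specht_setup = brauer_parameters m p d \<delta> i0
  for m p d :: nat and \<delta> :: "nat \<Rightarrow> 'k::field" and i0 +
  fixes \<xi> :: 'k and N t :: nat and lam :: "nat list list"
    and \<rho> :: "diagram \<Rightarrow> (tableau \<Rightarrow>\<^sub>0 'k) \<Rightarrow> (tableau \<Rightarrow>\<^sub>0 'k)"
  assumes xi: "\<xi> ^ m = 1" and primitive: "\<And>j. 0 < j \<Longrightarrow> j < m \<Longrightarrow> \<xi> ^ j \<noteq> 1"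
    and part: "mpartition m N lam" and t_dvd: "t dvd p"
    and stab: "stabiliser d p lam = {(t * j) mod p | j. True}"
    and rep: "seminormal_rep m \<xi> lam N \<rho>"
begin

section \<open>Rotation of tableaux and powers of the root of unity\<close>

lemma ppos: "p > 0" and dpos: "d > 0" and tpos: "t > 0"
proof -
  show "p > 0" "d > 0" using mpos mpd by (auto intro: gr0I)
  then show "t > 0" using t_dvd by (auto intro: gr0I)
qed

lemma len_lam: "length lam = m" and size_lam: "sum_list (map sum_list lam) = N"
  using part by (auto simp: mpartition_def)

text \<open>\<open>rotate\<close> turns to the left, so a shift by \<open>d\<close> to the right is
  a rotation by \<open>m - d\<close>; \<open>rot\<close> is the amount for the power
  \<open>t\<close> of the shift.\<close>

abbreviation rot :: "nat" where "rot \<equiv> t * (m - d)"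

lemma shift_rotate: "length xs = m \<Longrightarrow> (shift d ^^ a) xs = rotate (a * (m - d)) xs"
proof (induction a)
  case (Suc a)
  then show ?case by (simp add: shift_def rotate_rotate)
qed simp

text \<open>The stabiliser lists residues below \<open>p\<close>, so a trivial stabiliser has
  \<open>t = p\<close>, which is not one of its elements. In that case \<open>rot\<close> is a
  multiple of \<open>m\<close>.\<close>

lemma rot_lam: "rotate rot lam = lam"
proof (cases "t < p")
  case True
  have "t \<in> stabiliser d p lam" unfolding stab using True by (auto intro!: exI[of _ 1])
  then show ?thesis using shift_rotate[OF len_lam] by (simp add: stabiliser_def)
next
  case False
  then have "t = p" using t_dvd ppos by (meson dvd_imp_le le_neq_implies_less)
  then have "rot = m * (p - 1)" using mpd by (simp add: algebra_simps)
  then show ?thesis using len_lam by simp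
qed

lemma len_std: "T \<in> std_tableaux lam \<Longrightarrow> length T = m"
  using len_lam by (auto simp: std_tableaux_def)

lemma shift_std: "T \<in> std_tableaux lam \<Longrightarrow> (shift d ^^ t) T = rotate rot T"
  by (rule shift_rotate[OF len_std])

lemma position_shift:
  assumes T: "T \<in> std_tableaux lam" and i: "1 \<le> i" "i \<le> N"
  shows "component (rotate rot T) i = (component T i + d * t) mod m"
    and "row_minus_col (rotate rot T) i = row_minus_col T i" and "component T i < m"
proof -
  have T': "rotate rot T \<in> std_tableaux lam" by (rule std_rotate[OF T rot_lam])
  have i': "i \<in> {1..sum_list (map sum_list lam)}" using i size_lam by simp
  obtain s a b where p: "s < length T" "a < length (T ! s)" "b < length (T ! s ! a)" "T ! s ! a ! b = i" "position T i = (s, a, b)"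
    using std_position[OF T i'] .
  let ?s = "(s + d * t) mod m"
  have s: "s < m" using p(1) len_std[OF T] by simp
  have dm: "d \<le> m" using mpd ppos by simp
  \<comment> \<open>Up to a multiple of \<open>m\<close>, \<open>rot\<close> is the negative of
    \<open>d * t\<close>: the component at the place \<open>s\<close> arrives at the place
    \<open>s + d * t\<close>.\<close>
  have "(rot + ?s) mod m = (rot + (s + d * t)) mod m" by (simp add: mod_simps)
  also have "rot + (s + d * t) = s + t * m"
  proof -
    have "t * (m - d) + d * t = t * m" using dm by (metis add_mult_distrib2 le_add_diff_inverse2 mult.commute)
    then show ?thesis by simp
  qed
  also have "\<dots> mod m = s" using s by simp
  finally have n: "rotate rot T ! ?s = T ! s" using len_std[OF T] mpos by (simp add: nth_rotate)
  have q: "?s < length (rotate rot T)" "a < length (rotate rot T ! ?s)" "b < length (rotate rot T ! ?s ! a)" "rotate rot T ! ?s ! a ! b = i"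
    using p n len_std[OF T] mpos by simp_all
  obtain s' a' b' where p': "s' < length (rotate rot T)" "a' < length (rotate rot T ! s')" "b' < length (rotate rot T ! s' ! a')"
    "rotate rot T ! s' ! a' ! b' = i" "position (rotate rot T) i = (s', a', b')"
    using std_position[OF T' i'] .
  have "?s = s' \<and> a = a' \<and> b = b'" by (rule std_entry_unique[OF T' q p'(1-4)])
  then show "component (rotate rot T) i = (component T i + d * t) mod m"
    "row_minus_col (rotate rot T) i = row_minus_col T i" "component T i < m"
    using p(5) p'(5) s by (auto simp: component_def row_minus_col_def)
qed

lemma xi_mod: "\<xi> ^ (a mod m) = \<xi> ^ a"
proof -
  have "\<xi> ^ a = \<xi> ^ (m * (a div m) + a mod m)" by simp
  also have "\<dots> = \<xi> ^ (a mod m)" by (simp only: power_add power_mult xi power_one mult_1_left)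
  finally show ?thesis by simp
qed

lemma xi_cong: "[a = b] (mod m) \<Longrightarrow> \<xi> ^ a = \<xi> ^ b"
  by (metis cong_def xi_mod)

lemma xi_nonzero: "\<xi> \<noteq> 0"
  using xi mpos by (metis power_0_left not_gr_zero zero_neq_one)

lemma xi_eq_1: "\<xi> ^ a = 1 \<Longrightarrow> m dvd a"
  using primitive[of "a mod m"] xi_mod[of a] mpos by (auto simp: mod_eq_0_iff_dvd[symmetric]) 

section \<open>Commutation of the shift with the reflection group\<close>

abbreviation \<Sigma> :: "(tableau \<Rightarrow>\<^sub>0 'k) \<Rightarrow> (tableau \<Rightarrow>\<^sub>0 'k)"
  where "\<Sigma> \<equiv> lin_ext (\<lambda>T. basis ((shift d ^^ t) T))"

abbreviation TS :: "(tableau \<Rightarrow>\<^sub>0 'k) set" where "TS \<equiv> tableau_space lam"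
abbreviation GD :: "diagram set" where "GD \<equiv> group_diagrams m N"

lemma TS_0 [simp]: "0 \<in> TS"
  and TS_add: "x \<in> TS \<Longrightarrow> y \<in> TS \<Longrightarrow> x + y \<in> TS"
  and TS_pscale: "x \<in> TS \<Longrightarrow> pscale c x \<in> TS"
  and TS_basis: "basis T \<in> TS \<longleftrightarrow> T \<in> std_tableaux lam"
  using Poly_Mapping.keys_add[of x y] keys_pscale[of c x] by (auto simp: tableau_space_def)

lemma TS_Sigma: "x \<in> TS \<Longrightarrow> \<Sigma> x \<in> TS"
  unfolding tableau_space_def mem_Collect_eq
  by (rule keys_lin_ext) (use shift_std std_rotate[OF _ rot_lam] in \<open>simp add: subset_iff\<close>)

lemma rho_in: "w \<in> GD \<Longrightarrow> x \<in> TS \<Longrightarrow> \<rho> w x \<in> TS"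
  and rho_add: "w \<in> GD \<Longrightarrow> x \<in> TS \<Longrightarrow> y \<in> TS \<Longrightarrow> \<rho> w (x + y) = \<rho> w x + \<rho> w y"
  and rho_pscale: "w \<in> GD \<Longrightarrow> x \<in> TS \<Longrightarrow> \<rho> w (pscale c x) = pscale c (\<rho> w x)"
  and rho_mult: "w \<in> GD \<Longrightarrow> w' \<in> GD \<Longrightarrow> x \<in> TS \<Longrightarrow> \<rho> (compose m w w') x = \<rho> w (\<rho> w' x)"
  and rho_id: "x \<in> TS \<Longrightarrow> \<rho> (id_diagram N) x = x"
  using rep by (auto simp: seminormal_rep_def)

lemma rho_0 [simp]: "w \<in> GD \<Longrightarrow> \<rho> w 0 = 0"
  using rho_pscale[of w 0 0] by simp

abbreviation gs :: "(nat \<Rightarrow> nat) \<Rightarrow> (nat \<Rightarrow> nat) \<Rightarrow> diagram"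
  where "gs b c \<equiv> strands {1..N} id b c"

abbreviation perm :: "(nat \<Rightarrow> nat) \<Rightarrow> bool" where "perm b \<equiv> bij_betw b {1..N} {1..N}"
abbreviation lab :: "(nat \<Rightarrow> nat) \<Rightarrow> bool" where "lab c \<equiv> \<forall>j\<in>{1..N}. c j < m"

lemma gs_GD: "perm b \<Longrightarrow> lab c \<Longrightarrow> gs b c \<in> GD"
  unfolding group_diagrams_strands by blast

lemma gs_dgr: "perm b \<Longrightarrow> lab c \<Longrightarrow> gs b c \<in> dgr m {1..N} {1..N}"
  by (rule strands_in_dgr) auto

lemma compose_gs:
  assumes "perm b" "lab c" "perm b'" "lab c'"
  shows "compose m (gs b c) (gs b' c') = gs (b' \<circ> b) (\<lambda>j. (c j + c' (b j)) mod m)" "lf (gs b c) (gs b' c') = 1"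
  using compose_normal_strands(1)[of "{}" "{1..N}" id b c m "{1..N}" b' c'] compose_normal_strands(2)[of "{}" "{1..N}" id b c m "{1..N}" b' p \<delta> c']
    gs_dgr[OF assms(1,2)] assms by (auto simp: arcs_def bij_betw_def)

lemma label_sum_gs: "label_sum (gs b c) = sum c {1..N}"
  by (rule label_sum_strands) simp

lemma gs_cong: "(\<And>j. j \<in> {1..N} \<Longrightarrow> b j = b' j \<and> c j = c' j) \<Longrightarrow> gs b c = gs b' c'"
  by (rule strands_cong) auto

text \<open>Conjugation by the stabilising shift multiplies \<open>w\<close> by a power of the
  linear character that sends t_1 to \<xi> and the transpositions to 1. In this form the relation
  can be checked on generators.\<close>

definition twisted :: "diagram \<Rightarrow> bool"
  where "twisted w \<longleftrightarrow> w \<in> GD \<and> (\<forall>x\<in>TS. pscale (\<xi> ^ (d * t * label_sum w)) (\<Sigma> (\<rho> w x)) = \<rho> w (\<Sigma> x))"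

text \<open>Label sums are additive modulo \<open>m\<close> on the group, because the permutation of
  the first factor only reorders the labels of the second.\<close>

lemma twisted_gs_mult:
  assumes b: "perm b" "lab c" "perm b'" "lab c'" and tw: "twisted (gs b c)" "twisted (gs b' c')"
  shows "twisted (gs (b' \<circ> b) (\<lambda>j. (c j + c' (b j)) mod m))"
proof -
  let ?w = "gs b c" and ?w' = "gs b' c'" and ?c = "\<lambda>j. (c j + c' (b j)) mod m"
  have G: "?w \<in> GD" "?w' \<in> GD" by (rule gs_GD; use b in simp)+
  have "perm (b' \<circ> b)" using bij_betw_trans[OF b(1,3)] .
  then have G3: "gs (b' \<circ> b) ?c \<in> GD" by (rule gs_GD) (use mpos in auto)
  have "[sum ?c {1..N} = (\<Sum>j\<in>{1..N}. c j + c' (b j))] (mod m)" by (rule cong_sum) (simp add: cong_def)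
  also have "(\<Sum>j\<in>{1..N}. c j + c' (b j)) = sum c {1..N} + sum c' {1..N}"
    using sum.reindex_bij_betw[OF b(1), of c'] by (simp add: sum.distrib)
  finally have "[d * t * label_sum (gs (b' \<circ> b) ?c) = d * t * (label_sum ?w + label_sum ?w')] (mod m)"
    unfolding label_sum_gs by (rule cong_scalar_left)
  then have e: "\<xi> ^ (d * t * label_sum (gs (b' \<circ> b) ?c)) = \<xi> ^ (d * t * label_sum ?w) * \<xi> ^ (d * t * label_sum ?w')"
    by (simp add: xi_cong power_add[symmetric] distrib_left)
  show ?thesis unfolding twisted_def
  proof (intro conjI ballI G3)
    fix x assume x: "x \<in> TS"
    have r: "\<rho> (gs (b' \<circ> b) ?c) y = \<rho> ?w (\<rho> ?w' y)" if "y \<in> TS" for y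
      using rho_mult[OF G that] unfolding compose_gs(1)[OF b] .
    have "pscale (\<xi> ^ (d * t * label_sum ?w)) (\<Sigma> (\<rho> ?w (\<rho> ?w' x))) = \<rho> ?w (\<Sigma> (\<rho> ?w' x))"
      using tw(1) rho_in[OF G(2) x] by (simp add: twisted_def)
    moreover have "pscale (\<xi> ^ (d * t * label_sum ?w')) (\<Sigma> (\<rho> ?w' x)) = \<rho> ?w' (\<Sigma> x)"
      using tw(2) x by (simp add: twisted_def)
    ultimately have "pscale (\<xi> ^ (d * t * label_sum ?w')) (pscale (\<xi> ^ (d * t * label_sum ?w)) (\<Sigma> (\<rho> ?w (\<rho> ?w' x)))) = \<rho> ?w (\<rho> ?w' (\<Sigma> x))"
      using rho_pscale[OF G(1) TS_Sigma[OF rho_in[OF G(2) x]], symmetric] by simp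
    then show "pscale (\<xi> ^ (d * t * label_sum (gs (b' \<circ> b) ?c))) (\<Sigma> (\<rho> (gs (b' \<circ> b) ?c) x)) = \<rho> (gs (b' \<circ> b) ?c) (\<Sigma> x)"
      unfolding r[OF x] r[OF TS_Sigma[OF x]] e by (simp add: mult.commute)
  qed
qed

lemma twistedI:
  assumes G: "w \<in> GD" and b: "\<And>T. T \<in> std_tableaux lam \<Longrightarrow>
    pscale (\<xi> ^ (d * t * label_sum w)) (\<Sigma> (\<rho> w (basis T))) = \<rho> w (basis (rotate rot T))"
  shows "twisted w"
  unfolding twisted_def
proof (intro conjI ballI G)
  fix x assume "x \<in> TS"
  then have "Poly_Mapping.keys x \<subseteq> std_tableaux lam" by (simp add: tableau_space_def)
  then show "pscale (\<xi> ^ (d * t * label_sum w)) (\<Sigma> (\<rho> w x)) = \<rho> w (\<Sigma> x)"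
  proof (induction x rule: span_induct_basis)
    case (add x y)
    then have "x \<in> TS" "y \<in> TS" by (auto simp: tableau_space_def)
    then show ?case using add by (simp add: rho_add[OF G] lin_ext_add TS_Sigma pscale.scale_right_distrib)
  next
    case (basis c T)
    then have "rotate rot T \<in> std_tableaux lam" by (intro std_rotate rot_lam)
    then show ?case using b[OF basis] basis
      by (simp add: rho_pscale[OF G] TS_basis lin_ext_pscale shift_std) (metis mult.commute pscale.scale_scale)
  qed (use G in simp)
qed

lemma t_diagram_gs: "t_diagram m N i j = gs id (\<lambda>a. if a = i then j mod m else 0)"
  unfolding t_diagram_def strands_def by (simp only: Setcompr_eq_image id_apply)

lemma s_diagram_gs: "s_diagram N i = gs (Transposition.transpose i (Suc i)) (\<lambda>_. 0)"
  unfolding s_diagram_def strands_def by (simp only: Setcompr_eq_image id_apply)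

lemma perm_transpose: "i \<in> {1..N} \<Longrightarrow> j \<in> {1..N} \<Longrightarrow> perm (Transposition.transpose i j)"
  by (rule permutes_imp_bij[OF permutes_swap_id])

lemma lab0: "lab (\<lambda>_. 0)" and labt: "lab (\<lambda>a. if a = i then j mod m else 0)"
  using mpos by auto

lemma twisted_id: "twisted (gs id (\<lambda>_. 0))"
proof -
  have "gs id (\<lambda>_. 0) = id_diagram N" unfolding id_diagram_idd idd_def ..
  moreover have "gs id (\<lambda>_. 0) \<in> GD" by (rule gs_GD[OF _ lab0]) simp
  moreover have "label_sum (gs id (\<lambda>_. 0)) = 0" unfolding label_sum_gs by simp
  ultimately show ?thesis unfolding twisted_def by (simp add: rho_id TS_Sigma)
qed

text \<open>The shift moves the entry 1 from the component s to s + d t, which multiplies its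
  eigenvalue under t_1 by \<xi> to the power d t. The label is \<open>1 mod m\<close>, so that
  \<open>m = 1\<close> is covered as well.\<close>

lemma twisted_t1:
  assumes "1 \<le> N" shows "twisted (t_diagram m N 1 1)"
proof (rule twistedI)
  show "t_diagram m N 1 1 \<in> GD" unfolding t_diagram_gs by (rule gs_GD[OF _ labt]) simp
  fix T assume T: "T \<in> std_tableaux lam"
  have T': "rotate rot T \<in> std_tableaux lam" by (rule std_rotate[OF T rot_lam])
  have r: "\<rho> (t_diagram m N 1 1) (basis U) = pscale (\<xi> ^ component U 1) (basis U)" if "U \<in> std_tableaux lam" for U
    using rep that assms by (simp add: seminormal_rep_def)
  have "label_sum (t_diagram m N 1 1) = 1 mod m"
    unfolding t_diagram_gs label_sum_gs using assms by (simp add: sum.delta)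
  then have "[d * t * label_sum (t_diagram m N 1 1) = d * t] (mod m)"
    using cong_scalar_left[of "1 mod m" 1 m "d * t"] by (simp add: cong_def)
  then have "\<xi> ^ (d * t * label_sum (t_diagram m N 1 1)) = \<xi> ^ (d * t)" by (rule xi_cong)
  moreover have "\<xi> ^ component (rotate rot T) 1 = \<xi> ^ (component T 1 + d * t)"
    using position_shift(1)[OF T _ assms] by (simp add: xi_mod)
  ultimately show "pscale (\<xi> ^ (d * t * label_sum (t_diagram m N 1 1))) (\<Sigma> (\<rho> (t_diagram m N 1 1) (basis T))) =
      \<rho> (t_diagram m N 1 1) (basis (rotate rot T))"
    unfolding r[OF T] r[OF T'] lin_ext_pscale lin_ext_basis shift_std[OF T] by (simp add: power_add mult.commute)
qed

text \<open>Whether two entries share a component, and the difference of their rows and columns, are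
  unchanged by the shift; so the seminormal coefficients agree.\<close>

lemma twisted_s:
  assumes "1 \<le> i" "i < N" shows "twisted (s_diagram N i)"
proof (rule twistedI)
  show "s_diagram N i \<in> GD" unfolding s_diagram_gs by (rule gs_GD[OF perm_transpose lab0]) (use assms in auto)
  fix T assume T: "T \<in> std_tableaux lam"
  have T': "rotate rot T \<in> std_tableaux lam" by (rule std_rotate[OF T rot_lam])
  define iv where "iv U = (if component U i = component U (Suc i) then 1 / of_int (row_minus_col U i - row_minus_col U (Suc i)) else (0::'k))" for U
  have r: "\<rho> (s_diagram N i) (basis U) = pscale (iv U) (basis U) + pscale (1 + iv U) (if swap_entries i U \<in> std_tableaux lam then basis (swap_entries i U) else 0)"
    if "U \<in> std_tableaux lam" for U
    using rep that assms by (simp add: seminormal_rep_def Let_def iv_def)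
  have "component (rotate rot T) i = component (rotate rot T) (Suc i) \<longleftrightarrow> component T i = component T (Suc i)"
  proof -
    have "(x + d * t) mod m = (y + d * t) mod m \<longleftrightarrow> x = y" if "x < m" "y < m" for x y
      using that cong_add_rcancel_nat[of x "d * t" y m] by (simp add: cong_def)
    then show ?thesis using position_shift(1,3)[OF T, of i] position_shift(1,3)[OF T, of "Suc i"] assms by simp
  qed
  then have iv: "iv (rotate rot T) = iv T"
    unfolding iv_def using position_shift(2)[OF T, of i] position_shift(2)[OF T, of "Suc i"] assms by simp
  have sw: "swap_entries i (rotate rot T) = rotate rot (swap_entries i T)"
    unfolding swap_entries_def by (simp add: rotate_map)
  have "\<Sigma> (\<rho> (s_diagram N i) (basis T)) = \<rho> (s_diagram N i) (basis (rotate rot T))"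
    unfolding r[OF T] r[OF T'] iv sw std_rotate_iff[OF rot_lam]
    by (simp add: lin_ext_add lin_ext_pscale shift_std[OF T] shift_std)
  moreover have "label_sum (s_diagram N i) = 0" unfolding s_diagram_gs label_sum_gs by simp
  ultimately show "pscale (\<xi> ^ (d * t * label_sum (s_diagram N i))) (\<Sigma> (\<rho> (s_diagram N i) (basis T))) =
      \<rho> (s_diagram N i) (basis (rotate rot T))" by simp
qed

lemma twisted_perm_mult:
  assumes "perm b" "perm b'" "twisted (gs b (\<lambda>_. 0))" "twisted (gs b' (\<lambda>_. 0))"
  shows "twisted (gs (b' \<circ> b) (\<lambda>_. 0))"
  using twisted_gs_mult[OF assms(1) lab0 assms(2) lab0 assms(3,4)] by simp

text \<open>A transposition of distant points is obtained from a shorter one by conjugation with an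
  adjacent transposition.\<close>

lemma twisted_transpose_aux:
  assumes "1 \<le> i" "i + Suc k \<le> N" shows "twisted (gs (Transposition.transpose i (i + Suc k)) (\<lambda>_. 0))"
  using assms(2)
proof (induction k)
  case 0
  then show ?case using twisted_s[OF assms(1)] by (simp add: s_diagram_gs id_def)
next
  case (Suc k)
  let ?a = "i + Suc k"
  have s: "twisted (gs (Transposition.transpose ?a (Suc ?a)) (\<lambda>_. 0))" using twisted_s[of ?a] Suc.prems by (simp add: s_diagram_gs)
  have ps: "perm (Transposition.transpose ?a (Suc ?a))" by (rule perm_transpose) (use Suc.prems in auto)
  have pt: "perm (Transposition.transpose i ?a)" by (rule perm_transpose) (use Suc.prems assms in auto)
  have "twisted (gs (Transposition.transpose i ?a \<circ> Transposition.transpose ?a (Suc ?a)) (\<lambda>_. 0))"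
    by (rule twisted_perm_mult[OF ps pt s]) (use Suc in \<open>simp add: id_def\<close>)
  then have "twisted (gs (Transposition.transpose ?a (Suc ?a) \<circ> (Transposition.transpose i ?a \<circ> Transposition.transpose ?a (Suc ?a))) (\<lambda>_. 0))"
    by (intro twisted_perm_mult[OF bij_betw_trans[OF ps pt] ps _ s])
  also have "Transposition.transpose ?a (Suc ?a) \<circ> (Transposition.transpose i ?a \<circ> Transposition.transpose ?a (Suc ?a)) = Transposition.transpose i (i + Suc (Suc k))"
    by (auto simp: fun_eq_iff Transposition.transpose_def)
  finally show ?case .
qed

lemma twisted_transpose:
  assumes "i \<in> {1..N}" "j \<in> {1..N}" "i \<noteq> j" shows "twisted (gs (Transposition.transpose i j) (\<lambda>_. 0))"
proof -
  have *: "twisted (gs (Transposition.transpose i j) (\<lambda>_. 0))" if "i \<in> {1..N}" "j \<in> {1..N}" "i < j" for i j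
    using twisted_transpose_aux[of i "j - i - 1"] that by simp
  show ?thesis
  proof (cases "i < j")
    case False
    then show ?thesis using *[of j i] assms by (simp add: transpose_commute)
  qed (use * assms in simp)
qed

lemma twisted_perm: assumes b: "perm b" shows "twisted (gs b (\<lambda>_. 0))"
proof -
  \<comment> \<open>The induction on permutations by transpositions requires a map that is the
    identity outside {1..N}.\<close>
  define b' where "b' j = (if j \<in> {1..N} then b j else j)" for j
  have "b' permutes {1..N}"
  proof (rule bij_imp_permutes)
    show "perm b'" using b bij_betw_cong[of "{1..N}" b' b] by (simp add: b'_def)
  qed (auto simp: b'_def)
  then have "twisted (gs b' (\<lambda>_. 0))"
    using finite_atLeastAtMost
  proof (induction rule: permutes_induct)
    case id
    then show ?case using twisted_id by (simp add: id_def)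
  next
    case (swap i j q)
    show ?case
      by (rule twisted_perm_mult[OF permutes_imp_bij[OF swap.hyps(4)] perm_transpose[OF swap.hyps(1,2)] swap.IH twisted_transpose[OF swap.hyps(1-3)]])
  qed
  moreover have "gs b' (\<lambda>_. 0) = gs b (\<lambda>_. 0)" by (rule gs_cong) (simp add: b'_def)
  ultimately show ?thesis by simp
qed

text \<open>The element t_i is the conjugate of t_1 by the transposition of 1 and i.\<close>

lemma twisted_t:
  assumes i: "i \<in> {1..N}" shows "twisted (gs id (\<lambda>a. if a = i then 1 mod m else 0))"
proof -
  let ?\<tau> = "Transposition.transpose 1 i"
  have p: "perm ?\<tau>" by (rule perm_transpose) (use i in auto)
  have t1: "twisted (gs id (\<lambda>a. if a = 1 then 1 mod m else 0))" using twisted_t1 i unfolding t_diagram_gs by (simp del: One_nat_def)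
  have "twisted (gs (id \<circ> ?\<tau>) (\<lambda>j. (0 + (if ?\<tau> j = 1 then 1 mod m else 0)) mod m))"
    by (rule twisted_gs_mult[OF p lab0 _ labt twisted_perm[OF p] t1]) simp
  then have "twisted (gs (?\<tau> \<circ> (id \<circ> ?\<tau>)) (\<lambda>j. ((0 + (if ?\<tau> j = 1 then 1 mod m else 0)) mod m + 0) mod m))"
    by (intro twisted_gs_mult[OF _ _ p lab0 _ twisted_perm[OF p]]) (use p mpos in auto)
  moreover have "gs (?\<tau> \<circ> (id \<circ> ?\<tau>)) (\<lambda>j. ((0 + (if ?\<tau> j = 1 then 1 mod m else 0)) mod m + 0) mod m) = gs id (\<lambda>a. if a = i then 1 mod m else 0)"
    by (rule gs_cong) (auto simp: Transposition.transpose_def)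
  ultimately show ?thesis by simp
qed

text \<open>A diagonal element is a product of elements t_i; the induction on the sum of the labels
  splits off one of them at a time.\<close>

lemma twisted_lab: "lab c \<Longrightarrow> twisted (gs id c)"
proof (induction "sum c {1..N}" arbitrary: c)
  case 0
  then have "gs id c = gs id (\<lambda>_. 0)" by (intro gs_cong) simp
  then show ?case using twisted_id by (simp add: id_def)
next
  case (Suc k)
  then obtain i where i: "i \<in> {1..N}" "c i \<noteq> 0" by (metis sum.neutral nat.distinct(1))
  define c' where "c' = c(i := c i - 1)"
  have l: "lab c'" using Suc.prems by (auto simp: c'_def less_imp_diff_less)
  have "sum c {1..N} = c i + sum c ({1..N} - {i})" "sum c' {1..N} = c' i + sum c' ({1..N} - {i})"
    using i by (simp_all add: sum.remove)
  moreover have "sum c' ({1..N} - {i}) = sum c ({1..N} - {i})" by (rule sum.cong) (auto simp: c'_def)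
  ultimately have "k = sum c' {1..N}" using Suc.hyps(2) i by (simp add: c'_def)
  then have tc: "twisted (gs id c')" using Suc.hyps(1) l by blast
  have "twisted (gs (id \<circ> id) (\<lambda>j. (c' j + (if id j = i then 1 mod m else 0)) mod m))"
    by (rule twisted_gs_mult[OF _ l _ labt tc twisted_t[OF i(1)]]) simp_all
  moreover have "gs (id \<circ> id) (\<lambda>j. (c' j + (if id j = i then 1 mod m else 0)) mod m) = gs id c"
    by (rule gs_cong) (use i Suc.prems in \<open>auto simp: c'_def mod_simps\<close>)
  ultimately show ?case by simp
qed

lemma twisted_GD: assumes "w \<in> GD" shows "twisted w"
proof -
  obtain b c where b: "perm b" "lab c" "w = gs b c" using assms unfolding group_diagrams_strands by blast
  have "twisted (gs (b \<circ> id) (\<lambda>j. (c j + 0) mod m))"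
    by (rule twisted_gs_mult[OF _ b(2,1) lab0 twisted_lab[OF b(2)] twisted_perm[OF b(1)]]) simp
  moreover have "gs (b \<circ> id) (\<lambda>j. (c j + 0) mod m) = gs b c" by (rule gs_cong) (use b in auto)
  ultimately show ?thesis using b by simp
qed

section \<open>Eigenspaces of the shift\<close>

abbreviation SP :: "nat \<Rightarrow> (tableau \<Rightarrow>\<^sub>0 'k) set" where "SP z \<equiv> specht_space d \<xi> lam t z"

lemma SP_iff: "x \<in> SP z \<longleftrightarrow> x \<in> TS \<and> \<Sigma> x = pscale (\<xi> ^ (d * t * z)) x"
  unfolding specht_space_def by auto

lemma SP_TS: "x \<in> SP z \<Longrightarrow> x \<in> TS" by (simp add: SP_iff)

lemma SP_0 [simp]: "0 \<in> SP z"
  and SP_add: "x \<in> SP z \<Longrightarrow> y \<in> SP z \<Longrightarrow> x + y \<in> SP z"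
  and SP_pscale: "x \<in> SP z \<Longrightarrow> pscale c x \<in> SP z"
  by (auto simp: SP_iff TS_add TS_pscale lin_ext_add lin_ext_pscale pscale.scale_right_distrib mult.commute)

lemma SP_sum: "(\<And>i. i \<in> I \<Longrightarrow> f i \<in> SP z) \<Longrightarrow> sum f I \<in> SP z"
  by (induction I rule: infinite_finite_induct) (auto simp: SP_add)

abbreviation pt :: nat where "pt \<equiv> p div t"

lemma m_pt: "m = d * t * pt" using mpd t_dvd by simp

lemma xi_dt_cong: "[a = b] (mod pt) \<Longrightarrow> \<xi> ^ (d * t * a) = \<xi> ^ (d * t * b)"
proof -
  assume "[a = b] (mod pt)"
  then have "[d * t * a = d * t * b] (mod (d * t * pt))" by (rule cong_cmult_leftI)
  then show ?thesis unfolding m_pt[symmetric] by (rule xi_cong)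
qed

text \<open>The eigenvalue is a power of \<xi> raised to \<open>d * t\<close>, a root of unity of
  order dividing \<open>pt\<close>; this is what reading the superscript modulo p/t means.\<close>

lemma SP_cong: "[z = z'] (mod pt) \<Longrightarrow> SP z = SP z'"
  using xi_dt_cong[of z z'] by (auto simp: SP_iff)

text \<open>By \<open>twisted\<close>, applying \<open>w\<close> divides the eigenvalue of the shift
  by \<xi> to the power d t times the label sum of \<open>w\<close>. The hypothesis adds the label
  sum on the left because superscripts are natural numbers.\<close>

lemma rho_SP:
  assumes w: "w \<in> GD" and x: "x \<in> SP z" and z: "[z' + label_sum w = z] (mod pt)"
  shows "\<rho> w x \<in> SP z'"
proof -
  let ?c = "\<xi> ^ (d * t * label_sum w)"
  have xT: "x \<in> TS" by (rule SP_TS[OF x])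
  have "pscale ?c (\<Sigma> (\<rho> w x)) = \<rho> w (\<Sigma> x)" using twisted_GD[OF w] xT by (simp add: twisted_def)
  also have "\<Sigma> x = pscale (\<xi> ^ (d * t * z)) x" using x by (simp add: SP_iff)
  also have "\<rho> w \<dots> = pscale (\<xi> ^ (d * t * z)) (\<rho> w x)" by (rule rho_pscale[OF w xT])
  also have "\<xi> ^ (d * t * z) = ?c * \<xi> ^ (d * t * z')"
    using xi_dt_cong[OF z] by (simp add: distrib_left power_add mult.commute)
  finally have "pscale ?c (\<Sigma> (\<rho> w x)) = pscale ?c (pscale (\<xi> ^ (d * t * z')) (\<rho> w x))" by simp
  moreover have "?c \<noteq> 0" using xi_nonzero by simp
  ultimately have "\<Sigma> (\<rho> w x) = pscale (\<xi> ^ (d * t * z')) (\<rho> w x)" by (metis pscale.scale_left_imp_eq pscale.scale_cancel_left)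
  then show ?thesis using rho_in[OF w xT] by (simp add: SP_iff)
qed

text \<open>With no boxes the only tableau is the empty one, so the shift is the identity and a
  nonzero vector forces its eigenvalue to be 1. This takes the place of t_1 when there are no free
  lines.\<close>

lemma SP_no_strands:
  assumes N: "N = 0" and x: "x \<in> SP z" "x \<noteq> 0"
  shows "p dvd z"
proof -
  have l: "\<mu> = []" if "\<mu> \<in> set lam" for \<mu>
  proof -
    have "sum_list \<mu> = 0" using size_lam N that by (auto simp: sum_list_eq_0_iff)
    moreover have "0 \<notin> set \<mu>" using part that by (simp add: mpartition_def)
    ultimately show ?thesis by (cases \<mu>) auto
  qed
  then have lam: "lam = replicate m []" using len_lam by (metis replicate_length_same)
  have "rotate1 (replicate k x) = replicate k x" for k and x :: "nat list"
    by (cases k) (simp_all add: replicate_append_same)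
  then have rl: "rotate k lam = lam" for k unfolding lam by (induction k) simp_all
  have rr: "rotate k (replicate m []) = (replicate m [] :: tableau)" for k
  proof (induction k)
    case (Suc k)
    have "rotate1 (replicate j x) = replicate j x" for j and x :: "nat list list"
      by (cases j) (simp_all add: replicate_append_same)
    then show ?case using Suc by simp
  qed simp
  \<comment> \<open>The empty multipartition is fixed by every shift, so 1 belongs to the stabiliser
    as soon as \<open>p\<close> exceeds 1.\<close>
  have "t = 1"
  proof (cases "p = 1")
    case False
    have "(shift d ^^ 1) lam = lam" using shift_rotate[OF len_lam, of 1] rl by simp
    then have "1 \<in> stabiliser d p lam" using False ppos by (simp add: stabiliser_def)
    then obtain j where "1 = (t * j) mod p" unfolding stab by blast
    then have "t dvd 1" using t_dvd by (metis dvd_mod dvd_triv_left)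
    then show ?thesis by simp
  qed (use t_dvd in simp)
  have "T = replicate m []" if "T \<in> std_tableaux lam" for T
  proof -
    have "map (map length) T = replicate m []" using that lam by (simp add: std_tableaux_def)
    then have "\<forall>U\<in>set T. U = []" by (metis in_set_replicate list.map_disc_iff image_eqI set_map)
    then show ?thesis using len_std[OF that] by (metis replicate_length_same)
  qed
  then have "Poly_Mapping.keys x \<subseteq> {replicate m []}" using SP_TS[OF x(1)] by (auto simp: tableau_space_def)
  then have "\<Sigma> x = lin_ext basis x"
    by (intro lin_ext_cong) (auto simp: shift_rotate rr)
  then have "\<Sigma> x = x" by (simp add: lin_ext_expand)
  then have "pscale 1 x = pscale (\<xi> ^ (d * t * z)) x" using x(1) by (simp add: SP_iff)
  then have "\<xi> ^ (d * t * z) = 1" using x(2) by (metis pscale.scale_right_imp_eq)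
  then have "m dvd d * z" using xi_eq_1 \<open>t = 1\<close> by simp
  then show ?thesis using mpd dpos by (simp add: mult.commute)
qed

end

section \<open>A criterion for isomorphism with a tensor product\<close>

locale tensor_data =
  fixes S :: "('s, 'c) ring_scheme" and M :: "('s, 'm, 'e) module_scheme" and ract :: "'m \<Rightarrow> 'r \<Rightarrow> 'm"
    and R :: "('r, 'd) ring_scheme" and N :: "('r, 'n, 'f) module_scheme"
  assumes ringS: "ring S"
    and M_add: "x \<in> carrier M \<Longrightarrow> x' \<in> carrier M \<Longrightarrow> x \<oplus>\<^bsub>M\<^esub> x' \<in> carrier M"
    and M_smult: "b \<in> carrier S \<Longrightarrow> x \<in> carrier M \<Longrightarrow> b \<odot>\<^bsub>M\<^esub> x \<in> carrier M"
    and M_l_distr: "a \<in> carrier S \<Longrightarrow> b \<in> carrier S \<Longrightarrow> x \<in> carrier M \<Longrightarrow> (a \<oplus>\<^bsub>S\<^esub> b) \<odot>\<^bsub>M\<^esub> x = a \<odot>\<^bsub>M\<^esub> x \<oplus>\<^bsub>M\<^esub> b \<odot>\<^bsub>M\<^esub> x"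
    and M_r_distr: "b \<in> carrier S \<Longrightarrow> x \<in> carrier M \<Longrightarrow> x' \<in> carrier M \<Longrightarrow> b \<odot>\<^bsub>M\<^esub> (x \<oplus>\<^bsub>M\<^esub> x') = b \<odot>\<^bsub>M\<^esub> x \<oplus>\<^bsub>M\<^esub> b \<odot>\<^bsub>M\<^esub> x'"
    and M_assoc: "a \<in> carrier S \<Longrightarrow> b \<in> carrier S \<Longrightarrow> x \<in> carrier M \<Longrightarrow> (a \<otimes>\<^bsub>S\<^esub> b) \<odot>\<^bsub>M\<^esub> x = a \<odot>\<^bsub>M\<^esub> (b \<odot>\<^bsub>M\<^esub> x)"
    and M_one: "x \<in> carrier M \<Longrightarrow> \<one>\<^bsub>S\<^esub> \<odot>\<^bsub>M\<^esub> x = x"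
    and M_ract: "x \<in> carrier M \<Longrightarrow> c \<in> carrier R \<Longrightarrow> ract x c \<in> carrier M"
    and M_ract_smult: "b \<in> carrier S \<Longrightarrow> x \<in> carrier M \<Longrightarrow> c \<in> carrier R \<Longrightarrow> b \<odot>\<^bsub>M\<^esub> ract x c = ract (b \<odot>\<^bsub>M\<^esub> x) c"
    and N_add: "y \<in> carrier N \<Longrightarrow> y' \<in> carrier N \<Longrightarrow> y \<oplus>\<^bsub>N\<^esub> y' \<in> carrier N"
    and N_smult: "c \<in> carrier R \<Longrightarrow> y \<in> carrier N \<Longrightarrow> c \<odot>\<^bsub>N\<^esub> y \<in> carrier N"
begin

section \<open>Arithmetic modulo the tensor relations\<close>

abbreviation "rels \<equiv> tensor_relations M ract R N"

definition "F \<equiv> free_Abelian_group (carrier M \<times> carrier N)"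

definition "K \<equiv> generate F rels"

definition "coset c \<equiv> K #>\<^bsub>F\<^esub> c"

definition "ext b \<equiv> frag_extend (\<lambda>(x, y). frag_of (b \<odot>\<^bsub>M\<^esub> x, y))"

lemma carrier_F: "c \<in> carrier F \<longleftrightarrow> Poly_Mapping.keys c \<subseteq> carrier M \<times> carrier N"
  by (simp add: F_def)

lemma F_0 [simp]: "0 \<in> carrier F"
  and F_add: "c \<in> carrier F \<Longrightarrow> c' \<in> carrier F \<Longrightarrow> c + c' \<in> carrier F"
  and F_uminus: "c \<in> carrier F \<Longrightarrow> - c \<in> carrier F"
  and F_frag_of: "frag_of z \<in> carrier F \<longleftrightarrow> z \<in> carrier M \<times> carrier N"
  using Poly_Mapping.keys_add[of c c'] by (auto simp: carrier_F)

lemma F_diff: "c \<in> carrier F \<Longrightarrow> c' \<in> carrier F \<Longrightarrow> c - c' \<in> carrier F"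
  using F_add[of c "- c'"] F_uminus by simp

lemma rels_F: "rels \<subseteq> carrier F"
  unfolding tensor_relations_def using M_add M_ract N_add N_smult
  by (auto intro!: F_diff simp: F_frag_of)

lemma groupF: "comm_group F"
  unfolding F_def by (rule abelian_free_Abelian_group)

lemma F_simps [simp]: "c \<otimes>\<^bsub>F\<^esub> c' = c + c'" "\<one>\<^bsub>F\<^esub> = 0"
  by (simp_all add: F_def)

lemma inv_F: "c \<in> carrier F \<Longrightarrow> inv\<^bsub>F\<^esub> c = - c"
  by (simp add: F_def)

lemma subgroupK: "subgroup K F"
  unfolding K_def using groupF by (intro group.generate_is_subgroup rels_F) (simp add: comm_group_def)

lemma K_F: "c \<in> K \<Longrightarrow> c \<in> carrier F"
  using subgroup.subset[OF subgroupK] by blast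

lemma K_0 [simp]: "0 \<in> K"
  using subgroup.one_closed[OF subgroupK] by simp

lemma K_add: "c \<in> K \<Longrightarrow> c' \<in> K \<Longrightarrow> c + c' \<in> K"
  using subgroup.m_closed[OF subgroupK] by simp

lemma K_uminus: "c \<in> K \<Longrightarrow> - c \<in> K"
  using subgroup.m_inv_closed[OF subgroupK] inv_F[OF K_F] by metis

lemma K_diff: "c \<in> K \<Longrightarrow> c' \<in> K \<Longrightarrow> c - c' \<in> K"
  using K_add[of c "- c'"] K_uminus by simp

lemma K_rels: "c \<in> rels \<Longrightarrow> c \<in> K"
  unfolding K_def by (rule generate.incl)

lemma K_add_left: "x \<in> carrier M \<Longrightarrow> x' \<in> carrier M \<Longrightarrow> y \<in> carrier N \<Longrightarrow> frag_of (x \<oplus>\<^bsub>M\<^esub> x', y) - frag_of (x, y) - frag_of (x', y) \<in> K"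
  and K_add_right: "x \<in> carrier M \<Longrightarrow> y \<in> carrier N \<Longrightarrow> y' \<in> carrier N \<Longrightarrow> frag_of (x, y \<oplus>\<^bsub>N\<^esub> y') - frag_of (x, y) - frag_of (x, y') \<in> K"
  and K_balanced: "x \<in> carrier M \<Longrightarrow> c \<in> carrier R \<Longrightarrow> y \<in> carrier N \<Longrightarrow> frag_of (ract x c, y) - frag_of (x, c \<odot>\<^bsub>N\<^esub> y) \<in> K"
  by (rule K_rels, unfold tensor_relations_def, blast)+

lemma K_least:
  assumes "rels \<subseteq> A" "0 \<in> A" "\<And>c c'. c \<in> A \<Longrightarrow> c' \<in> A \<Longrightarrow> c + c' \<in> A" "\<And>c. c \<in> A \<Longrightarrow> - c \<in> A"
  shows "K \<subseteq> A"
proof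
  fix c assume "c \<in> K"
  then show "c \<in> A" unfolding K_def
  proof (induction rule: generate.induct)
    case (inv h)
    then have "h \<in> carrier F" "h \<in> A" using assms(1) rels_F by auto
    then show ?case using assms(4) inv_F by simp
  qed (use assms in auto)
qed

lemma coset_mem: "x \<in> coset c \<longleftrightarrow> x - c \<in> K"
proof
  assume "x \<in> coset c" then show "x - c \<in> K" by (auto simp: coset_def r_coset_def)
next
  assume "x - c \<in> K"
  then have "x - c + c \<in> coset c" unfolding coset_def r_coset_def by force
  then show "x \<in> coset c" by simp
qed

lemma coset_eq_iff: "coset c = coset c' \<longleftrightarrow> c - c' \<in> K"
proof
  assume "coset c = coset c'"
  then show "c - c' \<in> K" using coset_mem[of c c] coset_mem[of c c'] by simp
next
  assume k: "c - c' \<in> K"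
  have "x - c \<in> K \<longleftrightarrow> x - c' \<in> K" for x
    using K_add[OF _ k, of "x - c"] K_diff[OF _ k, of "x - c'"] by auto
  then show "coset c = coset c'" unfolding coset_mem[symmetric] by blast
qed

lemma coset_self: "c \<in> coset c"
  unfolding coset_def r_coset_def using K_0 by force

lemma ext_frag_of [simp]: "ext b (frag_of (x, y)) = frag_of (b \<odot>\<^bsub>M\<^esub> x, y)"
  and ext_add: "ext b (c + c') = ext b c + ext b c'"
  and ext_diff: "ext b (c - c') = ext b c - ext b c'"
  and ext_uminus: "ext b (- c) = - ext b c"
  and ext_0 [simp]: "ext b 0 = 0"
  by (simp_all add: ext_def frag_extend_add frag_extend_diff frag_extend_minus)

lemma F_induct [consumes 1, case_names zero one diff]:
  assumes "c \<in> carrier F" "P 0" "\<And>x y. x \<in> carrier M \<Longrightarrow> y \<in> carrier N \<Longrightarrow> P (frag_of (x, y))"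
    "\<And>c c'. c \<in> carrier F \<Longrightarrow> c' \<in> carrier F \<Longrightarrow> P c \<Longrightarrow> P c' \<Longrightarrow> P (c - c')"
  shows "P c"
proof -
  have "c \<in> carrier F \<and> P c" using assms(1)[unfolded carrier_F]
  proof (induction c rule: frag_induction)
    case (one z) then show ?case using assms(3) F_frag_of by (cases z) auto
  qed (use assms(2,4) F_diff in auto)
  then show ?thesis by simp
qed

lemma ext_F: "b \<in> carrier S \<Longrightarrow> c \<in> carrier F \<Longrightarrow> ext b c \<in> carrier F"
proof -
  assume b: "b \<in> carrier S" and c: "c \<in> carrier F"
  show "ext b c \<in> carrier F"
    using c by (induction c rule: F_induct) (auto simp: F_frag_of M_smult ext_diff F_diff b)
qed

text \<open>The left action sends relations to relations; for the balancing relation this is the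
  compatibility of the left and the right action.\<close>

lemma ext_K: assumes b: "b \<in> carrier S" and c: "c \<in> K" shows "ext b c \<in> K"
proof -
  have "K \<subseteq> {c. ext b c \<in> K}"
  proof (rule K_least)
    show "rels \<subseteq> {c. ext b c \<in> K}"
    proof
      fix c assume "c \<in> rels"
      then consider (1) x x' y where "c = frag_of (x \<oplus>\<^bsub>M\<^esub> x', y) - frag_of (x, y) - frag_of (x', y)" "x \<in> carrier M" "x' \<in> carrier M" "y \<in> carrier N"
        | (2) x y y' where "c = frag_of (x, y \<oplus>\<^bsub>N\<^esub> y') - frag_of (x, y) - frag_of (x, y')" "x \<in> carrier M" "y \<in> carrier N" "y' \<in> carrier N"
        | (3) x a y where "c = frag_of (ract x a, y) - frag_of (x, a \<odot>\<^bsub>N\<^esub> y)" "x \<in> carrier M" "a \<in> carrier R" "y \<in> carrier N"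
        unfolding tensor_relations_def by blast
      then show "c \<in> {c. ext b c \<in> K}"
        using K_add_left K_add_right K_balanced b
        by cases (simp_all add: ext_diff M_r_distr M_ract_smult M_smult)
    qed
  qed (auto simp: ext_add ext_uminus K_add K_uminus)
  then show ?thesis using c by blast
qed

section \<open>The tensor product as a left module\<close>

abbreviation "T \<equiv> tensor_module M ract R N"

lemma carrier_T: "carrier T = coset ` carrier F"
  unfolding tensor_module_def Let_def F_def[symmetric] K_def[symmetric] coset_def
  by (auto simp: FactGroup_def RCOSETS_def)

lemma T_zero: "\<zero>\<^bsub>T\<^esub> = coset 0"
proof -
  have "coset 0 = K" unfolding coset_def r_coset_def by auto
  then show ?thesis unfolding tensor_module_def Let_def F_def[symmetric] K_def[symmetric] by (simp add: FactGroup_def)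
qed

lemma T_add: "c \<in> carrier F \<Longrightarrow> c' \<in> carrier F \<Longrightarrow> coset c \<oplus>\<^bsub>T\<^esub> coset c' = coset (c + c')"
proof -
  assume c: "c \<in> carrier F" "c' \<in> carrier F"
  have n: "K \<lhd> F" using comm_group.normal_iff_subgroup[OF groupF] subgroupK by simp
  show ?thesis unfolding tensor_module_def Let_def F_def[symmetric] K_def[symmetric] coset_def
    using normal.rcos_sum[OF n c] by (simp add: FactGroup_def)
qed

text \<open>The scalar multiplication is defined as a union over all representatives of a coset. By
  \<open>ext_K\<close> they all yield the same coset, so the union is that coset.\<close>

lemma T_smult: assumes b: "b \<in> carrier S" and c: "c \<in> carrier F" shows "b \<odot>\<^bsub>T\<^esub> coset c = coset (ext b c)"
proof -
  have "coset (ext b c') = coset (ext b c)" if "c' \<in> coset c" for c'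
  proof -
    have k: "c' - c \<in> K" using that coset_mem by simp
    then have "c' \<in> carrier F" using F_add[OF K_F c, of "c' - c"] by simp
    then show ?thesis using ext_K[OF b k] coset_eq_iff ext_F b c by (simp add: ext_diff)
  qed
  then have "(\<Union>c'\<in>coset c. coset (ext b c')) = coset (ext b c)" using coset_self[of c] by blast
  then show ?thesis unfolding tensor_module_def Let_def F_def[symmetric] K_def[symmetric] coset_def ext_def by simp
qed

lemma abelian_group_T: "abelian_group T"
proof (rule abelian_groupI)
  fix x y z assume "x \<in> carrier T" "y \<in> carrier T" "z \<in> carrier T"
  then obtain a b c where "x = coset a" "y = coset b" "z = coset c" "a \<in> carrier F" "b \<in> carrier F" "c \<in> carrier F"
    unfolding carrier_T by blast
  then show "(x \<oplus>\<^bsub>T\<^esub> y) \<oplus>\<^bsub>T\<^esub> z = x \<oplus>\<^bsub>T\<^esub> (y \<oplus>\<^bsub>T\<^esub> z)" by (simp add: T_add F_add add.assoc)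
next
  fix x y assume "x \<in> carrier T" "y \<in> carrier T"
  then obtain a b where ab: "x = coset a" "y = coset b" "a \<in> carrier F" "b \<in> carrier F" unfolding carrier_T by blast
  then show "x \<oplus>\<^bsub>T\<^esub> y = y \<oplus>\<^bsub>T\<^esub> x" by (simp add: T_add add.commute)
  show "x \<oplus>\<^bsub>T\<^esub> y \<in> carrier T" using ab by (simp add: T_add carrier_T F_add)
next
  fix x assume "x \<in> carrier T"
  then obtain a where a: "x = coset a" "a \<in> carrier F" unfolding carrier_T by blast
  then show "\<zero>\<^bsub>T\<^esub> \<oplus>\<^bsub>T\<^esub> x = x" by (simp add: T_add T_zero)
  have "coset (- a) \<oplus>\<^bsub>T\<^esub> x = \<zero>\<^bsub>T\<^esub>" using a by (simp add: T_add T_zero F_uminus)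
  then show "\<exists>y\<in>carrier T. y \<oplus>\<^bsub>T\<^esub> x = \<zero>\<^bsub>T\<^esub>" using a F_uminus unfolding carrier_T by blast
qed (simp add: T_zero carrier_T)

lemma left_module_T: "left_module S T"
proof -
  interpret S: ring S by (rule ringS)
  interpret T: abelian_group T by (rule abelian_group_T)
  show ?thesis
  proof (unfold_locales)
    fix a b x assume ab: "a \<in> carrier S" "b \<in> carrier S" and "x \<in> carrier T"
    then obtain c where c: "x = coset c" "c \<in> carrier F" unfolding carrier_T by blast
    have "ext (a \<oplus>\<^bsub>S\<^esub> b) c - (ext a c + ext b c) \<in> K"
      using c(2)
    proof (induction c rule: F_induct)
      case (one x y)
      then show ?case using K_add_left[of "a \<odot>\<^bsub>M\<^esub> x" "b \<odot>\<^bsub>M\<^esub> x" y] ab by (simp add: M_l_distr M_smult diff_diff_eq)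
    next
      case (diff c c')
      then show ?case using K_diff[OF diff(3,4)] by (simp add: ext_diff algebra_simps)
    qed simp
    then show "(a \<oplus>\<^bsub>S\<^esub> b) \<odot>\<^bsub>T\<^esub> x = a \<odot>\<^bsub>T\<^esub> x \<oplus>\<^bsub>T\<^esub> b \<odot>\<^bsub>T\<^esub> x"
      using ab c by (simp add: T_smult T_add ext_F coset_eq_iff F_add)
    have "ext (a \<otimes>\<^bsub>S\<^esub> b) c = ext a (ext b c)"
      using c(2) by (induction c rule: F_induct) (simp_all add: ext_diff M_assoc ab)
    then show "(a \<otimes>\<^bsub>S\<^esub> b) \<odot>\<^bsub>T\<^esub> x = a \<odot>\<^bsub>T\<^esub> (b \<odot>\<^bsub>T\<^esub> x)" using ab c by (simp add: T_smult ext_F)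
  next
    fix a x assume a: "a \<in> carrier S" and "x \<in> carrier T"
    then obtain c where c: "x = coset c" "c \<in> carrier F" unfolding carrier_T by blast
    show "a \<odot>\<^bsub>T\<^esub> x \<in> carrier T" using a c by (simp add: T_smult carrier_T ext_F)
    fix y assume "y \<in> carrier T"
    then obtain c' where c': "y = coset c'" "c' \<in> carrier F" unfolding carrier_T by blast
    show "a \<odot>\<^bsub>T\<^esub> (x \<oplus>\<^bsub>T\<^esub> y) = a \<odot>\<^bsub>T\<^esub> x \<oplus>\<^bsub>T\<^esub> a \<odot>\<^bsub>T\<^esub> y"
      using a c c' by (simp add: T_smult T_add ext_F ext_add F_add)
  next
    fix x assume "x \<in> carrier T"
    then obtain c where c: "x = coset c" "c \<in> carrier F" unfolding carrier_T by blast
    have "ext \<one>\<^bsub>S\<^esub> c = c" using c(2) by (induction c rule: F_induct) (simp_all add: ext_diff M_one)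
    then show "\<one>\<^bsub>S\<^esub> \<odot>\<^bsub>T\<^esub> x = x" using c by (simp add: T_smult)
  qed
qed

text \<open>\<phi> induces a homomorphism \<open>h\<close> on the free group that kills the
  relations, and \<open>gen\<close> makes it surjective. For injectivity, \<Psi> need only invert
  \<phi> and respect differences modulo the relations. The module axioms for \<open>P\<close> are
  not assumed; they are transported along \<open>h\<close>.\<close>

theorem tensor_iso:
  fixes P :: "('s, 'v::ab_group_add, 'g) module_scheme" and \<phi> :: "'m \<Rightarrow> 'n \<Rightarrow> 'v" and \<Psi> :: "'v \<Rightarrow> ('m \<times> 'n \<Rightarrow>\<^sub>0 int)"
  assumes P: "\<zero>\<^bsub>P\<^esub> = 0" "\<And>u v. u \<oplus>\<^bsub>P\<^esub> v = u + v" "\<And>u v. u \<in> carrier P \<Longrightarrow> v \<in> carrier P \<Longrightarrow> u - v \<in> carrier P" "0 \<in> carrier P"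
    and P_smult: "\<And>b u v. b \<in> carrier S \<Longrightarrow> b \<odot>\<^bsub>P\<^esub> (u - v) = b \<odot>\<^bsub>P\<^esub> u - b \<odot>\<^bsub>P\<^esub> v"
    and \<phi>: "\<And>x y. x \<in> carrier M \<Longrightarrow> y \<in> carrier N \<Longrightarrow> \<phi> x y \<in> carrier P"
      "\<And>x x' y. x \<in> carrier M \<Longrightarrow> x' \<in> carrier M \<Longrightarrow> y \<in> carrier N \<Longrightarrow> \<phi> (x \<oplus>\<^bsub>M\<^esub> x') y = \<phi> x y + \<phi> x' y"
      "\<And>x y y'. x \<in> carrier M \<Longrightarrow> y \<in> carrier N \<Longrightarrow> y' \<in> carrier N \<Longrightarrow> \<phi> x (y \<oplus>\<^bsub>N\<^esub> y') = \<phi> x y + \<phi> x y'"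
      "\<And>x c y. x \<in> carrier M \<Longrightarrow> c \<in> carrier R \<Longrightarrow> y \<in> carrier N \<Longrightarrow> \<phi> (ract x c) y = \<phi> x (c \<odot>\<^bsub>N\<^esub> y)"
      "\<And>b x y. b \<in> carrier S \<Longrightarrow> x \<in> carrier M \<Longrightarrow> y \<in> carrier N \<Longrightarrow> \<phi> (b \<odot>\<^bsub>M\<^esub> x) y = b \<odot>\<^bsub>P\<^esub> \<phi> x y"
    and \<Psi>: "\<Psi> 0 \<in> K" "\<And>u v. u \<in> carrier P \<Longrightarrow> v \<in> carrier P \<Longrightarrow> \<Psi> (u - v) - (\<Psi> u - \<Psi> v) \<in> K"
      "\<And>x y. x \<in> carrier M \<Longrightarrow> y \<in> carrier N \<Longrightarrow> frag_of (x, y) - \<Psi> (\<phi> x y) \<in> K"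
    and gen: "\<And>A. 0 \<in> A \<Longrightarrow> (\<And>u v. u \<in> A \<Longrightarrow> v \<in> A \<Longrightarrow> u + v \<in> A) \<Longrightarrow>
      (\<And>x y. x \<in> carrier M \<Longrightarrow> y \<in> carrier N \<Longrightarrow> \<phi> x y \<in> A) \<Longrightarrow> carrier P \<subseteq> A"
  shows "left_module_iso S T P"
proof -
  let ?G = "\<lparr>carrier = (UNIV :: 'v set), monoid.mult = (+), one = 0\<rparr>"
  have G: "comm_group ?G" by (rule comm_groupI) (auto simp: add.assoc add.commute intro: exI[of _ "- x" for x])
  obtain h where h0: "h \<in> hom F ?G" and hf: "\<And>z. z \<in> carrier M \<times> carrier N \<Longrightarrow> h (frag_of z) = (case z of (x, y) \<Rightarrow> \<phi> x y)"
    unfolding F_def by (rule comm_group.free_Abelian_group_universal[OF G, where f="\<lambda>(x, y). \<phi> x y" and S="carrier M \<times> carrier N"]) auto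
  have hadd: "h (c + c') = h c + h c'" if "c \<in> carrier F" "c' \<in> carrier F" for c c'
    using hom_mult[OF h0 that] by simp
  have h0': "h 0 = 0" using hadd[of 0 0] by simp
  have hdiff: "h (c - c') = h c - h c'" if "c \<in> carrier F" "c' \<in> carrier F" for c c'
    using hadd[OF F_diff[OF that] that(2)] by (simp add: eq_diff_eq)
  have huminus: "h (- c) = - h c" if "c \<in> carrier F" for c using hdiff[OF F_0 that] h0' by simp
  have hfr: "h (frag_of (x, y)) = \<phi> x y" if "x \<in> carrier M" "y \<in> carrier N" for x y using hf[of "(x, y)"] that by simp
  have hP: "h c \<in> carrier P" if "c \<in> carrier F" for c
    using that by (induction c rule: F_induct) (auto simp: h0' P hfr \<phi>(1) hdiff)
  have hK: "h c = 0" if "c \<in> K" for c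
  proof -
    have "K \<subseteq> {c \<in> carrier F. h c = 0}"
    proof (rule K_least)
      show "rels \<subseteq> {c \<in> carrier F. h c = 0}"
      proof
        fix c assume c: "c \<in> rels"
        then consider (1) x x' y where "c = frag_of (x \<oplus>\<^bsub>M\<^esub> x', y) - frag_of (x, y) - frag_of (x', y)" "x \<in> carrier M" "x' \<in> carrier M" "y \<in> carrier N"
          | (2) x y y' where "c = frag_of (x, y \<oplus>\<^bsub>N\<^esub> y') - frag_of (x, y) - frag_of (x, y')" "x \<in> carrier M" "y \<in> carrier N" "y' \<in> carrier N"
          | (3) x a y where "c = frag_of (ract x a, y) - frag_of (x, a \<odot>\<^bsub>N\<^esub> y)" "x \<in> carrier M" "a \<in> carrier R" "y \<in> carrier N"
          unfolding tensor_relations_def by blast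
        then have "h c = 0"
          by cases (simp_all add: hdiff hfr F_frag_of F_diff M_add N_add M_ract N_smult \<phi>(2-4))
        then show "c \<in> {c \<in> carrier F. h c = 0}" using c rels_F by blast
      qed
    qed (auto simp: h0' hadd F_add F_uminus huminus)
    then show ?thesis using that by blast
  qed
  have hext: "h (ext b c) = b \<odot>\<^bsub>P\<^esub> h c" if b: "b \<in> carrier S" and c: "c \<in> carrier F" for b c
    using c
  proof (induction c rule: F_induct)
    case zero
    then show ?case using P_smult[OF b, of 0 0] by (simp add: h0')
  next
    case (diff c c')
    then show ?case by (simp add: ext_diff hdiff ext_F[OF b] P_smult[OF b])
  qed (use b in \<open>simp add: hfr M_smult \<phi>(5)\<close>)
  \<comment> \<open>Hence the kernel of \<open>h\<close> is contained in \<open>K\<close>: if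
    \<open>h c = 0\<close>, then \<open>c\<close> is congruent to \<open>\<Psi> 0\<close>, which
    lies in \<open>K\<close>.\<close>
  have hPsi: "c - \<Psi> (h c) \<in> K" if "c \<in> carrier F" for c
    using that
  proof (induction c rule: F_induct)
    case zero then show ?case using K_uminus[OF \<Psi>(1)] by (simp add: h0')
  next
    case (one x y) then show ?case using \<Psi>(3) by (simp add: hfr)
  next
    case (diff c c')
    have "c - c' - (\<Psi> (h c) - \<Psi> (h c')) \<in> K" using K_diff[OF diff(3,4)] by (simp add: algebra_simps)
    from K_diff[OF this \<Psi>(2)[OF hP[OF diff(1)] hP[OF diff(2)]]]
    show ?case using diff(1,2) by (simp add: hdiff)
  qed
  have surj: "h ` carrier F = carrier P"
  proof
    show "carrier P \<subseteq> h ` carrier F"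
    proof (rule gen)
      show "0 \<in> h ` carrier F" using h0' by force
      show "u + v \<in> h ` carrier F" if uv: "u \<in> h ` carrier F" "v \<in> h ` carrier F" for u v
      proof -
        obtain c c' where "u = h c" "v = h c'" "c \<in> carrier F" "c' \<in> carrier F" using uv by blast
        then have "u + v = h (c + c')" "c + c' \<in> carrier F" using hadd F_add by simp_all
        then show ?thesis by blast
      qed
      show "\<phi> x y \<in> h ` carrier F" if "x \<in> carrier M" "y \<in> carrier N" for x y
        using hfr[OF that] that F_frag_of by (metis SigmaI image_eqI)
    qed
  qed (use hP in blast)
  \<comment> \<open>The induced map on cosets, by a choice of representatives; independence of the
    choice is \<open>hK\<close>.\<close>
  define f where "f C = h (SOME c. c \<in> carrier F \<and> coset c = C)" for C
  have f: "f (coset c) = h c" if c: "c \<in> carrier F" for c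
  proof -
    let ?c = "SOME c'. c' \<in> carrier F \<and> coset c' = coset c"
    have "?c \<in> carrier F \<and> coset ?c = coset c" by (rule someI[of _ c]) (use c in simp)
    then have "?c - c \<in> K" "?c \<in> carrier F" using coset_eq_iff c by auto
    then show ?thesis unfolding f_def using hK[of "?c - c"] hdiff c by simp
  qed
  have lT: "left_module S T" by (rule left_module_T)
  interpret T: left_module S T by (rule lT)
  have P_rep: "\<exists>c\<in>carrier F. u = h c" if "u \<in> carrier P" for u using that surj by blast
  have sm: "b \<odot>\<^bsub>P\<^esub> h c = f (b \<odot>\<^bsub>T\<^esub> coset c)" if "b \<in> carrier S" "c \<in> carrier F" for b c
    using that by (simp add: T_smult f ext_F hext)
  have Pg: "abelian_group P"
  proof (rule abelian_groupI)
    show add: "x \<oplus>\<^bsub>P\<^esub> y \<in> carrier P" if "x \<in> carrier P" "y \<in> carrier P" for x y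
      using P(3)[OF that(1) P(3)[OF P(4) that(2)]] by (simp add: P(2))
    show "\<exists>y\<in>carrier P. y \<oplus>\<^bsub>P\<^esub> x = \<zero>\<^bsub>P\<^esub>" if "x \<in> carrier P" for x
      using P(3)[OF P(4) that] by (intro bexI[of _ "- x"]) (auto simp: P)
  qed (auto simp: P add.assoc add.commute)
  have "left_module S P"
  proof -
    interpret P: abelian_group P by (rule Pg)
    show ?thesis
    proof (unfold_locales)
      fix a b u assume ab: "a \<in> carrier S" "b \<in> carrier S" and u: "u \<in> carrier P"
      obtain c where c: "c \<in> carrier F" "u = h c" using P_rep[OF u] by blast
      have cT: "coset c \<in> carrier T" using c by (simp add: carrier_T)
      have "(a \<oplus>\<^bsub>S\<^esub> b) \<odot>\<^bsub>P\<^esub> u = f (a \<odot>\<^bsub>T\<^esub> coset c \<oplus>\<^bsub>T\<^esub> b \<odot>\<^bsub>T\<^esub> coset c)"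
        unfolding c(2) using sm[OF _ c(1), of "a \<oplus>\<^bsub>S\<^esub> b"] T.smult_l_distr[OF ab cT] ab by simp
      also have "\<dots> = a \<odot>\<^bsub>P\<^esub> u + b \<odot>\<^bsub>P\<^esub> u"
        using ab c by (simp add: T_smult T_add ext_F f F_add hadd hext)
      finally show "(a \<oplus>\<^bsub>S\<^esub> b) \<odot>\<^bsub>P\<^esub> u = a \<odot>\<^bsub>P\<^esub> u \<oplus>\<^bsub>P\<^esub> b \<odot>\<^bsub>P\<^esub> u" by (simp add: P)
      have "(a \<otimes>\<^bsub>S\<^esub> b) \<odot>\<^bsub>P\<^esub> u = f (a \<odot>\<^bsub>T\<^esub> (b \<odot>\<^bsub>T\<^esub> coset c))"
        unfolding c(2) using sm[OF _ c(1), of "a \<otimes>\<^bsub>S\<^esub> b"] T.smult_assoc[OF ab cT] ab by simp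
      then show "(a \<otimes>\<^bsub>S\<^esub> b) \<odot>\<^bsub>P\<^esub> u = a \<odot>\<^bsub>P\<^esub> (b \<odot>\<^bsub>P\<^esub> u)"
        using ab c by (simp add: T_smult ext_F f hext)
    next
      fix a u assume a: "a \<in> carrier S" and u: "u \<in> carrier P"
      obtain c where c: "c \<in> carrier F" "u = h c" using P_rep[OF u] by blast
      show "a \<odot>\<^bsub>P\<^esub> u \<in> carrier P" using hP[OF ext_F[OF a c(1)]] hext[OF a c(1)] c by simp
      fix v assume "v \<in> carrier P"
      have "a \<odot>\<^bsub>P\<^esub> (u - (0 - v)) = a \<odot>\<^bsub>P\<^esub> u - (a \<odot>\<^bsub>P\<^esub> 0 - a \<odot>\<^bsub>P\<^esub> v)" using P_smult[OF a, of u "0 - v"] P_smult[OF a, of 0 v] by simp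
      moreover have "a \<odot>\<^bsub>P\<^esub> 0 = 0" using P_smult[OF a, of 0 0] by simp
      ultimately show "a \<odot>\<^bsub>P\<^esub> (u \<oplus>\<^bsub>P\<^esub> v) = a \<odot>\<^bsub>P\<^esub> u \<oplus>\<^bsub>P\<^esub> a \<odot>\<^bsub>P\<^esub> v" by (simp add: P)
    next
      fix u assume u: "u \<in> carrier P"
      obtain c where c: "c \<in> carrier F" "u = h c" using P_rep[OF u] by blast
      have cT: "coset c \<in> carrier T" using c by (simp add: carrier_T)
      show "\<one>\<^bsub>S\<^esub> \<odot>\<^bsub>P\<^esub> u = u" unfolding c(2) using sm[OF _ c(1), of "\<one>\<^bsub>S\<^esub>"] T.smult_one[OF cT] f[OF c(1)] by simp
    qed
  qed
  moreover have "bij_betw f (carrier T) (carrier P)"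
  proof (rule bij_betw_imageI)
    show "inj_on f (carrier T)"
    proof (rule inj_onI)
      fix x y assume "x \<in> carrier T" "y \<in> carrier T" and e: "f x = f y"
      then obtain c c' where c: "x = coset c" "y = coset c'" "c \<in> carrier F" "c' \<in> carrier F" unfolding carrier_T by blast
      have "h (c - c') = 0" using e c by (simp add: f hdiff)
      then have "c - c' - \<Psi> 0 \<in> K" using hPsi[OF F_diff[OF c(3,4)]] by simp
      then have "c - c' \<in> K" using K_add[OF _ \<Psi>(1)] by fastforce
      then show "x = y" using c coset_eq_iff by simp
    qed
    show "f ` carrier T = carrier P" unfolding carrier_T image_image surj[symmetric] by (rule image_cong) (simp_all add: f)
  qed
  moreover have "f (x \<oplus>\<^bsub>T\<^esub> y) = f x \<oplus>\<^bsub>P\<^esub> f y" if "x \<in> carrier T" "y \<in> carrier T" for x y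
    using that unfolding carrier_T by (auto simp: T_add f F_add hadd P)
  moreover have "f (b \<odot>\<^bsub>T\<^esub> x) = b \<odot>\<^bsub>P\<^esub> f x" if "b \<in> carrier S" "x \<in> carrier T" for b x
    using that unfolding carrier_T by (auto simp: f sm[symmetric])
  ultimately show ?thesis unfolding left_module_iso_def using lT by blast
qed

end

section \<open>The action on dangles\<close>

locale standard_setup = specht_setup m p d \<delta> i0 \<xi> "n - 2 * l" t lam \<rho>
  for m p d :: nat and \<delta> :: "nat \<Rightarrow> 'k::field" and i0 and \<xi> :: 'k and n l t :: nat and lam \<rho> +
  fixes r :: nat and U W :: "diagram \<Rightarrow>\<^sub>0 'k"
  assumes l2: "2 * l \<le> n" and r0: "n = 2 * l \<Longrightarrow> r = 0"
    and U: "U \<in> hsp p {1..n} {1..n - 2 * l}" and W: "W \<in> hsp p {1..n - 2 * l} {1..n}"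
    and WU: "W \<cdot> U = basis (idd {1..n - 2 * l})"
    and corner: "\<And>x. x \<in> hsp 1 {1..n - 2 * l} {1..n - 2 * l} \<Longrightarrow> corner m p d \<delta> i0 n l x = U \<cdot> (x \<cdot> W)"
begin

abbreviation N :: nat where "N \<equiv> n - 2 * l"
abbreviation dd :: "dangle \<Rightarrow> diagram" where "dd v \<equiv> dangle_diagram n v"
abbreviation DG :: "dangle set" where "DG \<equiv> dangles m n l"
abbreviation Dn :: "diagram set" where "Dn \<equiv> dgr m {1..n} {1..N}"

section \<open>Splitting a diagram into a dangle and a group element\<close>

lemma GD_dgr: "w \<in> GD \<Longrightarrow> w \<in> dgr m {1..N} {1..N}"
  by (simp add: group_diagrams_def diagrams_dgr)

lemma dd_props:
  assumes v: "v \<in> DG"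
  shows "dd v \<in> Dn" "narcs (dd v) = v" "label_sum (dd v) = label_sum v" "card v = l"
proof -
  have e: "dd v = arcs v \<union> strands {1..N} (frees n v) id (\<lambda>_. 0)" by (rule dangle_diagram_normal[OF v])
  show "dd v \<in> Dn" unfolding e by (rule normal_in_dgr[OF v]) (use mpos in auto)
  show "narcs (dd v) = v" unfolding e by simp
  show "label_sum (dd v) = label_sum v" unfolding e label_sum_normal[OF v] by simp
  show "card v = l" using v by (simp add: dangles_def)
qed

lemma compose_GD:
  assumes D: "D \<in> Dn" "card (narcs D) \<le> l" and w: "w \<in> GD"
  shows "narcs (compose m D w) = narcs D" "through n (compose m D w) = compose m (through n D) w"
proof -
  obtain b c where nf: "narcs D \<in> DG" "perm b" "\<And>j. j \<in> {1..N} \<Longrightarrow> c j < m" "D = arcs (narcs D) \<union> strands {1..N} (frees n (narcs D)) b c"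
    by (rule normal_form[OF D l2]) blast
  obtain b' c' where w': "perm b'" "lab c'" "w = gs b' c'" using w unfolding group_diagrams_strands by blast
  let ?v = "narcs D"
  have im: "b ` {1..N} \<subseteq> {1..N}" "inj_on b' {1..N}" using nf(2) w'(1) by (auto simp: bij_betw_def)
  have D': "arcs ?v \<union> strands {1..N} (frees n ?v) b c \<in> Dn" using D(1) nf(4) by simp
  have e: "compose m D w = arcs ?v \<union> strands {1..N} (frees n ?v) (b' \<circ> b) (\<lambda>j. (c j + c' (b j)) mod m)"
    unfolding w'(3) by (subst nf(4), rule compose_normal_strands(1)[OF D' _ _ im(2,1)]) auto
  show "narcs (compose m D w) = narcs D" unfolding e by simp
  have "through n D = gs b c" by (subst nf(4), rule through_normal[OF nf(1)])
  then show "through n (compose m D w) = compose m (through n D) w"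
  proof -
    have "through n (compose m D w) = gs (b' \<circ> b) (\<lambda>j. (c j + c' (b j)) mod m)"
      unfolding e by (rule through_normal[OF nf(1)])
    moreover have "compose m (gs b c) (gs b' c') = gs (b' \<circ> b) (\<lambda>j. (c j + c' (b j)) mod m)"
      by (rule compose_gs(1)[OF nf(2) _ w'(1,2)]) (use nf(3) in simp)
    ultimately show ?thesis using \<open>through n D = gs b c\<close> w'(3) by (simp only:)
  qed
qed

lemma lf_GD: assumes D: "D \<in> dgr m A {1..N}" "finite A" and w: "w \<in> GD" shows "lf D w = 1"
proof -
  obtain b' c' where w': "perm b'" "lab c'" "w = gs b' c'" using w unfolding group_diagrams_strands by blast
  show ?thesis unfolding w'(3) by (rule compose_strands(2)[OF D]) (use w' in \<open>auto simp: bij_betw_def\<close>)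
qed

text \<open>The free lines of \<open>dd\<close> carry the label 0, so the labels of all
  through-strands go to the group element. The label sums therefore add exactly, not only modulo
  \<open>m\<close>.\<close>

lemma decompose:
  assumes D: "D \<in> Dn" "card (narcs D) \<le> l"
  shows "narcs D \<in> DG" "through n D \<in> GD" "compose m (dd (narcs D)) (through n D) = D"
    "label_sum D = label_sum (narcs D) + label_sum (through n D)"
proof -
  obtain b c where nf: "narcs D \<in> DG" "perm b" "\<And>j. j \<in> {1..N} \<Longrightarrow> c j < m" "D = arcs (narcs D) \<union> strands {1..N} (frees n (narcs D)) b c"
    by (rule normal_form[OF D l2]) blast
  let ?v = "narcs D"
  have t: "through n D = gs b c" by (subst nf(4), rule through_normal[OF nf(1)])
  show "?v \<in> DG" by (rule nf)
  show "through n D \<in> GD" unfolding t by (rule gs_GD) (use nf in auto)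
  have e: "dd ?v = arcs ?v \<union> strands {1..N} (frees n ?v) id (\<lambda>_. 0)" by (rule dangle_diagram_normal[OF nf(1)])
  have D': "arcs ?v \<union> strands {1..N} (frees n ?v) id (\<lambda>_. 0) \<in> Dn" using dd_props(1)[OF nf(1)] unfolding e .
  have "compose m (dd ?v) (gs b c) = arcs ?v \<union> strands {1..N} (frees n ?v) (b \<circ> id) (\<lambda>j. (0 + c (id j)) mod m)"
    unfolding e by (rule compose_normal_strands(1)[OF D']) (use nf(2) in \<open>auto simp: bij_betw_def\<close>)
  also have "strands {1..N} (frees n ?v) (b \<circ> id) (\<lambda>j. (0 + c (id j)) mod m) = strands {1..N} (frees n ?v) b c"
    by (rule strands_cong) (use nf(3) in auto)
  finally show "compose m (dd ?v) (through n D) = D" unfolding t by (rule trans) (rule nf(4)[symmetric])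
  have "label_sum D = label_sum (arcs ?v \<union> strands {1..N} (frees n ?v) b c)" using nf(4) by simp
  then show "label_sum D = label_sum ?v + label_sum (through n D)"
    unfolding t label_sum_normal[OF nf(1)] label_sum_gs .
qed

lemma not_GD_narcs:
  assumes w: "w \<in> dgr m {1..N} {1..N}" "w \<notin> GD"
  shows "card (narcs w) > 0"
proof (rule ccontr)
  assume "\<not> card (narcs w) > 0"
  then have c0: "card (narcs w) \<le> 0" by simp
  have "finite (narcs w)" by (rule finite_narcs[OF finite_dgr_member[OF _ _ w(1)]]) auto
  then have e: "narcs w = {}" using c0 by simp
  have w0: "w \<in> dgr m {1..N} {1..N - 2 * 0}" using w(1) by simp
  obtain b c where bc: "bij_betw b {1..N - 2 * 0} {1..N - 2 * 0}" "\<And>j. j \<in> {1..N - 2 * 0} \<Longrightarrow> c j < m"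
    "w = arcs (narcs w) \<union> strands {1..N - 2 * 0} (frees N (narcs w)) b c"
    using normal_form[OF w0 c0] by (metis le0 mult_0_right)
  have "strands {1..N} (frees N {}) b c = gs b c"
    by (rule strands_cong) (auto simp: free_nodes_empty simp del: upt_Suc)
  then have "w = gs b c" using bc(3) e by (simp add: arcs_def)
  then show False using gs_GD[of b c] bc(1,2) w(2) by simp
qed

text \<open>The future image of the pure tensor of \<open>D\<close> and \<open>s\<close>: with
  \<open>D\<close> a dangle \<open>v\<close> times a group element \<open>w\<close>, it is
  \<open>v\<close> tensor \<open>w s\<close>. Too many arcs give 0, as in the action on
  dangles.\<close>

definition star :: "diagram \<Rightarrow> (tableau \<Rightarrow>\<^sub>0 'k) \<Rightarrow> (dangle \<times> tableau \<Rightarrow>\<^sub>0 'k)"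
  where "star D s = (if card (narcs D) > l then 0 else ptensor (basis (narcs D)) (\<rho> (through n D) s))"

lemma ptensor_basis: "ptensor (basis v) s = lin_ext (\<lambda>T. basis (v, T)) s"
  by (simp add: ptensor_def)

lemma ptensor_add_right: "ptensor x (s + s') = ptensor x s + ptensor x s'"
  and ptensor_pscale_right: "ptensor x (pscale c s) = pscale c (ptensor x s)"
  and ptensor_0_right [simp]: "ptensor x 0 = 0"
  by (simp_all add: ptensor_def lin_ext_add lin_ext_pscale lin_ext_fun_add lin_ext_fun_pscale)

lemma star_add:
  assumes "D \<in> Dn" "s \<in> TS" "s' \<in> TS" shows "star D (s + s') = star D s + star D s'"
  using decompose(2)[OF assms(1)] assms by (simp add: star_def rho_add ptensor_add_right)

lemma star_pscale:
  assumes "D \<in> Dn" "s \<in> TS" shows "star D (pscale c s) = pscale c (star D s)"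
  using decompose(2)[OF assms(1)] assms by (simp add: star_def rho_pscale ptensor_pscale_right)

lemma star_0 [simp]: "D \<in> Dn \<Longrightarrow> star D 0 = 0"
  using star_pscale[of D 0 0] by simp

lemma compose_Dn: "X \<in> dgr m A {1..n} \<Longrightarrow> finite A \<Longrightarrow> D \<in> Dn \<Longrightarrow> compose m X D \<in> dgr m A {1..N}"
proof -
  assume X: "X \<in> dgr m A {1..n}" and A: "finite A" and D: "D \<in> Dn"
  show "compose m X D \<in> dgr m A {1..N}" by (rule compose_in_dgr[OF X D A]) (use mpos in auto)
qed

lemma star_compose_GD:
  assumes D: "D \<in> Dn" and w: "w \<in> GD" and s: "s \<in> TS"
  shows "star (compose m D w) s = star D (\<rho> w s)"
proof (cases "card (narcs D) \<le> l")
  case True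
  then show ?thesis
    using compose_GD[OF D True w] rho_mult[OF decompose(2)[OF D True] w s] by (simp add: star_def)
next
  case False
  have "card (narcs D) \<le> card (narcs (compose m D w))"
    by (rule card_narcs_compose_left[OF D GD_dgr[OF w]]) (use mpos in auto)
  then show ?thesis using False by (simp add: star_def)
qed

text \<open>Outside the group, \<open>w\<close> has arcs, and equally many on both sides. Its
  southern arcs survive in the composite, and \<open>arcs_count\<close> then forces more than
  \<open>l\<close> northern arcs.\<close>

lemma star_compose_not_GD:
  assumes D: "D \<in> Dn" and w: "w \<in> dgr m {1..N} {1..N}" "w \<notin> GD"
  shows "star (compose m D w) s = 0"
proof -
  let ?E = "compose m D w"
  have E: "?E \<in> Dn" by (rule compose_in_dgr[OF D w(1)]) (use mpos in auto)
  have "card (narcs (flip w)) = card (narcs w)" using arcs_count[OF w(1)] by simp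
  moreover have "card (narcs (flip w)) \<le> card (narcs (compose m (flip w) (flip D)))"
    by (rule card_narcs_compose_left[OF flip_in_dgr[OF w(1)] flip_in_dgr[OF D]]) (use mpos in auto)
  ultimately have "card (narcs (flip ?E)) > 0" using not_GD_narcs[OF w] by (simp add: compose_flip)
  moreover have "n + 2 * card (narcs (flip ?E)) = N + 2 * card (narcs ?E)" using arcs_count[OF E] by simp
  ultimately have "card (narcs ?E) > l" using l2 by linarith
  then show ?thesis by (simp add: star_def)
qed

text \<open>The action on dangles is composition with \<open>dd v\<close> followed by
  \<open>star\<close>, so compatibility of \<open>star\<close> with the action becomes associativity
  of composition.\<close>

lemma dangle_act_basis_star:
  "dangle_act_basis m p \<delta> \<rho> n l X v s = pscale (lf X (dd v)) (star (compose m X (dd v)) s)"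
  by (simp add: dangle_act_basis_def star_def dangle_above_narcs group_element_through)

lemma dangle_act_ptensor:
  assumes X: "X \<in> dgr m {1..n} {1..n}" and v: "v \<in> DG" and s: "s \<in> TS"
  shows "dangle_act m p \<delta> \<rho> n l (basis X) (ptensor (basis v) s) = pscale (lf X (dd v)) (star (compose m X (dd v)) s)"
proof -
  have E: "compose m X (dd v) \<in> Dn" by (rule compose_Dn[OF X _ dd_props(1)[OF v]]) simp
  have "Poly_Mapping.keys s \<subseteq> std_tableaux lam" using s by (simp add: tableau_space_def)
  then show ?thesis
  proof (induction s rule: span_induct_basis)
    case zero
    then show ?case using E by (simp add: dangle_act_def)
  next
    case (add x y)
    then have "x \<in> TS" "y \<in> TS" by (auto simp: tableau_space_def)
    then show ?case using add(3,4) E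
      by (simp add: dangle_act_def ptensor_add_right lin_ext_add star_add pscale.scale_right_distrib)
  next
    case (basis c T)
    then show ?case using E by (simp add: dangle_act_def ptensor_pscale_right lin_ext_pscale ptensor_basis
          dangle_act_basis_star star_pscale TS_basis mult.commute)
  qed
qed

text \<open>With \<open>D\<close> written as \<open>dd v\<close> followed by \<open>w\<close>,
  associativity moves \<open>w\<close> past \<open>X\<close>, and the loop factors agree because
  group elements close no loops. If \<open>D\<close> has too many arcs, so has the composite, and
  both sides vanish.\<close>

lemma dangle_act_star:
  assumes X: "X \<in> dgr m {1..n} {1..n}" and D: "D \<in> Dn" and s: "s \<in> TS"
  shows "dangle_act m p \<delta> \<rho> n l (basis X) (star D s) = pscale (lf X D) (star (compose m X D) s)"
proof (cases "card (narcs D) \<le> l")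
  case False
  have "card (narcs D) \<le> card (narcs (compose m X D))"
    by (rule card_narcs_compose_right[OF X D]) (use mpos in auto)
  then show ?thesis using False by (simp add: star_def dangle_act_def)
next
  case True
  let ?v = "narcs D" and ?w = "through n D"
  note d = decompose[OF D True]
  have dv: "dd ?v \<in> Dn" by (rule dd_props(1)[OF d(1)])
  have XD: "compose m X (dd ?v) \<in> Dn" by (rule compose_Dn[OF X _ dv]) simp
  have g: "good X" "good (dd ?v)" "good ?w" using good_dgr X dv GD_dgr[OF d(2)] by blast+
  have "dangle_act m p \<delta> \<rho> n l (basis X) (star D s) = dangle_act m p \<delta> \<rho> n l (basis X) (ptensor (basis ?v) (\<rho> ?w s))"
    using True by (simp add: star_def)
  also have "\<dots> = pscale (lf X (dd ?v)) (star (compose m X (dd ?v)) (\<rho> ?w s))"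
    by (rule dangle_act_ptensor[OF X d(1) rho_in[OF d(2) s]])
  also have "star (compose m X (dd ?v)) (\<rho> ?w s) = star (compose m (compose m X (dd ?v)) ?w) s"
    by (rule star_compose_GD[OF XD d(2) s, symmetric])
  also have "compose m (compose m X (dd ?v)) ?w = compose m X D"
    using compose_assoc(1)[OF g] d(3) by simp
  also have "lf X (dd ?v) = lf X D"
    using compose_assoc(2)[OF g, of m p \<delta>] d(3) lf_GD[OF XD _ d(2)] lf_GD[OF dv _ d(2)] by simp
  finally show ?thesis .
qed

definition starx :: "(diagram \<Rightarrow>\<^sub>0 'k) \<Rightarrow> (tableau \<Rightarrow>\<^sub>0 'k) \<Rightarrow> (dangle \<times> tableau \<Rightarrow>\<^sub>0 'k)"
  where "starx x s = lin_ext (\<lambda>D. star D s) x"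

lemma starx_add_left: "starx (x + y) s = starx x s + starx y s"
  and starx_pscale_left: "starx (pscale c x) s = pscale c (starx x s)"
  and starx_diff_left: "starx (x - y) s = starx x s - starx y s"
  and starx_basis [simp]: "starx (basis D) s = star D s"
  and starx_0_left [simp]: "starx 0 s = 0"
  by (simp_all add: starx_def lin_ext_add lin_ext_pscale lin_ext_diff)

lemma hsp_keys: "x \<in> hsp q A A' \<Longrightarrow> D \<in> Poly_Mapping.keys x \<Longrightarrow> D \<in> dgr m A A'"
  by (auto simp: hsp_def)

lemma starx_add_right:
  assumes "x \<in> hsp q {1..n} {1..N}" "s \<in> TS" "s' \<in> TS"
  shows "starx x (s + s') = starx x s + starx x s'"
proof -
  have "starx x (s + s') = lin_ext (\<lambda>D. star D s + star D s') x"
    unfolding starx_def by (rule lin_ext_cong) (use star_add hsp_keys assms in blast)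
  then show ?thesis by (simp add: starx_def lin_ext_fun_add)
qed

lemma dangle_act_lin:
  "dangle_act m p \<delta> \<rho> n l b (u + u') = dangle_act m p \<delta> \<rho> n l b u + dangle_act m p \<delta> \<rho> n l b u'"
  "dangle_act m p \<delta> \<rho> n l b (u - u') = dangle_act m p \<delta> \<rho> n l b u - dangle_act m p \<delta> \<rho> n l b u'"
  "dangle_act m p \<delta> \<rho> n l b (pscale c u) = pscale c (dangle_act m p \<delta> \<rho> n l b u)"
  "dangle_act m p \<delta> \<rho> n l (b + b') u = dangle_act m p \<delta> \<rho> n l b u + dangle_act m p \<delta> \<rho> n l b' u"
  "dangle_act m p \<delta> \<rho> n l (pscale c b) u = pscale c (dangle_act m p \<delta> \<rho> n l b u)"
proof -
  show a: "dangle_act m p \<delta> \<rho> n l b (u + u') = dangle_act m p \<delta> \<rho> n l b u + dangle_act m p \<delta> \<rho> n l b u'" for u u'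
    by (simp add: dangle_act_def lin_ext_add lin_ext_fun_add)
  show "dangle_act m p \<delta> \<rho> n l b (u - u') = dangle_act m p \<delta> \<rho> n l b u - dangle_act m p \<delta> \<rho> n l b u'"
    using a[of "u - u'" u'] by (simp add: eq_diff_eq)
qed (simp_all add: dangle_act_def lin_ext_add lin_ext_pscale lin_ext_fun_add lin_ext_fun_pscale)

lemma dangle_act_starx:
  assumes b: "b \<in> hsp q {1..n} {1..n}" and x: "x \<in> hsp q' {1..n} {1..N}" and s: "s \<in> TS"
  shows "dangle_act m p \<delta> \<rho> n l b (starx x s) = starx (b \<cdot> x) s"
proof (rule lin_ext_eqI[of b "dgr m {1..n} {1..n}" "\<lambda>b. dangle_act m p \<delta> \<rho> n l b (starx x s)" "\<lambda>b. starx (b \<cdot> x) s"])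
  fix X assume X: "X \<in> dgr m {1..n} {1..n}"
  show "dangle_act m p \<delta> \<rho> n l (basis X) (starx x s) = starx (basis X \<cdot> x) s"
    by (rule lin_ext_eqI[of x Dn "\<lambda>x. dangle_act m p \<delta> \<rho> n l (basis X) (starx x s)" "\<lambda>x. starx (basis X \<cdot> x) s"])
      (use x in \<open>auto simp: hsp_def dangle_act_lin starx_add_left starx_pscale_left dm_add_right dm_pscale_right dangle_act_star[OF X _ s]\<close>)
qed (use b in \<open>auto simp: hsp_def dangle_act_lin starx_add_left starx_pscale_left dm_add_left dm_pscale_left\<close>)

definition act :: "(diagram \<Rightarrow>\<^sub>0 'k) \<Rightarrow> (tableau \<Rightarrow>\<^sub>0 'k) \<Rightarrow> (tableau \<Rightarrow>\<^sub>0 'k)"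
  where "act a s = lin_ext (\<lambda>w. if w \<in> GD then \<rho> w s else 0) a"

lemma act_add: "act (a + a') s = act a s + act a' s"
  and act_pscale: "act (pscale c a) s = pscale c (act a s)"
  by (simp_all add: act_def lin_ext_add lin_ext_pscale)

lemma act_TS: "s \<in> TS \<Longrightarrow> act a s \<in> TS"
  unfolding act_def tableau_space_def mem_Collect_eq
  by (rule keys_lin_ext) (use rho_in in \<open>auto simp: tableau_space_def\<close>)

text \<open>The label sum of a diagram of the algebra is a multiple of \<open>p\<close>, hence of
  \<open>pt\<close>, so the superscript does not change.\<close>

lemma act_SP:
  assumes a: "a \<in> hsp p {1..N} {1..N}" and s: "s \<in> SP z" shows "act a s \<in> SP z"
  unfolding act_def lin_ext_def
proof (rule SP_sum, rule SP_pscale)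
  fix w assume "w \<in> Poly_Mapping.keys a"
  then have "p dvd label_sum w" using a by (auto simp: hsp_def)
  moreover have "pt dvd p" by (metis dvd_mult_div_cancel dvd_triv_right t_dvd)
  ultimately have "pt dvd label_sum w" by (rule dvd_trans[rotated])
  then have "[z + label_sum w = z] (mod pt)" by (simp add: cong_def mod_add_eq[symmetric])
  then show "(if w \<in> GD then \<rho> w s else 0) \<in> SP z" using rho_SP[OF _ s] by simp
qed

text \<open>The balancing relation. Group elements pass through \<open>star\<close> to the Specht
  vector; diagrams with arcs act by 0 there and create too many arcs on the other side.\<close>

lemma starx_dm_right:
  assumes x: "x \<in> hsp q {1..n} {1..N}" and a: "a \<in> hsp q' {1..N} {1..N}" and s: "s \<in> TS"
  shows "starx (x \<cdot> a) s = starx x (act a s)"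
proof (rule lin_ext_eqI[of a "dgr m {1..N} {1..N}" "\<lambda>a. starx (x \<cdot> a) s" "\<lambda>a. starx x (act a s)"])
  fix w assume w: "w \<in> dgr m {1..N} {1..N}"
  show "starx (x \<cdot> basis w) s = starx x (act (basis w) s)"
  proof (rule lin_ext_eqI[of x Dn "\<lambda>x. starx (x \<cdot> basis w) s" "\<lambda>x. starx x (act (basis w) s)"])
    fix D assume D: "D \<in> Dn"
    show "starx (basis D \<cdot> basis w) s = starx (basis D) (act (basis w) s)"
    proof (cases "w \<in> GD")
      case True
      then show ?thesis using star_compose_GD[OF D True s] lf_GD[OF D _ True]
        by (simp add: act_def starx_pscale_left)
    next
      case False
      then show ?thesis using star_compose_not_GD[OF D w False] D by (simp add: act_def starx_pscale_left)
    qed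
  qed (use x in \<open>auto simp: hsp_def starx_add_left starx_pscale_left dm_add_left dm_pscale_left\<close>)
next
  fix a a' show "starx x (act (a + a') s) = starx x (act a s) + starx x (act a' s)"
    unfolding act_add by (rule starx_add_right[OF x act_TS[OF s] act_TS[OF s]])
next
  fix c a
  have "starx x (pscale c y) = pscale c (starx x y)" if "y \<in> TS" for y
  proof -
    have "starx x (pscale c y) = lin_ext (\<lambda>D. pscale c (star D y)) x"
      unfolding starx_def by (rule lin_ext_cong) (use star_pscale hsp_keys[OF x] that in blast)
    then show ?thesis by (simp add: starx_def lin_ext_fun_pscale)
  qed
  then show "starx x (act (pscale c a) s) = pscale c (starx x (act a s))"
    unfolding act_pscale using act_TS[OF s] by simp
qed (use a in \<open>auto simp: hsp_def starx_add_left starx_pscale_left dm_add_right dm_pscale_right\<close>)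

section \<open>The ideal of diagrams with many arcs\<close>

text \<open>An upper bound for \<open>J\<close> that is described by diagrams instead of a
  generator. It suffices for showing that \<open>starx\<close> depends only on classes modulo
  \<open>J\<close>.\<close>

definition Kill :: "(diagram \<Rightarrow>\<^sub>0 'k) set"
  where "Kill = {b. Poly_Mapping.keys b \<subseteq> {D \<in> dgr m {1..n} {1..n}. p dvd label_sum D \<and> card (narcs D) > l}}"

lemma Kill_B: "b \<in> Kill \<Longrightarrow> b \<in> hsp p {1..n} {1..n}"
  by (auto simp: Kill_def hsp_def)

lemma KillI: "b \<in> hsp p {1..n} {1..n} \<Longrightarrow> Poly_Mapping.keys b \<subseteq> {D. card (narcs D) > l} \<Longrightarrow> b \<in> Kill"
  by (auto simp: Kill_def hsp_def)

lemma Kill_keys: "b \<in> Kill \<Longrightarrow> Poly_Mapping.keys b \<subseteq> {D \<in> dgr m {1..n} {1..n}. card (narcs D) > l}"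
  by (auto simp: Kill_def)

lemma ideal_Kill: "ideal Kill (B n)"
proof (rule idealI[OF ring_B])
  interpret B: ring "B n" by (rule ring_B)
  show "subgroup Kill (add_monoid (B n))"
  proof (rule B.add.subgroupI)
    show "Kill \<subseteq> carrier (B n)" using Kill_B by (auto simp: carrier_B)
    show "Kill \<noteq> {}" by (auto simp: Kill_def intro: exI[of _ 0])
    show "\<ominus>\<^bsub>B n\<^esub> a \<in> Kill" if "a \<in> Kill" for a
      using that Kill_B[OF that] by (subst B_minus) (auto simp: carrier_B Kill_def)
    show "a \<oplus>\<^bsub>B n\<^esub> b \<in> Kill" if "a \<in> Kill" "b \<in> Kill" for a b
      using that Poly_Mapping.keys_add[of a b] by (auto simp: Kill_def)
  qed
  fix a x assume a: "a \<in> Kill" and x: "x \<in> carrier (B n)"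
  have x': "x \<in> hsp p {1..n} {1..n}" using x by (simp add: carrier_B)
  have kx: "Poly_Mapping.keys x \<subseteq> dgr m {1..n} {1..n}" using x' by (auto simp: hsp_def)
  show "x \<otimes>\<^bsub>B n\<^esub> a \<in> Kill"
  proof -
    have "Poly_Mapping.keys (x \<cdot> a) \<subseteq> {D. card (narcs D) > l}"
    proof (rule dm_in_span[OF kx Kill_keys[OF a]])
      fix X Y assume "X \<in> dgr m {1..n} {1..n}" and Y: "Y \<in> {D \<in> dgr m {1..n} {1..n}. card (narcs D) > l}"
      then have "card (narcs Y) \<le> card (narcs (compose m X Y))"
        by (intro card_narcs_compose_right) (use mpos in auto)
      then show "compose m X Y \<in> {D. card (narcs D) > l}" using Y by simp
    qed
    then show ?thesis using KillI[OF dm_closed[OF x' Kill_B[OF a]]] by simp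
  qed
  show "a \<otimes>\<^bsub>B n\<^esub> x \<in> Kill"
  proof -
    have "Poly_Mapping.keys (a \<cdot> x) \<subseteq> {D. card (narcs D) > l}"
    proof (rule dm_in_span[OF Kill_keys[OF a] kx])
      fix X Y assume X: "X \<in> {D \<in> dgr m {1..n} {1..n}. card (narcs D) > l}" and "Y \<in> dgr m {1..n} {1..n}"
      then have "card (narcs X) \<le> card (narcs (compose m X Y))"
        by (intro card_narcs_compose_left) (use mpos in auto)
      then show "compose m X Y \<in> {D. card (narcs D) > l}" using X by simp
    qed
    then show ?thesis using KillI[OF dm_closed[OF Kill_B[OF a] x']] by simp
  qed
qed

abbreviation J :: "(diagram \<Rightarrow>\<^sub>0 'k) set" where "J \<equiv> lower_ideal m p d \<delta> i0 n l"

text \<open>The generator of \<open>J\<close> factors through \<open>n - 2 * Suc l\<close> strands.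
  A diagram with so few southern nodes has at least \<open>l + 1\<close> northern arcs, and
  composing from below keeps them.\<close>

lemma ideal_J: "ideal J (B n)" and J_Kill: "J \<subseteq> Kill"
proof -
  interpret B: ring "B n" by (rule ring_B)
  have "ideal J (B n) \<and> J \<subseteq> Kill"
  proof (cases "idem_exists d \<delta> n (Suc l)")
    case True
    let ?M = "n - 2 * Suc l"
    have n: "2 * Suc l \<le> n" using True by (simp add: idem_exists_def)
    obtain U' W' where U': "U' \<in> hsp p {1..n} {1..?M}" and W': "W' \<in> hsp p {1..?M} {1..n}"
      and c: "\<And>x. x \<in> hsp 1 {1..?M} {1..?M} \<Longrightarrow> corner m p d \<delta> i0 n (Suc l) x = U' \<cdot> (x \<cdot> W')"
      using corner_factor[OF True] by metis
    have e: "idem m p d \<delta> i0 n (Suc l) = U' \<cdot> W'"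
      unfolding idem_def id_diagram_idd c[OF idd_in_hsp] by (subst dm_one_left[OF W']) auto
    have "U' \<cdot> W' \<in> hsp p {1..n} {1..n}" by (rule dm_closed[OF U' W']) auto
    moreover have "Poly_Mapping.keys (U' \<cdot> W') \<subseteq> {D. card (narcs D) > l}"
    proof (rule dm_in_span[of _ "dgr m {1..n} {1..?M}" _ "dgr m {1..?M} {1..n}"])
      fix X Y assume X: "X \<in> dgr m {1..n} {1..?M}" and Y: "Y \<in> dgr m {1..?M} {1..n}"
      have "card (narcs X) \<le> card (narcs (compose m X Y))"
        by (rule card_narcs_compose_left[OF X Y]) (use mpos in auto)
      moreover have "n + 2 * card (narcs (flip X)) = ?M + 2 * card (narcs X)" using arcs_count[OF X] by simp
      ultimately show "compose m X Y \<in> {D. card (narcs D) > l}" using n by auto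
    qed (use U' W' in \<open>auto simp: hsp_def\<close>)
    ultimately have i: "idem m p d \<delta> i0 n (Suc l) \<in> Kill" unfolding e by (rule KillI)
    then have ic: "{idem m p d \<delta> i0 n (Suc l)} \<subseteq> carrier (B n)" using Kill_B by (auto simp: carrier_B)
    have "J = genideal (B n) {idem m p d \<delta> i0 n (Suc l)}" using True by (simp add: lower_ideal_def)
    then show ?thesis using B.genideal_ideal[OF ic] B.genideal_minimal[OF ideal_Kill] i by simp
  next
    case False
    then have "J = {0}" by (simp add: lower_ideal_def)
    then show ?thesis using B.zeroideal by (auto simp: Kill_def)
  qed
  then show "ideal J (B n)" "J \<subseteq> Kill" by auto
qed

lemma starx_Kill:
  assumes b: "b \<in> Kill" shows "starx (b \<cdot> U) s = 0"
proof -
  have "Poly_Mapping.keys (b \<cdot> U) \<subseteq> {D. card (narcs D) > l}"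
  proof (rule dm_in_span[OF Kill_keys[OF b], of _ "dgr m {1..n} {1..N}"])
    fix X Y assume X: "X \<in> {D \<in> dgr m {1..n} {1..n}. card (narcs D) > l}" and "Y \<in> Dn"
    then have "card (narcs X) \<le> card (narcs (compose m X Y))"
      by (intro card_narcs_compose_left) (use mpos in auto)
    then show "compose m X Y \<in> {D. card (narcs D) > l}" using X by simp
  qed (use U in \<open>auto simp: hsp_def\<close>)
  then have "starx (b \<cdot> U) s = lin_ext (\<lambda>D. 0) (b \<cdot> U)"
    unfolding starx_def by (intro lin_ext_cong) (auto simp: star_def)
  then show ?thesis by simp
qed

section \<open>The left module of the tensor product\<close>

abbreviation Q where "Q \<equiv> B n Quot J"

text \<open>The classes that make up the corner module, parametrised by \<open>H\<close>. Before
  passing to the quotient the parameter is recovered by multiplying with \<open>U\<close>, as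
  \<open>W \<cdot> U = 1\<close>.\<close>

definition cl :: "(diagram \<Rightarrow>\<^sub>0 'k) \<Rightarrow> (diagram \<Rightarrow>\<^sub>0 'k) set"
  where "cl x = J +>\<^bsub>B n\<^esub> (x \<cdot> W)"

abbreviation H :: "(diagram \<Rightarrow>\<^sub>0 'k) set" where "H \<equiv> hsp p {1..n} {1..N}"

lemma Quot_carrier: "carrier Q = (\<lambda>b. J +>\<^bsub>B n\<^esub> b) ` carrier (B n)"
  by (auto simp: FactRing_def A_RCOSETS_def' )

lemma Quot_mult: "a \<in> carrier (B n) \<Longrightarrow> b \<in> carrier (B n) \<Longrightarrow> (J +>\<^bsub>B n\<^esub> a) \<otimes>\<^bsub>Q\<^esub> (J +>\<^bsub>B n\<^esub> b) = J +>\<^bsub>B n\<^esub> (a \<cdot> b)"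
  using ring_hom_mult[OF ideal.rcos_ring_hom[OF ideal_J]] by simp

lemma Quot_add: "a \<in> carrier (B n) \<Longrightarrow> b \<in> carrier (B n) \<Longrightarrow> (J +>\<^bsub>B n\<^esub> a) \<oplus>\<^bsub>Q\<^esub> (J +>\<^bsub>B n\<^esub> b) = J +>\<^bsub>B n\<^esub> (a + b)"
  using ring_hom_add[OF ideal.rcos_ring_hom[OF ideal_J]] by simp

lemma coset_B_mem: "x \<in> J +>\<^bsub>B n\<^esub> a \<longleftrightarrow> x - a \<in> J"
proof
  assume "x \<in> J +>\<^bsub>B n\<^esub> a" then show "x - a \<in> J" by (auto simp: a_r_coset_def')
next
  assume "x - a \<in> J"
  then have "x - a + a \<in> J +>\<^bsub>B n\<^esub> a" unfolding a_r_coset_def' by force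
  then show "x \<in> J +>\<^bsub>B n\<^esub> a" by simp
qed

lemma xW: "x \<in> H \<Longrightarrow> x \<cdot> W \<in> carrier (B n)"
  unfolding carrier_B by (rule dm_closed[OF _ W]) auto

lemma xWU: "x \<in> H \<Longrightarrow> x \<cdot> W \<cdot> U = x"
  by (subst dm_assoc[OF hsp_mono hsp_mono[OF W] hsp_mono[OF U]]) (auto simp: WU dm_one_right)

text \<open>If the classes agree, the difference of \<open>x \<cdot> W\<close> and
  \<open>y \<cdot> W\<close> lies in \<open>J\<close>, hence in \<open>Kill\<close>. Multiplication
  by \<open>U\<close> turns it into \<open>x - y\<close>, and \<open>starx\<close> vanishes on
  \<open>Kill\<close> times \<open>U\<close>.\<close>

lemma starx_cong:
  assumes "x \<in> H" "y \<in> H" "cl x = cl y" shows "starx x s = starx y s"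
proof -
  have "0 \<in> J" by (rule additive_subgroup.zero_closed[OF ideal.axioms(1)[OF ideal_J], simplified])
  then have "x \<cdot> W \<in> cl x" unfolding cl_def coset_B_mem by simp
  then have "x \<cdot> W - y \<cdot> W \<in> J" unfolding assms(3) unfolding cl_def coset_B_mem .
  then have "starx ((x \<cdot> W - y \<cdot> W) \<cdot> U) s = 0" using starx_Kill J_Kill by blast
  then show ?thesis unfolding dm_diff_left starx_diff_left xWU[OF assms(1)] xWU[OF assms(2)] by simp
qed

lemma cl_add: "x \<in> H \<Longrightarrow> y \<in> H \<Longrightarrow> cl x \<oplus>\<^bsub>Q\<^esub> cl y = cl (x + y)"
  unfolding cl_def by (simp add: Quot_add xW dm_add_left)

lemma cl_smult: "b \<in> carrier (B n) \<Longrightarrow> x \<in> H \<Longrightarrow> (J +>\<^bsub>B n\<^esub> b) \<otimes>\<^bsub>Q\<^esub> cl x = cl (b \<cdot> x)"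
proof -
  assume b: "b \<in> carrier (B n)" and x: "x \<in> H"
  have "b \<cdot> (x \<cdot> W) = b \<cdot> x \<cdot> W"
    by (rule dm_assoc[symmetric, OF hsp_mono[OF b[unfolded carrier_B]] hsp_mono[OF x] hsp_mono[OF W]]) auto
  then show ?thesis unfolding cl_def using Quot_mult[OF b xW[OF x]] by simp
qed

lemma corner_H: "c \<in> hsp p {1..N} {1..N} \<Longrightarrow> corner m p d \<delta> i0 n l c = U \<cdot> (c \<cdot> W)"
  by (rule corner[OF hsp_mono])

lemma cW: "c \<in> hsp p {1..N} {1..N} \<Longrightarrow> c \<cdot> W \<in> hsp p {1..N} {1..n}"
  by (rule dm_closed[OF _ W]) auto

lemma UcW: "c \<in> hsp p {1..N} {1..N} \<Longrightarrow> U \<cdot> (c \<cdot> W) \<in> carrier (B n)"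
  unfolding carrier_B by (rule dm_closed[OF U cW]) auto

text \<open>Because \<open>W \<cdot> U = 1\<close>, the action of a corner element
  \<open>U c W\<close> from the right is composition with \<open>c\<close> from below.\<close>

lemma cl_ract:
  assumes x: "x \<in> H" and c: "c \<in> hsp p {1..N} {1..N}"
  shows "cl x \<otimes>\<^bsub>Q\<^esub> (J +>\<^bsub>B n\<^esub> corner m p d \<delta> i0 n l c) = cl (x \<cdot> c)"
proof -
  have "x \<cdot> W \<cdot> (U \<cdot> (c \<cdot> W)) = x \<cdot> W \<cdot> U \<cdot> (c \<cdot> W)"
    by (rule dm_assoc[symmetric, OF hsp_mono[OF xW[OF x, unfolded carrier_B]] hsp_mono[OF U] hsp_mono[OF cW[OF c]]]) auto
  also have "\<dots> = x \<cdot> c \<cdot> W" unfolding xWU[OF x]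
    by (rule dm_assoc[symmetric, OF hsp_mono[OF x] hsp_mono[OF c] hsp_mono[OF W]]) auto
  finally show ?thesis unfolding cl_def corner_H[OF c] by (simp add: Quot_mult xW[OF x] UcW[OF c])
qed

definition Qe :: "(diagram \<Rightarrow>\<^sub>0 'k, (diagram \<Rightarrow>\<^sub>0 'k) set) module"
  where "Qe = \<lparr>carrier = {y \<otimes>\<^bsub>Q\<^esub> (J +>\<^bsub>B n\<^esub> idem m p d \<delta> i0 n l) | y. y \<in> carrier Q},
               monoid.mult = undefined, monoid.one = undefined, ring.zero = \<zero>\<^bsub>Q\<^esub>, ring.add = ring.add Q,
               module.smult = (\<lambda>b y. (J +>\<^bsub>B n\<^esub> b) \<otimes>\<^bsub>Q\<^esub> y)\<rparr>"

lemma Qe_simps [simp]: "x \<oplus>\<^bsub>Qe\<^esub> y = x \<oplus>\<^bsub>Q\<^esub> y" "b \<odot>\<^bsub>Qe\<^esub> y = (J +>\<^bsub>B n\<^esub> b) \<otimes>\<^bsub>Q\<^esub> y"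
  by (simp_all add: Qe_def)

lemma idem_UW: "idem m p d \<delta> i0 n l = U \<cdot> W"
  unfolding idem_def id_diagram_idd corner[OF idd_in_hsp] by (subst dm_one_left[OF W]) auto

lemma UW: "U \<cdot> W \<in> carrier (B n)"
  unfolding carrier_B by (rule dm_closed[OF U W]) auto

text \<open>The idempotent is \<open>U \<cdot> W\<close>: a product \<open>b U W\<close> has the
  parameter \<open>b U\<close>, and conversely \<open>x W\<close> equals
  \<open>(x W) (U W)\<close>.\<close>

lemma carrier_Qe: "carrier Qe = cl ` H"
proof -
  have "carrier Qe = (\<lambda>b. J +>\<^bsub>B n\<^esub> (b \<cdot> (U \<cdot> W))) ` carrier (B n)"
    unfolding Qe_def idem_UW Quot_carrier by (auto simp: Quot_mult UW image_iff intro!: exI bexI)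
  also have "\<dots> = cl ` H"
  proof
    show "(\<lambda>b. J +>\<^bsub>B n\<^esub> (b \<cdot> (U \<cdot> W))) ` carrier (B n) \<subseteq> cl ` H"
    proof (rule image_subsetI)
      fix b assume b: "b \<in> carrier (B n)"
      have "b \<cdot> (U \<cdot> W) = b \<cdot> U \<cdot> W"
        by (rule dm_assoc[symmetric, OF hsp_mono[OF b[unfolded carrier_B]] hsp_mono[OF U] hsp_mono[OF W]]) auto
      moreover have "b \<cdot> U \<in> H" by (rule dm_closed[OF b[unfolded carrier_B] U]) auto
      ultimately show "J +>\<^bsub>B n\<^esub> (b \<cdot> (U \<cdot> W)) \<in> cl ` H" unfolding cl_def by auto
    qed
    show "cl ` H \<subseteq> (\<lambda>b. J +>\<^bsub>B n\<^esub> (b \<cdot> (U \<cdot> W))) ` carrier (B n)"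
    proof (rule image_subsetI)
      fix x assume x: "x \<in> H"
      have "x \<cdot> W \<cdot> (U \<cdot> W) = x \<cdot> W \<cdot> U \<cdot> W"
        by (rule dm_assoc[symmetric, OF hsp_mono[OF xW[OF x, unfolded carrier_B]] hsp_mono[OF U] hsp_mono[OF W]]) auto
      also have "\<dots> = x \<cdot> W" unfolding xWU[OF x] ..
      finally show "cl x \<in> (\<lambda>b. J +>\<^bsub>B n\<^esub> (b \<cdot> (U \<cdot> W))) ` carrier (B n)"
        unfolding cl_def using xW[OF x] by (metis (no_types, lifting) image_eqI)
    qed
  qed
  finally show ?thesis .
qed

abbreviation SM where "SM \<equiv> specht_module m d \<xi> \<rho> lam N t r"

lemma SM_simps [simp]: "carrier SM = SP r" "x \<oplus>\<^bsub>SM\<^esub> y = x + y" "a \<odot>\<^bsub>SM\<^esub> x = act a x"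
  by (simp_all add: specht_module_def act_def)

abbreviation ract :: "(diagram \<Rightarrow>\<^sub>0 'k) set \<Rightarrow> (diagram \<Rightarrow>\<^sub>0 'k) \<Rightarrow> (diagram \<Rightarrow>\<^sub>0 'k) set"
  where "ract \<equiv> \<lambda>y c. y \<otimes>\<^bsub>Q\<^esub> (J +>\<^bsub>B n\<^esub> corner m p d \<delta> i0 n l c)"

lemma bx: "b \<in> carrier (B n) \<Longrightarrow> x \<in> H \<Longrightarrow> b \<cdot> x \<in> H"
  unfolding carrier_B by (rule dm_closed) auto

lemma xc: "x \<in> H \<Longrightarrow> c \<in> hsp p {1..N} {1..N} \<Longrightarrow> x \<cdot> c \<in> H"
  by (rule dm_closed) auto

lemma b_assoc: "a \<in> carrier (B n) \<Longrightarrow> b \<in> carrier (B n) \<Longrightarrow> x \<in> H \<Longrightarrow> a \<cdot> b \<cdot> x = a \<cdot> (b \<cdot> x)"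
  unfolding carrier_B by (rule dm_assoc[OF hsp_mono hsp_mono hsp_mono]) auto

lemma bc_assoc: "b \<in> carrier (B n) \<Longrightarrow> x \<in> H \<Longrightarrow> c \<in> hsp p {1..N} {1..N} \<Longrightarrow> b \<cdot> x \<cdot> c = b \<cdot> (x \<cdot> c)"
  unfolding carrier_B by (rule dm_assoc[OF hsp_mono hsp_mono hsp_mono]) auto

lemma tensor_data_Qe: "tensor_data (B n) Qe ract (B N) SM"
proof (rule tensor_data.intro)
  interpret B: ring "B n" by (rule ring_B)
  note [simp] = carrier_Qe image_iff and [simp del] = One_nat_def
  show "ring (B n)" by (rule ring_B)
  have sm: "b \<odot>\<^bsub>Qe\<^esub> cl x = cl (b \<cdot> x)" if "b \<in> carrier (B n)" "x \<in> H" for b x using cl_smult[OF that] by simp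
  { fix y y' assume "y \<in> carrier Qe" "y' \<in> carrier Qe"
    then obtain x x' where x: "y = cl x" "x \<in> H" "y' = cl x'" "x' \<in> H" by auto
    show "y \<oplus>\<^bsub>Qe\<^esub> y' \<in> carrier Qe" using x hsp_add cl_add by auto
    fix b assume b: "b \<in> carrier (B n)"
    show "b \<odot>\<^bsub>Qe\<^esub> (y \<oplus>\<^bsub>Qe\<^esub> y') = b \<odot>\<^bsub>Qe\<^esub> y \<oplus>\<^bsub>Qe\<^esub> b \<odot>\<^bsub>Qe\<^esub> y'"
      using x b by (simp add: cl_add cl_smult hsp_add dm_add_right bx) }
  { fix a b y assume ab: "a \<in> carrier (B n)" "b \<in> carrier (B n)" and "y \<in> carrier Qe"
    then obtain x where x: "y = cl x" "x \<in> H" by auto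
    have "a + b \<in> carrier (B n)" "a \<cdot> b \<in> carrier (B n)" using B.a_closed[OF ab] B.m_closed[OF ab] by simp_all
    then show "(a \<oplus>\<^bsub>B n\<^esub> b) \<odot>\<^bsub>Qe\<^esub> y = a \<odot>\<^bsub>Qe\<^esub> y \<oplus>\<^bsub>Qe\<^esub> b \<odot>\<^bsub>Qe\<^esub> y"
      "(a \<otimes>\<^bsub>B n\<^esub> b) \<odot>\<^bsub>Qe\<^esub> y = a \<odot>\<^bsub>Qe\<^esub> (b \<odot>\<^bsub>Qe\<^esub> y)"
      using x ab by (simp_all add: cl_add cl_smult dm_add_left bx b_assoc) }
  { fix y assume "y \<in> carrier Qe"
    then obtain x where x: "y = cl x" "x \<in> H" by auto
    show "\<one>\<^bsub>B n\<^esub> \<odot>\<^bsub>Qe\<^esub> y = y"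
      using x sm[OF B.one_closed x(2)] dm_one_left[OF x(2)] by (simp add: id_diagram_idd)
    fix b assume b: "b \<in> carrier (B n)"
    show "b \<odot>\<^bsub>Qe\<^esub> y \<in> carrier Qe" using x b by (auto simp: cl_smult bx)
    fix c assume c: "c \<in> carrier (B N)"
    then have c': "c \<in> hsp p {1..N} {1..N}" by (simp add: carrier_B)
    show "b \<odot>\<^bsub>Qe\<^esub> ract y c = ract (b \<odot>\<^bsub>Qe\<^esub> y) c"
      using x b c' by (simp add: cl_smult cl_ract xc bx bc_assoc) }
  { fix y c assume "y \<in> carrier Qe" "c \<in> carrier (B N)"
    then obtain x where x: "y = cl x" "x \<in> H" and c': "c \<in> hsp p {1..N} {1..N}" by (auto simp: carrier_B)
    show "ract y c \<in> carrier Qe" using x c' by (auto simp: cl_ract xc) }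
qed (auto simp: SP_add act_SP carrier_B)

end

lemma lin_ext_compose: "lin_ext g (lin_ext f x) = lin_ext (\<lambda>a. lin_ext g (f a)) x"
  unfolding lin_ext_def[of f] lin_ext_sum lin_ext_pscale by (simp add: lin_ext_def)

context standard_setup
begin

section \<open>Comparison of the tensor product with the dangle module\<close>

text \<open>The tableau part of the coefficient of the dangle \<open>v\<close>; elements are thereby
  split into pure tensors over single dangles.\<close>

definition slice :: "dangle \<Rightarrow> (dangle \<times> tableau \<Rightarrow>\<^sub>0 'k) \<Rightarrow> (tableau \<Rightarrow>\<^sub>0 'k)"
  where "slice v = lin_ext (\<lambda>(v', T). if v' = v then basis T else 0)"

lemma slice_lin: "slice v (u + u') = slice v u + slice v u'" "slice v (u - u') = slice v u - slice v u'"
    "slice v (pscale c u) = pscale c (slice v u)" "slice v 0 = 0"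
  by (simp_all add: slice_def lin_ext_add lin_ext_diff lin_ext_pscale)

lemma slice_ptensor: "slice v (ptensor x y) = pscale (Poly_Mapping.lookup x v) y"
proof (rule lin_ext_eqI[of x UNIV "\<lambda>x. slice v (ptensor x y)" "\<lambda>x. pscale (Poly_Mapping.lookup x v) y"])
  fix a
  have "slice v (ptensor (basis a) y) = lin_ext (\<lambda>b. if a = v then basis b else 0) y"
    by (simp add: ptensor_basis slice_def lin_ext_compose)
  also have "\<dots> = (if a = v then y else 0)" by (simp add: lin_ext_expand)
  also have "\<dots> = pscale (Poly_Mapping.lookup (basis a) v) y" by (simp add: lookup_basis)
  finally show "slice v (ptensor (basis a) y) = pscale (Poly_Mapping.lookup (basis a) v) y" .
qed (auto simp: ptensor_def lin_ext_add lin_ext_pscale slice_lin lookup_add pscale.scale_left_distrib)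

abbreviation PM where "PM \<equiv> dangle_module m p d \<xi> \<delta> \<rho> n l lam t r"

abbreviation gens :: "(dangle \<times> tableau \<Rightarrow>\<^sub>0 'k) set"
  where "gens \<equiv> {ptensor v x | v x q. q < pt \<and> v \<in> dangle_space m n l q pt \<and> x \<in> SP ((q + r) mod pt)}"

lemma carrier_PM: "carrier PM = pscale.span gens"
  by (simp add: dangle_module_def)

lemma PM_simps [simp]: "\<zero>\<^bsub>PM\<^esub> = 0" "u \<oplus>\<^bsub>PM\<^esub> v = u + v" "b \<odot>\<^bsub>PM\<^esub> u = dangle_act m p \<delta> \<rho> n l b u"
  by (simp_all add: dangle_module_def)

lemma SP_diff: "x \<in> SP z \<Longrightarrow> y \<in> SP z \<Longrightarrow> x - y \<in> SP z"
  using SP_add[of x z "pscale (-1) y"] SP_pscale[of y z "-1"] by (simp add: pscale.scale_minus_left)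

text \<open>On a generator the label sum of each dangle is congruent to \<open>q\<close>, so the
  superscript is determined by the dangle. It can be left unreduced by
  \<open>SP_cong\<close>.\<close>

lemma PM_slice:
  assumes "u \<in> carrier PM"
  shows "Poly_Mapping.keys u \<subseteq> DG \<times> UNIV" and "v \<in> DG \<Longrightarrow> slice v u \<in> SP (label_sum v + r)"
proof -
  have "Poly_Mapping.keys u \<subseteq> DG \<times> UNIV \<and> (\<forall>v\<in>DG. slice v u \<in> SP (label_sum v + r))"
    using assms unfolding carrier_PM
  proof (induction rule: pscale.span_induct)
    case base
    show ?case
    proof (rule pscale.subspaceI)
      show "x + y \<in> {u. Poly_Mapping.keys u \<subseteq> DG \<times> UNIV \<and> (\<forall>v\<in>DG. slice v u \<in> SP (label_sum v + r))}"
        if "x \<in> {u. Poly_Mapping.keys u \<subseteq> DG \<times> UNIV \<and> (\<forall>v\<in>DG. slice v u \<in> SP (label_sum v + r))}"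
          "y \<in> {u. Poly_Mapping.keys u \<subseteq> DG \<times> UNIV \<and> (\<forall>v\<in>DG. slice v u \<in> SP (label_sum v + r))}" for x y
        using that Poly_Mapping.keys_add[of x y] by (auto simp: slice_lin SP_add)
      show "pscale c x \<in> {u. Poly_Mapping.keys u \<subseteq> DG \<times> UNIV \<and> (\<forall>v\<in>DG. slice v u \<in> SP (label_sum v + r))}"
        if "x \<in> {u. Poly_Mapping.keys u \<subseteq> DG \<times> UNIV \<and> (\<forall>v\<in>DG. slice v u \<in> SP (label_sum v + r))}" for c x
        using that keys_pscale[of c x] by (auto simp: slice_lin SP_pscale)
    qed (simp add: slice_lin)
  next
    case (step u)
    then obtain x y q where u: "u = ptensor x y" and x: "x \<in> dangle_space m n l q pt" and y: "y \<in> SP ((q + r) mod pt)"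
      by blast
    have kx: "Poly_Mapping.keys x \<subseteq> {v \<in> DG. [label_sum v = q] (mod pt)}" using x by (simp add: dangle_space_def)
    have "Poly_Mapping.keys u \<subseteq> DG \<times> UNIV"
      unfolding u ptensor_def by (intro keys_lin_ext) (use kx in auto)
    moreover have "slice v u \<in> SP (label_sum v + r)" if "v \<in> DG" for v
    proof (cases "v \<in> Poly_Mapping.keys x")
      case True
      then have "[label_sum v = q] (mod pt)" using kx by auto
      then have "[(q + r) mod pt = label_sum v + r] (mod pt)"
        by (metis cong_add_rcancel_nat cong_mod_left cong_refl cong_sym cong_trans)
      then have "y \<in> SP (label_sum v + r)" using y SP_cong by blast
      then show ?thesis unfolding u slice_ptensor by (rule SP_pscale)
    next
      case False
      then show ?thesis unfolding u slice_ptensor by (simp add: in_keys_iff)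
    qed
    ultimately show ?case by blast
  qed
  then show "Poly_Mapping.keys u \<subseteq> DG \<times> UNIV" "v \<in> DG \<Longrightarrow> slice v u \<in> SP (label_sum v + r)" by auto
qed

lemma slice_expand:
  assumes "Poly_Mapping.keys u \<subseteq> DG \<times> UNIV"
  shows "u = (\<Sum>v\<in>DG. ptensor (basis v) (slice v u))"
proof (rule lin_ext_eqI[OF assms, of "\<lambda>u. u"])
  fix a assume "a \<in> DG \<times> (UNIV :: tableau set)"
  then obtain v0 T where a: "a = (v0, T)" "v0 \<in> DG" by auto
  have "(\<Sum>v\<in>DG. ptensor (basis v) (slice v (basis a))) = (\<Sum>v\<in>DG. if v = v0 then basis (v0, T) else 0)"
    by (rule sum.cong) (auto simp: a slice_def ptensor_basis)
  also have "\<dots> = basis a" using a finite_dangles by (simp add: sum.delta)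
  finally show "basis a = (\<Sum>v\<in>DG. ptensor (basis v) (slice v (basis a)))" by simp
qed (simp_all add: slice_lin ptensor_add_right ptensor_pscale_right sum.distrib pscale.scale_sum_right)

section \<open>Powers of t_1 and lifting of dangles\<close>

definition tt :: "nat \<Rightarrow> diagram" where "tt j = t_diagram m N 1 j"

lemma tt_gs: "tt j = gs id (\<lambda>a. if a = 1 then j mod m else 0)"
  unfolding tt_def by (rule t_diagram_gs)

lemma tt_GD: "tt j \<in> GD"
  unfolding tt_gs by (rule gs_GD[OF _ labt]) simp

lemma tt_compose: "compose m (tt i) (tt j) = tt (i + j)"
proof -
  let ?a = "\<lambda>j a. if a = 1 then j mod m else (0::nat)"
  have "compose m (gs id (?a i)) (gs id (?a j)) = gs (id \<circ> id) (\<lambda>k. (?a i k + ?a j (id k)) mod m)"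
    by (rule compose_gs(1)[OF _ labt _ labt]) simp_all
  also have "\<dots> = gs id (?a (i + j))" by (rule gs_cong) (simp add: mod_simps)
  finally show ?thesis unfolding tt_gs .
qed

lemma tt_id: "m dvd j \<Longrightarrow> tt j = idd {1..N}"
  unfolding tt_gs idd_def by (rule gs_cong) auto

text \<open>On zero strands \<open>tt j\<close> is the empty diagram and carries no label; hence the
  exceptional case.\<close>

lemma label_sum_tt: "label_sum (tt j) = (if N = 0 then 0 else j mod m)"
  unfolding tt_gs label_sum_gs by (simp add: sum.delta)

lemma GD_compose: "w \<in> GD \<Longrightarrow> w' \<in> GD \<Longrightarrow> compose m w w' \<in> GD"
proof -
  assume "w \<in> GD" "w' \<in> GD"
  then obtain b c b' c' where w: "perm b" "lab c" "w = gs b c" "perm b'" "lab c'" "w' = gs b' c'"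
    unfolding group_diagrams_strands by blast
  show ?thesis unfolding w(3,6) compose_gs(1)[OF w(1,2,4,5)]
    by (rule gs_GD[OF bij_betw_trans[OF w(1,4)]]) (use mpos in auto)
qed

lemma GD_no_strands: "w \<in> GD \<Longrightarrow> N = 0 \<Longrightarrow> label_sum w = 0"
  unfolding group_diagrams_strands by (auto simp: strands_def label_sum_def)

lemma label_sum_compose_GD:
  assumes "D \<in> dgr m A {1..N}" "finite A" "w \<in> GD"
  shows "[label_sum (compose m D w) = label_sum D + label_sum w] (mod p)"
  by (rule label_sum_compose[OF good_dgr[OF assms(2) _ assms(1)] good_dgr[OF _ _ GD_dgr[OF assms(3)]] pm, of \<delta>])
    (use lf_GD[OF assms] in auto)

lemma pt_dvd_p: "pt dvd p" by (metis dvd_mult_div_cancel dvd_triv_right t_dvd)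

text \<open>The condition under which \<open>E v\<close> lies in \<open>H\<close>. With a free line
  present, its label cancels that of the arcs; without one, the label sum of the arcs must be
  divisible by \<open>p\<close> from the start.\<close>

definition liftable :: "dangle \<Rightarrow> bool"
  where "liftable v \<longleftrightarrow> N \<noteq> 0 \<or> p dvd label_sum v"

text \<open>Only \<open>N = 0\<close> is left, so \<open>r = 0\<close> and
  \<open>SP_no_strands\<close> applies to the label sum of \<open>v\<close> itself. These dangles
  contribute nothing to the span.\<close>

lemma not_liftable: "y \<in> SP (label_sum v + r) \<Longrightarrow> \<not> liftable v \<Longrightarrow> y = 0"
  using SP_no_strands[of y "label_sum v + r"] r0 l2 by (auto simp: liftable_def)

text \<open>\<open>t\<^sub>1\<close> moves the label sum of a dangle to its free lines, so that the diagram \<open>E v\<close> has label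
  sum \<open>0\<close> modulo \<open>p\<close>, at the cost of changing the Specht space.\<close>

definition E :: "dangle \<Rightarrow> diagram"
  where "E v = compose m (dd v) (tt (label_sum v * (m - 1)))"

lemma E_props:
  assumes v: "v \<in> DG"
  shows "E v \<in> Dn" "liftable v \<Longrightarrow> basis (E v) \<in> H" "compose m (E v) (tt (label_sum v)) = dd v"
proof -
  note dv = dd_props(1)[OF v]
  show EDn: "E v \<in> Dn" unfolding E_def by (rule compose_in_dgr[OF dv GD_dgr[OF tt_GD]]) (use mpos in auto)
  \<comment> \<open>Multiplication by \<open>m - 1\<close> is negation modulo \<open>m\<close>, so
    the exponent in \<open>E v\<close> is the negative of the label sum.\<close>
  have m1: "label_sum v * (m - 1) + label_sum v = label_sum v * m" using mpos by (simp add: algebra_simps)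
  have "[label_sum (E v) = label_sum v + label_sum (tt (label_sum v * (m - 1)))] (mod p)"
    unfolding E_def using label_sum_compose_GD[OF dv _ tt_GD] dd_props(3)[OF v] by simp
  moreover have "p dvd label_sum v + label_sum (tt (label_sum v * (m - 1)))" if "liftable v"
  proof (cases "N = 0")
    case True
    then show ?thesis using that by (simp add: label_sum_tt liftable_def)
  next
    case False
    have "(label_sum v + (label_sum v * (m - 1)) mod m) mod m = (label_sum v * m) mod m"
      using m1 by (simp add: mod_simps add.commute)
    then have "m dvd label_sum v + (label_sum v * (m - 1)) mod m" by (simp add: mod_eq_0_iff_dvd)
    then show ?thesis using False pm by (simp add: label_sum_tt) (metis dvd_trans)
  qed
  ultimately show "liftable v \<Longrightarrow> basis (E v) \<in> H" using EDn by (simp add: hsp_basis cong_dvd_iff)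
  have g: "good (dd v)" "good (tt j)" for j using good_dgr[OF _ _ dv] good_dgr[OF _ _ GD_dgr[OF tt_GD]] by auto
  show "compose m (E v) (tt (label_sum v)) = dd v"
    unfolding E_def compose_assoc(1)[OF g(1) g(2) g(2)] tt_compose m1
    by (subst tt_id) (simp_all add: compose_idd_right[OF dv] del: One_nat_def)
qed

text \<open>With a free line, t_1 to the power of the label sum lowers the superscript by it. With
  none, nothing moves, but then \<open>pt\<close> divides the label sum and the superscripts agree
  already.\<close>

lemma rho_tt:
  assumes "liftable v" "y \<in> SP (label_sum v + r)" shows "\<rho> (tt (label_sum v)) y \<in> SP r"
proof (rule rho_SP[OF tt_GD assms(2)])
  have ptm: "pt dvd m" using pt_dvd_p pm by (rule dvd_trans)
  show "[r + label_sum (tt (label_sum v)) = label_sum v + r] (mod pt)"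
  proof (cases "N = 0")
    case True
    then have "pt dvd label_sum v" using assms(1) pt_dvd_p by (auto simp: liftable_def intro: dvd_trans)
    then have "[0 = label_sum v] (mod pt)" by (simp add: cong_def mod_eq_0_iff_dvd)
    then show ?thesis using True cong_add_rcancel_nat[of 0 r "label_sum v" pt] by (simp add: label_sum_tt)
  next
    case False
    have "[label_sum v mod m = label_sum v] (mod pt)" by (rule cong_dvd_modulus_nat[OF _ ptm]) (simp add: cong_def)
    then show ?thesis using False cong_add_rcancel_nat[of "label_sum v mod m" r "label_sum v" pt]
      by (simp add: label_sum_tt add.commute)
  qed
qed

text \<open>The powers of t_1 in \<open>E v\<close> and in front of \<open>y\<close> cancel. So
  every pure tensor over a liftable dangle is reached from an element of the tensor product.\<close>

lemma star_E:
  assumes v: "v \<in> DG" and y: "y \<in> TS"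
  shows "star (E v) (\<rho> (tt (label_sum v)) y) = ptensor (basis v) y"
proof -
  have "star (E v) (\<rho> (tt (label_sum v)) y) = star (dd v) y"
    using star_compose_GD[OF E_props(1)[OF v] tt_GD[of "label_sum v"] y] E_props(3)[OF v] by simp
  also have "through n (dd v) = id_diagram N"
    unfolding dangle_diagram_normal[OF v] through_normal[OF v] id_diagram_idd idd_def ..
  then have "star (dd v) y = ptensor (basis v) y"
    using dd_props[OF v] y by (simp add: star_def rho_id)
  finally show ?thesis .
qed

text \<open>The label sum of \<open>D\<close> is divisible by \<open>p\<close>, so the labels of its
  arcs and of its group element are opposite modulo p/t, and the superscript rises by exactly the
  label sum of the dangle.\<close>

lemma starx_PM:
  assumes x: "x \<in> H" and s: "s \<in> SP r"
  shows "starx x s \<in> carrier PM"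
  unfolding carrier_PM starx_def lin_ext_def
proof (rule pscale.span_sum, rule pscale.span_scale)
  fix D assume "D \<in> Poly_Mapping.keys x"
  then have D: "D \<in> Dn" "p dvd label_sum D" using x by (auto simp: hsp_def)
  show "star D s \<in> pscale.span gens"
  proof (cases "card (narcs D) \<le> l")
    case True
    note dc = decompose[OF D(1) True]
    let ?q = "label_sum (narcs D) mod pt"
    have "pt dvd label_sum D" using pt_dvd_p D(2) by (rule dvd_trans)
    then have "[label_sum (narcs D) + label_sum (through n D) = 0] (mod pt)"
      using dc(4) by (simp add: cong_def mod_eq_0_iff_dvd)
    then have "[label_sum (narcs D) + label_sum (through n D) + r = 0 + r] (mod pt)" by (rule cong_add[OF _ cong_refl])
    then have "\<rho> (through n D) s \<in> SP (label_sum (narcs D) + r)"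
      by (intro rho_SP[OF dc(2) s]) (simp add: ac_simps)
    moreover have "SP (label_sum (narcs D) + r) = SP ((?q + r) mod pt)" by (rule SP_cong) (simp add: cong_def mod_simps)
    ultimately have "\<rho> (through n D) s \<in> SP ((?q + r) mod pt)" by simp
    moreover have "pt > 0" using tpos t_dvd ppos by (simp add: div_greater_zero_iff dvd_imp_le)
    then have "?q < pt" by simp
    moreover have "basis (narcs D) \<in> dangle_space m n l ?q pt" using dc(1) by (simp add: dangle_space_def cong_def)
    ultimately have "ptensor (basis (narcs D)) (\<rho> (through n D) s) \<in> gens" by blast
    then show ?thesis using True by (simp add: star_def pscale.span_base)
  qed (simp add: star_def pscale.span_zero)
qed

section \<open>The two maps and their compatibility modulo the relations\<close>

definition phi :: "(diagram \<Rightarrow>\<^sub>0 'k) set \<Rightarrow> (tableau \<Rightarrow>\<^sub>0 'k) \<Rightarrow> (dangle \<times> tableau \<Rightarrow>\<^sub>0 'k)"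
  where "phi y s = starx (SOME x. x \<in> H \<and> cl x = y) s"

lemma phi_cl: assumes "x \<in> H" shows "phi (cl x) s = starx x s"
proof -
  have "(SOME x'. x' \<in> H \<and> cl x' = cl x) \<in> H \<and> cl (SOME x'. x' \<in> H \<and> cl x' = cl x) = cl x"
    by (rule someI[of _ x]) (use assms in simp)
  then show ?thesis unfolding phi_def using starx_cong[OF _ assms] by blast
qed

interpretation TD: tensor_data "B n" Qe ract "B N" SM
  by (rule tensor_data_Qe)

text \<open>The case \<open>y = 0\<close> is split off for dangles that cannot be lifted: there
  \<open>E v\<close> need not give an element of the corner module, but \<open>y\<close> is 0 by
  \<open>not_liftable\<close>.\<close>

definition gg :: "dangle \<Rightarrow> (tableau \<Rightarrow>\<^sub>0 'k) \<Rightarrow> ((diagram \<Rightarrow>\<^sub>0 'k) set \<times> (tableau \<Rightarrow>\<^sub>0 'k) \<Rightarrow>\<^sub>0 int)"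
  where "gg v y = (if y = 0 then 0 else frag_of (cl (basis (E v)), \<rho> (tt (label_sum v)) y))"

text \<open>Additive only modulo the relations, as the formal generators \<open>frag_of\<close> are
  not additive in their arguments.\<close>

definition Psi :: "(dangle \<times> tableau \<Rightarrow>\<^sub>0 'k) \<Rightarrow> ((diagram \<Rightarrow>\<^sub>0 'k) set \<times> (tableau \<Rightarrow>\<^sub>0 'k) \<Rightarrow>\<^sub>0 int)"
  where "Psi u = (\<Sum>v\<in>DG. gg v (slice v u))"

lemma cl_Qe: "x \<in> H \<Longrightarrow> cl x \<in> carrier Qe"
  unfolding carrier_Qe by simp

lemma K_zero_right: "x \<in> H \<Longrightarrow> frag_of (cl x, 0) \<in> TD.K"
  using TD.K_uminus[OF TD.K_add_right[OF cl_Qe, of x 0 0]] by simp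

lemma K_zero_left: "s \<in> SP r \<Longrightarrow> frag_of (cl 0, s) \<in> TD.K"
  using TD.K_uminus[OF TD.K_add_left[OF cl_Qe cl_Qe, of 0 0 s]] cl_add[of 0 0] by simp

lemma gg_frag:
  assumes v: "v \<in> DG" "liftable v"
  shows "gg v y - frag_of (cl (basis (E v)), \<rho> (tt (label_sum v)) y) \<in> TD.K"
proof (cases "y = 0")
  case True
  then show ?thesis using TD.K_uminus[OF K_zero_right[OF E_props(2)[OF v]]] tt_GD by (simp add: gg_def)
qed (simp add: gg_def)

lemma K_cong_trans: "a - b \<in> TD.K \<Longrightarrow> b - c \<in> TD.K \<Longrightarrow> a - c \<in> TD.K"
  using TD.K_add[of "a - b" "b - c"] by simp

lemma K_cong_sym: "a - b \<in> TD.K \<Longrightarrow> b - a \<in> TD.K"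
  using TD.K_uminus[of "a - b"] by simp

lemma gg_diff:
  assumes v: "v \<in> DG" and y: "y \<in> SP (label_sum v + r)" "y' \<in> SP (label_sum v + r)"
  shows "gg v (y - y') - (gg v y - gg v y') \<in> TD.K"
proof (cases "liftable v")
  case False
  then have "y = 0" "y' = 0" using not_liftable y by auto
  then show ?thesis by (simp add: gg_def)
next
  case True
  let ?f = "\<lambda>y. frag_of (cl (basis (E v)), \<rho> (tt (label_sum v)) y)"
  note yy = SP_diff[OF y]
  have "\<rho> (tt (label_sum v)) y = \<rho> (tt (label_sum v)) (y - y') + \<rho> (tt (label_sum v)) y'"
    using rho_add[OF tt_GD SP_TS[OF yy] SP_TS[OF y(2)]] by simp
  then have a: "?f y - ?f (y - y') - ?f y' \<in> TD.K"
    using TD.K_add_right[OF cl_Qe[OF E_props(2)[OF v True]], of "\<rho> (tt (label_sum v)) (y - y')" "\<rho> (tt (label_sum v)) y'"]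
      rho_tt[OF True yy] rho_tt[OF True y(2)] by simp
  note b = gg_frag[OF v True, of "y - y'"] gg_frag[OF v True, of y] gg_frag[OF v True, of y']
  have "gg v (y - y') - (gg v y - gg v y') = (gg v (y - y') - ?f (y - y')) - (gg v y - ?f y) + (gg v y' - ?f y') - (?f y - ?f (y - y') - ?f y')"
    by (simp add: algebra_simps)
  also have "\<dots> \<in> TD.K" by (intro TD.K_diff TD.K_add a b)
  finally show ?thesis .
qed

lemma K_sum: "(\<And>i. i \<in> I \<Longrightarrow> f i \<in> TD.K) \<Longrightarrow> sum f I \<in> TD.K"
  by (induction I rule: infinite_finite_induct) (auto intro: TD.K_add)

lemma Psi_diff:
  assumes "u \<in> carrier PM" "u' \<in> carrier PM"
  shows "Psi (u - u') - (Psi u - Psi u') \<in> TD.K"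
proof -
  have "Psi (u - u') - (Psi u - Psi u') = (\<Sum>v\<in>DG. gg v (slice v u - slice v u') - (gg v (slice v u) - gg v (slice v u')))"
    by (simp add: Psi_def slice_lin sum_subtractf)
  also have "\<dots> \<in> TD.K" by (intro K_sum gg_diff PM_slice assms)
  finally show ?thesis .
qed

lemma Psi_0 [simp]: "Psi 0 = 0"
  by (simp add: Psi_def slice_lin gg_def)

lemma Psi_ptensor: "v \<in> DG \<Longrightarrow> Psi (ptensor (basis v) y) = gg v y"
proof -
  assume v: "v \<in> DG"
  have "Psi (ptensor (basis v) y) = (\<Sum>v'\<in>DG. if v' = v then gg v y else 0)"
    unfolding Psi_def by (rule sum.cong) (auto simp: slice_ptensor lookup_basis gg_def)
  then show ?thesis using v finite_dangles by (simp add: sum.delta)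
qed

text \<open>Cutting arcs gives \<open>D\<close> as \<open>D'\<close> times \<open>x\<close>, and
  \<open>x\<close> passes to the Specht vector, where it acts by 0. The scalar \<open>c\<close> is
  carried along because the free abelian group has no scalars of its own.\<close>

lemma frag_of_arcs:
  assumes D: "D \<in> Dn" "p dvd label_sum D" "card (narcs D) > l" and s: "s \<in> SP r"
  shows "frag_of (cl (pscale c (basis D)), s) \<in> TD.K"
proof -
  have "n + 2 * card (narcs (flip D)) = N + 2 * card (narcs D)" using arcs_count[OF D(1)] by simp
  then have "card (narcs (flip D)) > 0" using D(3) l2 by linarith
  then have "narcs D \<noteq> {}" "narcs (flip D) \<noteq> {}" using D(3) by auto
  then obtain u e u' e' where u: "(u, e) \<in> narcs D" and u': "(u', e') \<in> narcs (flip D)" by fast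
  have eu: "(North ` u, e) \<in> D" using u by (simp add: narcs_def)
  have fu: "(North ` u', e') \<in> flip D" using u' by (simp add: narcs_def)
  \<comment> \<open>Flipping once more brings the northern arc of \<open>flip D\<close> back as a
    southern arc of \<open>D\<close>.\<close>
  then have "(flip_node ` North ` u', e') \<in> flip (flip D)" unfolding flip_def[of "flip D"] by force
  then have eu': "(South ` u', e') \<in> D" by (simp add: image_image)
  have "card u = 2" using dgr_edge(2)[OF D(1) eu] by (simp add: card_image inj_on_def)
  then obtain a b where ab: "u = {a, b}" "a \<noteq> b" by (auto simp: card_2_iff)
  have "card u' = 2" using dgr_edge(2)[OF D(1) eu'] by (simp add: card_image inj_on_def)
  then obtain a' b' where ab': "u' = {a', b'}" "a' \<noteq> b'" by (auto simp: card_2_iff)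
  have e1: "({North a, North b}, e) \<in> D" and e2: "({South a', South b'}, e') \<in> D" using eu eu' ab ab' by simp_all
  obtain D' x where D': "D' \<in> Dn" and x: "x \<in> dgr m {1..N} {1..N}" "({North a', North b'}, (m - e') mod m) \<in> x"
    and c: "compose m D' x = D" and lf: "\<And>p \<delta>. loop_factor m p \<delta> D' x = (1::'k)" and ls: "m dvd label_sum x"
    by (rule cut_arcs[OF D(1) _ _ mpos e1 ab(2) e2 ab'(2)]) auto
  have xG: "x \<notin> GD"
  proof
    assume "x \<in> GD"
    then obtain y z where "{North a', North b'} = {North y, South z}" using x(2) unfolding group_diagrams_def by fast
    then show False by (auto simp: doubleton_eq_iff)
  qed
  have px: "p dvd label_sum x" using pm ls by (rule dvd_trans)
  have xh: "basis x \<in> hsp p {1..N} {1..N}" using x(1) px by (simp add: hsp_basis)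
  have "[label_sum D = label_sum D' + label_sum x] (mod p)"
    unfolding c[symmetric] by (rule label_sum_compose[OF good_dgr[OF _ _ D'] good_dgr[OF _ _ x(1)] pm, of \<delta>]) (use lf in auto)
  then have "p dvd label_sum D'" using D(2) px by (simp add: cong_dvd_iff dvd_add_left_iff)
  then have D'h: "pscale c (basis D') \<in> H" for c :: 'k using D' by (intro hsp_pscale) (simp add: hsp_basis)
  have "pscale c (basis D') \<cdot> basis x = pscale c (basis D)" using lf c by (simp add: dm_pscale_left)
  then have "cl (pscale c (basis D)) = ract (cl (pscale c (basis D'))) (basis x)" using cl_ract[OF D'h xh] by simp
  moreover have "act (basis x) s = 0" using xG by (simp add: act_def)
  ultimately have "frag_of (cl (pscale c (basis D)), s) - frag_of (cl (pscale c (basis D')), 0) \<in> TD.K"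
    using TD.K_balanced[OF cl_Qe[OF D'h], of "basis x" s c] xh s by (simp add: carrier_B)
  from TD.K_add[OF this K_zero_right[OF D'h[of c]]] show ?thesis by simp
qed

text \<open>\<open>D\<close> equals \<open>E v\<close> times t_1^L times \<open>w\<close>, where L
  is the label sum of the dangle \<open>v\<close>. The product of the last two has label sum
  divisible by \<open>p\<close>, so it belongs to the algebra on \<open>N\<close> strands and may be
  moved across the tensor sign; neither factor alone need belong.\<close>

lemma frag_of_star:
  assumes D: "D \<in> Dn" "p dvd label_sum D" "card (narcs D) \<le> l" and s: "s \<in> SP r"
  shows "frag_of (cl (pscale c (basis D)), s) - Psi (pscale c (star D s)) \<in> TD.K"
proof -
  note dc = decompose[OF D(1,3)]
  define v w L where "v = narcs D" and "w = through n D" and "L = label_sum v"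
  have v: "v \<in> DG" and w: "w \<in> GD" and vw: "compose m (dd v) w = D" and ls: "label_sum D = L + label_sum w"
    using dc by (auto simp: v_def w_def L_def)
  \<comment> \<open>Without free lines \<open>w\<close> is empty, so the label sum of
    \<open>D\<close> is that of \<open>v\<close>.\<close>
  have lift: "liftable v" using GD_no_strands[OF w] ls D(2) by (auto simp: liftable_def L_def)
  have sT: "s \<in> TS" by (rule SP_TS[OF s])
  have rT: "\<rho> w s \<in> TS" by (rule rho_in[OF w sT])
  define z where "z = pscale c (basis (compose m (tt L) w))"
  have tw: "compose m (tt L) w \<in> GD" by (rule GD_compose[OF tt_GD w])
  have "[label_sum (compose m (tt L) w) = label_sum (tt L) + label_sum w] (mod p)"
    by (rule label_sum_compose_GD[OF GD_dgr[OF tt_GD] _ w]) simp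
  moreover have "p dvd label_sum (tt L) + label_sum w"
  proof (cases "N = 0")
    case True then show ?thesis using GD_no_strands[OF w] by (simp add: label_sum_tt)
  next
    case False
    have "[L mod m = L] (mod p)" by (rule cong_dvd_modulus_nat[OF _ pm]) (simp add: cong_def)
    then have "[L mod m + label_sum w = L + label_sum w] (mod p)" by (rule cong_add[OF _ cong_refl])
    then show ?thesis using False D(2) ls by (simp add: label_sum_tt cong_dvd_iff)
  qed
  ultimately have zh: "z \<in> hsp p {1..N} {1..N}"
    unfolding z_def using GD_dgr[OF tw] by (intro hsp_pscale) (simp add: hsp_basis cong_dvd_iff)
  note Eh = E_props(2)[OF v lift]
  have act: "act z s = \<rho> (tt L) (pscale c (\<rho> w s))"
    using tw rho_mult[OF tt_GD w sT] rho_pscale[OF tt_GD rT] by (simp add: z_def act_def lin_ext_pscale)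
  have Ez: "basis (E v) \<cdot> z = pscale c (basis D)"
  proof -
    have g: "good (E v)" "good (tt L)" "good w"
      using good_dgr[OF _ _ E_props(1)[OF v]] good_dgr[OF _ _ GD_dgr[OF tt_GD]] good_dgr[OF _ _ GD_dgr[OF w]] by auto
    have "compose m (E v) (compose m (tt L) w) = D"
      unfolding compose_assoc(1)[OF g, symmetric] using E_props(3)[OF v] vw by (simp add: L_def)
    then show ?thesis using lf_GD[OF E_props(1)[OF v] _ tw] by (simp add: z_def dm_pscale_right)
  qed
  have "frag_of (ract (cl (basis (E v))) z, s) - frag_of (cl (basis (E v)), act z s) \<in> TD.K"
    using TD.K_balanced[OF cl_Qe[OF Eh], of z s] zh s by (simp add: carrier_B)
  then have 1: "frag_of (cl (pscale c (basis D)), s) - frag_of (cl (basis (E v)), \<rho> (tt L) (pscale c (\<rho> w s))) \<in> TD.K"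
    unfolding cl_ract[OF Eh zh] Ez act .
  have 2: "frag_of (cl (basis (E v)), \<rho> (tt L) (pscale c (\<rho> w s))) - gg v (pscale c (\<rho> w s)) \<in> TD.K"
    unfolding L_def by (rule K_cong_sym[OF gg_frag[OF v lift]])
  have "pscale c (star D s) = ptensor (basis v) (pscale c (\<rho> w s))"
    using D(3) by (simp add: star_def v_def w_def ptensor_pscale_right)
  then have "Psi (pscale c (star D s)) = gg v (pscale c (\<rho> w s))" using Psi_ptensor[OF v] by simp
  then show ?thesis using K_cong_trans[OF 1 2] by simp
qed

text \<open>\<open>Psi\<close> inverts the comparison map on pure tensors. By additivity modulo the
  relations this reduces to a scaled diagram, with few arcs or with many.\<close>

lemma frag_of_starx:
  assumes x: "x \<in> H" and s: "s \<in> SP r"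
  shows "frag_of (cl x, s) - Psi (starx x s) \<in> TD.K"
proof -
  have "Poly_Mapping.keys x \<subseteq> {D \<in> Dn. p dvd label_sum D}" using x by (simp add: hsp_def)
  then show ?thesis
  proof (induction x rule: span_induct_basis)
    case zero
    then show ?case using K_zero_left[OF s] by simp
  next
    case (add x y)
    then have xy: "x \<in> H" "y \<in> H" by (simp_all add: hsp_def)
    have "frag_of (cl (x + y), s) - frag_of (cl x, s) - frag_of (cl y, s) \<in> TD.K"
      using TD.K_add_left[OF cl_Qe[OF xy(1)] cl_Qe[OF xy(2)], of s] s cl_add[OF xy] by simp
    moreover have "Psi (starx (x + y) s - starx y s) - (Psi (starx (x + y) s) - Psi (starx y s)) \<in> TD.K"
      by (rule Psi_diff) (use starx_PM s xy hsp_add in auto)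
    then have "Psi (starx x s) - (Psi (starx (x + y) s) - Psi (starx y s)) \<in> TD.K" by (simp add: starx_add_left)
    \<comment> \<open>The four elements of \<open>K\<close> telescope to the claim for
      \<open>x + y\<close>.\<close>
    ultimately have "(frag_of (cl (x + y), s) - frag_of (cl x, s) - frag_of (cl y, s)) + (frag_of (cl x, s) - Psi (starx x s)) +
        (frag_of (cl y, s) - Psi (starx y s)) + (Psi (starx x s) - (Psi (starx (x + y) s) - Psi (starx y s))) \<in> TD.K"
      using add(3,4) by (intro TD.K_add)
    then show ?case by simp
  next
    case (basis c D)
    show ?case
    proof (cases "card (narcs D) \<le> l")
      case True
      then show ?thesis using frag_of_star[of D s c] basis s by (simp add: starx_pscale_left)
    next
      case False
      then show ?thesis using frag_of_arcs[of D s c] basis s by (simp add: starx_pscale_left star_def)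
    qed
  qed
qed

theorem tensor_dangle_iso: "left_module_iso (B n) (tensor_module Qe ract (B N) SM) PM"
proof (rule TD.tensor_iso[where \<phi>=phi and \<Psi>=Psi])
  show "u - v \<in> carrier PM" if "u \<in> carrier PM" "v \<in> carrier PM" for u v
    using that unfolding carrier_PM by (rule pscale.span_diff)
  show "0 \<in> carrier PM" unfolding carrier_PM by (rule pscale.span_zero)
  show "b \<odot>\<^bsub>PM\<^esub> (u - v) = b \<odot>\<^bsub>PM\<^esub> u - b \<odot>\<^bsub>PM\<^esub> v" for b u v by (simp add: dangle_act_lin)
  show "phi x y \<in> carrier PM" if "x \<in> carrier Qe" "y \<in> carrier SM" for x y
    using that starx_PM by (auto simp: carrier_Qe phi_cl)
  show "phi (x \<oplus>\<^bsub>Qe\<^esub> x') y = phi x y + phi x' y" if "x \<in> carrier Qe" "x' \<in> carrier Qe" "y \<in> carrier SM" for x x' y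
    using that by (auto simp: carrier_Qe phi_cl cl_add hsp_add starx_add_left simp del: One_nat_def)
  show "phi x (y \<oplus>\<^bsub>SM\<^esub> y') = phi x y + phi x y'" if "x \<in> carrier Qe" "y \<in> carrier SM" "y' \<in> carrier SM" for x y y'
    using that starx_add_right SP_TS by (auto simp: carrier_Qe phi_cl)
  show "phi (ract x c) y = phi x (c \<odot>\<^bsub>SM\<^esub> y)" if x: "x \<in> carrier Qe" and c: "c \<in> carrier (B N)" and y: "y \<in> carrier SM" for x c y
  proof -
    obtain x' where x': "x = cl x'" "x' \<in> H" using x unfolding carrier_Qe by blast
    have c': "c \<in> hsp p {1..N} {1..N}" using c by (simp add: carrier_B)
    have yT: "y \<in> TS" using y SP_TS by simp
    show ?thesis unfolding x'(1) cl_ract[OF x'(2) c'] phi_cl[OF xc[OF x'(2) c']] phi_cl[OF x'(2)]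
      using starx_dm_right[OF x'(2) c' yT] by simp
  qed
  show "phi (b \<odot>\<^bsub>Qe\<^esub> x) y = b \<odot>\<^bsub>PM\<^esub> phi x y" if b: "b \<in> carrier (B n)" and x: "x \<in> carrier Qe" and y: "y \<in> carrier SM" for b x y
  proof -
    obtain x' where x': "x = cl x'" "x' \<in> H" using x unfolding carrier_Qe by blast
    have yT: "y \<in> TS" using y SP_TS by simp
    show ?thesis unfolding x'(1) Qe_simps cl_smult[OF b x'(2)] phi_cl[OF bx[OF b x'(2)]] phi_cl[OF x'(2)]
      using dangle_act_starx[OF b[unfolded carrier_B] x'(2) yT] by simp
  qed
  show "Psi (u - v) - (Psi u - Psi v) \<in> TD.K" if "u \<in> carrier PM" "v \<in> carrier PM" for u v by (rule Psi_diff[OF that])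
  show "frag_of (x, y) - Psi (phi x y) \<in> TD.K" if "x \<in> carrier Qe" "y \<in> carrier SM" for x y
    using that frag_of_starx by (auto simp: carrier_Qe phi_cl)
  \<comment> \<open>Over a liftable dangle the pure tensor is a value of \<open>phi\<close> by
    \<open>star_E\<close>; over any other it is 0.\<close>
  show "carrier PM \<subseteq> A" if A: "0 \<in> A" "\<And>u v. u \<in> A \<Longrightarrow> v \<in> A \<Longrightarrow> u + v \<in> A"
    "\<And>x y. x \<in> carrier Qe \<Longrightarrow> y \<in> carrier SM \<Longrightarrow> phi x y \<in> A" for A
  proof
    fix u assume u: "u \<in> carrier PM"
    have "ptensor (basis v) (slice v u) \<in> A" if v: "v \<in> DG" for v
    proof (cases "liftable v")
      case True
      note y = PM_slice(2)[OF u v]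
      have "phi (cl (basis (E v))) (\<rho> (tt (label_sum v)) (slice v u)) \<in> A"
        by (rule A(3)[OF cl_Qe[OF E_props(2)[OF v True]]]) (use rho_tt[OF True y] in simp)
      then show ?thesis unfolding phi_cl[OF E_props(2)[OF v True]] starx_basis star_E[OF v SP_TS[OF y]] .
    next
      case False
      then show ?thesis using not_liftable[OF PM_slice(2)[OF u v]] A(1) by simp
    qed
    then have sum: "(\<Sum>v\<in>S. ptensor (basis v) (slice v u)) \<in> A" if "S \<subseteq> DG" for S
      using that by (induction S rule: infinite_finite_induct) (auto intro: A)
    show "u \<in> A" using sum[OF order_refl] slice_expand[OF PM_slice(1)[OF u], symmetric] by (simp only:)
  qed
qed simp_all

end

text \<open>\<open>\<rho>\<close> may be any map that obeys the seminormal formulas and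
  \<open>i0\<close> any index of a nonzero parameter. For \<open>n = 2 * l\<close> with all
  parameters zero there is no idempotent e_0 and hence no standard module of this shape.\<close>

theorem theorem3p3p1:
  fixes \<xi> :: "'k::{alg_closed_field, field_char_0}"
    and \<delta> :: "nat \<Rightarrow> 'k"
    and m p d n l t r i0 :: nat
    and lam :: "nat list list"
    and \<rho> :: "diagram \<Rightarrow> (tableau \<Rightarrow>\<^sub>0 'k) \<Rightarrow> (tableau \<Rightarrow>\<^sub>0 'k)"
  assumes "m > 0" "p > 0" "d > 0" "n > 0" "m = p * d"
    and "\<xi> ^ m = 1" "\<forall>j. 0 < j \<and> j < m \<longrightarrow> \<xi> ^ j \<noteq> 1"
    and "(\<exists>i<d. \<delta> i \<noteq> 0) \<longrightarrow> i0 < d \<and> \<delta> i0 \<noteq> 0"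
    and "2 * l \<le> n" "mpartition m (n - 2 * l) lam"
    and "t dvd p" "stabiliser d p lam = {(t * j) mod p | j. True}" "r < p div t"
    and "n = 2 * l \<longrightarrow> (\<exists>i<d. \<delta> i \<noteq> 0) \<and> r = 0"
    and "seminormal_rep m \<xi> lam (n - 2 * l) \<rho>"
  shows "left_module_iso (brauer_algebra m p \<delta> n)
           (standard_module m p d \<xi> \<delta> i0 \<rho> n l lam t r)
           (dangle_module m p d \<xi> \<delta> \<rho> n l lam t r)"
proof -
  interpret b: brauer_parameters m p d \<delta> i0 by unfold_locales (use assms in auto)
  have "idem_exists d \<delta> n l" using assms(9,14) by (auto simp: idem_exists_def)
  then obtain U W where UW: "U \<in> b.hsp p {1..n} {1..n - 2 * l}" "W \<in> b.hsp p {1..n - 2 * l} {1..n}"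
    "diag_mult m p \<delta> W U = basis (idd {1..n - 2 * l})"
    "\<And>x. x \<in> b.hsp 1 {1..n - 2 * l} {1..n - 2 * l} \<Longrightarrow> corner m p d \<delta> i0 n l x = diag_mult m p \<delta> U (diag_mult m p \<delta> x W)"
    by (rule b.corner_factor) blast
  interpret s: standard_setup m p d \<delta> i0 \<xi> n l t lam \<rho> r U W
    by unfold_locales (use assms UW in auto)
  have "standard_module m p d \<xi> \<delta> i0 \<rho> n l lam t r = tensor_module s.Qe s.ract (b.B s.N) s.SM"
    unfolding standard_module_def Let_def s.Qe_def ..
  then show ?thesis using s.tensor_dangle_iso by simp
qed

end
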